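(* Let $n\ge 1$ and let $\Sigma$ be a complete $n$-dimensional properly immersed self-expander hypersurface in $\mathbb{R}^{n+1}$ with mean curvature $H$. Then the bottom $\lambda_1$ of the spectrum of the drifted Laplacian $\mathcal{L}=\Delta+\frac12\langle x,\nabla\cdot\rangle$ on $\Sigma$ (i.e. the first weighted $L^2$ eigenvalue of $\mathcal{L}$) satisfies $$\lambda_1\geq \frac{n}{2}+\inf_{x\in \Sigma}H^2.$$ Moreover, the equality $\lambda_1=\frac n2+\inf_{x\in\Sigma}H^2$ holds if and only if $\Sigma$ is a hyperplane $\mathbb{R}^n$ through the origin.
   Context: Manifolds are connected. A self-expander hypersurface is a smooth $n$-dimensional hypersurface $\Sigma$ immersed in Euclidean space $\mathbb{R}^{n+1}$ whose mean curvature satisfies $H=-\frac12\langle x,{\bf n}\rangle$, where $x$ is the position vector, ${\bf n}$ is the unit normal field, and $H$ is defined by ${\bf H}=-H{\bf n}$ with ${\bf H}=\sum_{i=1}^n(\bar\nabla_{e_i}e_i)^\perp$ the mean curvature vector ($\{e_i\}$ a local orthonormal frame of $\Sigma$, $\bar\nabla$ the Euclidean connection). Properly immersed means that the preimage in $\Sigma$ of every compact subset of $\mathbb{R}^{n+1}$ is compact. $\nabla,\Delta,d\sigma$ denote the gradient, Laplacian and volume element of the induced metric on $\Sigma$. $\mathcal{L}u=\Delta u+\frac12\langle x,\nabla u\rangle$ is a densely defined self-adjoint operator in $L^2(\Sigma,e^{\frac{|x|^2}{4}}d\sigma)$; $\lambda$ is a weighted $L^2$ eigenvalue of $\mathcal{L}$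 if there is a nonzero smooth $u\in L^2(\Sigma,e^{\frac{|x|^2}{4}}d\sigma)$ with $\mathcal{L}u+\lambda u=0$. The bottom of the spectrum is $$\lambda_1=\inf\left\{\frac{\int_{\Sigma}|\nabla \varphi|^2e^{\frac{|x|^2}{4}}d\sigma}{\int_{\Sigma}\varphi^2e^{\frac{|x|^2}{4}}d\sigma}:\ \varphi\in C_0^{\infty}(\Sigma),\ \int_{\Sigma}\varphi^2e^{\frac{|x|^2}{4}}d\sigma\neq 0\right\}.$$ *)

theory Defs
  imports "HOL-Analysis.Analysis"
begin

section \<open>Smooth maps between Euclidean spaces\<close>

fun Ck_on :: "nat \<Rightarrow> 'a::real_normed_vector set \<Rightarrow> ('a \<Rightarrow> 'b::real_normed_vector) \<Rightarrow> bool" where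
  "Ck_on 0 S f \<longleftrightarrow> continuous_on S f"
| "Ck_on (Suc k) S f \<longleftrightarrow>
     (\<forall>x\<in>S. f differentiable (at x)) \<and> (\<forall>v. Ck_on k S (\<lambda>x. frechet_derivative f (at x) v))"

text \<open>Only used for open sets \<^term>\<open>S\<close>.\<close>

definition smooth_on :: "'a::real_normed_vector set \<Rightarrow> ('a \<Rightarrow> 'b::real_normed_vector) \<Rightarrow> bool" where
  "smooth_on S f \<longleftrightarrow> (\<forall>k. Ck_on k S f)"

section \<open>Smooth manifolds\<close>

text \<open>
  A manifold is a whole type \<^typ>\<open>'m\<close>, whose topology is the manifold topology, together with a
  smooth atlas. The members of an atlas are local parametrizations \<open>(U, p)\<close>, that is, inverse
  charts: \<open>p\<close> maps the open set \<open>U\<close> of the Euclidean space homeomorphically onto an open subset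
  of the manifold.
\<close>

type_synonym ('n, 'm) param = "(real^'n) set \<times> (real^'n \<Rightarrow> 'm)"

definition smooth_atlas :: "('n::finite, 'm::topological_space) param set \<Rightarrow> bool" where
  "smooth_atlas A \<longleftrightarrow>
     (\<forall>(U, p)\<in>A. open U \<and> open (p ` U) \<and> homeomorphism U (p ` U) p (inv_into U p)) \<and>
     (\<Union>(U, p)\<in>A. p ` U) = UNIV \<and>
     (\<forall>(U, p)\<in>A. \<forall>(V, q)\<in>A. smooth_on (U \<inter> p -` (q ` V)) (inv_into V q \<circ> p))"

text \<open>Smoothness on an open subset \<open>W\<close> of the manifold.\<close>

definition smooth_fun_on ::
  "('n::finite, 'm::topological_space) param set \<Rightarrow> 'm set \<Rightarrow> ('m \<Rightarrow> 'b::real_normed_vector) \<Rightarrow> bool"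
where
  "smooth_fun_on A W f \<longleftrightarrow> (\<forall>(U, p)\<in>A. smooth_on (U \<inter> p -` W) (f \<circ> p))"

definition param_at :: "('n::finite, 'm) param set \<Rightarrow> 'm \<Rightarrow> ('n, 'm) param" where
  "param_at A x = (SOME c. c \<in> A \<and> x \<in> snd c ` fst c)"

text \<open>
  The differential of \<open>f\<close> at \<open>x\<close>, where the tangent space at \<open>x\<close> is identified with the coordinate
  space by means of one fixed parametrization \<^term>\<open>param_at A x\<close>. Everything below that is derived
  from it is independent of the choice of that parametrization.
\<close>

definition differential ::
  "('n::finite, 'm) param set \<Rightarrow> ('m \<Rightarrow> 'b::real_normed_vector) \<Rightarrow> 'm \<Rightarrow> real^'n \<Rightarrow> 'b"
where
  "differential A f x =
     (case param_at A x of (U, p) \<Rightarrow> frechet_derivative (f \<circ> p) (at (inv_into U p x)))"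

section \<open>Immersed hypersurfaces and their induced geometry\<close>

definition immersed_hypersurface ::
  "('n::finite, 'm::{t2_space, second_countable_topology}) param set \<Rightarrow> ('m \<Rightarrow> real^'k::finite) \<Rightarrow> bool"
where
  "immersed_hypersurface A F \<longleftrightarrow>
     CARD('k) = CARD('n) + 1 \<and> smooth_atlas A \<and> connected (UNIV :: 'm set) \<and>
     smooth_fun_on A UNIV F \<and> (\<forall>x. inj (differential A F x))"

definition properly_immersed :: "('m::topological_space \<Rightarrow> real^'k::finite) \<Rightarrow> bool" where
  "properly_immersed F \<longleftrightarrow> (\<forall>K. compact K \<longrightarrow> compact (F -` K))"

text \<open>
  Tangent vectors of the hypersurface are identified with their images under the (injective)
  differential of the immersion \<open>F\<close>; under this identification the induced metric is the
  inner product of the ambient space.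
\<close>

definition tangent_space ::
  "('n::finite, 'm) param set \<Rightarrow> ('m \<Rightarrow> real^'k::finite) \<Rightarrow> 'm \<Rightarrow> (real^'k) set"
where
  "tangent_space A F x = range (differential A F x)"

text \<open>
  The derivative of \<open>f\<close> at \<open>x\<close> in the direction of the tangent vector \<open>w\<close>; for a vector-valued \<open>f\<close>
  this is the Euclidean connection along the immersion.
\<close>

definition directional_deriv ::
  "('n::finite, 'm) param set \<Rightarrow> ('m \<Rightarrow> real^'k::finite) \<Rightarrow> ('m \<Rightarrow> 'b::real_normed_vector) \<Rightarrow> 'm \<Rightarrow> real^'k \<Rightarrow> 'b"
where
  "directional_deriv A F f x w = differential A f x (inv (differential A F x) w)"

definition gradient ::
  "('n::finite, 'm) param set \<Rightarrow> ('m \<Rightarrow> real^'k::finite) \<Rightarrow> ('m \<Rightarrow> real) \<Rightarrow> 'm \<Rightarrow> real^'k"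
where
  "gradient A F \<phi> x =
     (THE w. w \<in> tangent_space A F x \<and>
        (\<forall>v\<in>tangent_space A F x. w \<bullet> v = directional_deriv A F \<phi> x v))"

definition normal_part ::
  "('n::finite, 'm) param set \<Rightarrow> ('m \<Rightarrow> real^'k::finite) \<Rightarrow> 'm \<Rightarrow> real^'k \<Rightarrow> real^'k"
where
  "normal_part A F x w =
     (THE v. v \<in> (tangent_space A F x)\<^sup>\<bottom> \<and> w - v \<in> tangent_space A F x)"

definition orthonormal_frame ::
  "('n::finite, 'm::topological_space) param set \<Rightarrow> ('m \<Rightarrow> real^'k::finite) \<Rightarrow> 'm set
     \<Rightarrow> ('n \<Rightarrow> 'm \<Rightarrow> real^'k) \<Rightarrow> bool"
where
  "orthonormal_frame A F W e \<longleftrightarrow>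
     open W \<and> (\<forall>i. smooth_fun_on A W (e i)) \<and>
     (\<forall>x\<in>W. (\<forall>i. e i x \<in> tangent_space A F x) \<and>
             (\<forall>i j. e i x \<bullet> e j x = (if i = j then 1 else 0)))"

text \<open>The sum below does not depend on the choice of the local orthonormal frame around \<open>x\<close>.\<close>

definition mean_curvature_vector ::
  "('n::finite, 'm::topological_space) param set \<Rightarrow> ('m \<Rightarrow> real^'k::finite) \<Rightarrow> 'm \<Rightarrow> real^'k"
where
  "mean_curvature_vector A F x =
     (let e = (SOME e. \<exists>W. x \<in> W \<and> orthonormal_frame A F W e)
      in \<Sum>i\<in>UNIV. normal_part A F x (directional_deriv A F (e i) x (e i x)))"

text \<open>
  No continuity is required of \<open>N\<close>: a change of sign of \<open>N\<close> at a point changes the sign of the mean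
  curvature there, and affects neither the self-expander equation nor the square of the mean
  curvature. In this way one-sided hypersurfaces, on which the unit normal field is only locally
  a smooth field, are included.
\<close>

definition unit_normal_field ::
  "('n::finite, 'm) param set \<Rightarrow> ('m \<Rightarrow> real^'k::finite) \<Rightarrow> ('m \<Rightarrow> real^'k) \<Rightarrow> bool"
where
  "unit_normal_field A F N \<longleftrightarrow> (\<forall>x. norm (N x) = 1 \<and> N x \<in> (tangent_space A F x)\<^sup>\<bottom>)"

definition mean_curvature ::
  "('n::finite, 'm::topological_space) param set \<Rightarrow> ('m \<Rightarrow> real^'k::finite) \<Rightarrow> ('m \<Rightarrow> real^'k) \<Rightarrow> 'm \<Rightarrow> real"
where
  "mean_curvature A F N x = (THE h. mean_curvature_vector A F x = - (h *\<^sub>R N x))"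

definition self_expander ::
  "('n::finite, 'm::topological_space) param set \<Rightarrow> ('m \<Rightarrow> real^'k::finite) \<Rightarrow> ('m \<Rightarrow> real^'k) \<Rightarrow> bool"
where
  "self_expander A F N \<longleftrightarrow> (\<forall>x. mean_curvature A F N x = - (1 / 2) * (F x \<bullet> N x))"

section \<open>Riemannian distance and completeness\<close>

definition piecewise_C1_curve ::
  "('n::finite, 'm::topological_space) param set \<Rightarrow> (real \<Rightarrow> 'm) \<Rightarrow> bool"
where
  "piecewise_C1_curve A \<gamma> \<longleftrightarrow>
     continuous_on {0..1} \<gamma> \<and>
     (\<exists>T. finite T \<and>
        (\<forall>(U, p)\<in>A. (inv_into U p \<circ> \<gamma>) C1_differentiable_on ({t\<in>{0<..<1}. \<gamma> t \<in> p ` U} - T)))"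

text \<open>
  The length of a curve is possibly infinite, because the velocity may be unbounded near
  the finitely many exceptional parameters; this does not affect the infimum below.
\<close>

definition curve_length :: "('m \<Rightarrow> real^'k::finite) \<Rightarrow> (real \<Rightarrow> 'm) \<Rightarrow> ennreal" where
  "curve_length F \<gamma> =
     (\<integral>\<^sup>+ t. indicator {0..1} t * ennreal (norm (vector_derivative (F \<circ> \<gamma>) (at t))) \<partial>lborel)"

definition riemannian_dist ::
  "('n::finite, 'm::topological_space) param set \<Rightarrow> ('m \<Rightarrow> real^'k::finite) \<Rightarrow> 'm \<Rightarrow> 'm \<Rightarrow> ennreal"
where
  "riemannian_dist A F x y =
     Inf {curve_length F \<gamma> | \<gamma>. piecewise_C1_curve A \<gamma> \<and> \<gamma> 0 = x \<and> \<gamma> 1 = y}"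

definition complete_hypersurface ::
  "('n::finite, 'm::topological_space) param set \<Rightarrow> ('m \<Rightarrow> real^'k::finite) \<Rightarrow> bool"
where
  "complete_hypersurface A F \<longleftrightarrow>
     (\<forall>s :: nat \<Rightarrow> 'm.
        (\<forall>\<epsilon>>0. \<exists>M. \<forall>i\<ge>M. \<forall>j\<ge>M. riemannian_dist A F (s i) (s j) < \<epsilon>) \<longrightarrow>
        (\<exists>x. (\<lambda>i. riemannian_dist A F (s i) x) \<longlonglongrightarrow> 0))"

section \<open>Volume and the bottom of the spectrum\<close>

definition volume_density :: "(real^'n::finite \<Rightarrow> real^'k::finite) \<Rightarrow> real^'n \<Rightarrow> real" where
  "volume_density X u =
     sqrt (det ((\<chi> i j. frechet_derivative X (at u) (axis i 1) \<bullet> frechet_derivative X (at u) (axis j 1))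
       :: real^'n^'n))"

text \<open>The unique Borel measure that is \<open>sqrt (det g) du\<close> in every local parametrization.\<close>

definition riemannian_measure ::
  "('n::finite, 'm::topological_space) param set \<Rightarrow> ('m \<Rightarrow> real^'k::finite) \<Rightarrow> 'm measure"
where
  "riemannian_measure A F =
     (THE \<mu>. sets \<mu> = sets borel \<and>
        (\<forall>(U, p)\<in>A. \<forall>B\<in>sets borel. B \<subseteq> U \<longrightarrow>
           emeasure \<mu> (p ` B) = (\<integral>\<^sup>+ u. indicator B u * ennreal (volume_density (F \<circ> p) u) \<partial>lborel)))"

definition test_function ::
  "('n::finite, 'm::topological_space) param set \<Rightarrow> ('m \<Rightarrow> real) \<Rightarrow> bool"
where
  "test_function A \<phi> \<longleftrightarrow> smooth_fun_on A UNIV \<phi> \<and> compact (closure {x. \<phi> x \<noteq> 0})"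

definition weighted_integral ::
  "('n::finite, 'm::topological_space) param set \<Rightarrow> ('m \<Rightarrow> real^'k::finite) \<Rightarrow> ('m \<Rightarrow> real) \<Rightarrow> real"
where
  "weighted_integral A F f =
     (\<integral>x. f x * exp ((norm (F x))\<^sup>2 / 4) \<partial>riemannian_measure A F)"

text \<open>
  The bottom of the spectrum of the drifted Laplacian, the self-adjoint operator associated with
  the Dirichlet form in the numerator.
\<close>

definition spectrum_bottom ::
  "('n::finite, 'm::topological_space) param set \<Rightarrow> ('m \<Rightarrow> real^'k::finite) \<Rightarrow> real"
where
  "spectrum_bottom A F =
     Inf {weighted_integral A F (\<lambda>x. (norm (gradient A F \<phi> x))\<^sup>2) /
            weighted_integral A F (\<lambda>x. (\<phi> x)\<^sup>2) | \<phi>.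
          test_function A \<phi> \<and> weighted_integral A F (\<lambda>x. (\<phi> x)\<^sup>2) \<noteq> 0}"

text \<open>
  For an immersion of an \<open>n\<close>-manifold, being a homeomorphism onto a hyperplane amounts to being
  an isometry onto it.
\<close>

definition is_hyperplane_through_origin :: "('m::topological_space \<Rightarrow> real^'k::finite) \<Rightarrow> bool" where
  "is_hyperplane_through_origin F \<longleftrightarrow>
     (\<exists>a g. a \<noteq> 0 \<and> homeomorphism UNIV {y. a \<bullet> y = 0} F g)"

end

theory Submission
  imports Defs
begin

text \<open>
  The function \<open>exp (-|x|\<^sup>2 / 4)\<close> is a positive supersolution. Integrating the divergence of \<open>a f\<^sup>2 exp (|x|\<^sup>2 / 4) x\<close>
  and completing a square gives, with \<open>x\<^sup>T\<close> the tangential part of \<open>x\<close>,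
  \<open>\<integral> |\<nabla>f|\<^sup>2 = \<integral> |\<nabla>f + 2 a f x\<^sup>T|\<^sup>2 + \<integral> (2 a n + 4 a H\<^sup>2 + (a - 4 a\<^sup>2) |x\<^sup>T|\<^sup>2) f\<^sup>2\<close> in the weighted measure.
  The choice \<open>a = 1/4\<close> is the lower bound.

  Suppose equality holds and \<open>H\<^sup>2\<close> exceeds its infimum somewhere. The relative mass of a minimizing sequence then
  tends to zero near that point; since the first integral (for \<open>a = 1/4\<close>) does so as well, Poincare's inequality for
  \<open>f exp (|x|\<^sup>2 / 4)\<close> propagates this to all compact sets. But the choice \<open>a = 1/8\<close> keeps the mass from escaping
  to infinity, a contradiction; so \<open>H\<^sup>2\<close> is constant.

  The function \<open>|x|\<^sup>2\<close> attains its minimum by properness, and its Hessian there forces \<open>H = 0\<close>.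
  Then \<open>x\<close> is everywhere tangential, so the hypersurface is a properly immersed smooth cone, that is, a hyperplane.
  Conversely, cutoffs of \<open>exp (-|x|\<^sup>2 / 4)\<close> on a hyperplane show that the bound is attained.
\<close>

section \<open>Calculus of $C^k$ functions\<close>

text \<open>The self-expander equation enters the integral estimates through div x^T = n + 2 H^2 and
  |x|^2 = |x^T|^2 + 4 H^2. Both involve H^2 alone, so \<open>\<sigma>\<close> = 4 H^2 takes the
  place of \<open>N\<close>, whose sign may jump from point to point. The coefficient a - 4 a^2
  vanishes at a = 1/4 and is largest, 1/16, at a = 1/8, where the potential dominates |x|^2 / 16. No
  minimizer is constructed in the equality case; that would call for compact embeddings and elliptic
  regularity. Instead, the points with a neighbourhood of vanishing relative mass form a set that is
  open by definition and closed by Poincare's inequality. An immersion may pass through the origin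
  along several sheets, so smoothness at each preimage of the origin does not by itself make a cone
  a hyperplane. Segments to the origin are lifted to the hypersurface; the end point of the lift
  depends locally constantly on the initial point, and connectedness leaves a single sheet.\<close>

lemma has_derivative_frechet:
  "f differentiable (at x) \<Longrightarrow> (f has_derivative frechet_derivative f (at x)) (at x)"
  by (simp add: frechet_derivative_works)

lemma frechet_derivative_eqI:
  "(f has_derivative D) (at x) \<Longrightarrow> frechet_derivative f (at x) = D"
  by (metis frechet_derivative_at)

lemma frechet_derivative_cong_open:
  assumes "open S" "x \<in> S" "\<And>y. y \<in> S \<Longrightarrow> f y = g y"
  shows "frechet_derivative f (at x) = frechet_derivative g (at x)"
    "f differentiable (at x) \<longleftrightarrow> g differentiable (at x)"
proof -
  have "(f has_derivative D) (at x) \<longleftrightarrow> (g has_derivative D) (at x)" for D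
    using has_derivative_transform_within_open[of f D x UNIV S g]
      has_derivative_transform_within_open[of g D x UNIV S f] assms by auto
  then show "frechet_derivative f (at x) = frechet_derivative g (at x)"
    "f differentiable (at x) \<longleftrightarrow> g differentiable (at x)"
    unfolding frechet_derivative_def differentiable_def by auto
qed

lemma Ck_on_subset: "Ck_on k S f \<Longrightarrow> T \<subseteq> S \<Longrightarrow> Ck_on k T f"
  by (induction k arbitrary: f) (auto intro: continuous_on_subset)

lemma Ck_on_Suc_imp: "Ck_on (Suc k) S f \<Longrightarrow> Ck_on k S f"
proof (induction k arbitrary: f)
  case 0
  then show ?case
    by (auto intro!: differentiable_imp_continuous_on simp: differentiable_on_def
        differentiable_at_withinI)
next
  case (Suc k)
  then show ?case by (metis Ck_on.simps(2))
qed

lemma Ck_on_le: "Ck_on k S f \<Longrightarrow> j \<le> k \<Longrightarrow> Ck_on j S f"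
  by (induction k) (use Ck_on_Suc_imp le_Suc_eq in blast)+

lemma Ck_on_imp_continuous_on: "Ck_on k S f \<Longrightarrow> continuous_on S f"
  using Ck_on_le[of k S f 0] by simp

lemma Ck_on_cong:
  assumes "open S" "\<And>x. x \<in> S \<Longrightarrow> f x = g x"
  shows "Ck_on k S f \<longleftrightarrow> Ck_on k S g"
  using assms(2)
proof (induction k arbitrary: f g)
  case 0
  then show ?case using continuous_on_cong by auto
next
  case (Suc k)
  show ?case
  proof -
    have "frechet_derivative f (at x) = frechet_derivative g (at x)"
      "f differentiable (at x) \<longleftrightarrow> g differentiable (at x)" if "x \<in> S" for x
      using frechet_derivative_cong_open[OF assms(1) that Suc.prems] by auto
    then show ?thesis
      using Suc.IH[of "\<lambda>x. frechet_derivative f (at x) v" "\<lambda>x. frechet_derivative g (at x) v" for v] by simp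
  qed
qed

lemma Ck_on_SucI:
  assumes "open S" "\<And>x. x \<in> S \<Longrightarrow> (f has_derivative D x) (at x)"
    "\<And>v. Ck_on k S (\<lambda>x. D x v)"
  shows "Ck_on (Suc k) S f"
proof -
  have "Ck_on k S (\<lambda>x. frechet_derivative f (at x) v)" for v
    using Ck_on_cong[OF assms(1), of "\<lambda>x. frechet_derivative f (at x) v" "\<lambda>x. D x v"]
      frechet_derivative_eqI[OF assms(2)] assms(3) by auto
  then show ?thesis
    using assms(2) by (auto simp: differentiable_def)
qed

lemma Ck_on_SucD:
  assumes "Ck_on (Suc k) S f"
  shows "x \<in> S \<Longrightarrow> (f has_derivative frechet_derivative f (at x)) (at x)"
    "Ck_on k S (\<lambda>x. frechet_derivative f (at x) v)"
  using assms has_derivative_frechet by auto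

lemma Ck_on_const: "Ck_on k S (\<lambda>x. c)"
proof (induction k arbitrary: c)
  case (Suc k)
  have "frechet_derivative (\<lambda>x. c) (at x) = (\<lambda>v. 0)" for x :: 'a
    by (intro frechet_derivative_eqI) auto
  then show ?case using Suc by simp
qed simp

lemma Ck_on_bounded_linear:
  assumes "bounded_linear f" shows "Ck_on k S f"
proof (cases k)
  case 0
  then show ?thesis
    using assms linear_continuous_on by auto
next
  case (Suc j)
  have "frechet_derivative f (at x) = f" for x
    using assms bounded_linear_imp_has_derivative frechet_derivative_eqI by blast
  then show ?thesis
    using Suc assms Ck_on_const bounded_linear_imp_differentiable by auto
qed

lemma Ck_on_id: "Ck_on k S (\<lambda>x. x)"
  by (rule Ck_on_bounded_linear) (rule bounded_linear_ident)

lemma Ck_on_linear_compose: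
  assumes "open S" "bounded_linear L" "Ck_on k S f"
  shows "Ck_on k S (\<lambda>x. L (f x))"
  using assms(3)
proof (induction k arbitrary: f)
  case 0
  then show ?case
    using assms(2) by (simp add: bounded_linear.continuous_on)
next
  case (Suc k)
  show ?case
  proof (rule Ck_on_SucI[OF assms(1)])
    fix x assume "x \<in> S"
    then show "((\<lambda>x. L (f x)) has_derivative (\<lambda>v. L (frechet_derivative f (at x) v))) (at x)"
      using Ck_on_SucD(1)[OF Suc.prems] assms(2) bounded_linear.has_derivative by blast
  qed (use Ck_on_SucD(2)[OF Suc.prems] Suc.IH in blast)
qed

lemma Ck_on_add:
  assumes "open S" "Ck_on k S f" "Ck_on k S g"
  shows "Ck_on k S (\<lambda>x. f x + g x)"
  using assms(2,3)
proof (induction k arbitrary: f g)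
  case 0
  then show ?case by (auto intro: continuous_intros)
next
  case (Suc k)
  show ?case
    by (rule Ck_on_SucI[OF assms(1) has_derivative_add])
      (use Ck_on_SucD[OF Suc.prems(1)] Ck_on_SucD[OF Suc.prems(2)] Suc.IH in auto)
qed

lemma Ck_on_uminus:
  assumes "open S" "Ck_on k S f" shows "Ck_on k S (\<lambda>x. - f x)"
  using Ck_on_linear_compose[OF assms(1) bounded_linear_minus[OF bounded_linear_ident] assms(2)] .

lemma Ck_on_diff:
  assumes "open S" "Ck_on k S f" "Ck_on k S g"
  shows "Ck_on k S (\<lambda>x. f x - g x)"
  using Ck_on_add[OF assms(1,2) Ck_on_uminus[OF assms(1,3)]] by simp

lemma Ck_on_sum:
  assumes "open S" "\<And>i. i \<in> I \<Longrightarrow> Ck_on k S (f i)"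
  shows "Ck_on k S (\<lambda>x. \<Sum>i\<in>I. f i x)"
  using assms(2)
proof (induction I rule: infinite_finite_induct)
  case (insert i I)
  then show ?case
    using Ck_on_add[OF assms(1), of k "f i" "\<lambda>x. \<Sum>i\<in>I. f i x"] by simp
qed (simp_all add: Ck_on_const)

lemma Ck_on_bilinear:
  assumes "open S" "bounded_bilinear B" "Ck_on k S f" "Ck_on k S g"
  shows "Ck_on k S (\<lambda>x. B (f x) (g x))"
  using assms(3,4)
proof (induction k arbitrary: f g)
  case 0
  then show ?case
    using assms(2) by (simp add: bounded_bilinear.continuous_on)
next
  case (Suc k)
  show ?case
  proof (rule Ck_on_SucI[OF assms(1)])
    fix x assume "x \<in> S"
    then show "((\<lambda>x. B (f x) (g x)) has_derivative
        (\<lambda>v. B (f x) (frechet_derivative g (at x) v) + B (frechet_derivative f (at x) v) (g x))) (at x)"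
      using Ck_on_SucD(1)[OF Suc.prems(1)] Ck_on_SucD(1)[OF Suc.prems(2)]
        bounded_bilinear.FDERIV[OF assms(2)] by blast
  next
    fix v
    show "Ck_on k S (\<lambda>x. B (f x) (frechet_derivative g (at x) v) + B (frechet_derivative f (at x) v) (g x))"
      using Ck_on_SucD(2)[OF Suc.prems(1)] Ck_on_SucD(2)[OF Suc.prems(2)]
        Suc.prems[THEN Ck_on_Suc_imp] Suc.IH
      by (intro Ck_on_add assms(1)) auto
  qed
qed

lemmas Ck_on_scaleR = Ck_on_bilinear[OF _ bounded_bilinear_scaleR]
lemmas Ck_on_mult = Ck_on_bilinear[OF _ bounded_bilinear_mult]
lemmas Ck_on_inner = Ck_on_bilinear[OF _ bounded_bilinear_inner]

text \<open>\<open>Ck_on\<close> speaks of derivatives in a fixed direction. Expanding in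
  \<open>Basis\<close> reduces a derivative along a varying vector to finitely many fixed
  directions; the rules for compositions and for derivatives along vector fields rest on
  this.\<close>

lemma linear_basis_sum:
  fixes h :: "'a::euclidean_space \<Rightarrow> 'b::real_vector"
  assumes "linear h"
  shows "h w = (\<Sum>b\<in>Basis. (w \<bullet> b) *\<^sub>R h b)"
proof -
  have "h w = h (\<Sum>b\<in>Basis. (w \<bullet> b) *\<^sub>R b)"
    by (simp only: euclidean_representation)
  also have "\<dots> = (\<Sum>b\<in>Basis. (w \<bullet> b) *\<^sub>R h b)"
    by (simp only: linear_sum[OF assms] linear_scale[OF assms])
  finally show ?thesis .
qed

text \<open>Induction on k for all g at once: the derivative of the composite is a finite sum of
  components of the derivative of f times fixed-direction derivatives of g taken at f x, and the
  induction hypothesis applies to the latter.\<close>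

lemma Ck_on_compose:
  fixes f :: "'a::real_normed_vector \<Rightarrow> 'b::euclidean_space" and g :: "'b \<Rightarrow> 'c::real_normed_vector"
  assumes "open S" "open T" "Ck_on k S f" "Ck_on k T g" "\<And>x. x \<in> S \<Longrightarrow> f x \<in> T"
  shows "Ck_on k S (\<lambda>x. g (f x))"
  using assms(3,4)
proof (induction k arbitrary: g)
  case 0
  then show ?case
    using assms(5) by (auto intro: continuous_on_compose2[of T g S f])
next
  case (Suc k)
  let ?D = "\<lambda>x v. \<Sum>b\<in>Basis. (frechet_derivative f (at x) v \<bullet> b) *\<^sub>R frechet_derivative g (at (f x)) b"
  show ?case
  proof (rule Ck_on_SucI[OF assms(1)])
    fix x assume x: "x \<in> S"
    have g: "(g has_derivative frechet_derivative g (at (f x))) (at (f x))"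
      using Ck_on_SucD(1)[OF Suc.prems(2)] assms(5) x by auto
    then interpret g: linear "frechet_derivative g (at (f x))"
      by (rule has_derivative_linear)
    have "((\<lambda>x. g (f x)) has_derivative
        (\<lambda>v. frechet_derivative g (at (f x)) (frechet_derivative f (at x) v))) (at x)"
      using diff_chain_at[OF Ck_on_SucD(1)[OF Suc.prems(1) x] g] by (simp add: comp_def)
    moreover have "frechet_derivative g (at (f x)) w = (\<Sum>b\<in>Basis. (w \<bullet> b) *\<^sub>R frechet_derivative g (at (f x)) b)" for w
      by (rule linear_basis_sum) (rule g.linear_axioms)
    ultimately show "((\<lambda>x. g (f x)) has_derivative ?D x) (at x)"
      by (metis (no_types, lifting) has_derivative_eq_rhs ext)
  next
    fix v
    have "Ck_on k S (\<lambda>x. frechet_derivative f (at x) v \<bullet> b)" for b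
      using Ck_on_SucD(2)[OF Suc.prems(1)] by (intro Ck_on_inner assms(1) Ck_on_const)
    moreover have "Ck_on k S (\<lambda>x. frechet_derivative g (at (f x)) b)" for b
      using Suc.IH[OF Ck_on_Suc_imp[OF Suc.prems(1)] Ck_on_SucD(2)[OF Suc.prems(2)]] .
    ultimately show "Ck_on k S (\<lambda>x. ?D x v)"
      by (intro Ck_on_sum Ck_on_scaleR assms(1))
  qed
qed

lemma Ck_on_local:
  assumes "\<And>x. x \<in> S \<Longrightarrow> \<exists>T. open T \<and> x \<in> T \<and> Ck_on k T f"
  shows "Ck_on k S f"
  using assms
proof (induction k arbitrary: f)
  case 0
  have "continuous (at x within S) f" if "x \<in> S" for x
  proof -
    obtain T where "open T" "x \<in> T" "continuous_on T f"
      using 0 \<open>x \<in> S\<close> by (metis Ck_on.simps(1))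
    then show ?thesis
      using continuous_on_eq_continuous_at continuous_at_imp_continuous_at_within by blast
  qed
  then show ?case
    by (simp add: continuous_on_eq_continuous_within)
next
  case (Suc k)
  have "Ck_on k S (\<lambda>x. frechet_derivative f (at x) v)" for v
    by (rule Suc.IH) (use Suc.prems in force)
  moreover have "\<forall>x\<in>S. f differentiable (at x)"
    using Suc.prems by fastforce
  ultimately show ?case by simp
qed

lemma Ck_on_Un:
  "open S \<Longrightarrow> open T \<Longrightarrow> Ck_on k S f \<Longrightarrow> Ck_on k T f \<Longrightarrow> Ck_on k (S \<union> T) f"
  by (rule Ck_on_local) auto

text \<open>Serves functions that are given by a formula inside a chart and vanish outside a compact
  part of it.\<close>

lemma Ck_on_zero_extend:
  assumes "open S" "open T" "Ck_on k S f" "\<And>x. x \<in> T \<Longrightarrow> f x = 0"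
  shows "Ck_on k (S \<union> T) f"
  by (rule Ck_on_Un[OF assms(1-3)])
    (use Ck_on_cong[OF assms(2), of f "\<lambda>_. 0"] assms(4) Ck_on_const in blast)

lemma has_derivative_real_mult:
  "(f has_real_derivative D) (at x) \<Longrightarrow> (f has_derivative (\<lambda>v. D * v)) (at x)"
  by (simp add: has_field_derivative_def)

text \<open>The induction closes because the derivative is a polynomial in \<open>inverse\<close>
  itself. For \<open>sqrt\<close> below, the derivative is half of \<open>inverse\<close> after
  \<open>sqrt\<close>.\<close>

lemma Ck_on_inverse: "Ck_on k {x. x \<noteq> (0::real)} inverse"
proof (induction k)
  case 0
  then show ?case by (auto intro!: continuous_intros)
next
  case (Suc k)
  have o: "open {x. x \<noteq> (0::real)}"
    by (simp add: open_Collect_neq)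
  show ?case
  proof (rule Ck_on_SucI[OF o])
    show "(inverse has_derivative (\<lambda>v. - (inverse x * inverse x) * v)) (at x)"
      if "x \<in> {x. x \<noteq> 0}" for x :: real
      using that by (intro has_derivative_real_mult) (auto intro!: derivative_eq_intros)
    show "Ck_on k {x. x \<noteq> 0} (\<lambda>x::real. - (inverse x * inverse x) * v)" for v
      by (intro Ck_on_mult Ck_on_uminus Ck_on_const o Suc)
  qed
qed

lemma Ck_on_sqrt: "Ck_on k {0<..} sqrt"
proof (induction k)
  case 0
  then show ?case by (auto intro!: continuous_intros)
next
  case (Suc k)
  have o: "open {(0::real)<..}" by simp
  have i: "Ck_on k {0<..} (\<lambda>x. inverse (sqrt x))"
    by (rule Ck_on_compose[OF o _ Suc Ck_on_inverse]) (auto simp: open_Collect_neq)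
  show ?case
  proof (rule Ck_on_SucI[OF o])
    show "(sqrt has_derivative (\<lambda>v. (inverse (sqrt x) / 2) * v)) (at x)" if "x \<in> {0<..}" for x
      using DERIV_real_sqrt[of x] that by (intro has_derivative_real_mult) auto
    have "Ck_on k {0<..} (\<lambda>x. inverse (sqrt x) * (v / 2))" for v
      by (intro Ck_on_mult Ck_on_const o i)
    then show "Ck_on k {0<..} (\<lambda>x. (inverse (sqrt x) / 2) * v)" for v
      by simp
  qed
qed

lemma Ck_on_exp: "Ck_on k S (exp :: real \<Rightarrow> real)"
proof -
  have "Ck_on k UNIV (exp :: real \<Rightarrow> real)"
  proof (induction k)
    case 0
    then show ?case by (auto intro!: continuous_intros)
  next
    case (Suc k)
    show ?case
      by (rule Ck_on_SucI[OF _ has_derivative_real_mult[OF DERIV_exp]])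
        (auto intro!: Ck_on_mult Ck_on_const Suc)
  qed
  then show ?thesis by (rule Ck_on_subset) simp
qed

lemma continuous_on_frechet:
  fixes f :: "'a::euclidean_space \<Rightarrow> 'b::real_normed_vector"
  assumes "Ck_on (Suc k) S f" "continuous_on S V"
  shows "continuous_on S (\<lambda>x. frechet_derivative f (at x) (V x))"
proof -
  have "frechet_derivative f (at x) (V x) = (\<Sum>b\<in>Basis. (V x \<bullet> b) *\<^sub>R frechet_derivative f (at x) b)" if "x \<in> S" for x
  proof -
    show ?thesis
      using Ck_on_SucD(1)[OF assms(1) that] by (intro linear_basis_sum has_derivative_linear)
  qed
  moreover have "continuous_on S (\<lambda>x. \<Sum>b\<in>Basis. (V x \<bullet> b) *\<^sub>R frechet_derivative f (at x) b)"
    using Ck_on_imp_continuous_on[OF Ck_on_SucD(2)[OF assms(1)]] assms(2)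
    by (intro continuous_intros) auto
  ultimately show ?thesis using continuous_on_cong by (metis (no_types, lifting))
qed

lemma Ck_on_frechet:
  fixes f :: "'a::euclidean_space \<Rightarrow> 'b::real_normed_vector"
  assumes "open S" "Ck_on (Suc k) S f" "Ck_on k S V"
  shows "Ck_on k S (\<lambda>x. frechet_derivative f (at x) (V x))"
proof -
  have eq: "frechet_derivative f (at x) (V x) = (\<Sum>b\<in>Basis. (V x \<bullet> b) *\<^sub>R frechet_derivative f (at x) b)" if "x \<in> S" for x
  proof -
    show ?thesis
      using Ck_on_SucD(1)[OF assms(2) that] by (intro linear_basis_sum has_derivative_linear)
  qed
  have "Ck_on k S (\<lambda>x. \<Sum>b\<in>Basis. (V x \<bullet> b) *\<^sub>R frechet_derivative f (at x) b)"
    by (intro Ck_on_sum Ck_on_scaleR Ck_on_inner Ck_on_const assms Ck_on_SucD(2)[OF assms(2)])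
  then show ?thesis using Ck_on_cong[OF assms(1) eq] by simp
qed

section \<open>Symmetry of second derivatives\<close>

lemma has_real_derivative_along_line:
  fixes f :: "'a::real_normed_vector \<Rightarrow> real"
  assumes "(f has_derivative D) (at (a + t *\<^sub>R v))"
  shows "((\<lambda>s. f (a + s *\<^sub>R v)) has_real_derivative D v) (at t)"
proof -
  have "((\<lambda>s. a + s *\<^sub>R v) has_derivative (\<lambda>s. s *\<^sub>R v)) (at t)"
    by (auto intro!: derivative_eq_intros)
  from diff_chain_at[OF this assms]
  have "((\<lambda>s. f (a + s *\<^sub>R v)) has_derivative (\<lambda>s. D (s *\<^sub>R v))) (at t)"
    by (simp add: comp_def)
  moreover have "D (s *\<^sub>R v) = D v * s" for s
    using linear_scale[OF has_derivative_linear[OF assms]] by simp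
  ultimately show ?thesis
    by (simp add: has_field_derivative_def)
qed

text \<open>Two applications of the mean value theorem: to the difference of f across the side t w
  as a function of the position along v, then to the v-derivative along w. The second difference is
  symmetric in v and w, whereas the derivative on the right records an order.\<close>

lemma frechet_derivative_second_difference:
  fixes f :: "'a::euclidean_space \<Rightarrow> real"
  assumes "open S" "Ck_on 2 S f" "0 < t" "\<And>p q. p \<in> {0..t} \<Longrightarrow> q \<in> {0..t} \<Longrightarrow> a + p *\<^sub>R v + q *\<^sub>R w \<in> S"
  shows "\<exists>p\<in>{0..t}. \<exists>q\<in>{0..t}.
     f (a + t *\<^sub>R v + t *\<^sub>R w) - f (a + t *\<^sub>R v) - f (a + t *\<^sub>R w) + f a =
     t * t * frechet_derivative (\<lambda>x. frechet_derivative f (at x) v) (at (a + p *\<^sub>R v + q *\<^sub>R w)) w"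
proof -
  have C: "Ck_on (Suc (Suc 0)) S f" using assms(2) by (simp add: numeral_2_eq_2)
  define g where "g p = f (a + p *\<^sub>R v + t *\<^sub>R w) - f (a + p *\<^sub>R v)" for p
  define g' where "g' p = frechet_derivative f (at (a + p *\<^sub>R v + t *\<^sub>R w)) v - frechet_derivative f (at (a + p *\<^sub>R v)) v" for p
  have "(g has_real_derivative g' p) (at p)" if "p \<in> {0..t}" for p
  proof -
    have 1: "a + p *\<^sub>R v + t *\<^sub>R w \<in> S" "a + p *\<^sub>R v \<in> S"
      using assms(4)[of p t] assms(4)[of p 0] that \<open>0 < t\<close> by auto
    have "((\<lambda>p. f ((a + t *\<^sub>R w) + p *\<^sub>R v)) has_real_derivative frechet_derivative f (at ((a + t *\<^sub>R w) + p *\<^sub>R v)) v) (at p)"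
      using 1 by (intro has_real_derivative_along_line Ck_on_SucD(1)[OF C]) (simp add: algebra_simps)
    moreover have "((\<lambda>p. f (a + p *\<^sub>R v)) has_real_derivative frechet_derivative f (at (a + p *\<^sub>R v)) v) (at p)"
      using 1 by (intro has_real_derivative_along_line Ck_on_SucD(1)[OF C])
    ultimately show ?thesis
      unfolding g_def g'_def by (intro DERIV_diff) (simp_all only: add.assoc add.commute[of "t *\<^sub>R w"])
  qed
  then obtain p where p: "0 < p" "p < t" "g t - g 0 = (t - 0) * g' p"
    using MVT2[of 0 t g g'] \<open>0 < t\<close> by auto
  define h where "h q = frechet_derivative f (at (a + p *\<^sub>R v + q *\<^sub>R w)) v" for q
  have "(h has_real_derivative frechet_derivative (\<lambda>x. frechet_derivative f (at x) v) (at (a + p *\<^sub>R v + q *\<^sub>R w)) w) (at q)"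
    if "q \<in> {0..t}" for q
    unfolding h_def
    using assms(4)[of p q] p that
    by (intro has_real_derivative_along_line Ck_on_SucD(1)[OF Ck_on_SucD(2)[OF C]]) auto
  then obtain q where "0 < q" "q < t" "h t - h 0 = (t - 0) *
      frechet_derivative (\<lambda>x. frechet_derivative f (at x) v) (at (a + p *\<^sub>R v + q *\<^sub>R w)) w"
    using MVT2[of 0 t h "\<lambda>q. frechet_derivative (\<lambda>x. frechet_derivative f (at x) v) (at (a + p *\<^sub>R v + q *\<^sub>R w)) w"]
      \<open>0 < t\<close> by auto
  then show ?thesis
    using p unfolding g_def g'_def h_def by (intro bexI[of _ p] bexI[of _ q]) (auto simp: algebra_simps)
qed

text \<open>Both mixed derivatives equal the same second difference divided by t^2, each at some
  point of a small parallelogram at a; continuity at a then identifies them.\<close>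

lemma frechet_derivative_symmetric_real:
  fixes f :: "'a::euclidean_space \<Rightarrow> real"
  assumes "open S" "Ck_on 2 S f" "a \<in> S"
  shows "frechet_derivative (\<lambda>x. frechet_derivative f (at x) v) (at a) w =
         frechet_derivative (\<lambda>x. frechet_derivative f (at x) w) (at a) v"
proof -
  have C: "Ck_on (Suc (Suc 0)) S f" using assms(2) by (simp add: numeral_2_eq_2)
  define A where "A v w x = frechet_derivative (\<lambda>x. frechet_derivative f (at x) v) (at x) w" for v w x
  have A: "isCont (A v w) a" for v w
    using Ck_on_SucD(2)[OF Ck_on_SucD(2)[OF C], of v w] assms(1,3)
    by (simp add: A_def[abs_def] continuous_on_eq_continuous_at)
  have "\<bar>A v w a - A w v a\<bar> \<le> e" if "e > 0" for e
  proof -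
    have "\<forall>\<^sub>F x in nhds a. \<bar>A v w x - A v w a\<bar> < e/2 \<and> \<bar>A w v x - A w v a\<bar> < e/2 \<and> x \<in> S"
    proof (intro eventually_conj eventually_nhds_in_open assms(1,3))
      have *: "\<forall>\<^sub>F x in nhds a. \<bar>A v w x - A v w a\<bar> < e/2" for v w
        using tendstoD[OF A[of v w, unfolded isCont_def tendsto_at_iff_tendsto_nhds] half_gt_zero[OF \<open>e > 0\<close>]]
        by (simp add: dist_real_def)
      show "\<forall>\<^sub>F x in nhds a. \<bar>A v w x - A v w a\<bar> < e/2" "\<forall>\<^sub>F x in nhds a. \<bar>A w v x - A w v a\<bar> < e/2"
        by (rule *)+
    qed
    then obtain d where d: "d > 0" "\<And>x. dist x a < d \<Longrightarrow> \<bar>A v w x - A v w a\<bar> < e/2 \<and> \<bar>A w v x - A w v a\<bar> < e/2 \<and> x \<in> S"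
      unfolding eventually_nhds_metric by auto
    \<comment> \<open>The parallelogram with sides t v and t w then stays within d / 2 of a; the
      summand 1 keeps the denominator positive if v and w vanish.\<close>
    define t where "t = d / (2 * (1 + norm v + norm w))"
    have N: "1 + norm v + norm w > 0"
      using norm_ge_zero[of v] norm_ge_zero[of w] by linarith
    then have t: "t > 0" using \<open>d > 0\<close> by (simp add: t_def)
    have near: "dist (a + p *\<^sub>R v + q *\<^sub>R w) a < d" if "p \<in> {0..t}" "q \<in> {0..t}" for p q
    proof -
      have "dist (a + p *\<^sub>R v + q *\<^sub>R w) a = norm (p *\<^sub>R v + q *\<^sub>R w)"
        by (simp add: dist_norm)
      also have "\<dots> \<le> norm (p *\<^sub>R v) + norm (q *\<^sub>R w)"
        by (rule norm_triangle_ineq)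
      also have "\<dots> \<le> t * norm v + t * norm w"
        using that by (auto intro!: add_mono mult_right_mono)
      also have "\<dots> \<le> t * (1 + norm v + norm w)"
        using t by (simp add: algebra_simps)
      also have "\<dots> = d / 2" using N unfolding t_def by (simp add: field_simps)
      finally show ?thesis using \<open>d > 0\<close> by simp
    qed
    obtain p q where 1: "p \<in> {0..t}" "q \<in> {0..t}" "f (a + t *\<^sub>R v + t *\<^sub>R w) - f (a + t *\<^sub>R v) - f (a + t *\<^sub>R w) + f a =
        t * t * A v w (a + p *\<^sub>R v + q *\<^sub>R w)"
      using frechet_derivative_second_difference[OF assms(1,2) t, of a v w] d(2) near unfolding A_def by blast
    have "a + p *\<^sub>R w + q *\<^sub>R v \<in> S" if "p \<in> {0..t}" "q \<in> {0..t}" for p q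
      using d(2)[OF near[OF that(2,1)]] by (simp add: algebra_simps)
    then obtain p' q' where 2: "p' \<in> {0..t}" "q' \<in> {0..t}" "f (a + t *\<^sub>R w + t *\<^sub>R v) - f (a + t *\<^sub>R w) - f (a + t *\<^sub>R v) + f a =
        t * t * A w v (a + p' *\<^sub>R w + q' *\<^sub>R v)"
      using frechet_derivative_second_difference[OF assms(1,2) t, of a w v] unfolding A_def by blast
    have "t * t * A v w (a + p *\<^sub>R v + q *\<^sub>R w) = t * t * A w v (a + p' *\<^sub>R w + q' *\<^sub>R v)"
      using 1(3) 2(3) by (simp add: algebra_simps)
    then have "A v w (a + p *\<^sub>R v + q *\<^sub>R w) = A w v (a + p' *\<^sub>R w + q' *\<^sub>R v)"
      using t by simp
    moreover have "\<bar>A v w (a + p *\<^sub>R v + q *\<^sub>R w) - A v w a\<bar> < e/2"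
      using d(2)[OF near[OF 1(1,2)]] by simp
    moreover have "\<bar>A w v (a + p' *\<^sub>R w + q' *\<^sub>R v) - A w v a\<bar> < e/2"
      using d(2)[OF near[OF 2(2,1)]] by (simp add: algebra_simps)
    ultimately show ?thesis by linarith
  qed
  then have "\<bar>A v w a - A w v a\<bar> \<le> 0"
    by (metis dense linorder_not_le)
  then show ?thesis by (simp add: A_def)
qed

lemma frechet_derivative_symmetric:
  fixes f :: "'a::euclidean_space \<Rightarrow> 'b::euclidean_space"
  assumes "open S" "Ck_on 2 S f" "a \<in> S"
  shows "frechet_derivative (\<lambda>x. frechet_derivative f (at x) v) (at a) w =
         frechet_derivative (\<lambda>x. frechet_derivative f (at x) w) (at a) v"
proof (rule euclidean_eqI)
  fix b :: 'b assume "b \<in> Basis"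
  have C: "Ck_on (Suc (Suc 0)) S f" using assms(2) by (simp add: numeral_2_eq_2)
  have 1: "frechet_derivative (\<lambda>x. f x \<bullet> b) (at x) v = frechet_derivative f (at x) v \<bullet> b" if "x \<in> S" for x v
    using frechet_derivative_eqI[OF has_derivative_inner_left[OF Ck_on_SucD(1)[OF C that]]] by simp
  have 2: "frechet_derivative (\<lambda>x. frechet_derivative (\<lambda>x. f x \<bullet> b) (at x) v) (at a) w =
      frechet_derivative (\<lambda>x. frechet_derivative f (at x) v) (at a) w \<bullet> b" for v w
  proof -
    have "frechet_derivative (\<lambda>x. frechet_derivative (\<lambda>x. f x \<bullet> b) (at x) v) (at a) =
        frechet_derivative (\<lambda>x. frechet_derivative f (at x) v \<bullet> b) (at a)"
      using 1 by (intro frechet_derivative_cong_open(1)[OF assms(1,3)]) auto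
    also have "\<dots> = (\<lambda>w. frechet_derivative (\<lambda>x. frechet_derivative f (at x) v) (at a) w \<bullet> b)"
      by (rule frechet_derivative_eqI[OF has_derivative_inner_left[OF Ck_on_SucD(1)[OF Ck_on_SucD(2)[OF C] assms(3)]]])
    finally show ?thesis by simp
  qed
  have "Ck_on 2 S (\<lambda>x. f x \<bullet> b)"
    by (intro Ck_on_inner assms Ck_on_const)
  from frechet_derivative_symmetric_real[OF assms(1) this assms(3)] 2
  show "frechet_derivative (\<lambda>x. frechet_derivative f (at x) v) (at a) w \<bullet> b =
         frechet_derivative (\<lambda>x. frechet_derivative f (at x) w) (at a) v \<bullet> b" by metis
qed

section \<open>Smooth cutoff functions\<close>

definition flat :: "real \<Rightarrow> real" where
  "flat x = (if x > 0 then exp (- inverse x) else 0)"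

lemma flat_nonneg [simp]: "flat x \<ge> 0" by (simp add: flat_def)

lemma flat_pos_iff [simp]: "flat x > 0 \<longleftrightarrow> x > 0" by (simp add: flat_def)

lemma flat_eq_0_iff [simp]: "flat x = 0 \<longleftrightarrow> x \<le> 0" by (simp add: flat_def not_less)

text \<open>The family below is closed under differentiation.\<close>

definition flat_pow :: "nat \<Rightarrow> real \<Rightarrow> real" where
  "flat_pow m x = inverse x ^ m * flat x"

text \<open>A single term of the exponential series.\<close>

lemma power_div_fact_le_exp:
  assumes "0 \<le> (y::real)" shows "y ^ k / fact k \<le> exp y"
proof -
  have "sum (\<lambda>n. y ^ n /\<^sub>R fact n) {k} \<le> (\<Sum>n. y ^ n /\<^sub>R fact n)"
    using assms by (intro sum_le_suminf summable_exp_generic) auto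
  then show ?thesis by (simp add: exp_def divide_inverse mult.commute)
qed

text \<open>For x > 0 this is the term of order m + 2 in the series of exp (1 / x). Two powers
  beyond m are taken so that the difference quotient at 0 is of order h, which gives the derivative
  there.\<close>

lemma flat_pow_le:
  "\<bar>flat_pow m x\<bar> \<le> fact (m + 2) * x\<^sup>2"
proof (cases "x > 0")
  case True
  have "inverse x ^ m * inverse x ^ 2 / fact (m + 2) \<le> exp (inverse x)"
    using power_div_fact_le_exp[of "inverse x" "m + 2"] True by (simp only: power_add) simp
  then have "inverse x ^ m * inverse x ^ 2 \<le> fact (m + 2) * exp (inverse x)"
    by (simp add: pos_divide_le_eq mult.commute)
  then have "inverse x ^ m * (inverse x ^ 2 * x ^ 2) * exp (- inverse x) \<le>
      fact (m + 2) * (exp (inverse x) * exp (- inverse x)) * x ^ 2"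
    using mult_right_mono[of _ _ "x^2 * exp (- inverse x)"] by (fastforce simp: ac_simps)
  moreover have "inverse x ^ 2 * x ^ 2 = 1"
    using True by (simp add: field_simps)
  moreover have "exp (inverse x) * exp (- inverse x) = 1"
    by (simp add: exp_minus_inverse)
  ultimately show ?thesis using True by (simp add: flat_pow_def flat_def)
qed (simp add: flat_pow_def flat_def)

lemma flat_pow_deriv:
  "(flat_pow m has_real_derivative flat_pow (m + 2) x - real m * flat_pow (m + 1) x) (at x)"
proof -
  consider "x > 0" | "x < 0" | "x = 0" by linarith
  then show ?thesis
  proof cases
    case 1
    have "((\<lambda>x. inverse x ^ m * exp (- inverse x)) has_real_derivative
        inverse x ^ m * (exp (- inverse x) * inverse x ^ 2) +
        (real m * inverse x ^ (m - 1) * (- (inverse x ^ 2))) * exp (- inverse x)) (at x)"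
      using 1 by (auto intro!: derivative_eq_intros simp: power2_eq_square algebra_simps)
    \<comment> \<open>For m = 0 the truncated exponent m - 1 is harmless because of the factor
      \<open>real m\<close>.\<close>
    moreover have e1: "real m * inverse x ^ (m - 1) * (- (inverse x ^ 2)) = - real m * inverse x ^ (m + 1)"
      by (cases m) (auto simp: power2_eq_square algebra_simps)
    moreover have e2: "inverse x ^ m * (exp (- inverse x) * inverse x ^ 2) + (- real m * inverse x ^ (m + 1)) * exp (- inverse x) =
        flat_pow (m + 2) x - real m * flat_pow (m + 1) x"
      using 1 by (simp add: flat_pow_def flat_def power_add power2_eq_square)
    ultimately have "((\<lambda>x. inverse x ^ m * exp (- inverse x)) has_real_derivative
        flat_pow (m + 2) x - real m * flat_pow (m + 1) x) (at x)"
      unfolding e1 e2 by blast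
    then show ?thesis
      by (rule has_field_derivative_transform_within_open[of _ _ _ "{0<..}"])
        (use 1 in \<open>auto simp: flat_pow_def flat_def\<close>)
  next
    case 2
    have "((\<lambda>x. 0) has_real_derivative flat_pow (m + 2) x - real m * flat_pow (m + 1) x) (at x)"
      using 2 by (simp add: flat_pow_def flat_def)
    then show ?thesis
      by (rule has_field_derivative_transform_within_open[of _ _ _ "{..<0}"])
        (use 2 in \<open>auto simp: flat_pow_def flat_def\<close>)
  next
    case 3
    have "((\<lambda>h. flat_pow m h / h) \<longlongrightarrow> 0) (at 0)"
    proof (rule Lim_null_comparison)
      show "((\<lambda>h. fact (m + 2) * \<bar>h\<bar>) \<longlongrightarrow> 0) (at (0::real))"
        by (auto intro!: tendsto_eq_intros)
      have "norm (flat_pow m h / h) \<le> fact (m + 2) * \<bar>h\<bar>" if "h \<noteq> 0" for h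
      proof -
        have "\<bar>flat_pow m h\<bar> \<le> fact (m + 2) * \<bar>h\<bar> * \<bar>h\<bar>"
          using flat_pow_le[of m h] by (simp only: mult.assoc abs_mult_self_eq power2_eq_square)
        then show ?thesis using that by (simp add: abs_divide pos_divide_le_eq del: fact_Suc)
      qed
      then show "\<forall>\<^sub>F h in at 0. norm (flat_pow m h / h) \<le> fact (m + 2) * \<bar>h\<bar>"
        by (simp add: eventually_at_filter)
    qed
    then show ?thesis
      using 3 by (simp add: DERIV_def flat_pow_def flat_def)
  qed
qed

lemma Ck_on_flat_pow: "Ck_on k UNIV (flat_pow m)"
proof (induction k arbitrary: m)
  case 0
  then show ?case
    by (auto intro!: DERIV_continuous_on[OF flat_pow_deriv])
next
  case (Suc k)
  show ?case
    by (rule Ck_on_SucI[OF _ has_derivative_real_mult[OF flat_pow_deriv]])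
      (auto intro!: Ck_on_mult Ck_on_diff Ck_on_const Suc)
qed

lemma Ck_on_flat: "Ck_on k S flat"
proof -
  have "flat = flat_pow 0" by (simp add: flat_pow_def fun_eq_iff)
  then show ?thesis using Ck_on_subset[OF Ck_on_flat_pow, of S k 0] by simp
qed

lemma Ck_on_real_compose:
  fixes f :: "'a::real_normed_vector \<Rightarrow> real" and g :: "real \<Rightarrow> real"
  assumes "open S" "Ck_on k S f" "\<And>T. Ck_on k T g"
  shows "Ck_on k S (\<lambda>x. g (f x))"
  using Ck_on_compose[OF assms(1) open_UNIV assms(2) assms(3)] by simp

lemma Ck_on_divide:
  fixes f g :: "'a::real_normed_vector \<Rightarrow> real"
  assumes "open S" "Ck_on k S f" "Ck_on k S g" "\<And>x. x \<in> S \<Longrightarrow> g x \<noteq> 0"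
  shows "Ck_on k S (\<lambda>x. f x / g x)"
proof -
  have "open {x. x \<noteq> (0::real)}" by (simp add: open_Collect_neq)
  then have "Ck_on k S (\<lambda>x. inverse (g x))"
    using Ck_on_compose[OF assms(1) _ assms(3) Ck_on_inverse] assms(4) by auto
  from Ck_on_mult[OF assms(1,2) this] show ?thesis by (simp add: divide_inverse)
qed

definition smooth_step :: "real \<Rightarrow> real" where
  "smooth_step x = flat (1 - x) / (flat (1 - x) + flat x)"

lemma smooth_step_denominator: "flat (1 - x) + flat x > 0"
  using flat_pos_iff[of x] flat_pos_iff[of "1 - x"] flat_nonneg[of x] flat_nonneg[of "1 - x"]
  by (smt (verit))

lemma smooth_step:
  "x \<le> 0 \<Longrightarrow> smooth_step x = 1" "x \<ge> 1 \<Longrightarrow> smooth_step x = 0"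
  "smooth_step x \<ge> 0" "smooth_step x \<le> 1"
  using smooth_step_denominator[of x] by (auto simp: smooth_step_def)

lemma Ck_on_smooth_step: "Ck_on k S smooth_step"
proof -
  have "Ck_on k UNIV smooth_step"
    unfolding smooth_step_def[abs_def] using smooth_step_denominator
    by (intro Ck_on_divide Ck_on_add Ck_on_real_compose[of UNIV k _ flat] Ck_on_diff Ck_on_const Ck_on_id Ck_on_flat)
      (auto simp: less_imp_neq[symmetric])
  then show ?thesis by (rule Ck_on_subset) simp
qed

section \<open>Orthonormal frames\<close>

text \<open>The vectors \<open>e a\<close> are orthonormal for the form pulled back by L, but
  nothing says that they span. The coordinate map \<open>M\<close> is onto because each combination
  of the \<open>e a\<close> returns its own coefficients, hence it is injective by
  dimension.\<close>

lemma orthonormal_expansion: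
  fixes L :: "real^'n::finite \<Rightarrow> real^'k::finite" and e :: "'n \<Rightarrow> real^'n"
  assumes "linear L" and ON: "\<And>a b. L (e a) \<bullet> L (e b) = (if a = b then 1 else 0)"
  shows "v = (\<Sum>a\<in>UNIV. (L v \<bullet> L (e a)) *\<^sub>R e a)"
proof -
  interpret L: linear L by fact
  define M :: "real^'n \<Rightarrow> real^'n" where "M v = (\<chi> a. L v \<bullet> L (e a))" for v
  have M: "linear M"
    by (auto simp: M_def vec_eq_iff L.add L.scale inner_add_left intro!: linearI)
  have Me: "M (\<Sum>b\<in>UNIV. c b *\<^sub>R e b) = (\<chi> a. c a)" for c
    by (simp add: M_def vec_eq_iff L.sum L.scale inner_sum_left ON if_distrib cong: if_cong)
  have "surj M"
    by (rule surjI[of M "\<lambda>c. \<Sum>b\<in>UNIV. (c $ b) *\<^sub>R e b"]) (simp add: Me)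
  then have "inj M" using M linear_surjective_imp_injective by blast
  moreover have "M v = M (\<Sum>a\<in>UNIV. (L v \<bullet> L (e a)) *\<^sub>R e a)"
    unfolding Me by (simp add: M_def)
  ultimately show ?thesis by (metis injD)
qed

text \<open>Otherwise y, \<nu> and the n frame vectors would be n + 2 nonzero orthogonal vectors in
  a space of dimension n + 1.\<close>

lemma orthonormal_complete:
  fixes L :: "real^'n::finite \<Rightarrow> real^'k::finite" and e :: "'n \<Rightarrow> real^'n"
  assumes "CARD('k) = CARD('n) + 1"
    and ON: "\<And>a b. L (e a) \<bullet> L (e b) = (if a = b then 1 else 0)"
    and "\<And>a. \<nu> \<bullet> L (e a) = 0" "norm \<nu> = 1" "\<And>a. y \<bullet> L (e a) = 0" "y \<bullet> \<nu> = 0"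
  shows "y = 0"
proof (rule ccontr)
  assume "y \<noteq> 0"
  let ?B = "range (\<lambda>a. L (e a))"
  have inj: "inj (\<lambda>a. L (e a))"
    by (rule injI) (metis ON zero_neq_one)
  have nz: "L (e a) \<noteq> 0" for a
    by (metis ON inner_zero_left zero_neq_one)
  have y: "y \<notin> insert \<nu> ?B"
  proof
    assume "y \<in> insert \<nu> ?B"
    then consider "y = \<nu>" | a where "y = L (e a)" by auto
    then have "y \<bullet> y = 0" using assms(5,6) by cases metis+
    then show False using \<open>y \<noteq> 0\<close> by simp
  qed
  have \<nu>: "\<nu> \<noteq> 0" "\<nu> \<notin> ?B"
  proof -
    show "\<nu> \<noteq> 0" using assms(4) by auto
    show "\<nu> \<notin> ?B"
    proof
      assume "\<nu> \<in> ?B"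
      then obtain a where "\<nu> = L (e a)" by auto
      then have "\<nu> \<bullet> \<nu> = 0" using assms(3) by metis
      then show False using \<open>\<nu> \<noteq> 0\<close> by simp
    qed
  qed
  have "pairwise orthogonal (insert y (insert \<nu> ?B))"
    unfolding pairwise_def orthogonal_def using ON assms(3,5,6) inj
    by (auto simp: inner_commute inj_eq)
  then have "independent (insert y (insert \<nu> ?B))"
    using \<open>y \<noteq> 0\<close> \<nu> nz by (intro pairwise_orthogonal_independent) auto
  then have "card (insert y (insert \<nu> ?B)) \<le> DIM(real^'k)"
    using independent_bound by blast
  moreover have "card (insert y (insert \<nu> ?B)) = CARD('n) + 2"
    using y \<nu> by (simp add: card_image inj)
  ultimately show False using assms(1) by simp
qed

lemma orthonormal_decomposition:
  fixes L :: "real^'n::finite \<Rightarrow> real^'k::finite" and e :: "'n \<Rightarrow> real^'n"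
  assumes "CARD('k) = CARD('n) + 1"
    and ON: "\<And>a b. L (e a) \<bullet> L (e b) = (if a = b then 1 else 0)"
    and \<nu>: "\<And>a. \<nu> \<bullet> L (e a) = 0" "norm \<nu> = 1"
  shows "y = (\<Sum>a\<in>UNIV. (y \<bullet> L (e a)) *\<^sub>R L (e a)) + (y \<bullet> \<nu>) *\<^sub>R \<nu>"
    "y \<bullet> y = (\<Sum>a\<in>UNIV. (y \<bullet> L (e a))\<^sup>2) + (y \<bullet> \<nu>)\<^sup>2"
proof -
  let ?s = "\<Sum>a\<in>UNIV. (y \<bullet> L (e a)) *\<^sub>R L (e a)"
  have "y - (?s + (y \<bullet> \<nu>) *\<^sub>R \<nu>) = 0"
  proof (rule orthonormal_complete[OF assms(1) ON \<nu>])
    show "(y - (?s + (y \<bullet> \<nu>) *\<^sub>R \<nu>)) \<bullet> L (e a) = 0" for a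
      using \<nu>(1) by (simp add: inner_diff_left inner_add_left inner_sum_left ON if_distrib cong: if_cong)
    have "\<nu> \<bullet> \<nu> = 1" using \<nu>(2) by (simp add: dot_square_norm)
    then show "(y - (?s + (y \<bullet> \<nu>) *\<^sub>R \<nu>)) \<bullet> \<nu> = 0"
      using \<nu>(1)[unfolded inner_commute[of \<nu>]]
      by (simp add: inner_diff_left inner_add_left inner_sum_left)
  qed
  then show y: "y = ?s + (y \<bullet> \<nu>) *\<^sub>R \<nu>" by simp
  have "y \<bullet> y = y \<bullet> (?s + (y \<bullet> \<nu>) *\<^sub>R \<nu>)"
    using y by simp
  then show "y \<bullet> y = (\<Sum>a\<in>UNIV. (y \<bullet> L (e a))\<^sup>2) + (y \<bullet> \<nu>)\<^sup>2"
    by (simp add: inner_add_right inner_sum_right power2_eq_square)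
qed

text \<open>Gram-Schmidt applied to the coordinate vector fields in the pulled-back metric, for all
  u at once. Every step is smooth because the norm that is divided by never vanishes, X being an
  immersion.\<close>

lemma smooth_orthonormal_frame:
  fixes X :: "real^'n::finite \<Rightarrow> real^'k::finite"
  assumes "open U" and X: "\<And>k. Ck_on k U X"
    and inj: "\<And>u. u \<in> U \<Longrightarrow> inj (frechet_derivative X (at u))"
  obtains E :: "'n \<Rightarrow> real^'n \<Rightarrow> real^'n" where "\<And>a k. Ck_on k U (E a)"
    "\<And>u a b. u \<in> U \<Longrightarrow> frechet_derivative X (at u) (E a u) \<bullet> frechet_derivative X (at u) (E b u) = (if a = b then 1 else 0)"
proof -
  let ?D = "\<lambda>u. frechet_derivative X (at u)"
  have lin: "linear (?D u)" if "u \<in> U" for u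
    using Ck_on_SucD(1)[OF X that] by (rule has_derivative_linear)
  have "\<exists>E :: 'n \<Rightarrow> real^'n \<Rightarrow> real^'n. (\<forall>a\<in>S. \<forall>k. Ck_on k U (E a)) \<and>
     (\<forall>u\<in>U. \<forall>a\<in>S. E a u \<in> span ((\<lambda>b. axis b 1) ` S) \<and> (\<forall>b\<in>S. ?D u (E a u) \<bullet> ?D u (E b u) = (if a = b then 1 else 0)))"
    if "finite S" for S :: "'n set"
    using that
  proof (induction S)
    case (insert c S)
    then obtain E where EC: "\<And>a k. a \<in> S \<Longrightarrow> Ck_on k U (E a)"
      and Espan: "\<And>u a. u \<in> U \<Longrightarrow> a \<in> S \<Longrightarrow> E a u \<in> span ((\<lambda>b. axis b 1) ` S)"
      and EON: "\<And>u a b. u \<in> U \<Longrightarrow> a \<in> S \<Longrightarrow> b \<in> S \<Longrightarrow> ?D u (E a u) \<bullet> ?D u (E b u) = (if a = b then 1 else 0)"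
      by metis
    define w where "w u = axis c 1 - (\<Sum>a\<in>S. (?D u (axis c 1) \<bullet> ?D u (E a u)) *\<^sub>R E a u)" for u
    have wC: "Ck_on k U w" for k
      unfolding w_def
      by (intro Ck_on_diff Ck_on_sum Ck_on_scaleR Ck_on_inner assms(1) Ck_on_const Ck_on_frechet[OF assms(1) X] EC)
    have w_span: "w u \<in> span ((\<lambda>b. axis b 1) ` insert c S)" if "u \<in> U" for u
    proof -
      have [simp]: "E a u \<in> span (insert (axis c 1) ((\<lambda>b. axis b 1) ` S))" if "a \<in> S" for a
        using Espan[OF \<open>u \<in> U\<close> that] span_mono[of "(\<lambda>b. axis b 1) ` S" "insert (axis c 1) ((\<lambda>b. axis b 1) ` S)"] by auto
      show ?thesis
        unfolding w_def by (rule span_diff[OF span_base]) (auto intro!: span_sum span_scale)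
    qed
    have w_nz: "?D u (w u) \<bullet> ?D u (w u) > 0" if "u \<in> U" for u
    proof -
      \<comment> \<open>The earlier frame vectors have no component along the new coordinate c, so
        that of \<open>w u\<close> remains 1. This is why the induction keeps track of the
        span.\<close>
      have "span ((\<lambda>b. axis b 1) ` S) \<subseteq> {v :: real^'n. v $ c = 0}"
        using \<open>c \<notin> S\<close> by (intro span_minimal) (auto simp: axis_def subspace_def)
      then have "E a u $ c = 0" if "a \<in> S" for a
        using Espan[OF \<open>u \<in> U\<close> that] by auto
      then have "w u $ c = 1"
        by (simp add: w_def axis_def)
      then have "w u \<noteq> 0" by auto
      then have "?D u (w u) \<noteq> 0"
        using inj[OF that] lin[OF that] by (metis injD linear_0)
      then show ?thesis by simp
    qed
    have w_orth: "?D u (w u) \<bullet> ?D u (E b u) = 0" if "u \<in> U" "b \<in> S" for u b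
    proof -
      interpret D: linear "?D u" by (rule lin[OF that(1)])
      have "(\<Sum>a\<in>S. ?D u (axis c 1) \<bullet> ?D u (E a u) * (?D u (E a u) \<bullet> ?D u (E b u))) =
          (\<Sum>a\<in>S. ?D u (axis c 1) \<bullet> ?D u (E a u) * (if a = b then 1 else 0))"
        using EON[OF that(1) _ that(2)] by (intro sum.cong) auto
      then show ?thesis
        using that(2) insert.hyps(1)
        by (simp add: w_def D.diff D.sum D.scale inner_diff_left inner_sum_left if_distrib cong: if_cong)
    qed
    define N where "N u = inverse (sqrt (?D u (w u) \<bullet> ?D u (w u)))" for u
    have NC: "Ck_on k U N" for k
    proof -
      have 1: "Ck_on k U (\<lambda>u. ?D u (w u) \<bullet> ?D u (w u))"
        by (intro Ck_on_inner assms(1) Ck_on_frechet[OF assms(1) X] wC)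
      have 2: "Ck_on k U (\<lambda>u. sqrt (?D u (w u) \<bullet> ?D u (w u)))"
        by (rule Ck_on_compose[OF assms(1) _ 1 Ck_on_sqrt]) (use w_nz in auto)
      show ?thesis unfolding N_def
        by (rule Ck_on_compose[OF assms(1) _ 2 Ck_on_inverse]) (use w_nz in \<open>auto simp: open_Collect_neq less_imp_neq[symmetric]\<close>)
    qed
    have NN: "N u * N u * (?D u (w u) \<bullet> ?D u (w u)) = 1" if "u \<in> U" for u
    proof -
      have "N u * N u = inverse (?D u (w u) \<bullet> ?D u (w u))"
        using w_nz[OF that] by (simp add: N_def flip: inverse_mult_distrib)
      then show ?thesis using w_nz[OF that] by simp
    qed
    define E' where "E' = E(c := \<lambda>u. N u *\<^sub>R w u)"
    have E'S: "E' a = E a" if "a \<in> S" for a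
      using that \<open>c \<notin> S\<close> by (auto simp: E'_def)
    have E'c: "E' c u = N u *\<^sub>R w u" for u by (simp add: E'_def)
    show ?case
    proof (intro exI[of _ E'] conjI ballI allI)
      fix a k assume "a \<in> insert c S"
      then show "Ck_on k U (E' a)"
        using E'S EC Ck_on_scaleR[OF assms(1) NC wC] by (cases "a = c") (auto simp: E'_def)
    next
      fix u a assume u: "u \<in> U" and "a \<in> insert c S"
      then show "E' a u \<in> span ((\<lambda>b. axis b 1) ` insert c S)"
        using E'S[of a] Espan[OF u, of a] span_mono[of "(\<lambda>b. axis b 1) ` S" "(\<lambda>b. axis b 1) ` insert c S"]
          span_scale[OF w_span[OF u], of "N u"] E'c[of u]
        by (cases "a = c") auto
    next
      fix u a b assume u: "u \<in> U" and ab: "a \<in> insert c S" "b \<in> insert c S"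
      interpret D: linear "?D u" by (rule lin[OF u])
      show "?D u (E' a u) \<bullet> ?D u (E' b u) = (if a = b then 1 else 0)"
        using ab E'S[of a] E'S[of b] EON[OF u, of a b] NN[OF u] w_orth[OF u, of b] w_orth[OF u, of a]
        by (cases "a = c"; cases "b = c") (auto simp: E'c D.scale inner_commute mult.assoc)
    qed
  qed simp
  from this[of UNIV] obtain E :: "'n \<Rightarrow> real^'n \<Rightarrow> real^'n" where
    "\<And>a k. Ck_on k U (E a)"
    "\<And>u a b. u \<in> U \<Longrightarrow> ?D u (E a u) \<bullet> ?D u (E b u) = (if a = b then 1 else 0)"
    by (metis UNIV_I finite)
  then show ?thesis by (rule that)
qed

section \<open>Charts of an immersed hypersurface\<close>

definition Ck_fun :: "('n::finite, 'm::topological_space) param set \<Rightarrow> nat \<Rightarrow> ('m \<Rightarrow> 'b::real_normed_vector) \<Rightarrow> bool" where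
  "Ck_fun A k f \<longleftrightarrow> (\<forall>(U, p)\<in>A. Ck_on k U (f \<circ> p))"

text \<open>Differentiability is asked for in every chart around x, in particular in the arbitrary
  one used by \<open>differential\<close>, so that the chain rule applies between any two of
  them.\<close>

definition chart_differentiable :: "('n::finite, 'm) param set \<Rightarrow> ('m \<Rightarrow> 'b::real_normed_vector) \<Rightarrow> 'm \<Rightarrow> bool" where
  "chart_differentiable A f x \<longleftrightarrow> (\<forall>(U, p)\<in>A. \<forall>u\<in>U. p u = x \<longrightarrow> (f \<circ> p) differentiable (at u))"

lemma smooth_fun_on_UNIV: "smooth_fun_on A UNIV f \<longleftrightarrow> (\<forall>k. Ck_fun A k f)"
  by (auto simp: smooth_fun_on_def Ck_fun_def smooth_on_def)

lemma Ck_funD: "Ck_fun A k f \<Longrightarrow> (U, p) \<in> A \<Longrightarrow> Ck_on k U (\<lambda>u. f (p u))"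
  by (auto simp: Ck_fun_def comp_def)

lemma Ck_fun_imp_chart_differentiable: "Ck_fun A (Suc k) f \<Longrightarrow> chart_differentiable A f x"
  by (auto simp: Ck_fun_def chart_differentiable_def)

locale atlas =
  fixes A :: "('n::finite, 'm::{t2_space, second_countable_topology}) param set"
  assumes smooth_atlas: "smooth_atlas A"
begin

lemma chart:
  assumes "(U, p) \<in> A"
  shows "open U" "open (p ` U)" "homeomorphism U (p ` U) p (inv_into U p)"
    "inj_on p U" "continuous_on U p" "continuous_on (p ` U) (inv_into U p)"
  using assms smooth_atlas unfolding smooth_atlas_def homeomorphism_def
  by (auto intro!: inj_on_inverseI[of U "inv_into U p" p])

lemma inv_chart [simp]: "(U, p) \<in> A \<Longrightarrow> u \<in> U \<Longrightarrow> inv_into U p (p u) = u"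
  using chart(4) by (auto intro: inv_into_f_f)

lemma chart_cover: obtains U p u where "(U, p) \<in> A" "u \<in> U" "p u = x"
proof -
  have "x \<in> (\<Union>(U, p)\<in>A. p ` U)" using smooth_atlas unfolding smooth_atlas_def by auto
  then show ?thesis using that by auto
qed

lemma open_chart_preimage: "(U, p) \<in> A \<Longrightarrow> open W \<Longrightarrow> open (U \<inter> p -` W)"
  using chart(1,5) continuous_on_open_vimage by (metis Int_commute)

lemma open_chart_image: "(U, p) \<in> A \<Longrightarrow> open W \<Longrightarrow> W \<subseteq> U \<Longrightarrow> open (p ` W)"
proof -
  assume c: "(U, p) \<in> A" and W: "open W" "W \<subseteq> U"
  have "p ` W = p ` U \<inter> inv_into U p -` W"
    using c W by (force simp: inv_chart[OF c])
  then show ?thesis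
    using continuous_on_open_vimage[OF chart(2)[OF c]] chart(6)[OF c] W by (metis Int_commute)
qed

lemma transition_smooth:
  assumes "(U, p) \<in> A" "(V, q) \<in> A"
  shows "Ck_on k (U \<inter> p -` (q ` V)) (\<lambda>u. inv_into V q (p u))"
  using assms smooth_atlas unfolding smooth_atlas_def smooth_on_def by (fastforce simp: comp_def)

lemma param_at: obtains V q where "param_at A x = (V, q)" "(V, q) \<in> A" "x \<in> q ` V"
proof -
  obtain U p u where "(U, p) \<in> A" "u \<in> U" "p u = x" by (rule chart_cover)
  then have "\<exists>c. c \<in> A \<and> x \<in> snd c ` fst c" by (intro exI[of _ "(U, p)"]) auto
  from someI_ex[OF this] that[of "fst (param_at A x)" "snd (param_at A x)"]
  show ?thesis by (auto simp: param_at_def)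
qed

definition transition_deriv :: "(real^'n \<Rightarrow> 'm) \<Rightarrow> real^'n \<Rightarrow> real^'n \<Rightarrow> real^'n" where
  "transition_deriv p u =
     (case param_at A (p u) of (V, q) \<Rightarrow> frechet_derivative (\<lambda>u. inv_into V q (p u)) (at u))"

text \<open>\<open>differential\<close> refers to one arbitrarily chosen chart. The transition into
  that chart has a smooth left inverse near u, so its derivative is injective, hence bijective;
  composition with it translates between the chosen chart and any other.\<close>

lemma
  assumes c: "(U, p) \<in> A" and u: "u \<in> U"
  shows linear_transition_deriv: "linear (transition_deriv p u)"
    and bij_transition_deriv: "bij (transition_deriv p u)"
    and chart_differential: "chart_differentiable A f (p u) \<Longrightarrow>
       frechet_derivative (f \<circ> p) (at u) = differential A f (p u) \<circ> transition_deriv p u"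
proof -
  obtain V q where pa: "param_at A (p u) = (V, q)" and q: "(V, q) \<in> A" "p u \<in> q ` V"
    by (rule param_at)
  let ?t = "\<lambda>u. inv_into V q (p u)" and ?s = "\<lambda>v. inv_into U p (q v)"
  define v where "v = ?t u"
  have v: "v \<in> V" "q v = p u" using q by (auto simp: v_def inv_into_into f_inv_into_f)
  have su: "?s v = u" using v c u by simp
  let ?O = "U \<inter> p -` (q ` V)" and ?O' = "V \<inter> q -` (p ` U)"
  have O: "open ?O" "u \<in> ?O" "open ?O'" "v \<in> ?O'"
    using open_chart_preimage[OF c chart(2)[OF q(1)]] open_chart_preimage[OF q(1) chart(2)[OF c]] u v q by auto
  have t: "(?t has_derivative frechet_derivative ?t (at u)) (at u)"
    using Ck_on_SucD(1)[OF transition_smooth[OF c q(1)] O(2)] .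
  have s: "(?s has_derivative frechet_derivative ?s (at v)) (at v)"
    using Ck_on_SucD(1)[OF transition_smooth[OF q(1) c] O(4)] .
  define T where "T = frechet_derivative ?t (at u)"
  have Tdef: "transition_deriv p u = T" by (simp add: transition_deriv_def pa T_def)
  have lin: "linear T" using t by (simp add: T_def has_derivative_linear)
  have "((\<lambda>u. ?s (?t u)) has_derivative (\<lambda>x. frechet_derivative ?s (at v) (T x))) (at u)"
    using diff_chain_at[OF t s[unfolded v_def]] by (simp add: comp_def T_def v_def)
  then have "((\<lambda>u. u) has_derivative (\<lambda>x. frechet_derivative ?s (at v) (T x))) (at u)"
    by (rule has_derivative_transform_within_open[OF _ O(1,2)])
      (use c in \<open>auto simp: f_inv_into_f\<close>)
  then have "(\<lambda>x. frechet_derivative ?s (at v) (T x)) = (\<lambda>x. x)"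
    using has_derivative_unique has_derivative_ident by blast
  then have "inj T" by (metis injI)
  then have "bij T" using lin linear_injective_imp_surjective by (auto simp: bij_def)
  then show "linear (transition_deriv p u)" "bij (transition_deriv p u)" using lin Tdef by auto
  show "frechet_derivative (f \<circ> p) (at u) = differential A f (p u) \<circ> transition_deriv p u"
    if "chart_differentiable A f (p u)"
  proof -
    have "(f \<circ> q) differentiable (at v)"
      using that q(1) v unfolding chart_differentiable_def by fastforce
    then have fq: "((f \<circ> q) has_derivative frechet_derivative (f \<circ> q) (at v)) (at (?t u))"
      by (simp add: has_derivative_frechet flip: v_def)
    have "(((f \<circ> q) \<circ> ?t) has_derivative frechet_derivative (f \<circ> q) (at v) \<circ> T) (at u)"
      using diff_chain_at[OF t fq] by (simp only: T_def)
    then have "((f \<circ> p) has_derivative frechet_derivative (f \<circ> q) (at v) \<circ> T) (at u)"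
      by (rule has_derivative_transform_within_open[OF _ O(1,2)]) (auto simp: f_inv_into_f)
    then show ?thesis
      by (simp add: differential_def pa frechet_derivative_eqI v_def Tdef)
  qed
qed

lemma Ck_fun_imp_continuous: "Ck_fun A k f \<Longrightarrow> continuous_on UNIV f"
  for f :: "'m \<Rightarrow> 'b::real_normed_vector"
proof -
  assume f: "Ck_fun A k f"
  have "isCont f x" for x
  proof -
    obtain U p u where c: "(U, p) \<in> A" "u \<in> U" "p u = x" by (rule chart_cover)
    have "continuous_on (p ` U) (\<lambda>y. f (p (inv_into U p y)))"
      by (rule continuous_on_compose2[OF Ck_on_imp_continuous_on[OF Ck_funD[OF f c(1)]] chart(6)[OF c(1)]])
        (auto intro: inv_into_into)
    then have "continuous_on (p ` U) f"
      by (rule continuous_on_eq) (simp add: f_inv_into_f)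
    then show ?thesis
      using chart(2)[OF c(1)] c by (auto simp: continuous_on_eq_continuous_at)
  qed
  then show ?thesis by (simp add: continuous_at_imp_continuous_on)
qed

lemma continuous_on_UNIV_charts:
  assumes "\<And>U p. (U, p) \<in> A \<Longrightarrow> continuous_on U (\<lambda>u. f (p u))"
  shows "continuous_on UNIV (f :: 'm \<Rightarrow> 'b::real_normed_vector)"
  using Ck_fun_imp_continuous[of 0 f] assms by (auto simp: Ck_fun_def comp_def)

end

locale hypersurface = atlas A
  for A :: "('n::finite, 'm::{t2_space, second_countable_topology}) param set" +
  fixes F :: "'m \<Rightarrow> real^'k::finite"
  assumes dimension: "CARD('k) = CARD('n) + 1"
    and connected_UNIV: "connected (UNIV :: 'm set)"
    and smooth_F: "Ck_fun A k F"
    and inj_differential: "inj (differential A F x)"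
begin

abbreviation (input) dF :: "(real^'n \<Rightarrow> 'm) \<Rightarrow> real^'n \<Rightarrow> real^'n \<Rightarrow> real^'k" where
  "dF p u \<equiv> frechet_derivative (\<lambda>u. F (p u)) (at u)"

lemma Ck_F: "(U, p) \<in> A \<Longrightarrow> Ck_on k U (\<lambda>u. F (p u))"
  using smooth_F by (rule Ck_funD)

lemma linear_dF: "(U, p) \<in> A \<Longrightarrow> u \<in> U \<Longrightarrow> linear (dF p u)"
  using Ck_on_SucD(1)[OF Ck_F] by (rule has_derivative_linear)

text \<open>The transition derivative is a bijection of coordinate space, so it affects neither
  injectivity nor range and cancels in \<open>directional_deriv\<close>. From here on tangential
  notions are computed in whichever chart is at hand.\<close>

lemma
  assumes c: "(U, p) \<in> A" "u \<in> U"
  shows inj_dF: "inj (dF p u)"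
    and tangent_space_chart: "tangent_space A F (p u) = range (dF p u)"
    and directional_deriv_chart: "chart_differentiable A f (p u) \<Longrightarrow>
      directional_deriv A F f (p u) (dF p u v) = frechet_derivative (\<lambda>u. f (p u)) (at u) v"
proof -
  note T = linear_transition_deriv[OF c] bij_transition_deriv[OF c]
  have F: "dF p u = differential A F (p u) \<circ> transition_deriv p u"
    using chart_differential[OF c, of F] Ck_fun_imp_chart_differentiable[OF smooth_F] by (simp add: comp_def)
  show "inj (dF p u)"
    unfolding F using inj_differential T(2) by (simp add: inj_compose bij_def)
  show "tangent_space A F (p u) = range (dF p u)"
    unfolding F tangent_space_def using T(2) by (metis bij_is_surj image_comp)
  show "chart_differentiable A f (p u) \<Longrightarrow>
      directional_deriv A F f (p u) (dF p u v) = frechet_derivative (\<lambda>u. f (p u)) (at u) v"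
    using chart_differential[OF c, of f] F inj_differential by (simp add: directional_deriv_def comp_def)
qed

lemma subspace_tangent: "subspace (tangent_space A F x)"
proof -
  obtain U p u where c: "(U, p) \<in> A" "u \<in> U" "p u = x" by (rule chart_cover)
  then show ?thesis
    using tangent_space_chart[OF c(1,2)] linear_subspace_image[OF linear_dF[OF c(1,2)] subspace_UNIV] by simp
qed

text \<open>The frame is kept in coordinates, before \<open>dF\<close> is applied, so that its
  vectors can be inserted into derivatives of functions on the chart.\<close>

definition frame :: "(real^'n) set \<Rightarrow> (real^'n \<Rightarrow> 'm) \<Rightarrow> 'n \<Rightarrow> real^'n \<Rightarrow> real^'n" where
  "frame U p = (SOME E. (\<forall>a k. Ck_on k U (E a)) \<and>
    (\<forall>u\<in>U. \<forall>a b. dF p u (E a u) \<bullet> dF p u (E b u) = (if a = b then 1 else 0)))"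

lemma
  assumes c: "(U, p) \<in> A"
  shows Ck_frame: "Ck_on k U (frame U p a)"
    and frame_orthonormal: "u \<in> U \<Longrightarrow> dF p u (frame U p a u) \<bullet> dF p u (frame U p b u) = (if a = b then 1 else 0)"
proof -
  have "\<exists>E :: 'n \<Rightarrow> real^'n \<Rightarrow> real^'n. (\<forall>a k. Ck_on k U (E a)) \<and>
    (\<forall>u\<in>U. \<forall>a b. dF p u (E a u) \<bullet> dF p u (E b u) = (if a = b then 1 else 0))"
    by (rule smooth_orthonormal_frame[OF chart(1)[OF c] Ck_F[OF c] inj_dF[OF c]]) blast+
  from someI_ex[OF this] show "Ck_on k U (frame U p a)"
    "u \<in> U \<Longrightarrow> dF p u (frame U p a u) \<bullet> dF p u (frame U p b u) = (if a = b then 1 else 0)"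
    unfolding frame_def by blast+
qed

text \<open>\<open>gradient\<close> is a definite description. The frame provides a tangent vector
  with the required products; it is unique since the difference of two candidates is tangent and
  orthogonal to itself.\<close>

lemma
  assumes c: "(U, p) \<in> A" "u \<in> U" and f: "chart_differentiable A f (p u)"
  shows gradient_tangent: "gradient A F f (p u) \<in> range (dF p u)"
    and gradient_inner: "gradient A F f (p u) \<bullet> dF p u v = frechet_derivative (\<lambda>u. f (p u)) (at u) v"
proof -
  let ?D = "frechet_derivative (\<lambda>u. f (p u)) (at u)" and ?e = "\<lambda>a. frame U p a u"
  have "(\<lambda>u. f (p u)) differentiable (at u)"
    using f c by (auto simp: chart_differentiable_def comp_def)
  then interpret D: linear ?D
    using has_derivative_frechet has_derivative_linear by blast
  interpret L: linear "dF p u" by (rule linear_dF[OF c])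
  define w where "w = dF p u (\<Sum>a\<in>UNIV. ?D (?e a) *\<^sub>R ?e a)"
  have w: "w \<bullet> dF p u v = ?D v" for v
  proof -
    have v: "v = (\<Sum>a\<in>UNIV. (dF p u v \<bullet> dF p u (?e a)) *\<^sub>R ?e a)"
      by (rule orthonormal_expansion[OF linear_dF[OF c] frame_orthonormal[OF c]])
    have "?D v = (\<Sum>a\<in>UNIV. (dF p u v \<bullet> dF p u (?e a)) * ?D (?e a))"
      by (subst v) (simp add: D.sum D.scale)
    then show ?thesis
      by (simp add: w_def L.sum L.scale inner_sum_left inner_commute[of "dF p u v"] mult.commute)
  qed
  let ?P = "\<lambda>w. w \<in> tangent_space A F (p u) \<and>
        (\<forall>v\<in>tangent_space A F (p u). w \<bullet> v = directional_deriv A F f (p u) v)"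
  have "?P w"
    using w directional_deriv_chart[OF c f] by (auto simp: tangent_space_chart[OF c] w_def)
  moreover have "w' = w" if "?P w'" for w'
  proof -
    have "w' - w \<in> tangent_space A F (p u)"
      using that \<open>?P w\<close> subspace_diff[OF subspace_tangent] by blast
    then have "(w' - w) \<bullet> (w' - w) = 0"
      using that \<open>?P w\<close> by (simp add: inner_diff_left)
    then show ?thesis by simp
  qed
  ultimately have "gradient A F f (p u) = w"
    unfolding gradient_def by (rule the_equality)
  then show "gradient A F f (p u) \<in> range (dF p u)" "gradient A F f (p u) \<bullet> dF p u v = ?D v"
    using w by (auto simp: w_def)
qed

end

section \<open>Change of variables\<close>

text \<open>
  The change-of-variables theorem of the library needs a well-ordered index type, so the index type
  is copied to a type that carries such an order.
\<close>

typedef 'a wo = "UNIV :: 'a set" by auto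

instance wo :: (finite) finite
proof
  have "(UNIV :: 'a wo set) = range Abs_wo"
    by (metis Rep_wo_inverse UNIV_eq_I rangeI)
  moreover have "finite (range Abs_wo :: 'a wo set)" by simp
  ultimately show "finite (UNIV :: 'a wo set)" by metis
qed

instantiation wo :: (countable) wellorder
begin

definition less_eq_wo :: "'a wo \<Rightarrow> 'a wo \<Rightarrow> bool" where
  "less_eq_wo x y \<longleftrightarrow> to_nat (Rep_wo x) \<le> to_nat (Rep_wo y)"

definition less_wo :: "'a wo \<Rightarrow> 'a wo \<Rightarrow> bool" where
  "less_wo x y \<longleftrightarrow> to_nat (Rep_wo x) < to_nat (Rep_wo y)"

instance
proof
  fix P :: "'a wo \<Rightarrow> bool" and a
  assume *: "\<And>x. (\<And>y. y < x \<Longrightarrow> P y) \<Longrightarrow> P x"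
  show "P a"
    by (induction "to_nat (Rep_wo a)" arbitrary: a rule: less_induct) (metis * less_wo_def)
qed (auto simp: less_eq_wo_def less_wo_def Rep_wo_inject)

end

lemma Rep_Abs_wo [simp]: "Rep_wo (Abs_wo x) = x"
  by (simp add: Abs_wo_inverse)

lemma bij_Rep_wo: "bij Rep_wo"
  by (rule o_bij[of Abs_wo]) (auto simp: Rep_wo_inverse)

lemma bij_Abs_wo: "bij Abs_wo"
  by (rule o_bij[of Rep_wo]) (auto simp: Rep_wo_inverse)

definition to_wo :: "real^'n \<Rightarrow> real^('n wo)" where "to_wo x = (\<chi> i. x $ Rep_wo i)"

definition from_wo :: "real^('n wo) \<Rightarrow> real^'n" where "from_wo y = (\<chi> i. y $ Abs_wo i)"

lemma to_from_wo [simp]: "to_wo (from_wo y) = y" "from_wo (to_wo x) = x"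
  by (simp_all add: to_wo_def from_wo_def vec_eq_iff Rep_wo_inverse)

lemma bounded_linear_to_wo: "bounded_linear (to_wo :: real^'n::finite \<Rightarrow> _)"
  by (intro linear_conv_bounded_linear[THEN iffD1] linearI) (auto simp: to_wo_def vec_eq_iff)

lemma bounded_linear_from_wo: "bounded_linear (from_wo :: _ \<Rightarrow> real^'n::finite)"
  by (intro linear_conv_bounded_linear[THEN iffD1] linearI) (auto simp: from_wo_def vec_eq_iff)

lemma borel_measurable_to_wo [measurable]: "(to_wo :: real^'n::finite \<Rightarrow> _) \<in> borel_measurable borel"
  by (intro borel_measurable_continuous_onI linear_continuous_on bounded_linear_to_wo)

lemma prod_Basis_vec:
  fixes f :: "real^'n::finite \<Rightarrow> 'b::comm_monoid_mult"
  shows "(\<Prod>b\<in>Basis. f b) = (\<Prod>i\<in>UNIV. f (axis i 1))"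
proof -
  have B: "(Basis :: (real^'n) set) = range (\<lambda>i. axis i 1)"
    by (auto simp: Basis_vec_def)
  have "inj (\<lambda>i::'n. axis i (1::real))"
    by (auto simp: inj_def axis_eq_axis)
  then show ?thesis unfolding B by (subst prod.reindex) (simp_all add: comp_def)
qed

text \<open>Lebesgue measure is determined by its values on boxes, and relabelling coordinates only
  permutes the sides of a box.\<close>

lemma distr_lborel_to_wo: "distr lborel borel to_wo = (lborel :: (real^('n::finite wo)) measure)"
proof (rule lborel_eqI[symmetric])
  fix l u :: "real^('n wo)"
  assume le: "\<And>b. b \<in> Basis \<Longrightarrow> l \<bullet> b \<le> u \<bullet> b"
  have le': "l $ i \<le> u $ i" for i
    using le[of "axis i 1"] by (simp add: inner_axis axis_in_Basis_iff)
  have "to_wo -` box l u = box (from_wo l) (from_wo u)"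
    by (auto simp: mem_box_cart to_wo_def from_wo_def Rep_wo_inverse) (metis Rep_Abs_wo Rep_wo_inverse)+
  then have "emeasure (distr lborel borel to_wo) (box l u) = emeasure lborel (box (from_wo l) (from_wo u))"
    by (simp add: emeasure_distr)
  also have "\<dots> = (\<Prod>b\<in>Basis. (from_wo u - from_wo l) \<bullet> b)"
    using le' by (intro emeasure_lborel_box) (auto simp: Basis_vec_def inner_axis from_wo_def)
  also have "\<dots> = (\<Prod>i\<in>UNIV. (u - l) $ Abs_wo i)"
    by (simp add: prod_Basis_vec inner_axis from_wo_def)
  also have "\<dots> = (\<Prod>i\<in>UNIV. (u - l) $ i)"
    by (intro arg_cong[of _ _ ennreal] prod.reindex_bij_witness[of _ Rep_wo Abs_wo]) (auto simp: Rep_wo_inverse)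
  finally show "emeasure (distr lborel borel to_wo) (box l u) = (\<Prod>b\<in>Basis. (u - l) \<bullet> b)"
    by (simp add: prod_Basis_vec inner_axis)
qed simp

text \<open>Conjugating the transposition of a and b by h gives the transposition of h a and h b.
  Signs of permutations are thus transported to another index type.\<close>

lemma swapidseq_conj:
  assumes "swapidseq n p" "bij h" shows "swapidseq n (h \<circ> p \<circ> inv h)"
  using assms(1)
proof induction
  case id
  have "h \<circ> id \<circ> inv h = id"
    using assms(2) by (simp add: fun_eq_iff bij_is_surj surj_f_inv_f)
  then show ?case by (simp only: swapidseq.id)
next
  case (comp_Suc n p a b)
  have eq: "h \<circ> (Transposition.transpose a b \<circ> p) \<circ> inv h = Transposition.transpose (h a) (h b) \<circ> (h \<circ> p \<circ> inv h)"
    using bij_is_inj[OF assms(2)] by (auto simp: fun_eq_iff Transposition.transpose_def inj_eq)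
  have "h a \<noteq> h b"
    using comp_Suc.hyps(2) bij_is_inj[OF assms(2)] by (simp add: inj_eq)
  then show ?case
    unfolding eq by (rule swapidseq.comp_Suc[OF comp_Suc.IH])
qed

lemma sign_conj:
  assumes "permutation p" "bij h" shows "sign (h \<circ> p \<circ> inv h) = sign p"
  using assms swapidseq_conj unfolding permutation_def sign_def by (metis evenperm_unique)

lemma det_reindex_wo:
  fixes M :: "real^'n::finite^'n"
  shows "det (\<chi> i j. M $ Rep_wo i $ Rep_wo j) = det M"
proof -
  have inv: "inv Rep_wo = Abs_wo"
    by (rule inv_unique_comp) (auto simp: Rep_wo_inverse)
  have conj: "(Rep_wo \<circ> p \<circ> Abs_wo) permutes UNIV \<and> sign (Rep_wo \<circ> p \<circ> Abs_wo) = sign p"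
    if "p permutes UNIV" for p :: "'n wo \<Rightarrow> 'n wo"
  proof -
    have "bij p" using that by (simp add: permutes_bij)
    then have "bij (Rep_wo \<circ> p \<circ> Abs_wo)"
      using \<open>bij p\<close> bij_Rep_wo bij_Abs_wo by (intro bij_comp)
    moreover have "sign (Rep_wo \<circ> p \<circ> Abs_wo) = sign p"
      using sign_conj[OF _ bij_Rep_wo, of p] that inv permutation_permutes by (metis finite)
    ultimately show ?thesis by (auto simp: bij_iff permutes_def)
  qed
  have "det (\<chi> i j. M $ Rep_wo i $ Rep_wo j) =
      (\<Sum>p\<in>{p. p permutes (UNIV :: 'n wo set)}. of_int (sign p) * (\<Prod>i\<in>UNIV. M $ Rep_wo i $ Rep_wo (p i)))"
    by (simp add: det_def)
  also have "\<dots> = (\<Sum>p\<in>{p. p permutes (UNIV :: 'n set)}. of_int (sign p) * (\<Prod>i\<in>UNIV. M $ i $ p i))"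
  proof (rule sum.reindex_bij_witness[of _ "\<lambda>p. Abs_wo \<circ> p \<circ> Rep_wo" "\<lambda>p. Rep_wo \<circ> p \<circ> Abs_wo"])
    fix p :: "'n \<Rightarrow> 'n" assume p: "p \<in> {p. p permutes UNIV}"
    show "Rep_wo \<circ> (Abs_wo \<circ> p \<circ> Rep_wo) \<circ> Abs_wo = p" by (simp add: fun_eq_iff)
    have "bij p" using p by (simp add: permutes_bij)
    then have "bij (Abs_wo \<circ> p \<circ> Rep_wo)"
      using \<open>bij p\<close> bij_Rep_wo bij_Abs_wo by (intro bij_comp)
    then show "Abs_wo \<circ> p \<circ> Rep_wo \<in> {p. p permutes UNIV}"
      by (auto simp: bij_iff permutes_def)
  next
    fix p :: "'n wo \<Rightarrow> 'n wo" assume "p \<in> {p. p permutes UNIV}"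
    then have p: "(Rep_wo \<circ> p \<circ> Abs_wo) permutes UNIV" "sign (Rep_wo \<circ> p \<circ> Abs_wo) = sign p"
      using conj by auto
    then show "Rep_wo \<circ> p \<circ> Abs_wo \<in> {p. p permutes UNIV}" by simp
    show "Abs_wo \<circ> (Rep_wo \<circ> p \<circ> Abs_wo) \<circ> Rep_wo = p"
      by (simp add: fun_eq_iff Rep_wo_inverse)
    have "(\<Prod>i\<in>UNIV. M $ i $ (Rep_wo \<circ> p \<circ> Abs_wo) i) = (\<Prod>i\<in>UNIV. M $ Rep_wo i $ Rep_wo (p i))"
      by (rule prod.reindex_bij_witness[of _ Rep_wo Abs_wo]) (auto simp: Rep_wo_inverse)
    then show "of_int (sign (Rep_wo \<circ> p \<circ> Abs_wo)) * (\<Prod>i\<in>UNIV. M $ i $ (Rep_wo \<circ> p \<circ> Abs_wo) i) =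
       of_int (sign p) * (\<Prod>i\<in>UNIV. M $ Rep_wo i $ Rep_wo (p i))"
      using p by simp
  qed
  finally show ?thesis by (simp add: det_def)
qed

text \<open>The equivalence for gauge integrals settles the case of an image of finite measure. Read
  in the other direction, it shows that a finite integral forces a finite measure, so the two sides
  are infinite together.\<close>

lemma emeasure_lborel_image_wo:
  fixes T :: "real^'n::{finite,wellorder} \<Rightarrow> real^'n::_"
  assumes B: "B \<in> sets borel" "T ` B \<in> sets borel"
    and T: "\<And>x. x \<in> B \<Longrightarrow> (T has_derivative T' x) (at x)" "inj_on T B"
    and meas: "(\<lambda>x. indicator B x * \<bar>det (matrix (T' x))\<bar>) \<in> borel_measurable borel"
  shows "emeasure lborel (T ` B) = (\<integral>\<^sup>+x. ennreal (indicator B x * \<bar>det (matrix (T' x))\<bar>) \<partial>lborel)"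
proof -
  have iff: "T ` B \<in> lmeasurable \<and> measure lebesgue (T ` B) = m \<longleftrightarrow> ((\<lambda>x. \<bar>det (matrix (T' x))\<bar>) has_integral m) B" for m
    using B T by (intro has_measure_differentiable_image) (auto intro: has_derivative_at_withinI)
  show ?thesis
  proof (cases "emeasure lborel (T ` B) < \<infinity>")
    case True
    then have "T ` B \<in> lmeasurable"
      using B(2) by (simp add: fmeasurable_def)
    then have "((\<lambda>x. \<bar>det (matrix (T' x))\<bar>) has_integral measure lebesgue (T ` B)) B"
      using iff by blast
    then have "(\<integral>\<^sup>+x. ennreal (indicator B x * \<bar>det (matrix (T' x))\<bar>) \<partial>lborel) = measure lebesgue (T ` B)"
      by (intro nn_integral_has_integral_lebesgue) auto
    also have "\<dots> = emeasure lebesgue (T ` B)"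
      using \<open>T ` B \<in> lmeasurable\<close> by (simp add: emeasure_eq_measure2)
    finally show ?thesis using B(2) by simp
  next
    case False
    have "\<not> (\<integral>\<^sup>+x. ennreal (indicator B x * \<bar>det (matrix (T' x))\<bar>) \<partial>lborel) < \<infinity>"
    proof
      assume "(\<integral>\<^sup>+x. ennreal (indicator B x * \<bar>det (matrix (T' x))\<bar>) \<partial>lborel) < \<infinity>"
      then have "(\<lambda>x. indicator B x * \<bar>det (matrix (T' x))\<bar>) integrable_on UNIV"
        by (intro nn_integral_integrable_on meas) auto
      also have "(\<lambda>x. indicator B x * \<bar>det (matrix (T' x))\<bar>) = (\<lambda>x. if x \<in> B then \<bar>det (matrix (T' x))\<bar> else 0)"
        by (auto simp: fun_eq_iff)
      finally have "(\<lambda>x. \<bar>det (matrix (T' x))\<bar>) integrable_on B"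
        by (simp add: integrable_restrict_UNIV)
      then have "T ` B \<in> lmeasurable"
        using iff by (auto simp: integrable_on_def)
      then show False using False B(2) by (simp add: fmeasurable_def)
    qed
    then show ?thesis using False by (simp add: less_top[symmetric])
  qed
qed

text \<open>T is conjugated with the relabelling of coordinates, which preserves Lebesgue measure
  and the Jacobian determinant.\<close>

lemma emeasure_lborel_image:
  fixes T :: "real^'n::finite \<Rightarrow> real^'n"
  assumes B: "B \<in> sets borel" "T ` B \<in> sets borel"
    and T: "\<And>x. x \<in> B \<Longrightarrow> (T has_derivative T' x) (at x)" "inj_on T B"
    and meas: "(\<lambda>x. indicator B x * \<bar>det (matrix (T' x))\<bar>) \<in> borel_measurable borel"
  shows "emeasure lborel (T ` B) = (\<integral>\<^sup>+x. ennreal (indicator B x * \<bar>det (matrix (T' x))\<bar>) \<partial>lborel)"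
proof -
  let ?T = "\<lambda>y. to_wo (T (from_wo y))" and ?T' = "\<lambda>y v. to_wo (T' (from_wo y) (from_wo v))"
  have im: "to_wo ` S = from_wo -` S" for S :: "(real^'n) set"
    by (force simp: image_iff)
  have from_meas: "(from_wo :: _ \<Rightarrow> real^'n) \<in> borel_measurable borel"
    by (intro borel_measurable_continuous_onI linear_continuous_on bounded_linear_from_wo)
  have sets_im: "to_wo ` S \<in> sets borel" if "S \<in> sets borel" for S :: "(real^'n) set"
    using measurable_sets[OF from_meas that] by (simp add: im)
  have e: "emeasure lborel (to_wo ` S) = emeasure lborel S" if "S \<in> sets borel" for S :: "(real^'n) set"
  proof -
    have "emeasure lborel (to_wo ` S) = emeasure (distr lborel borel to_wo) (to_wo ` S)"
      by (simp only: distr_lborel_to_wo)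
    also have "\<dots> = emeasure lborel (to_wo -` (to_wo ` S))"
      using sets_im[OF that] by (subst emeasure_distr) auto
    also have "to_wo -` (to_wo ` S) = S" by (auto simp: im)
    finally show ?thesis .
  qed
  have det_eq: "det (matrix (?T' (to_wo x))) = det (matrix (T' x))" if "x \<in> B" for x
  proof -
    have "matrix (?T' (to_wo x)) = (\<chi> i j. matrix (T' x) $ Rep_wo i $ Rep_wo j)"
    proof -
      have "from_wo (axis j 1) = axis (Rep_wo j) 1" for j :: "'n wo"
        by (auto simp: from_wo_def axis_def vec_eq_iff Rep_wo_inverse)
      then show ?thesis by (simp add: matrix_def) (simp add: to_wo_def)
    qed
    then show ?thesis by (simp add: det_reindex_wo)
  qed
  have integrand: "indicator (to_wo ` B) y * \<bar>det (matrix (?T' y))\<bar> =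
      indicator B (from_wo y) * \<bar>det (matrix (T' (from_wo y)))\<bar>" for y
    using det_eq[of "from_wo y"] by (auto simp: im indicator_def)
  have Tim: "?T ` (to_wo ` B) = to_wo ` (T ` B)" by (auto simp: image_image)
  have "emeasure lborel (T ` B) = emeasure lborel (?T ` (to_wo ` B))"
    using e[OF B(2)] Tim by simp
  also have "\<dots> = (\<integral>\<^sup>+y. ennreal (indicator (to_wo ` B) y * \<bar>det (matrix (?T' y))\<bar>) \<partial>lborel)"
  proof (rule emeasure_lborel_image_wo)
    show "to_wo ` B \<in> sets borel" "?T ` (to_wo ` B) \<in> sets borel"
      using sets_im B Tim by auto
    show "inj_on ?T (to_wo ` B)"
      using T(2) by (auto simp: inj_on_def) (metis to_from_wo(2))+
    show "(?T has_derivative ?T' y) (at y)" if "y \<in> to_wo ` B" for y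
    proof -
      have "(T has_derivative T' (from_wo y)) (at (from_wo y))"
        using that T(1) by (auto simp: im)
      from diff_chain_at[OF bounded_linear_imp_has_derivative[OF bounded_linear_from_wo] this]
      show ?thesis
        using bounded_linear.has_derivative[OF bounded_linear_to_wo] by (fastforce simp: comp_def)
    qed
    show "(\<lambda>y. indicator (to_wo ` B) y * \<bar>det (matrix (?T' y))\<bar>) \<in> borel_measurable borel"
      unfolding integrand using measurable_compose[OF from_meas meas] .
  qed
  also have "\<dots> = (\<integral>\<^sup>+y. ennreal (indicator (to_wo ` B) y * \<bar>det (matrix (?T' y))\<bar>) \<partial>distr lborel borel to_wo)"
    by (simp only: distr_lborel_to_wo)
  also have "\<dots> = (\<integral>\<^sup>+x. ennreal (indicator B x * \<bar>det (matrix (T' x))\<bar>) \<partial>lborel)"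
    unfolding integrand using measurable_compose[OF from_meas meas] by (subst nn_integral_distr) auto
  finally show ?thesis .
qed

lemma continuous_on_det:
  fixes M :: "'a::topological_space \<Rightarrow> real^'n::finite^'n"
  assumes "\<And>i j. continuous_on S (\<lambda>x. M x $ i $ j)"
  shows "continuous_on S (\<lambda>x. det (M x))"
  unfolding det_def by (intro continuous_intros assms)

lemma continuous_on_det_matrix:
  fixes T :: "real^'n::finite \<Rightarrow> real^'n"
  assumes "Ck_on 1 V T"
  shows "continuous_on V (\<lambda>x. det (matrix (frechet_derivative T (at x))))"
proof (rule continuous_on_det)
  fix i j
  have "continuous_on V (\<lambda>x. frechet_derivative T (at x) (axis j 1))"
    using assms by (simp add: numeral_1_eq_Suc_0)
  then show "continuous_on V (\<lambda>x. matrix (frechet_derivative T (at x)) $ i $ j)"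
    by (simp add: matrix_def continuous_on_component)
qed

lemma borel_measurable_indicator_mult:
  fixes f :: "'a::topological_space \<Rightarrow> real"
  assumes "V \<in> sets borel" "continuous_on V f" "B \<in> sets borel" "B \<subseteq> V"
  shows "(\<lambda>x. indicator B x * f x) \<in> borel_measurable borel"
  using borel_measurable_continuous_on_indicator[OF assms(3) continuous_on_subset[OF assms(2,4)]] by simp

lemma borel_measurable_if_const:
  assumes "open V" "continuous_on V f"
  shows "(\<lambda>x. if x \<in> V then f x else c) \<in> borel_measurable borel"
  using assms by (intro borel_measurable_continuous_on_if) auto

text \<open>The image of B is its preimage under the inverse S, which is made a total Borel map by a
  constant value off the open image of V.\<close>

lemma sets_borel_image:
  assumes "open (T ` V)" "continuous_on (T ` V) S" "\<And>x. x \<in> V \<Longrightarrow> S (T x) = x"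
    "B \<subseteq> V" "B \<in> sets borel"
  shows "T ` B \<in> sets borel"
proof (cases "V = {}")
  case False
  then obtain c where c: "c \<in> V" by auto
  have "(\<lambda>y. if y \<in> T ` V then S y else c) -` B \<inter> space borel \<in> sets borel"
    by (rule measurable_sets[OF borel_measurable_if_const[OF assms(1,2)] assms(5)])
  then have "T ` V \<inter> ((\<lambda>y. if y \<in> T ` V then S y else c) -` B) \<in> sets borel"
    using assms(1) by (intro sets.Int) auto
  moreover have "T ` V \<inter> ((\<lambda>y. if y \<in> T ` V then S y else c) -` B) = T ` B"
    using assms(3,4) by auto
  ultimately show ?thesis by simp
qed (use assms in auto)

text \<open>The set version says that Lebesgue measure on the image of V is the push-forward of the
  measure with density |det T'| on V. Equality of these two measures carries over to
  integrals.\<close>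

lemma nn_integral_diffeomorphism:
  fixes T :: "real^'n::finite \<Rightarrow> real^'n" and f :: "real^'n \<Rightarrow> ennreal"
  assumes V: "open V" "Ck_on 1 V T" "open (T ` V)" "continuous_on (T ` V) S" "\<And>x. x \<in> V \<Longrightarrow> S (T x) = x"
    and f: "f \<in> borel_measurable borel"
  shows "(\<integral>\<^sup>+y. indicator (T ` V) y * f y \<partial>lborel) =
    (\<integral>\<^sup>+x. ennreal (indicator V x * \<bar>det (matrix (frechet_derivative T (at x)))\<bar>) * f (T x) \<partial>lborel)"
proof -
  define J where "J x = \<bar>det (matrix (frechet_derivative T (at x)))\<bar>" for x
  have cT: "continuous_on V T" using V(2) Ck_on_imp_continuous_on by blast
  have JV: "continuous_on V J"
    unfolding J_def using continuous_on_det_matrix[OF V(2)] by (intro continuous_intros)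
  have Jm: "(\<lambda>x. indicator B x * J x) \<in> borel_measurable borel" if "B \<in> sets borel" "B \<subseteq> V" for B
    using borel_measurable_indicator_mult[OF _ JV that] V(1) by simp
  have Jm'[measurable]: "(\<lambda>x. ennreal (indicator V x * J x)) \<in> borel_measurable borel"
    using Jm[of V] V(1) by simp
  define T' where "T' = (\<lambda>x. if x \<in> V then T x else 0)"
  have T'[measurable]: "T' \<in> borel_measurable borel"
    unfolding T'_def by (rule borel_measurable_if_const[OF V(1) cT])
  have inj: "inj_on T V" using V(5) by (metis inj_onI)
  define N where "N = distr (density lborel (\<lambda>x. ennreal (indicator V x * J x))) borel T'"
  have "density lborel (indicator (T ` V)) = N"
  proof (rule measure_eqI)
    show "sets (density lborel (indicator (T ` V))) = sets N" by (simp add: N_def)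
    fix B assume "B \<in> sets (density lborel (indicator (T ` V)))"
    then have B[measurable]: "B \<in> sets borel" by simp
    let ?B = "V \<inter> (T' -` B)"
    have TB: "T ` ?B = T ` V \<inter> B" by (auto simp: T'_def)
    have sB: "?B \<in> sets borel"
      using measurable_sets[OF T' B] V(1) by (intro sets.Int) auto
    have "emeasure (density lborel (indicator (T ` V))) B = emeasure lborel (T ` V \<inter> B)"
      using V(3) by (subst emeasure_density) (auto simp flip: indicator_inter_arith)
    also have "\<dots> = (\<integral>\<^sup>+x. ennreal (indicator ?B x * J x) \<partial>lborel)"
      unfolding TB[symmetric] J_def
    proof (rule emeasure_lborel_image[OF sB])
      show "T ` ?B \<in> sets borel" by (rule sets_borel_image[OF V(3-5) _ sB]) auto
      show "inj_on T ?B" using inj by (rule inj_on_subset) auto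
      show "(\<lambda>x. indicator ?B x * \<bar>det (matrix (frechet_derivative T (at x)))\<bar>) \<in> borel_measurable borel"
        using Jm[OF sB] unfolding J_def by blast
    qed (use V(2) Ck_on_SucD(1)[of 0 V T] in auto)
    also have "\<dots> = (\<integral>\<^sup>+x. ennreal (indicator V x * J x) * indicator (T' -` B) x \<partial>lborel)"
      by (intro nn_integral_cong) (auto simp: indicator_def)
    also have "\<dots> = emeasure N B"
      using measurable_sets[OF T' B] by (simp add: N_def emeasure_distr emeasure_density)
    finally show "emeasure (density lborel (indicator (T ` V))) B = emeasure N B" .
  qed
  then have "(\<integral>\<^sup>+y. f y \<partial>density lborel (indicator (T ` V))) = (\<integral>\<^sup>+y. f y \<partial>N)" by simp
  moreover have "(\<integral>\<^sup>+y. f y \<partial>density lborel (indicator (T ` V))) = (\<integral>\<^sup>+y. indicator (T ` V) y * f y \<partial>lborel)"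
    using V(3) f by (intro nn_integral_density) auto
  moreover have "(\<integral>\<^sup>+y. f y \<partial>N) = (\<integral>\<^sup>+x. ennreal (indicator V x * J x) * f (T' x) \<partial>lborel)"
    using f unfolding N_def by (simp add: nn_integral_distr nn_integral_density)
  moreover have "\<dots> = (\<integral>\<^sup>+x. ennreal (indicator V x * J x) * f (T x) \<partial>lborel)"
    by (intro nn_integral_cong) (auto simp: T'_def indicator_def)
  ultimately show ?thesis by (simp add: J_def)
qed

section \<open>The Riemannian measure\<close>

context hypersurface
begin

lemma volume_density_comp: "volume_density (F \<circ> p) u = volume_density (\<lambda>u. F (p u)) u"
  by (simp add: comp_def)

text \<open>Orthonormality of the frame is the matrix identity E G E^T = 1 between the Gram matrix G
  and the matrix E of frame coordinates; take determinants.\<close>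

lemma gram_frame:
  assumes c: "(U, p) \<in> A" "u \<in> U" and e: "\<And>a b. dF p u (e a) \<bullet> dF p u (e b) = (if a = b then 1 else 0)"
  shows "det ((\<chi> i j. dF p u (axis i 1) \<bullet> dF p u (axis j 1)) :: real^'n^'n) * (det (\<chi> a i. e a $ i))\<^sup>2 = 1"
proof -
  interpret L: linear "dF p u" by (rule linear_dF[OF c])
  let ?G = "(\<chi> i j. dF p u (axis i 1) \<bullet> dF p u (axis j 1)) :: real^'n^'n"
  let ?E = "(\<chi> a i. e a $ i) :: real^'n^'n"
  have rep: "dF p u v = (\<Sum>i\<in>UNIV. (v $ i) *\<^sub>R dF p u (axis i 1))" for v
  proof -
    have "v = (\<Sum>i\<in>UNIV. (v $ i) *\<^sub>R axis i 1)"
      using basis_expansion[of v] by (simp add: scalar_mult_eq_scaleR)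
    then have "dF p u v = dF p u (\<Sum>i\<in>UNIV. (v $ i) *\<^sub>R axis i 1)" by simp
    then show ?thesis by (simp only: L.sum L.scale)
  qed
  have "?E ** ?G ** transpose ?E = mat 1"
  proof -
    have "(?E ** ?G ** transpose ?E) $ a $ b = dF p u (e a) \<bullet> dF p u (e b)" for a b
      unfolding rep[of "e a"] rep[of "e b"]
      by (simp add: matrix_matrix_mult_def transpose_def inner_sum_left inner_sum_right sum_distrib_right mult_ac)
    then show ?thesis by (simp add: vec_eq_iff e mat_def)
  qed
  then have "det (?E ** ?G ** transpose ?E) = 1" by simp
  then show ?thesis by (simp add: det_mul det_transpose power2_eq_square mult_ac)
qed

lemma volume_density_eq:
  assumes c: "(U, p) \<in> A" "u \<in> U" and e: "\<And>a b. dF p u (e a) \<bullet> dF p u (e b) = (if a = b then 1 else 0)"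
  shows "det (\<chi> a i. e a $ i) \<noteq> 0" "volume_density (\<lambda>u. F (p u)) u = inverse \<bar>det (\<chi> a i. e a $ i)\<bar>"
proof -
  let ?d = "det (\<chi> a i. e a $ i)"
  let ?G = "(\<chi> i j. dF p u (axis i 1) \<bullet> dF p u (axis j 1)) :: real^'n^'n"
  have *: "det ?G * ?d\<^sup>2 = 1" by (rule gram_frame[OF c e])
  then show "?d \<noteq> 0" by auto
  then have "det ?G = inverse (?d\<^sup>2)" using * by (simp add: field_simps)
  then show "volume_density (\<lambda>u. F (p u)) u = inverse \<bar>?d\<bar>"
    by (simp add: volume_density_def real_sqrt_inverse)
qed

lemma volume_density_pos:
  assumes "(U, p) \<in> A" "u \<in> U"
  shows "volume_density (\<lambda>u. F (p u)) u > 0"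
  using volume_density_eq[OF assms frame_orthonormal[OF assms(1,2)]] by simp

lemma Ck_det:
  fixes M :: "'a::real_normed_vector \<Rightarrow> real^'n^'n"
  assumes "open S" "\<And>i j. Ck_on k S (\<lambda>x. M x $ i $ j)"
  shows "Ck_on k S (\<lambda>x. det (M x))"
proof -
  have "Ck_on k S (\<lambda>x. \<Prod>i\<in>I. M x $ i $ p i)" for p :: "'n \<Rightarrow> 'n" and I
    by (induction I rule: infinite_finite_induct)
      (auto intro!: Ck_on_const Ck_on_mult assms)
  then show ?thesis
    unfolding det_def by (intro Ck_on_sum Ck_on_mult Ck_on_const assms(1))
qed

lemma Ck_volume_density:
  assumes c: "(U, p) \<in> A"
  shows "Ck_on k U (volume_density (\<lambda>u. F (p u)))"
proof -
  note o = chart(1)[OF c]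
  have 1: "Ck_on k U (\<lambda>u. det ((\<chi> i j. dF p u (axis i 1) \<bullet> dF p u (axis j 1)) :: real^'n^'n))"
    by (rule Ck_det[OF o]) (simp, intro Ck_on_inner o Ck_on_frechet[OF o Ck_F[OF c]] Ck_on_const)
  show ?thesis
    unfolding volume_density_def[abs_def]
  proof (rule Ck_on_compose[OF o _ 1 Ck_on_sqrt])
    fix u assume "u \<in> U"
    from volume_density_pos[OF c this]
    show "det ((\<chi> i j. dF p u (axis i 1) \<bullet> dF p u (axis j 1)) :: real^'n^'n) \<in> {0<..}"
      by (simp add: volume_density_def)
  qed simp
qed

lemma borel_measurable_volume [measurable (raw)]:
  assumes c: "(U, p) \<in> A"
  shows "(\<lambda>u. ennreal (indicator U u * volume_density (\<lambda>u. F (p u)) u)) \<in> borel_measurable borel"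
  using borel_measurable_indicator_mult[OF _ Ck_on_imp_continuous_on[OF Ck_volume_density[OF c]], of U] chart(1)[OF c]
  by simp

text \<open>The derivative of the transition map sends an orthonormal frame in the chart q to one in
  the chart p and multiplies the determinant of its coordinates by det T'. Volume densities are
  reciprocals of such determinants.\<close>

lemma volume_density_transition:
  assumes c: "(U, p) \<in> A" "(V, q) \<in> A" and v: "v \<in> V" "q v \<in> p ` U"
  defines "T \<equiv> \<lambda>v. inv_into U p (q v)"
  shows "volume_density (\<lambda>v. F (q v)) v =
    \<bar>det (matrix (frechet_derivative T (at v)))\<bar> * volume_density (\<lambda>u. F (p u)) (T v)"
proof -
  have u: "T v \<in> U" "p (T v) = q v"
    using v(2) by (auto simp: T_def inv_into_into f_inv_into_f)
  have O: "open (V \<inter> q -` (p ` U))" "v \<in> V \<inter> q -` (p ` U)"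
    using open_chart_preimage[OF c(2) chart(2)[OF c(1)]] v by auto
  have T: "(T has_derivative frechet_derivative T (at v)) (at v)"
    unfolding T_def using Ck_on_SucD(1)[OF transition_smooth[OF c(2,1)] O(2)] .
  have "((\<lambda>v. F (p (T v))) has_derivative (\<lambda>w. dF p (T v) (frechet_derivative T (at v) w))) (at v)"
    using diff_chain_at[OF T Ck_on_SucD(1)[OF Ck_F[OF c(1)] u(1)]] by (simp add: comp_def)
  then have "((\<lambda>v. F (q v)) has_derivative (\<lambda>w. dF p (T v) (frechet_derivative T (at v) w))) (at v)"
    by (rule has_derivative_transform_within_open[OF _ O]) (auto simp: T_def f_inv_into_f)
  then have dF: "dF q v w = dF p (T v) (frechet_derivative T (at v) w)" for w
    by (simp add: frechet_derivative_eqI)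
  let ?D = "frechet_derivative T (at v)"
  have lin: "linear ?D" using T by (rule has_derivative_linear)
  let ?e = "\<lambda>a. frame V q a v"
  have e: "dF q v (?e a) \<bullet> dF q v (?e b) = (if a = b then 1 else 0)" for a b
    by (rule frame_orthonormal[OF c(2) v(1)])
  have e': "dF p (T v) (?D (?e a)) \<bullet> dF p (T v) (?D (?e b)) = (if a = b then 1 else 0)" for a b
    using e by (simp add: dF)
  have "(\<chi> a i. ?D (?e a) $ i) = (\<chi> a i. ?e a $ i) ** transpose (matrix ?D)"
  proof -
    have "?D w $ i = (\<Sum>j\<in>UNIV. matrix ?D $ i $ j * w $ j)" for w i
    proof -
      have "?D w $ i = (matrix ?D *v w) $ i"
        using fun_cong[OF matrix_vector_mul(2)[OF lin], of w] by simp
      then show ?thesis by (simp add: matrix_vector_mult_def)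
    qed
    then show ?thesis
      by (simp add: vec_eq_iff matrix_matrix_mult_def transpose_def mult.commute)
  qed
  then have "det (\<chi> a i. ?D (?e a) $ i) = det (\<chi> a i. ?e a $ i) * det (matrix ?D)"
    by (simp add: det_mul)
  then have "det (matrix ?D) \<noteq> 0"
    and b: "volume_density (\<lambda>u. F (p u)) (T v) = inverse \<bar>det (\<chi> a i. ?e a $ i) * det (matrix ?D)\<bar>"
    using volume_density_eq[OF c(1) u(1), of "\<lambda>a. ?D (?e a)"] e' by auto
  then show ?thesis
    unfolding b volume_density_eq(2)[OF c(2) v(1) e] by (simp add: abs_mult)
qed

section \<open>Construction and uniqueness of the measure from countably many charts\<close>

lemma chart_sequence:
  obtains c :: "nat \<Rightarrow> ('n, 'm) param" where "range c \<subseteq> A" "(\<Union>i. snd (c i) ` fst (c i)) = UNIV"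
proof -
  have "\<And>S. S \<in> (\<lambda>c. snd c ` fst c) ` A \<Longrightarrow> open S"
    using chart(2) by auto
  from Lindelof[OF this] obtain \<F> where \<F>: "\<F> \<subseteq> (\<lambda>c. snd c ` fst c) ` A" "countable \<F>" "\<Union>\<F> = \<Union>((\<lambda>c. snd c ` fst c) ` A)"
    by blast
  obtain B where B: "B \<subseteq> A" "countable B" "\<F> = (\<lambda>c. snd c ` fst c) ` B"
    using iffD1[OF countable_subset_image conjI[OF \<F>(2,1)]] by blast
  have U: "\<Union>\<F> = UNIV"
  proof -
    have "x \<in> \<Union>((\<lambda>c. snd c ` fst c) ` A)" for x
    proof -
      obtain U p u where "(U, p) \<in> A" "u \<in> U" "p u = x" by (rule chart_cover)
      then show ?thesis by force
    qed
    then show ?thesis using \<F>(3) by auto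
  qed
  then have "B \<noteq> {}" using B(3) by auto
  then have "range (from_nat_into B) = B" using B(2) by (simp add: range_from_nat_into)
  moreover have "(\<Union>i. snd (from_nat_into B i) ` fst (from_nat_into B i)) =
      (\<Union>c\<in>range (from_nat_into B). snd c ` fst c)" by auto
  ultimately have "(\<Union>i. snd (from_nat_into B i) ` fst (from_nat_into B i)) = (\<Union>c\<in>B. snd c ` fst c)"
    by (simp only:)
  then show ?thesis
    using that[of "from_nat_into B"] \<open>range (from_nat_into B) = B\<close> B U by auto
qed

lemma sets_chart_image: "(U, p) \<in> A \<Longrightarrow> B \<in> sets borel \<Longrightarrow> B \<subseteq> U \<Longrightarrow> p ` B \<in> sets borel"
  by (rule sets_borel_image[OF chart(2) chart(6)]) auto

text \<open>Nothing is known about p outside U, not even measurability; this total map agrees with p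
  on U and is Borel.\<close>

definition ext :: "(real^'n) set \<Rightarrow> (real^'n \<Rightarrow> 'm) \<Rightarrow> real^'n \<Rightarrow> 'm" where
  "ext U p u = (if u \<in> U then p u else undefined)"

lemma ext_measurable: "(U, p) \<in> A \<Longrightarrow> ext U p \<in> borel_measurable borel"
  unfolding ext_def[abs_def] by (intro borel_measurable_if_const chart)

definition chart_measure :: "(real^'n) set \<Rightarrow> (real^'n \<Rightarrow> 'm) \<Rightarrow> 'm measure" where
  "chart_measure U p =
     distr (density lborel (\<lambda>u. ennreal (indicator U u * volume_density (\<lambda>u. F (p u)) u))) borel (ext U p)"

lemma sets_chart_measure [simp]: "sets (chart_measure U p) = sets borel"
  by (simp add: chart_measure_def)

lemma nn_integral_chart_measure:
  assumes c: "(U, p) \<in> A" and f: "f \<in> borel_measurable borel"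
  shows "(\<integral>\<^sup>+x. f x \<partial>chart_measure U p) =
    (\<integral>\<^sup>+u. ennreal (indicator U u * volume_density (\<lambda>u. F (p u)) u) * f (p u) \<partial>lborel)"
proof -
  have "(\<integral>\<^sup>+x. f x \<partial>chart_measure U p) =
    (\<integral>\<^sup>+u. ennreal (indicator U u * volume_density (\<lambda>u. F (p u)) u) * f (ext U p u) \<partial>lborel)"
    unfolding chart_measure_def using ext_measurable[OF c] f borel_measurable_volume[OF c]
    by (simp add: nn_integral_distr nn_integral_density)
  also have "\<dots> = (\<integral>\<^sup>+u. ennreal (indicator U u * volume_density (\<lambda>u. F (p u)) u) * f (p u) \<partial>lborel)"
    by (intro nn_integral_cong) (auto simp: ext_def indicator_def)
  finally show ?thesis .
qed

lemma emeasure_chart_measure: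
  assumes c: "(U, p) \<in> A" and B: "B \<in> sets borel"
  shows "emeasure (chart_measure U p) B =
    (\<integral>\<^sup>+u. ennreal (indicator U u * volume_density (\<lambda>u. F (p u)) u) * indicator B (p u) \<partial>lborel)"
  using nn_integral_chart_measure[OF c, of "indicator B"] B by simp

text \<open>The measures of two charts agree on the overlap: the Jacobian from the change of
  variables is the factor by which the volume densities differ.\<close>

lemma chart_measure_transition:
  assumes c: "(U, p) \<in> A" "(V, q) \<in> A" and D: "D \<in> sets borel" "D \<subseteq> p ` U" and B: "B \<in> sets borel" "B \<subseteq> V"
  shows "emeasure (chart_measure U p) (q ` B \<inter> D) =
    (\<integral>\<^sup>+v. ennreal (indicator B v * volume_density (\<lambda>v. F (q v)) v) * indicator D (q v) \<partial>lborel)"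
proof -
  let ?T = "\<lambda>v. inv_into U p (q v)" and ?S = "\<lambda>u. inv_into V q (p u)"
  let ?V = "V \<inter> q -` (p ` U)" and ?U = "U \<inter> p -` (q ` V)"
  have V: "open ?V" "open ?U"
    using open_chart_preimage[OF c(1) chart(2)[OF c(2)]] open_chart_preimage[OF c(2) chart(2)[OF c(1)]] by auto
  have TV: "?T ` ?V = ?U"
  proof
    show "?T ` ?V \<subseteq> ?U"
    proof
      fix u assume "u \<in> ?T ` ?V"
      then obtain v where v: "v \<in> V" "q v \<in> p ` U" "u = ?T v" by auto
      then have "u \<in> U" "p u = q v" by (simp_all only: inv_into_into f_inv_into_f)
      then show "u \<in> ?U" using v by auto
    qed
    show "?U \<subseteq> ?T ` ?V"
    proof
      fix u assume u: "u \<in> ?U"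
      then obtain v where v: "v \<in> V" "p u = q v" by auto
      then have "?T v = u" using u c(1) by (metis IntD1 inv_chart)
      moreover have "v \<in> ?V" using u v by (metis IntD1 IntI imageI vimageI)
      ultimately show "u \<in> ?T ` ?V" by blast
    qed
  qed
  have qB: "q ` B \<inter> D \<in> sets borel"
    using sets_chart_image[OF c(2) B] D by auto
  let ?f = "\<lambda>u. ennreal (indicator U u * volume_density (\<lambda>u. F (p u)) u) * indicator (q ` B \<inter> D) (ext U p u)"
  have "emeasure (chart_measure U p) (q ` B \<inter> D) =
    (\<integral>\<^sup>+u. ennreal (indicator U u * volume_density (\<lambda>u. F (p u)) u) * indicator (q ` B \<inter> D) (p u) \<partial>lborel)"
    by (rule emeasure_chart_measure[OF c(1) qB])
  also have "\<dots> = (\<integral>\<^sup>+u. indicator (?T ` ?V) u * ?f u \<partial>lborel)"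
    unfolding TV using B(2) by (intro nn_integral_cong) (auto simp: indicator_def ext_def)
  also have "\<dots> = (\<integral>\<^sup>+v. ennreal (indicator ?V v * \<bar>det (matrix (frechet_derivative ?T (at v)))\<bar>) * ?f (?T v) \<partial>lborel)"
  proof (rule nn_integral_diffeomorphism[OF V(1) transition_smooth[OF c(2,1)]])
    show "open (?T ` ?V)" using V TV by simp
    show "continuous_on (?T ` ?V) ?S"
      unfolding TV using Ck_on_imp_continuous_on[OF transition_smooth[OF c(1,2)]] .
    show "?S (?T v) = v" if "v \<in> ?V" for v
      using that c(2) by (auto simp: f_inv_into_f)
    have "(\<lambda>u. indicator (q ` B \<inter> D) (ext U p u) :: ennreal) \<in> borel_measurable borel"
      using measurable_compose[OF ext_measurable[OF c(1)] borel_measurable_indicator[OF qB]] by simp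
    then show "?f \<in> borel_measurable borel"
      using borel_measurable_volume[OF c(1)] by (intro borel_measurable_times_ennreal) auto
  qed
  also have "\<dots> = (\<integral>\<^sup>+v. ennreal (indicator B v * volume_density (\<lambda>v. F (q v)) v) * indicator D (q v) \<partial>lborel)"
  proof (rule nn_integral_cong)
    fix v :: "real^'n"
    show "ennreal (indicator ?V v * \<bar>det (matrix (frechet_derivative ?T (at v)))\<bar>) * ?f (?T v) =
      ennreal (indicator B v * volume_density (\<lambda>v. F (q v)) v) * indicator D (q v)"
    proof (cases "v \<in> B \<and> q v \<in> D")
      case True
      then have v: "v \<in> V" "q v \<in> p ` U" using B D by auto
      then have "ext U p (?T v) = q v" "?T v \<in> U" by (auto simp: ext_def f_inv_into_f inv_into_into)
      then show ?thesis
        using True v volume_density_transition[OF c v]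
          volume_density_pos[OF c(1), of "?T v"]
        by (auto simp: indicator_def simp flip: ennreal_mult)
    next
      case False
      have "?f (?T v) = 0" if v: "v \<in> ?V"
      proof -
        have "ext U p (?T v) = q v" using v by (auto simp: ext_def f_inv_into_f inv_into_into)
        moreover have "q v \<notin> q ` B \<inter> D"
          using False v B inj_on_image_mem_iff[OF chart(4)[OF c(2)]] by auto
        ultimately show ?thesis by simp
      qed
      moreover have "indicator B v * indicator D (q v) = (0::ennreal)" using False by (auto simp: indicator_def)
      ultimately show ?thesis using False by (cases "v \<in> ?V") (auto simp: indicator_def)
    qed
  qed
  finally show ?thesis .
qed

lemma suminf_swap_ennreal: "(\<Sum>i. \<Sum>j. f i j) = (\<Sum>j. \<Sum>i. f i (j::nat) :: ennreal)" for f :: "nat \<Rightarrow> nat \<Rightarrow> ennreal"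
proof -
  have "(\<Sum>i. \<Sum>j. f i j) = (\<integral>\<^sup>+i. (\<Sum>j. f i j) \<partial>count_space UNIV)"
    by (simp add: nn_integral_count_space_nat)
  also have "\<dots> = (\<Sum>j. \<integral>\<^sup>+i. f i j \<partial>count_space UNIV)"
    by (rule nn_integral_suminf) simp
  finally show ?thesis by (simp add: nn_integral_count_space_nat)
qed

definition is_riemannian_measure :: "'m measure \<Rightarrow> bool" where
  "is_riemannian_measure \<mu> \<longleftrightarrow> sets \<mu> = sets borel \<and>
    (\<forall>(U, p)\<in>A. \<forall>B\<in>sets borel. B \<subseteq> U \<longrightarrow>
           emeasure \<mu> (p ` B) = (\<integral>\<^sup>+ u. indicator B u * ennreal (volume_density (F \<circ> p) u) \<partial>lborel))"

lemma chart_partition: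
  obtains D :: "nat \<Rightarrow> 'm set" and c :: "nat \<Rightarrow> ('n, 'm) param"
  where "\<And>i. c i \<in> A" "\<And>i. D i \<in> sets borel" "\<And>i. D i \<subseteq> snd (c i) ` fst (c i)"
    "disjoint_family D" "(\<Union>i. D i) = UNIV"
proof -
  obtain c :: "nat \<Rightarrow> ('n, 'm) param" where c: "range c \<subseteq> A" "(\<Union>i. snd (c i) ` fst (c i)) = UNIV"
    by (rule chart_sequence)
  let ?O = "\<lambda>i. snd (c i) ` fst (c i)"
  have "range ?O \<subseteq> sets borel"
    using c(1) chart(2) by (metis (no_types, lifting) borel_open image_subset_iff prod.collapse range_subsetD)
  then have "range (disjointed ?O) \<subseteq> sets borel"
    by (rule sets.range_disjointed_sets)
  then show ?thesis
    using that[of c "disjointed ?O"] c disjointed_subset[of ?O] disjoint_family_disjointed[of ?O] UN_disjointed_eq[of ?O]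
    by (simp add: image_subset_iff)
qed

text \<open>The measure of E is the sum of the chart measures of its pieces along a countable Borel
  partition subordinate to charts. For the image of a set under any further chart q, each piece is
  recomputed in q, and the indicators of the pieces sum to 1.\<close>

lemma ex_riemannian_measure: "\<exists>\<mu>. is_riemannian_measure \<mu>"
proof -
  obtain D :: "nat \<Rightarrow> 'm set" and c :: "nat \<Rightarrow> ('n, 'm) param"
    where c: "\<And>i. c i \<in> A" and D: "\<And>i. D i \<in> sets borel" "\<And>i. D i \<subseteq> snd (c i) ` fst (c i)"
      "disjoint_family D" "(\<Union>i. D i) = UNIV" by (rule chart_partition) blast
  have c': "(fst (c i), snd (c i)) \<in> A" for i using c by simp
  let ?M = "\<lambda>i. chart_measure (fst (c i)) (snd (c i))"
  let ?m = "\<lambda>E. \<Sum>i. emeasure (?M i) (E \<inter> D i)"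
  define \<mu> where "\<mu> = measure_of UNIV (sets borel) ?m"
  have sets: "sets \<mu> = sets borel"
    using sets.sigma_sets_eq[of "borel :: 'm measure"] by (simp add: \<mu>_def sets_measure_of)
  have em: "emeasure \<mu> E = ?m E" if "E \<in> sets borel" for E
    unfolding \<mu>_def
  proof (rule emeasure_measure_of_sigma)
    show "sigma_algebra UNIV (sets (borel :: 'm measure))"
      using sets.sigma_algebra_axioms[of "borel :: 'm measure"] by simp
    show "positive (sets borel) ?m" by (simp add: positive_def)
    show "countably_additive (sets borel) ?m"
    proof (rule countably_additiveI)
      fix E :: "nat \<Rightarrow> 'm set"
      assume E: "range E \<subseteq> sets borel" "disjoint_family E"
      have "emeasure (?M i) ((\<Union>n. E n) \<inter> D i) = (\<Sum>n. emeasure (?M i) (E n \<inter> D i))" for i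
      proof -
        have "disjoint_family (\<lambda>n. E n \<inter> D i)" using E(2) by (auto simp: disjoint_family_on_def)
        moreover have "range (\<lambda>n. E n \<inter> D i) \<subseteq> sets (?M i)" using E(1) D(1) by auto
        ultimately have "(\<Sum>n. emeasure (?M i) (E n \<inter> D i)) = emeasure (?M i) (\<Union>n. E n \<inter> D i)"
          by (intro suminf_emeasure)
        then show ?thesis by (simp add: Int_UN_distrib2)
      qed
      then show "(\<Sum>n. ?m (E n)) = ?m (\<Union>n. E n)"
        using suminf_swap_ennreal[of "\<lambda>n i. emeasure (?M i) (E n \<inter> D i)"] by simp
    qed
  qed fact
  have "emeasure \<mu> (q ` B) = (\<integral>\<^sup>+ u. indicator B u * ennreal (volume_density (F \<circ> q) u) \<partial>lborel)"
    if q: "(V, q) \<in> A" and B: "B \<in> sets borel" "B \<subseteq> V" for V q B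
  proof -
    let ?v = "\<lambda>v. ennreal (indicator B v * volume_density (\<lambda>v. F (q v)) v)"
    have qD: "(\<lambda>v. indicator (D i) (ext V q v) :: ennreal) \<in> borel_measurable borel" for i
      using measurable_compose[OF ext_measurable[OF q] borel_measurable_indicator[of "D i"]] D(1) by simp
    have vm: "?v \<in> borel_measurable borel"
      using borel_measurable_indicator_mult[OF _ Ck_on_imp_continuous_on[OF Ck_volume_density[OF q]] B] chart(1)[OF q] by simp
    have "emeasure \<mu> (q ` B) = ?m (q ` B)"
      by (rule em[OF sets_chart_image[OF q B]])
    also have "\<dots> = (\<Sum>i. \<integral>\<^sup>+v. ?v v * indicator (D i) (q v) \<partial>lborel)"
      using chart_measure_transition[OF c' q D(1,2) B] by simp
    also have "\<dots> = (\<Sum>i. \<integral>\<^sup>+v. ?v v * indicator (D i) (ext V q v) \<partial>lborel)"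
      using B(2) by (intro arg_cong[of _ _ suminf] ext nn_integral_cong) (auto simp: ext_def indicator_def)
    also have "\<dots> = (\<integral>\<^sup>+v. (\<Sum>i. ?v v * indicator (D i) (ext V q v)) \<partial>lborel)"
      using vm qD by (intro nn_integral_suminf[symmetric] borel_measurable_times_ennreal) auto
    also have "\<dots> = (\<integral>\<^sup>+v. ?v v \<partial>lborel)"
    proof -
      have "(\<Sum>i. indicator (D i) x) = (1::ennreal)" for x
        using suminf_indicator[OF D(3), of x] D(4) by simp
      then show ?thesis by simp
    qed
    also have "\<dots> = (\<integral>\<^sup>+ u. indicator B u * ennreal (volume_density (F \<circ> q) u) \<partial>lborel)"
      unfolding volume_density_comp by (intro nn_integral_cong) (auto simp: indicator_def)
    finally show ?thesis .
  qed
  then show ?thesis using sets unfolding is_riemannian_measure_def by (intro exI[of _ \<mu>]) auto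
qed

text \<open>Cut along the partition, a Borel set becomes a disjoint union of images of Borel sets in
  charts. This also serves to recognize the measure of a hyperplane as Lebesgue measure.\<close>

lemma riemannian_measure_eqI:
  assumes "sets \<mu> = sets borel" "sets \<nu> = sets borel"
    "\<And>U p B. (U, p) \<in> A \<Longrightarrow> B \<in> sets borel \<Longrightarrow> B \<subseteq> U \<Longrightarrow> emeasure \<mu> (p ` B) = emeasure \<nu> (p ` B)"
  shows "\<mu> = \<nu>"
proof (rule measure_eqI)
  show "sets \<mu> = sets \<nu>" using assms by simp
  fix E assume "E \<in> sets \<mu>"
  then have E: "E \<in> sets borel" using assms(1) by simp
  obtain D :: "nat \<Rightarrow> 'm set" and c :: "nat \<Rightarrow> ('n, 'm) param"
    where c: "\<And>i. c i \<in> A" and D: "\<And>i. D i \<in> sets borel" "\<And>i. D i \<subseteq> snd (c i) ` fst (c i)"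
      "disjoint_family D" "(\<Union>i. D i) = UNIV" by (rule chart_partition) blast
  have c': "(fst (c i), snd (c i)) \<in> A" for i using c by simp
  have eq: "emeasure \<mu> (E \<inter> D i) = emeasure \<nu> (E \<inter> D i)" for i
  proof -
    let ?U = "fst (c i)" and ?p = "snd (c i)"
    let ?B = "?U \<inter> (ext ?U ?p -` (E \<inter> D i))"
    have "ext ?U ?p -` (E \<inter> D i) \<inter> space borel \<in> sets borel"
      using E D by (intro measurable_sets[OF ext_measurable[OF c']]) auto
    then have "?B \<in> sets borel" using chart(1)[OF c'[of i]] by (intro sets.Int) auto
    moreover have "?p ` ?B = E \<inter> D i" using D(2)[of i] by (auto simp: ext_def)
    ultimately show ?thesis using assms(3)[OF c'[of i], of ?B] by auto
  qed
  have "emeasure \<mu> E = (\<Sum>i. emeasure \<mu> (E \<inter> D i))" if "sets \<mu> = sets borel" for \<mu> :: "'m measure"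
  proof -
    have "(\<Sum>i. emeasure \<mu> (E \<inter> D i)) = emeasure \<mu> (\<Union>i. E \<inter> D i)"
    proof (rule suminf_emeasure)
      show "disjoint_family (\<lambda>i. E \<inter> D i)"
        using D(3) unfolding disjoint_family_on_def by blast
    qed (use that E D in auto)
    also have "(\<Union>i. E \<inter> D i) = E" using D(4) by auto
    finally show ?thesis by simp
  qed
  then show "emeasure \<mu> E = emeasure \<nu> E" using eq assms(1,2) by simp
qed

abbreviation (input) \<mu> :: "'m measure" where "\<mu> \<equiv> riemannian_measure A F"

lemma is_riemannian_measure: "is_riemannian_measure \<mu>"
proof -
  have "\<exists>!\<mu>. is_riemannian_measure \<mu>"
  proof (rule ex_ex1I[OF ex_riemannian_measure])
    fix \<mu> \<nu> assume "is_riemannian_measure \<mu>" "is_riemannian_measure \<nu>"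
    then show "\<mu> = \<nu>"
      unfolding is_riemannian_measure_def by (intro riemannian_measure_eqI) force+
  qed
  then show ?thesis
    unfolding riemannian_measure_def is_riemannian_measure_def by (rule theI')
qed

lemma sets_riemannian [simp, measurable_cong]: "sets \<mu> = sets borel"
  using is_riemannian_measure by (simp add: is_riemannian_measure_def)

lemma measurable_riemannian [simp]: "measurable \<mu> M = measurable borel M"
  by (rule measurable_cong_sets) simp_all

lemma space_riemannian [simp]: "space \<mu> = UNIV"
  using sets_eq_imp_space_eq[OF sets_riemannian] by simp

lemma emeasure_riemannian:
  assumes "(U, p) \<in> A" "B \<in> sets borel" "B \<subseteq> U"
  shows "emeasure \<mu> (p ` B) = (\<integral>\<^sup>+u. indicator B u * ennreal (volume_density (\<lambda>u. F (p u)) u) \<partial>lborel)"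
  using is_riemannian_measure assms unfolding is_riemannian_measure_def volume_density_comp by fast

lemma density_riemannian_chart:
  assumes c: "(U, p) \<in> A"
  shows "density \<mu> (indicator (p ` U)) = chart_measure U p"
proof (rule measure_eqI)
  fix E assume "E \<in> sets (density \<mu> (indicator (p ` U)))"
  then have E: "E \<in> sets borel" by simp
  let ?B = "U \<inter> (ext U p -` E)"
  have "ext U p -` E \<inter> space borel \<in> sets borel"
    using E by (intro measurable_sets[OF ext_measurable[OF c]]) auto
  then have B: "?B \<in> sets borel" using chart(1)[OF c] by (intro sets.Int) auto
  have pB: "p ` ?B = p ` U \<inter> E" by (auto simp: ext_def)
  have "emeasure (density \<mu> (indicator (p ` U))) E = emeasure \<mu> (p ` ?B)"
    unfolding pB using E chart(2)[OF c]
    by (subst emeasure_density) (auto simp flip: indicator_inter_arith)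
  also have "\<dots> = (\<integral>\<^sup>+u. ennreal (indicator U u * volume_density (\<lambda>u. F (p u)) u) * indicator E (p u) \<partial>lborel)"
    by (subst emeasure_riemannian[OF c B]) (auto intro!: nn_integral_cong simp: indicator_def ext_def)
  also have "\<dots> = emeasure (chart_measure U p) E"
    by (rule emeasure_chart_measure[OF c E, symmetric])
  finally show "emeasure (density \<mu> (indicator (p ` U))) E = emeasure (chart_measure U p) E" .
qed simp

lemma nn_integral_riemannian_chart:
  assumes c: "(U, p) \<in> A" and f: "f \<in> borel_measurable borel"
  shows "(\<integral>\<^sup>+x. indicator (p ` U) x * f x \<partial>\<mu>) =
    (\<integral>\<^sup>+u. ennreal (indicator U u * volume_density (\<lambda>u. F (p u)) u) * f (p u) \<partial>lborel)"
  using nn_integral_chart_measure[OF c f] f chart(2)[OF c]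
  by (subst (asm) density_riemannian_chart[OF c, symmetric], subst (asm) nn_integral_density) auto

lemma integral_riemannian_chart:
  fixes f :: "'m \<Rightarrow> real"
  assumes c: "(U, p) \<in> A" and f: "f \<in> borel_measurable borel" and zero: "\<And>x. x \<notin> p ` U \<Longrightarrow> f x = 0"
  shows "(\<integral>x. f x \<partial>\<mu>) = (\<integral>u. indicator U u * volume_density (\<lambda>u. F (p u)) u * f (p u) \<partial>lborel)"
proof -
  have "(\<integral>x. f x \<partial>\<mu>) = (\<integral>x. indicator (p ` U) x *\<^sub>R f x \<partial>\<mu>)"
    using zero by (intro Bochner_Integration.integral_cong) (auto simp: indicator_def)
  also have "\<dots> = (\<integral>x. f x \<partial>density \<mu> (\<lambda>x. ennreal (indicator (p ` U) x)))"
    using f chart(2)[OF c] by (subst integral_density) auto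
  also have "density \<mu> (\<lambda>x. ennreal (indicator (p ` U) x)) = chart_measure U p"
    using density_riemannian_chart[OF c] by (simp add: ennreal_indicator)
  also have "(\<integral>x. f x \<partial>chart_measure U p) =
      (\<integral>u. f (ext U p u) \<partial>density lborel (\<lambda>u. ennreal (indicator U u * volume_density (\<lambda>u. F (p u)) u)))"
    unfolding chart_measure_def using ext_measurable[OF c] f by (subst integral_distr) auto
  also have "\<dots> = (\<integral>u. (indicator U u * volume_density (\<lambda>u. F (p u)) u) *\<^sub>R f (ext U p u) \<partial>lborel)"
  proof (rule integral_density)
    show "(\<lambda>u. f (ext U p u)) \<in> borel_measurable lborel"
      using measurable_compose[OF ext_measurable[OF c] f] by simp
    show "(\<lambda>u. indicator U u * volume_density (\<lambda>u. F (p u)) u) \<in> borel_measurable lborel"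
      using borel_measurable_indicator_mult[OF _ Ck_on_imp_continuous_on[OF Ck_volume_density[OF c]], of U] chart(1)[OF c]
      by simp
    show "AE u in lborel. 0 \<le> indicator U u * volume_density (\<lambda>u. F (p u)) u"
      using volume_density_pos[OF c] by (auto simp: indicator_def intro!: AE_I2 less_imp_le)
  qed
  also have "\<dots> = (\<integral>u. indicator U u * volume_density (\<lambda>u. F (p u)) u * f (p u) \<partial>lborel)"
    by (intro Bochner_Integration.integral_cong) (auto simp: ext_def indicator_def)
  finally show ?thesis .
qed

end

section \<open>Integrals of divergences in Euclidean space\<close>

lemma lborel_integral_translate:
  fixes f :: "'a::euclidean_space \<Rightarrow> real"
  assumes "f \<in> borel_measurable borel"
  shows "(\<integral>x. f (c + x) \<partial>lborel) = (\<integral>x. f x \<partial>lborel)"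
proof -
  have "(\<integral>x. f x \<partial>lborel) = (\<integral>x. f x \<partial>distr lborel borel ((+) c))"
    by (simp add: lborel_distr_plus)
  also have "\<dots> = (\<integral>x. f (c + x) \<partial>lborel)"
    using assms by (subst integral_distr) auto
  finally show ?thesis by simp
qed

lemma integrable_compact_support:
  fixes f :: "'a::euclidean_space \<Rightarrow> real"
  assumes "continuous_on UNIV f" "compact K" "\<And>x. x \<notin> K \<Longrightarrow> f x = 0"
  shows "integrable lborel f"
proof -
  have "integrable lborel (\<lambda>x. indicator K x *\<^sub>R f x)"
    using assms by (intro borel_integrable_compact) (auto intro: continuous_on_subset)
  also have "(\<lambda>x. indicator K x *\<^sub>R f x) = f"
    using assms(3) by (auto simp: indicator_def fun_eq_iff)
  finally show ?thesis .
qed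

text \<open>The difference quotients in direction v have integral zero by translation invariance,
  and they converge to the derivative under a common integrable bound.\<close>

lemma integral_directional_derivative_eq_0:
  fixes f :: "'a::euclidean_space \<Rightarrow> real"
  assumes f: "Ck_on 1 UNIV f" and K: "compact K" "\<And>x. x \<notin> K \<Longrightarrow> f x = 0"
  shows "(\<integral>x. frechet_derivative f (at x) v \<partial>lborel) = 0"
proof -
  let ?D = "\<lambda>x. frechet_derivative f (at x) v"
  have f': "Ck_on (Suc 0) UNIV f" using f by simp
  have der: "(f has_derivative frechet_derivative f (at x)) (at x)" for x
    using Ck_on_SucD(1)[OF f'] by simp
  have contD: "continuous_on UNIV ?D" using Ck_on_SucD(2)[OF f'] by simp
  have contf: "continuous_on UNIV f" using f Ck_on_imp_continuous_on by blast
  have D0: "?D x = 0" if "x \<notin> K" for x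
  proof -
    have "open (- K)" "x \<in> - K" using K(1) that by (auto simp: compact_imp_closed)
    from frechet_derivative_cong_open(1)[OF this, of f "\<lambda>_. 0"] K(2)
    show ?thesis by simp
  qed
  obtain M where M: "\<And>x. \<bar>?D x\<bar> \<le> M"
  proof -
    have "bounded (?D ` K)"
      using K(1) contD by (intro compact_imp_bounded compact_continuous_image) (auto intro: continuous_on_subset)
    then obtain M where "\<And>x. x \<in> K \<Longrightarrow> \<bar>?D x\<bar> \<le> M" "M > 0"
      by (auto simp: bounded_pos)
    then have "\<bar>?D x\<bar> \<le> M" for x using D0[of x] by (cases "x \<in> K") auto
    then show ?thesis by (rule that)
  qed
  define h :: "nat \<Rightarrow> real" where "h j = inverse (real (Suc j))" for j
  have h: "h j > 0" "h j \<le> 1" for j by (auto simp: h_def field_simps)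
  define g where "g j x = (f (x + h j *\<^sub>R v) - f x) / h j" for j x
  \<comment> \<open>K swept back along v for times in [0, 1]. It contains the supports of all the
    quotients, because the increments \<open>h j\<close> are at most 1.\<close>
  let ?K = "(\<lambda>(x, s). x - s *\<^sub>R v) ` (K \<times> {0..1})"
  have K': "compact ?K"
    using K(1) by (intro compact_continuous_image compact_Times) (auto intro!: continuous_intros simp: case_prod_unfold)
  have "K \<subseteq> ?K"
  proof
    fix x assume "x \<in> K"
    then show "x \<in> ?K" by (intro image_eqI[of _ _ "(x, 0)"]) auto
  qed
  have int_f: "integrable lborel f" by (rule integrable_compact_support[OF contf K])
  have g_int: "(\<integral>x. g j x \<partial>lborel) = 0" for j
  proof -
    have m: "f \<in> borel_measurable borel" using contf by (rule borel_measurable_continuous_onI)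
    have "integrable lborel (\<lambda>x. f (x + h j *\<^sub>R v))"
    proof (rule integrable_compact_support)
      show "continuous_on UNIV (\<lambda>x. f (x + h j *\<^sub>R v))"
        by (rule continuous_on_compose2[OF contf]) (auto intro!: continuous_intros)
      show "f (x + h j *\<^sub>R v) = 0" if "x \<notin> ?K" for x
      proof (rule K(2), rule notI)
        assume "x + h j *\<^sub>R v \<in> K"
        then have "x \<in> ?K" using h[of j] by (intro image_eqI[of _ _ "(x + h j *\<^sub>R v, h j)"]) auto
        then show False using that by simp
      qed
    qed (rule K')
    then have "(\<integral>x. g j x \<partial>lborel) = ((\<integral>x. f (x + h j *\<^sub>R v) \<partial>lborel) - (\<integral>x. f x \<partial>lborel)) / h j"
      unfolding g_def using int_f by simp
    also have "(\<integral>x. f (x + h j *\<^sub>R v) \<partial>lborel) = (\<integral>x. f x \<partial>lborel)"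
      using lborel_integral_translate[OF m, of "h j *\<^sub>R v"] by (simp add: add.commute)
    finally show ?thesis by simp
  qed
  have "(\<lambda>j. \<integral>x. g j x \<partial>lborel) \<longlonglongrightarrow> (\<integral>x. ?D x \<partial>lborel)"
  proof (rule integral_dominated_convergence)
    show "?D \<in> borel_measurable lborel"
      using borel_measurable_continuous_onI[OF contD] by simp
    have "continuous_on UNIV (g j)" for j
      unfolding g_def using h(1)[of j]
      by (intro continuous_intros continuous_on_compose2[OF contf]) auto
    then show "g j \<in> borel_measurable lborel" for j
      using borel_measurable_continuous_onI by auto
    show "integrable lborel (\<lambda>x. M * indicator ?K x)"
      using emeasure_bounded_finite[OF compact_imp_bounded[OF K']] borel_closed[OF compact_imp_closed[OF K']]
      by (intro integrable_mult_right integrable_real_indicator) simp_all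
    show "AE x in lborel. (\<lambda>j. g j x) \<longlonglongrightarrow> ?D x"
    proof (rule AE_I2)
      fix x
      have "((\<lambda>s. f (x + s *\<^sub>R v)) has_real_derivative ?D x) (at 0)"
        using der by (intro has_real_derivative_along_line) auto
      then have "((\<lambda>s. (f (x + s *\<^sub>R v) - f x) / s) \<longlongrightarrow> ?D x) (at 0)"
        by (simp add: DERIV_def)
      moreover have "h \<longlonglongrightarrow> 0"
        unfolding h_def[abs_def] by (rule LIMSEQ_inverse_real_of_nat)
      then have "filterlim h (at 0) sequentially"
        unfolding filterlim_at using h(1) by (auto simp: less_imp_neq[symmetric] intro!: always_eventually)
      ultimately show "(\<lambda>j. g j x) \<longlonglongrightarrow> ?D x"
        unfolding g_def by (rule filterlim_compose)
    qed
    show "AE x in lborel. norm (g j x) \<le> M * indicator ?K x" for j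
    proof (rule AE_I2)
      fix x
      show "norm (g j x) \<le> M * indicator ?K x"
      proof (cases "x \<in> ?K")
        case True
        have "\<exists>z>0. z < h j \<and> f (x + h j *\<^sub>R v) - f (x + 0 *\<^sub>R v) = (h j - 0) * frechet_derivative f (at (x + z *\<^sub>R v)) v"
          using h(1)[of j] der by (intro MVT2 has_real_derivative_along_line) auto
        then obtain z where "f (x + h j *\<^sub>R v) - f x = h j * ?D (x + z *\<^sub>R v)" by auto
        then have "g j x = ?D (x + z *\<^sub>R v)"
          unfolding g_def using h(1)[of j] by simp
        then show ?thesis using M True by simp
      next
        case False
        then have "x \<notin> K" using \<open>K \<subseteq> ?K\<close> by auto
        moreover have "x + h j *\<^sub>R v \<notin> K"
        proof
          assume "x + h j *\<^sub>R v \<in> K"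
          then have "x \<in> ?K" using h[of j] by (intro image_eqI[of _ _ "(x + h j *\<^sub>R v, h j)"]) auto
          then show False using False by simp
        qed
        ultimately show ?thesis using False K(2) by (simp add: g_def)
      qed
    qed
  qed
  then show ?thesis using g_int by (simp add: LIMSEQ_const_iff)
qed

text \<open>A permutation other than the identity moves at least two indices. After one factor of
  its product is differentiated, an off-diagonal entry of the identity matrix remains, so only the
  trace survives.\<close>

lemma has_derivative_det_at_identity:
  fixes M :: "'a::real_normed_vector \<Rightarrow> real^'n::finite^'n"
  assumes der: "\<And>i j. ((\<lambda>x. M x $ i $ j) has_derivative M' i j) (at x)" and id: "M x = mat 1"
  shows "((\<lambda>x. det (M x)) has_derivative (\<lambda>h. \<Sum>i\<in>UNIV. M' i i h)) (at x)"
proof -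
  let ?P = "\<lambda>p h. \<Sum>i\<in>UNIV. M' i (p i) h * (\<Prod>j\<in>UNIV - {i}. M x $ j $ p j)"
  have "((\<lambda>x. \<Prod>i\<in>UNIV. M x $ i $ p i) has_derivative ?P p) (at x)" for p
    using der by (intro has_derivative_prod) auto
  then have "((\<lambda>x. det (M x)) has_derivative (\<lambda>h. \<Sum>p\<in>{p. p permutes UNIV}. of_int (sign p) * ?P p h)) (at x)"
    unfolding det_def by (intro has_derivative_sum has_derivative_mult_right)
  moreover have "(\<Sum>p\<in>{p. p permutes UNIV}. of_int (sign p) * ?P p h) = (\<Sum>i\<in>UNIV. M' i i h)" for h
  proof -
    have "?P p h = 0" if p: "p permutes UNIV" "p \<noteq> id" for p
    proof (rule sum.neutral, rule ballI)
      fix i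
      obtain j where "j \<noteq> i" "p j \<noteq> j"
      proof -
        obtain k where k: "p k \<noteq> k" using p(2) by (auto simp: fun_eq_iff)
        show ?thesis
        proof (cases "k = i")
          case True
          then show ?thesis using that[of "p k"] k permutes_inj[OF p(1)] by (metis injD)
        qed (use k that in blast)
      qed
      then have "(\<Prod>j\<in>UNIV - {i}. M x $ j $ p j) = 0"
        by (intro prod_zero) (auto simp: id mat_def intro!: bexI[of _ j])
      then show "M' i (p i) h * (\<Prod>j\<in>UNIV - {i}. M x $ j $ p j) = 0" by simp
    qed
    then have "(\<Sum>p\<in>{p. p permutes UNIV}. of_int (sign p) * ?P p h) = (\<Sum>p\<in>{id}. of_int (sign p) * ?P p h)"
      by (intro sum.mono_neutral_right) (auto simp: permutes_id finite_permutations)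
    also have "\<dots> = (\<Sum>i\<in>UNIV. M' i i h)"
      by (simp add: id mat_def)
    finally show ?thesis .
  qed
  ultimately show ?thesis by simp
qed

text \<open>Independence of the trace from the basis: expand the coordinate vectors in the frame and
  exchange the two sums.\<close>

lemma trace_orthonormal:
  fixes L M :: "real^'n::finite \<Rightarrow> _" and e :: "'n \<Rightarrow> real^'n"
  assumes "linear (L :: _ \<Rightarrow> real^'k::finite)" "linear (M :: _ \<Rightarrow> real^'n)"
    and ON: "\<And>a b. L (e a) \<bullet> L (e b) = (if a = b then 1 else 0)"
  shows "(\<Sum>i\<in>UNIV. M (axis i 1) $ i) = (\<Sum>a\<in>UNIV. L (M (e a)) \<bullet> L (e a))"
proof -
  interpret L: linear L by fact
  interpret M: linear M by fact
  have "M (axis i 1) = (\<Sum>a\<in>UNIV. (L (axis i 1) \<bullet> L (e a)) *\<^sub>R M (e a))" for i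
    by (subst orthonormal_expansion[OF assms(1) ON, of "axis i 1"]) (simp only: M.sum M.scale)
  then have "(\<Sum>i\<in>UNIV. M (axis i 1) $ i) = (\<Sum>i\<in>UNIV. \<Sum>a\<in>UNIV. (L (axis i 1) \<bullet> L (e a)) * M (e a) $ i)"
    by simp
  also have "\<dots> = (\<Sum>a\<in>UNIV. \<Sum>i\<in>UNIV. (L (axis i 1) \<bullet> L (e a)) * M (e a) $ i)"
    by (rule sum.swap)
  also have "\<dots> = (\<Sum>a\<in>UNIV. L (\<Sum>i\<in>UNIV. (M (e a) $ i) *\<^sub>R axis i 1) \<bullet> L (e a))"
    by (simp add: L.sum L.scale inner_sum_left mult.commute)
  also have "\<dots> = (\<Sum>a\<in>UNIV. L (M (e a)) \<bullet> L (e a))"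
    by (simp add: basis_expansion flip: scalar_mult_eq_scaleR)
  finally show ?thesis .
qed

text \<open>Product rule for the pairing of the derivative with a moving vector. The first term is
  the second derivative with the vector frozen at its value E x.\<close>

lemma has_derivative_frechet_apply:
  fixes f :: "'a::euclidean_space \<Rightarrow> 'b::real_normed_vector"
  assumes S: "open S" and f: "Ck_on 2 S f" and x: "x \<in> S" and E: "(E has_derivative E') (at x)"
  shows "((\<lambda>x. frechet_derivative f (at x) (E x)) has_derivative
     (\<lambda>h. frechet_derivative (\<lambda>y. frechet_derivative f (at y) (E x)) (at x) h + frechet_derivative f (at x) (E' h))) (at x)"
proof -
  have f2: "Ck_on (Suc (Suc 0)) S f" using f by (simp add: numeral_2_eq_2)
  let ?D = "\<lambda>x. frechet_derivative f (at x)"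
  have D: "((\<lambda>y. ?D y b) has_derivative frechet_derivative (\<lambda>y. ?D y b) (at x)) (at x)" for b
    using Ck_on_SucD(1)[OF Ck_on_SucD(2)[OF f2] x] .
  have rep: "?D y v = (\<Sum>b\<in>Basis. (v \<bullet> b) *\<^sub>R ?D y b)" if "y \<in> S" for y v
    using Ck_on_SucD(1)[OF f2 that] by (intro linear_basis_sum has_derivative_linear)
  have "((\<lambda>y. \<Sum>b\<in>Basis. (E y \<bullet> b) *\<^sub>R ?D y b) has_derivative
     (\<lambda>h. \<Sum>b\<in>Basis. (E x \<bullet> b) *\<^sub>R frechet_derivative (\<lambda>y. ?D y b) (at x) h + (E' h \<bullet> b) *\<^sub>R ?D x b)) (at x)"
    by (intro has_derivative_sum has_derivative_scaleR has_derivative_inner_left E D)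
  then have 1: "((\<lambda>y. ?D y (E y)) has_derivative
     (\<lambda>h. \<Sum>b\<in>Basis. (E x \<bullet> b) *\<^sub>R frechet_derivative (\<lambda>y. ?D y b) (at x) h + (E' h \<bullet> b) *\<^sub>R ?D x b)) (at x)"
    by (rule has_derivative_transform_within_open[OF _ S x]) (simp add: rep[symmetric])
  have "((\<lambda>y. \<Sum>b\<in>Basis. (E x \<bullet> b) *\<^sub>R ?D y b) has_derivative
      (\<lambda>h. \<Sum>b\<in>Basis. (E x \<bullet> b) *\<^sub>R frechet_derivative (\<lambda>y. ?D y b) (at x) h)) (at x)"
    by (intro has_derivative_sum has_derivative_scaleR_right D)
  then have "((\<lambda>y. ?D y (E x)) has_derivative
      (\<lambda>h. \<Sum>b\<in>Basis. (E x \<bullet> b) *\<^sub>R frechet_derivative (\<lambda>y. ?D y b) (at x) h)) (at x)"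
    by (rule has_derivative_transform_within_open[OF _ S x]) (simp add: rep[symmetric])
  then have 2: "frechet_derivative (\<lambda>y. ?D y (E x)) (at x) h = (\<Sum>b\<in>Basis. (E x \<bullet> b) *\<^sub>R frechet_derivative (\<lambda>y. ?D y b) (at x) h)" for h
    by (simp add: frechet_derivative_eqI)
  show ?thesis
    using 1 by (rule has_derivative_eq_rhs) (simp add: fun_eq_iff sum.distrib 2 rep[OF x, of "E' _"])
qed

section \<open>The mean curvature of a self-expander\<close>

context hypersurface
begin

lemma orthogonal_tangent_iff:
  assumes c: "(U, p) \<in> A" "u \<in> U"
  shows "y \<in> (tangent_space A F (p u))\<^sup>\<bottom> \<longleftrightarrow> (\<forall>v. y \<bullet> dF p u v = 0)"
  unfolding tangent_space_chart[OF c] orthogonal_comp_def orthogonal_def by (auto simp: inner_commute)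

text \<open>Subtracting the frame expansion of the tangential part yields a vector as in the
  description of \<open>normal_part\<close>, and two such vectors differ by one that is tangent and
  normal at once.\<close>

lemma normal_part_inner:
  assumes y: "y \<in> (tangent_space A F x)\<^sup>\<bottom>"
  shows "normal_part A F x w \<in> (tangent_space A F x)\<^sup>\<bottom>" "normal_part A F x w \<bullet> y = w \<bullet> y"
proof -
  obtain U p u where c: "(U, p) \<in> A" "u \<in> U" and x: "p u = x" by (rule chart_cover)
  interpret L: linear "dF p u" by (rule linear_dF[OF c])
  let ?e = "\<lambda>a. frame U p a u"
  let ?P = "\<lambda>v. v \<in> (tangent_space A F x)\<^sup>\<bottom> \<and> w - v \<in> tangent_space A F x"
  have tan: "tangent_space A F x = range (dF p u)" using tangent_space_chart[OF c] x by simp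
  have orth: "z \<in> (tangent_space A F x)\<^sup>\<bottom> \<longleftrightarrow> (\<forall>v. z \<bullet> dF p u v = 0)" for z
    using orthogonal_tangent_iff[OF c] x by simp
  define t where "t = (\<Sum>a\<in>UNIV. (w \<bullet> dF p u (?e a)) *\<^sub>R ?e a)"
  have "(w - dF p u t) \<bullet> dF p u v = 0" for v
  proof -
    have v: "v = (\<Sum>a\<in>UNIV. (dF p u v \<bullet> dF p u (?e a)) *\<^sub>R ?e a)"
      by (rule orthonormal_expansion[OF linear_dF[OF c] frame_orthonormal[OF c]])
    have "(w - dF p u t) \<bullet> dF p u (?e a) = 0" for a
      by (simp add: t_def L.sum L.scale inner_diff_left inner_sum_left frame_orthonormal[OF c] if_distrib cong: if_cong)
    then show ?thesis
      by (subst v) (simp add: L.sum L.scale inner_sum_right)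
  qed
  then have "w - dF p u t \<in> (tangent_space A F x)\<^sup>\<bottom>" using orth by blast
  moreover have "w - (w - dF p u t) \<in> tangent_space A F x" by (simp add: tan)
  ultimately have "?P (w - dF p u t)" by blast
  moreover have "v = v'" if "?P v" "?P v'" for v v'
  proof -
    have "v - v' = (w - v') - (w - v)" by simp
    then have "v - v' \<in> tangent_space A F x"
      using that subspace_diff[OF subspace_tangent, of "w - v'" x "w - v"] by simp
    then obtain z where z: "v - v' = dF p u z" unfolding tan by auto
    have "(v - v') \<bullet> dF p u z = 0"
      using that by (simp add: inner_diff_left orth)
    then have "(v - v') \<bullet> (v - v') = 0"
      by (simp only: z)
    then show ?thesis by simp
  qed
  ultimately have "\<exists>!v. ?P v" by blast
  then have P: "?P (normal_part A F x w)"
    unfolding normal_part_def by (rule theI')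
  then show "normal_part A F x w \<in> (tangent_space A F x)\<^sup>\<bottom>" by simp
  obtain z where "w - normal_part A F x w = dF p u z" using P unfolding tan by auto
  then have "(w - normal_part A F x w) \<bullet> y = 0"
    using y by (simp add: orth inner_commute)
  then show "normal_part A F x w \<bullet> y = w \<bullet> y" by (simp add: inner_diff_left)
qed

text \<open>The second derivative of the immersion in coordinates; its normal part is the second
  fundamental form.\<close>

definition hess :: "(real^'n \<Rightarrow> 'm) \<Rightarrow> real^'n \<Rightarrow> real^'n \<Rightarrow> real^'n \<Rightarrow> real^'k" where
  "hess p u v w = frechet_derivative (\<lambda>u. dF p u v) (at u) w"

lemma hess_commute:
  assumes c: "(U, p) \<in> A" "u \<in> U" shows "hess p u v w = hess p u w v"
  unfolding hess_def by (rule frechet_derivative_symmetric[OF chart(1)[OF c(1)] Ck_F[OF c(1)] c(2)])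

lemma has_derivative_dF_apply:
  assumes c: "(U, p) \<in> A" "u \<in> U" and E: "(E has_derivative E') (at u)"
  shows "((\<lambda>u. dF p u (E u)) has_derivative (\<lambda>h. hess p u (E u) h + dF p u (E' h))) (at u)"
  unfolding hess_def by (rule has_derivative_frechet_apply[OF chart(1)[OF c(1)] Ck_F[OF c(1)] c(2) E])

text \<open>Ensures that the choice inside \<open>mean_curvature_vector\<close> yields a genuine
  frame. The chart frame is pushed into the ambient space, and transition maps make it smooth in all
  other charts.\<close>

lemma ex_orthonormal_frame:
  assumes c: "(U, p) \<in> A"
  shows "\<exists>e. orthonormal_frame A F (p ` U) e"
proof -
  define e where "e a x = dF p (inv_into U p x) (frame U p a (inv_into U p x))" for a x
  have "smooth_on (V \<inter> q -` (p ` U)) (e a \<circ> q)" if q: "(V, q) \<in> A" for V q a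
    unfolding smooth_on_def
  proof
    fix k
    have "Ck_on k (V \<inter> q -` (p ` U)) (\<lambda>v. (\<lambda>u. dF p u (frame U p a u)) (inv_into U p (q v)))"
    proof (rule Ck_on_compose[where T = U and g = "\<lambda>u. dF p u (frame U p a u)"])
      show "open (V \<inter> q -` (p ` U))" using open_chart_preimage[OF q chart(2)[OF c]] .
      show "Ck_on k U (\<lambda>u. dF p u (frame U p a u))"
        by (rule Ck_on_frechet[OF chart(1)[OF c] Ck_F[OF c] Ck_frame[OF c]])
      show "Ck_on k (V \<inter> q -` (p ` U)) (\<lambda>v. inv_into U p (q v))"
        by (rule transition_smooth[OF q c])
      show "inv_into U p (q v) \<in> U" if "v \<in> V \<inter> q -` (p ` U)" for v
        using that by (auto intro: inv_into_into)
    qed (rule chart(1)[OF c])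
    then show "Ck_on k (V \<inter> q -` (p ` U)) (e a \<circ> q)"
      by (simp add: e_def comp_def)
  qed
  then have "smooth_fun_on A (p ` U) (e a)" for a
    unfolding smooth_fun_on_def by auto
  moreover have "e a (p u) \<in> tangent_space A F (p u) \<and> e a (p u) \<bullet> e b (p u) = (if a = b then 1 else 0)" if "u \<in> U" for u a b
    using that c frame_orthonormal[OF c that] tangent_space_chart[OF c that] by (simp add: e_def)
  ultimately show ?thesis
    unfolding orthonormal_frame_def using chart(2)[OF c] by (intro exI[of _ e]) auto
qed

text \<open>The derivative of the field dF (E) along itself is the second derivative on (E, E) plus
  a tangential term, which the normal part removes. The frame e is the value at the point of the
  very frame that the definition chooses, so independence of the choice does not have to be
  established.\<close>

lemma mean_curvature_vector_chart:
  assumes c: "(U, p) \<in> A" "u \<in> U"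
  obtains e :: "'n \<Rightarrow> real^'n" where
    "\<And>a b. dF p u (e a) \<bullet> dF p u (e b) = (if a = b then 1 else 0)"
    "mean_curvature_vector A F (p u) \<in> (tangent_space A F (p u))\<^sup>\<bottom>"
    "\<And>y. y \<in> (tangent_space A F (p u))\<^sup>\<bottom> \<Longrightarrow>
       mean_curvature_vector A F (p u) \<bullet> y = (\<Sum>a\<in>UNIV. hess p u (e a) (e a) \<bullet> y)"
proof -
  let ?Q = "\<lambda>e. \<exists>W. p u \<in> W \<and> orthonormal_frame A F W e"
  define f where "f = (SOME e. ?Q e)"
  have "\<exists>e. ?Q e" using ex_orthonormal_frame[OF c(1)] c(2) by blast
  then have "?Q f" unfolding f_def by (rule someI_ex)
  then obtain W where W: "p u \<in> W" "open W" and fs: "\<And>a. smooth_fun_on A W (f a)"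
    and f: "\<And>x a. x \<in> W \<Longrightarrow> f a x \<in> tangent_space A F x"
      "\<And>x a b. x \<in> W \<Longrightarrow> f a x \<bullet> f b x = (if a = b then 1 else 0)"
    unfolding orthonormal_frame_def by auto
  interpret L: linear "dF p u" by (rule linear_dF[OF c])
  let ?O = "U \<inter> p -` W"
  have O: "open ?O" "u \<in> ?O" using open_chart_preimage[OF c(1) W(2)] c W by auto
  have fC: "Ck_on k ?O (\<lambda>u. f a (p u))" for a k
    using fs[of a] c(1) unfolding smooth_fun_on_def smooth_on_def by (fastforce simp: comp_def)
  \<comment> \<open>The coordinates of the chosen frame; expanding in the chart frame shows that
    they are smooth.\<close>
  define E where "E a u = (\<Sum>b\<in>UNIV. (f a (p u) \<bullet> dF p u (frame U p b u)) *\<^sub>R frame U p b u)" for a u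
  have EC: "Ck_on k ?O (E a)" for a k
    unfolding E_def
    by (intro Ck_on_sum Ck_on_scaleR Ck_on_inner O fC Ck_on_subset[OF Ck_on_frechet[OF chart(1)[OF c(1)] Ck_F[OF c(1)] Ck_frame[OF c(1)]]]
        Ck_on_subset[OF Ck_frame[OF c(1)]]) auto
  have fE: "f a (p v) = dF p v (E a v)" if v: "v \<in> ?O" for a v
  proof -
    have "f a (p v) \<in> range (dF p v)" using f(1)[of "p v" a] v tangent_space_chart[OF c(1)] by auto
    then obtain w where w: "f a (p v) = dF p v w" by auto
    have "w = (\<Sum>b\<in>UNIV. (dF p v w \<bullet> dF p v (frame U p b v)) *\<^sub>R frame U p b v)"
      using v by (intro orthonormal_expansion linear_dF[OF c(1)] frame_orthonormal[OF c(1)]) auto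
    then show ?thesis by (simp add: E_def w)
  qed
  let ?e = "\<lambda>a. E a u"
  have ON: "dF p u (?e a) \<bullet> dF p u (?e b) = (if a = b then 1 else 0)" for a b
    using fE[OF O(2)] f(2)[OF W(1)] by simp
  have cd: "chart_differentiable A (f a) (p u)" for a
    unfolding chart_differentiable_def
  proof (intro ballI, clarify)
    fix V q v assume q: "(V, q) \<in> A" "v \<in> V" "q v = p u"
    have "Ck_on (Suc 0) (V \<inter> q -` W) (f a \<circ> q)"
      using fs[of a] q(1) unfolding smooth_fun_on_def smooth_on_def by fast
    then show "(f a \<circ> q) differentiable (at v)" using q W by auto
  qed
  have dd: "directional_deriv A F (f a) (p u) (f a (p u)) = hess p u (?e a) (?e a) + dF p u (frechet_derivative (E a) (at u) (?e a))" for a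
  proof -
    have "directional_deriv A F (f a) (p u) (f a (p u)) = frechet_derivative (\<lambda>u. f a (p u)) (at u) (?e a)"
      unfolding fE[OF O(2)] by (rule directional_deriv_chart[OF c cd])
    also have "frechet_derivative (\<lambda>u. f a (p u)) (at u) = frechet_derivative (\<lambda>u. dF p u (E a u)) (at u)"
      by (rule frechet_derivative_cong_open(1)[OF O]) (rule fE)
    also have "\<dots> = (\<lambda>h. hess p u (E a u) h + dF p u (frechet_derivative (E a) (at u) h))"
      by (rule frechet_derivative_eqI[OF has_derivative_dF_apply[OF c Ck_on_SucD(1)[OF EC O(2)]]])
    finally show ?thesis by simp
  qed
  have mcv: "mean_curvature_vector A F (p u) =
      (\<Sum>a\<in>UNIV. normal_part A F (p u) (directional_deriv A F (f a) (p u) (f a (p u))))"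
    by (simp add: mean_curvature_vector_def f_def Let_def)
  show ?thesis
  proof (rule that[of ?e])
    show "dF p u (?e a) \<bullet> dF p u (?e b) = (if a = b then 1 else 0)" for a b by (rule ON)
    have "(0::real^'k) \<in> (tangent_space A F (p u))\<^sup>\<bottom>"
      by (simp add: orthogonal_tangent_iff[OF c])
    then have "normal_part A F (p u) w \<in> (tangent_space A F (p u))\<^sup>\<bottom>" for w
      by (rule normal_part_inner)
    then show "mean_curvature_vector A F (p u) \<in> (tangent_space A F (p u))\<^sup>\<bottom>"
      unfolding mcv by (intro subspace_sum subspace_orthogonal_comp)
    fix y assume y: "y \<in> (tangent_space A F (p u))\<^sup>\<bottom>"
    then have "dF p u v \<bullet> y = 0" for v
      by (metis inner_commute orthogonal_tangent_iff[OF c])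
    then show "mean_curvature_vector A F (p u) \<bullet> y = (\<Sum>a\<in>UNIV. hess p u (?e a) (?e a) \<bullet> y)"
      unfolding mcv using y by (simp add: inner_sum_left normal_part_inner(2) dd inner_add_left)
  qed
qed

end

locale expander = hypersurface A F
  for A :: "('n::finite, 'm::{t2_space, second_countable_topology}) param set" and F :: "'m \<Rightarrow> real^'k::finite" +
  fixes N :: "'m \<Rightarrow> real^'k"
  assumes unit_normal: "unit_normal_field A F N"
    and expander: "self_expander A F N"
begin

lemma norm_N: "norm (N x) = 1" and N_orth: "N x \<in> (tangent_space A F x)\<^sup>\<bottom>"
  using unit_normal by (auto simp: unit_normal_field_def)

lemma N_dF: "(U, p) \<in> A \<Longrightarrow> u \<in> U \<Longrightarrow> N (p u) \<bullet> dF p u v = 0"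
  using N_orth orthogonal_tangent_iff by blast

lemma normal_eq:
  assumes "y \<in> (tangent_space A F x)\<^sup>\<bottom>" shows "y = (y \<bullet> N x) *\<^sub>R N x"
proof -
  obtain U p u where c: "(U, p) \<in> A" "u \<in> U" and x: "p u = x" by (rule chart_cover)
  have y: "y \<bullet> dF p u v = 0" for v using assms orthogonal_tangent_iff[OF c] x by auto
  show ?thesis
    using orthonormal_decomposition(1)[OF dimension frame_orthonormal[OF c] N_dF[OF c] norm_N, of y] y x by simp
qed

text \<open>This is 4 H^2, unaffected by the sign of \<open>N\<close>.\<close>

definition \<sigma> :: "'m \<Rightarrow> real" where "\<sigma> x = (F x \<bullet> N x)\<^sup>2"

lemma mean_curvature_sq: "(mean_curvature A F N x)\<^sup>2 = \<sigma> x / 4"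
  using expander by (simp add: self_expander_def \<sigma>_def power2_eq_square)

lemma mean_curvature_vector_eq: "mean_curvature_vector A F x = (F x \<bullet> N x / 2) *\<^sub>R N x"
proof -
  let ?M = "mean_curvature_vector A F x"
  obtain U p u where c: "(U, p) \<in> A" "u \<in> U" and x: "p u = x" by (rule chart_cover)
  have "?M \<in> (tangent_space A F x)\<^sup>\<bottom>"
    using mean_curvature_vector_chart[OF c] x by metis
  then have M: "?M = (?M \<bullet> N x) *\<^sub>R N x" by (rule normal_eq)
  have "N x \<noteq> 0" using norm_N[of x] by auto
  have "(THE h. ?M = - (h *\<^sub>R N x)) = - (?M \<bullet> N x)"
  proof (rule the_equality)
    show "?M = - (- (?M \<bullet> N x) *\<^sub>R N x)" using M by simp
    fix h assume h: "?M = - (h *\<^sub>R N x)"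
    have "N x \<bullet> N x = 1" using norm_N[of x] by (simp add: dot_square_norm)
    then show "h = - (?M \<bullet> N x)" using h by simp
  qed
  then have "mean_curvature A F N x = - (?M \<bullet> N x)" by (simp add: mean_curvature_def)
  then have *: "?M \<bullet> N x = F x \<bullet> N x / 2"
    using expander by (simp add: self_expander_def)
  show ?thesis using M unfolding * .
qed

lemma norm_F_sq:
  fixes e :: "'n \<Rightarrow> real^'n"
  assumes c: "(U, p) \<in> A" "u \<in> U" and e: "\<And>a b. dF p u (e a) \<bullet> dF p u (e b) = (if a = b then 1 else 0)"
  shows "(norm (F (p u)))\<^sup>2 = (\<Sum>a\<in>UNIV. (F (p u) \<bullet> dF p u (e a))\<^sup>2) + \<sigma> (p u)"
  using orthonormal_decomposition(2)[where L = "dF p u" and e = e, OF dimension e N_dF[OF c] norm_N, of "F (p u)"]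
  by (simp add: \<sigma>_def power2_norm_eq_inner)

lemma norm_gradient_sq:
  fixes e :: "'n \<Rightarrow> real^'n"
  assumes c: "(U, p) \<in> A" "u \<in> U" and f: "chart_differentiable A f (p u)"
    and e: "\<And>a b. dF p u (e a) \<bullet> dF p u (e b) = (if a = b then 1 else 0)"
  shows "(norm (gradient A F f (p u)))\<^sup>2 = (\<Sum>a\<in>UNIV. (frechet_derivative (\<lambda>u. f (p u)) (at u) (e a))\<^sup>2)"
proof -
  obtain v where "gradient A F f (p u) = dF p u v" using gradient_tangent[OF c f] by auto
  then have "gradient A F f (p u) \<bullet> N (p u) = 0" using N_dF[OF c] by (simp add: inner_commute)
  then show ?thesis
    using orthonormal_decomposition(2)[where L = "dF p u" and e = e, OF dimension e N_dF[OF c] norm_N, of "gradient A F f (p u)"]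
      gradient_inner[OF c f] by (simp add: power2_norm_eq_inner)
qed

text \<open>The coordinates of x^T: \<open>dF\<close> maps this vector to the tangential part of the
  position vector.\<close>

definition tangential :: "(real^'n) set \<Rightarrow> (real^'n \<Rightarrow> 'm) \<Rightarrow> real^'n \<Rightarrow> real^'n" where
  "tangential U p u = (\<Sum>a\<in>UNIV. (F (p u) \<bullet> dF p u (frame U p a u)) *\<^sub>R frame U p a u)"

lemma Ck_tangential:
  assumes c: "(U, p) \<in> A" shows "Ck_on k U (tangential U p)"
  unfolding tangential_def[abs_def]
  by (intro Ck_on_sum Ck_on_scaleR Ck_on_inner chart(1)[OF c] Ck_F[OF c] Ck_frame[OF c]
      Ck_on_frechet[OF chart(1)[OF c] Ck_F[OF c]])

lemma dF_tangential:
  assumes c: "(U, p) \<in> A" "u \<in> U"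
  shows "F (p u) - dF p u (tangential U p u) = (F (p u) \<bullet> N (p u)) *\<^sub>R N (p u)"
proof -
  interpret L: linear "dF p u" by (rule linear_dF[OF c])
  show ?thesis
    using orthonormal_decomposition(1)[OF dimension frame_orthonormal[OF c] N_dF[OF c] norm_N, of "F (p u)"]
    by (simp add: tangential_def L.sum L.scale algebra_simps)
qed

lemma inner_gradient_F:
  assumes c: "(U, p) \<in> A" "u \<in> U" and f: "chart_differentiable A f (p u)"
  shows "F (p u) \<bullet> gradient A F f (p u) = frechet_derivative (\<lambda>u. f (p u)) (at u) (tangential U p u)"
proof -
  obtain v where v: "gradient A F f (p u) = dF p u v" using gradient_tangent[OF c f] by auto
  have "F (p u) = dF p u (tangential U p u) + (F (p u) \<bullet> N (p u)) *\<^sub>R N (p u)"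
    using dF_tangential[OF c] by (simp add: algebra_simps)
  from arg_cong[OF this, of "\<lambda>y. y \<bullet> dF p u v"]
  have "F (p u) \<bullet> gradient A F f (p u) = dF p u (tangential U p u) \<bullet> gradient A F f (p u)"
    using N_dF[OF c, of v] unfolding v by (simp add: inner_add_left)
  then show ?thesis using gradient_inner[OF c f] by (simp add: inner_commute)
qed

text \<open>In coordinates, div x^T = n + <mean curvature vector, x>, and the product is
  \<open>\<sigma>\<close> / 2. With Z the normal part of x, the relation Z . dF (e a) = 0 is
  differentiated along e a and summed over a; the derivatives of Z bring in n and the divergence,
  the derivatives of dF the mean curvature.\<close>

lemma divergence_identity:
  assumes c: "(U, p) \<in> A" "u \<in> U"
  defines "\<omega> \<equiv> volume_density (\<lambda>u. F (p u))" and "Y \<equiv> tangential U p"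
  shows "frechet_derivative \<omega> (at u) (Y u) + \<omega> u * (\<Sum>i\<in>UNIV. frechet_derivative Y (at u) (axis i 1) $ i) =
    \<omega> u * (real CARD('n) + \<sigma> (p u) / 2)"
proof -
  let ?X = "\<lambda>u. F (p u)"
  note U = chart(1)[OF c(1)]
  interpret L: linear "dF p u" by (rule linear_dF[OF c])
  obtain e :: "'n \<Rightarrow> real^'n" where e: "\<And>a b. dF p u (e a) \<bullet> dF p u (e b) = (if a = b then 1 else 0)"
    and mcv: "\<And>y. y \<in> (tangent_space A F (p u))\<^sup>\<bottom> \<Longrightarrow>
       mean_curvature_vector A F (p u) \<bullet> y = (\<Sum>a\<in>UNIV. hess p u (e a) (e a) \<bullet> y)"
    by (rule mean_curvature_vector_chart[OF c]) blast
  have Y: "(Y has_derivative frechet_derivative Y (at u)) (at u)"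
    unfolding Y_def using Ck_on_SucD(1)[OF Ck_tangential[OF c(1)] c(2)] .
  have X: "(?X has_derivative dF p u) (at u)"
    using Ck_on_SucD(1)[OF Ck_F[OF c(1)] c(2)] .
  have dFv: "((\<lambda>u. dF p u v) has_derivative hess p u v) (at u)" for v
    unfolding hess_def using Ck_on_SucD(1)[OF Ck_on_SucD(2)[OF Ck_F[OF c(1)]] c(2)] .
  let ?Z = "\<lambda>u. F (p u) - dF p u (Y u)"
  have Zorth: "?Z v \<bullet> dF p v w = 0" if "v \<in> U" for v w
    unfolding Y_def dF_tangential[OF c(1) that] using N_dF[OF c(1) that] by simp
  have 1: "(dF p u (e a) - (hess p u (Y u) (e a) + dF p u (frechet_derivative Y (at u) (e a)))) \<bullet> dF p u (e a)
      + ?Z u \<bullet> hess p u (e a) (e a) = 0" for a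
  proof -
    have "((\<lambda>v. ?Z v \<bullet> dF p v (e a)) has_derivative
       (\<lambda>h. ?Z u \<bullet> hess p u (e a) h + (dF p u h - (hess p u (Y u) h + dF p u (frechet_derivative Y (at u) h))) \<bullet> dF p u (e a))) (at u)"
      by (intro has_derivative_inner has_derivative_diff X has_derivative_dF_apply[OF c Y] dFv)
    moreover have "((\<lambda>v. ?Z v \<bullet> dF p v (e a)) has_derivative (\<lambda>h. 0)) (at u)"
    proof -
      have "((\<lambda>v. 0::real) has_derivative (\<lambda>h. 0)) (at u)" by simp
      then show ?thesis
        by (rule has_derivative_transform_within_open[OF _ U c(2)]) (simp add: Zorth)
    qed
    ultimately have "(\<lambda>h. ?Z u \<bullet> hess p u (e a) h + (dF p u h - (hess p u (Y u) h + dF p u (frechet_derivative Y (at u) h))) \<bullet> dF p u (e a)) = (\<lambda>h. 0)"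
      by (rule has_derivative_unique)
    from fun_cong[OF this, of "e a"] show ?thesis by (simp add: add.commute)
  qed
  \<comment> \<open>The logarithmic derivative of the density. The constant coordinate vectors e
    make the Gram matrix the identity at u, where the derivative of its determinant is a trace and
    that of the square root is 1/2.\<close>
  have 2: "frechet_derivative \<omega> (at u) h = \<omega> u * (\<Sum>a\<in>UNIV. hess p u (e a) h \<bullet> dF p u (e a))" for h
  proof -
    let ?E = "(\<chi> a i. e a $ i) :: real^'n^'n"
    define M where "M v = ((\<chi> a b. dF p v (e a) \<bullet> dF p v (e b)) :: real^'n^'n)" for v
    have d0: "det ?E \<noteq> 0" and w0: "\<omega> u = inverse \<bar>det ?E\<bar>"
      using volume_density_eq[OF c e] by (auto simp: \<omega>_def)
    have gram: "M v = ?E ** (\<chi> i j. dF p v (axis i 1) \<bullet> dF p v (axis j 1)) ** transpose ?E" if "v \<in> U" for v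
    proof -
      interpret Lv: linear "dF p v" by (rule linear_dF[OF c(1) that])
      have rep: "dF p v w = (\<Sum>i\<in>UNIV. (w $ i) *\<^sub>R dF p v (axis i 1))" for w
      proof -
        have "w = (\<Sum>i\<in>UNIV. (w $ i) *\<^sub>R axis i 1)"
          using basis_expansion[of w] by (simp add: scalar_mult_eq_scaleR)
        then have "dF p v w = dF p v (\<Sum>i\<in>UNIV. (w $ i) *\<^sub>R axis i 1)" by simp
        then show ?thesis by (simp only: Lv.sum Lv.scale)
      qed
      show ?thesis
        unfolding M_def rep[of "e _"]
        by (simp add: vec_eq_iff matrix_matrix_mult_def transpose_def inner_sum_left inner_sum_right sum_distrib_right mult_ac)
    qed
    have weq: "\<omega> v = inverse \<bar>det ?E\<bar> * sqrt (det (M v))" if "v \<in> U" for v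
      unfolding gram[OF that] \<omega>_def volume_density_def using d0
      by (simp add: det_mul det_transpose real_sqrt_mult)
    have "((\<lambda>v. M v $ a $ b) has_derivative
        (\<lambda>h. dF p u (e a) \<bullet> hess p u (e b) h + hess p u (e a) h \<bullet> dF p u (e b))) (at u)" for a b
      unfolding M_def by simp (intro has_derivative_inner dFv)
    moreover have M1: "M u = mat 1" by (simp add: M_def e mat_def vec_eq_iff)
    ultimately have "((\<lambda>v. det (M v)) has_derivative
        (\<lambda>h. \<Sum>a\<in>UNIV. dF p u (e a) \<bullet> hess p u (e a) h + hess p u (e a) h \<bullet> dF p u (e a))) (at u)"
      by (rule has_derivative_det_at_identity)
    then have Md: "((\<lambda>v. det (M v)) has_derivative (\<lambda>h. 2 * (\<Sum>a\<in>UNIV. hess p u (e a) h \<bullet> dF p u (e a)))) (at u)"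
      by (rule has_derivative_eq_rhs) (simp add: inner_commute[of "dF p u _"] sum_distrib_left fun_eq_iff)
    have "(sqrt has_derivative (\<lambda>h. 1/2 * h)) (at (det (M u)))"
      using DERIV_real_sqrt[of 1] by (intro has_derivative_real_mult) (simp add: M1)
    from diff_chain_at[OF Md this]
    have "((\<lambda>v. sqrt (det (M v))) has_derivative (\<lambda>h. \<Sum>a\<in>UNIV. hess p u (e a) h \<bullet> dF p u (e a))) (at u)"
      by (simp add: comp_def)
    from has_derivative_mult_right[OF this, of "inverse \<bar>det ?E\<bar>"]
    have "(\<omega> has_derivative (\<lambda>h. inverse \<bar>det ?E\<bar> * (\<Sum>a\<in>UNIV. hess p u (e a) h \<bullet> dF p u (e a)))) (at u)"
      by (rule has_derivative_transform_within_open[OF _ U c(2)]) (simp add: weq)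
    from frechet_derivative_eqI[OF this] show ?thesis by (simp add: w0)
  qed
  have 3: "(\<Sum>i\<in>UNIV. frechet_derivative Y (at u) (axis i 1) $ i) =
      (\<Sum>a\<in>UNIV. dF p u (frechet_derivative Y (at u) (e a)) \<bullet> dF p u (e a))"
    by (rule trace_orthonormal[OF linear_dF[OF c] has_derivative_linear[OF Y] e])
  have "?Z u = (F (p u) \<bullet> N (p u)) *\<^sub>R N (p u)" unfolding Y_def by (rule dF_tangential[OF c])
  then have "(\<Sum>a\<in>UNIV. hess p u (e a) (e a) \<bullet> ?Z u) = (F (p u) \<bullet> N (p u)) * (mean_curvature_vector A F (p u) \<bullet> N (p u))"
    using mcv[OF N_orth] by (simp add: sum_distrib_left)
  also have "\<dots> = \<sigma> (p u) / 2"
    using norm_N[of "p u"] by (simp add: mean_curvature_vector_eq \<sigma>_def power2_eq_square dot_square_norm)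
  finally have 4: "(\<Sum>a\<in>UNIV. ?Z u \<bullet> hess p u (e a) (e a)) = \<sigma> (p u) / 2"
    by (simp add: inner_commute)
  define z where "z = ?Z u"
  have "0 = (\<Sum>a\<in>UNIV. (dF p u (e a) - (hess p u (Y u) (e a) + dF p u (frechet_derivative Y (at u) (e a)))) \<bullet> dF p u (e a)
      + z \<bullet> hess p u (e a) (e a))"
    unfolding z_def by (simp only: 1 sum.neutral_const)
  \<comment> \<open>Symmetry of \<open>hess\<close> exchanges its arguments here, so that the sum
    matches the derivative of the density along Y.\<close>
  also have "\<dots> = real CARD('n) - (\<Sum>a\<in>UNIV. hess p u (e a) (Y u) \<bullet> dF p u (e a)) -
     (\<Sum>a\<in>UNIV. dF p u (frechet_derivative Y (at u) (e a)) \<bullet> dF p u (e a)) + \<sigma> (p u) / 2"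
    using e hess_commute[OF c, of "Y u"]
    by (simp add: inner_diff_left inner_add_left sum.distrib sum_subtractf 4[folded z_def])
  finally have "(\<Sum>a\<in>UNIV. hess p u (e a) (Y u) \<bullet> dF p u (e a)) +
     (\<Sum>a\<in>UNIV. dF p u (frechet_derivative Y (at u) (e a)) \<bullet> dF p u (e a)) = real CARD('n) + \<sigma> (p u) / 2"
    by linarith
  then show ?thesis
    unfolding 2 3 distrib_left[symmetric] by (simp only:)
qed

end

section \<open>The divergence theorem\<close>

context hypersurface
begin

lemma chart_cball:
  obtains U p u r where "(U, p) \<in> A" "p u = x" "r > 0" "cball u r \<subseteq> U"
proof -
  obtain U p u where c: "(U, p) \<in> A" "u \<in> U" "p u = x" by (rule chart_cover)
  then obtain r where "r > 0" "cball u r \<subseteq> U"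
    using chart(1)[OF c(1)] open_contains_cball by blast
  then show ?thesis using that c by blast
qed

lemma compact_chart_image:
  assumes "(U, p) \<in> A" "compact K" "K \<subseteq> U" shows "compact (p ` K)"
  using assms chart(5) by (intro compact_continuous_image) (auto intro: continuous_on_subset)

lemma emeasure_chart_compact:
  assumes c: "(U, p) \<in> A" and K: "compact K" "K \<subseteq> U"
  shows "emeasure \<mu> (p ` K) < \<infinity>"
proof -
  let ?v = "volume_density (\<lambda>u. F (p u))"
  have "bounded (?v ` K)"
    using K Ck_on_imp_continuous_on[OF Ck_volume_density[OF c]]
    by (intro compact_imp_bounded compact_continuous_image) (auto intro: continuous_on_subset)
  then obtain M where M: "\<And>u. u \<in> K \<Longrightarrow> \<bar>?v u\<bar> \<le> M" by (auto simp: bounded_iff)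
  have "emeasure \<mu> (p ` K) = (\<integral>\<^sup>+u. indicator K u * ennreal (?v u) \<partial>lborel)"
    using K by (intro emeasure_riemannian[OF c]) (auto simp: compact_imp_closed)
  also have "\<dots> \<le> (\<integral>\<^sup>+u. ennreal M * indicator K u \<partial>lborel)"
  proof (rule nn_integral_mono)
    fix u show "indicator K u * ennreal (?v u) \<le> ennreal M * indicator K u"
      using M[of u] by (cases "u \<in> K") (auto intro: ennreal_leI)
  qed
  also have "\<dots> = ennreal M * emeasure lborel K"
    using K by (subst nn_integral_cmult_indicator) (auto simp: compact_imp_closed)
  also have "\<dots> < \<infinity>"
    using emeasure_bounded_finite[OF compact_imp_bounded[OF K(1)]] by (simp add: ennreal_mult_less_top)
  finally show ?thesis .
qed

lemma emeasure_compact_finite: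
  assumes "compact C" shows "emeasure \<mu> C < \<infinity>"
proof -
  have "\<exists>Q. open Q \<and> x \<in> Q \<and> emeasure \<mu> Q < \<infinity>" for x
  proof -
    obtain U p u r where c: "(U, p) \<in> A" "p u = x" "r > 0" "cball u r \<subseteq> U" by (rule chart_cball)
    have "open (p ` ball u r)" using open_chart_image[OF c(1), of "ball u r"] c(4) ball_subset_cball by blast
    moreover have "emeasure \<mu> (p ` ball u r) \<le> emeasure \<mu> (p ` cball u r)"
      using compact_imp_closed[OF compact_chart_image[OF c(1) compact_cball c(4)]] ball_subset_cball
      by (intro emeasure_mono image_mono) auto
    moreover have "\<dots> < \<infinity>" by (rule emeasure_chart_compact[OF c(1) compact_cball c(4)])
    ultimately show ?thesis using c by (intro exI[of _ "p ` ball u r"]) auto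
  qed
  then obtain Q where Q: "\<And>x. open (Q x)" "\<And>x. x \<in> Q x" "\<And>x. emeasure \<mu> (Q x) < \<infinity>" by metis
  obtain D where D: "D \<subseteq> C" "finite D" "C \<subseteq> (\<Union>x\<in>D. Q x)"
  proof (rule compactE_image[OF assms, of C Q])
    show "C \<subseteq> (\<Union>x\<in>C. Q x)" using Q(2) by auto
  qed (use Q(1) that in auto)
  have "emeasure \<mu> C \<le> emeasure \<mu> (\<Union>x\<in>D. Q x)"
    using D Q(1) by (intro emeasure_mono) auto
  also have "\<dots> \<le> (\<Sum>x\<in>D. emeasure \<mu> (Q x))"
    using D Q(1) by (intro emeasure_subadditive_finite) auto
  also have "\<dots> < \<infinity>" using Q(3) D(2) by (simp add: ennreal_sum_less_top)
  finally show ?thesis .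
qed

lemma integrable_compact_supp:
  fixes f :: "'m \<Rightarrow> real"
  assumes "continuous_on UNIV f" "compact C" "\<And>x. x \<notin> C \<Longrightarrow> f x = 0"
  shows "integrable \<mu> f"
proof -
  have "bounded (f ` C)"
    using assms by (intro compact_imp_bounded compact_continuous_image) (auto intro: continuous_on_subset)
  then obtain M where "\<And>x. x \<in> C \<Longrightarrow> \<bar>f x\<bar> \<le> M" by (auto simp: bounded_iff)
  then show ?thesis
    using assms borel_measurable_continuous_onI[OF assms(1)] emeasure_compact_finite[OF assms(2)]
      compact_imp_closed[OF assms(2)]
    by (intro integrableI_bounded_set[where A = C and B = M]) auto
qed

lemma frechet_derivative_vanish:
  assumes c: "(U, p) \<in> A" "u \<in> U" and Q: "open Q" "p u \<in> Q" "\<And>x. x \<in> Q \<Longrightarrow> f x = 0"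
  shows "frechet_derivative (\<lambda>u. f (p u)) (at u) = (\<lambda>v. 0)"
proof -
  have "frechet_derivative (\<lambda>u. f (p u)) (at u) = frechet_derivative (\<lambda>u. 0) (at u)"
    using Q c by (intro frechet_derivative_cong_open(1)[OF open_chart_preimage[OF c(1) Q(1)]]) auto
  then show ?thesis by simp
qed

text \<open>\<open>flat\<close> of r^2 - |v - u|^2, carried over by a chart and extended by zero.
  The image of the closed ball is compact, hence closed in a Hausdorff space, so every other chart
  splits into an open part with the formula and an open part where the function is zero.\<close>

lemma ex_bump:
  obtains U p K and b :: "'m \<Rightarrow> real" where "(U, p) \<in> A" "compact K" "K \<subseteq> U" "\<And>k. Ck_fun A k b"
    "\<And>y. b y \<ge> 0" "b x > 0" "\<And>y. y \<notin> p ` K \<Longrightarrow> b y = 0"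
proof -
  obtain U p u r where c: "(U, p) \<in> A" "p u = x" "r > 0" "cball u r \<subseteq> U" by (rule chart_cball)
  let ?K = "cball u r"
  define g where "g v = flat (r\<^sup>2 - (v - u) \<bullet> (v - u))" for v
  have gC: "Ck_on k UNIV g" for k
    unfolding g_def[abs_def]
    by (rule Ck_on_real_compose[where g = flat]) (auto intro!: Ck_on_diff Ck_on_inner Ck_on_const Ck_on_id Ck_on_flat)
  define b where "b y = (if y \<in> p ` U then g (inv_into U p y) else 0)" for y
  have u: "u \<in> U" using c by auto
  have off: "b y = 0" if "y \<notin> p ` ?K" for y
  proof (cases "y \<in> p ` U")
    case True
    then obtain v where v: "v \<in> U" "y = p v" by auto
    then have "v \<notin> ?K" using that by auto
    then have "r < norm (v - u)" by (simp add: dist_norm norm_minus_commute)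
    then have "r\<^sup>2 < (norm (v - u))\<^sup>2" using c(3) by (intro power_strict_mono) auto
    then show ?thesis using v c by (simp add: b_def g_def power2_norm_eq_inner)
  qed (simp add: b_def)
  have "Ck_on k V (\<lambda>v. b (q v))" if q: "(V, q) \<in> A" for V q k
  proof -
    let ?S = "V \<inter> q -` (p ` U)" and ?T = "V \<inter> q -` (- (p ` ?K))"
    have "closed (p ` ?K)" using compact_chart_image[OF c(1) compact_cball c(4)] compact_imp_closed by blast
    then have o: "open ?S" "open ?T"
      using open_chart_preimage[OF q] chart(2)[OF c(1)] by auto
    have "Ck_on k ?S (\<lambda>v. g (inv_into U p (q v)))"
      by (rule Ck_on_compose[OF o(1) open_UNIV transition_smooth[OF q c(1)] gC]) auto
    then have "Ck_on k ?S (\<lambda>v. b (q v))"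
      by (subst Ck_on_cong[OF o(1)]) (auto simp: b_def)
    then have "Ck_on k (?S \<union> ?T) (\<lambda>v. b (q v))"
      using off by (intro Ck_on_zero_extend o) auto
    moreover have "?S \<union> ?T = V" using image_mono[OF c(4), of p] by blast
    ultimately show ?thesis by simp
  qed
  then have "Ck_fun A k b" for k by (auto simp: Ck_fun_def comp_def)
  moreover have "b y \<ge> 0" for y by (simp add: b_def g_def)
  moreover have "b x = g u" using c(2)[symmetric] u c(1) by (simp add: b_def)
  then have "b x > 0" using c(3) by (simp add: g_def)
  ultimately show ?thesis using that[OF c(1) compact_cball c(4)] off by blast
qed

end

context expander
begin

abbreviation radial :: "('m \<Rightarrow> real) \<Rightarrow> 'm \<Rightarrow> real" where
  "radial f x \<equiv> F x \<bullet> gradient A F f x"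

text \<open>Writing \<open>\<sigma>\<close> as |x|^2 - |x^T|^2 eliminates \<open>N\<close>, which
  need not be continuous; smoothness of \<open>\<sigma>\<close> follows from this form.\<close>

lemma \<sigma>_chart:
  assumes "(U, p) \<in> A" "u \<in> U"
  shows "\<sigma> (p u) = F (p u) \<bullet> F (p u) - (\<Sum>a\<in>UNIV. (F (p u) \<bullet> dF p u (frame U p a u)) * (F (p u) \<bullet> dF p u (frame U p a u)))"
  using norm_F_sq[OF assms frame_orthonormal[OF assms(1,2)]]
  unfolding power2_norm_eq_inner by (simp add: power2_eq_square)

lemma Ck_\<sigma>: "Ck_fun A k \<sigma>"
  unfolding Ck_fun_def
proof clarify
  fix U p assume c: "(U, p) \<in> A"
  note o = chart(1)[OF c]
  have "Ck_on k U (\<lambda>u. F (p u) \<bullet> F (p u) - (\<Sum>a\<in>UNIV. (F (p u) \<bullet> dF p u (frame U p a u)) * (F (p u) \<bullet> dF p u (frame U p a u))))"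
    by (intro Ck_on_diff Ck_on_sum Ck_on_mult Ck_on_inner o Ck_F[OF c] Ck_frame[OF c]
      Ck_on_frechet[OF o Ck_F[OF c]])
  then show "Ck_on k U (\<sigma> \<circ> p)"
    by (subst Ck_on_cong[OF o]) (auto simp: \<sigma>_chart[OF c])
qed

lemma continuous_\<sigma>: "continuous_on UNIV \<sigma>"
  by (rule Ck_fun_imp_continuous[OF Ck_\<sigma>])

lemma continuous_F: "continuous_on UNIV F"
  by (rule Ck_fun_imp_continuous[OF smooth_F])

lemma continuous_radial:
  assumes f: "Ck_fun A 1 f" shows "continuous_on UNIV (radial f)"
proof (rule continuous_on_UNIV_charts)
  fix U p assume c: "(U, p) \<in> A"
  have f': "Ck_fun A (Suc 0) f" using f by simp
  have "continuous_on U (\<lambda>u. frechet_derivative (\<lambda>u. f (p u)) (at u) (tangential U p u))"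
    by (rule continuous_on_frechet[OF Ck_funD[OF f' c] Ck_on_imp_continuous_on[OF Ck_tangential[OF c]]])
  then show "continuous_on U (\<lambda>u. radial f (p u))"
    by (rule continuous_on_eq) (simp add: inner_gradient_F[OF c _ Ck_fun_imp_chart_differentiable[OF f']])
qed

lemma continuous_norm_gradient:
  assumes f: "Ck_fun A 1 f" shows "continuous_on UNIV (\<lambda>x. (norm (gradient A F f x))\<^sup>2)"
proof (rule continuous_on_UNIV_charts)
  fix U p assume c: "(U, p) \<in> A"
  have f': "Ck_fun A (Suc 0) f" using f by simp
  have "continuous_on U (\<lambda>u. \<Sum>a\<in>UNIV. (frechet_derivative (\<lambda>u. f (p u)) (at u) (frame U p a u))\<^sup>2)"
    by (intro continuous_intros continuous_on_frechet[OF Ck_funD[OF f' c] Ck_on_imp_continuous_on[OF Ck_frame[OF c]]])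
  then show "continuous_on U (\<lambda>u. (norm (gradient A F f (p u)))\<^sup>2)"
    by (rule continuous_on_eq)
      (simp add: norm_gradient_sq[OF c _ Ck_fun_imp_chart_differentiable[OF f'] frame_orthonormal[OF c]])
qed

lemma
  assumes f: "Ck_fun A 1 f" and C: "compact C" "\<And>y. y \<notin> C \<Longrightarrow> f y = 0" and x: "x \<notin> C"
  shows radial_vanish: "radial f x = 0" and gradient_vanish: "(norm (gradient A F f x))\<^sup>2 = 0"
proof -
  have f': "Ck_fun A (Suc 0) f" using f by simp
  obtain U p u where c: "(U, p) \<in> A" "u \<in> U" "p u = x" by (rule chart_cover)
  have D: "frechet_derivative (\<lambda>u. f (p u)) (at u) = (\<lambda>v. 0)"
    using C x c by (intro frechet_derivative_vanish[OF c(1,2), of "- C"]) (auto simp: compact_imp_closed)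
  show "radial f x = 0"
    using inner_gradient_F[OF c(1,2) Ck_fun_imp_chart_differentiable[OF f']] c(3) D by simp
  show "(norm (gradient A F f x))\<^sup>2 = 0"
    using norm_gradient_sq[OF c(1,2) Ck_fun_imp_chart_differentiable[OF f'] frame_orthonormal[OF c(1,2)]] c(3) D by simp
qed

text \<open>The divergence of f x^T.\<close>

abbreviation div_x :: "('m \<Rightarrow> real) \<Rightarrow> 'm \<Rightarrow> real" where
  "div_x f x \<equiv> radial f x + f x * (real CARD('n) + \<sigma> x / 2)"

lemma continuous_div_x:
  assumes "Ck_fun A 1 f" shows "continuous_on UNIV (div_x f)"
  by (intro continuous_intros continuous_radial[OF assms] continuous_\<sigma> Ck_fun_imp_continuous[OF assms]) auto

text \<open>The coordinate field with components f \<omega> Y_i, extended by zero off the chart, is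
  C^1 with compact support. Its Euclidean divergence is \<omega> times \<open>div_x f\<close>, and
  the integral of each partial derivative is zero.\<close>

lemma divergence_chart:
  assumes c: "(U, p) \<in> A" and f: "Ck_fun A 1 f" and K: "compact K" "K \<subseteq> U" "\<And>x. x \<notin> p ` K \<Longrightarrow> f x = 0"
  shows "(\<integral>x. div_x f x \<partial>\<mu>) = 0"
proof -
  note o = chart(1)[OF c]
  have f': "Ck_fun A (Suc 0) f" using f by simp
  let ?w = "volume_density (\<lambda>u. F (p u))" and ?Y = "tangential U p" and ?f = "\<lambda>u. f (p u)"
  have K': "compact (p ` K)" by (rule compact_chart_image[OF c K(1,2)])
  have off: "?f u = 0" if "u \<in> U" "u \<notin> K" for u
    using that K inj_on_image_mem_iff[OF chart(4)[OF c]] by (intro K(3)) auto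
  define V where "V i u = (if u \<in> U then ?f u * ?w u * ?Y u $ i else 0)" for i u
  have YC: "Ck_on 1 U (\<lambda>u. ?Y u $ i)" for i
    by (rule Ck_on_linear_compose[OF o bounded_linear_vec_nth Ck_tangential[OF c]])
  have VC: "Ck_on 1 UNIV (V i)" for i
  proof -
    have "Ck_on 1 U (\<lambda>u. ?f u * ?w u * ?Y u $ i)"
      by (intro Ck_on_mult o YC Ck_volume_density[OF c] Ck_funD[OF f c])
    then have 1: "Ck_on 1 U (V i)"
      by (subst Ck_on_cong[OF o]) (auto simp: V_def)
    have "Ck_on 1 (U \<union> - K) (V i)"
      using K(1) off by (intro Ck_on_zero_extend[OF o _ 1]) (auto simp: V_def compact_imp_closed)
    moreover have "U \<union> - K = UNIV" using K(2) by auto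
    ultimately show ?thesis by simp
  qed
  have Voff: "V i u = 0" if "u \<notin> K" for i u using that off by (auto simp: V_def)
  have DV: "(\<Sum>i\<in>UNIV. frechet_derivative (V i) (at u) (axis i 1)) = indicator U u * ?w u * div_x f (p u)" for u
  proof (cases "u \<in> U")
    case True
    have Df: "(?f has_derivative frechet_derivative ?f (at u)) (at u)"
      using Ck_on_SucD(1)[OF Ck_funD[OF f' c] True] .
    have Dw: "(?w has_derivative frechet_derivative ?w (at u)) (at u)"
      using Ck_on_SucD(1)[OF Ck_volume_density[OF c] True] .
    have DY: "(?Y has_derivative frechet_derivative ?Y (at u)) (at u)"
      using Ck_on_SucD(1)[OF Ck_tangential[OF c] True] .
    have DYi: "((\<lambda>u. ?Y u $ i) has_derivative (\<lambda>h. frechet_derivative ?Y (at u) h $ i)) (at u)" for i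
      by (rule bounded_linear.has_derivative[OF bounded_linear_vec_nth DY])
    have "((\<lambda>u. ?f u * ?w u * ?Y u $ i) has_derivative
       (\<lambda>h. ?f u * ?w u * (frechet_derivative ?Y (at u) h $ i) +
          (?f u * frechet_derivative ?w (at u) h + frechet_derivative ?f (at u) h * ?w u) * ?Y u $ i)) (at u)" for i
      by (intro has_derivative_mult Df Dw DYi)
    then have DVi: "(V i has_derivative
       (\<lambda>h. ?f u * ?w u * (frechet_derivative ?Y (at u) h $ i) +
          (?f u * frechet_derivative ?w (at u) h + frechet_derivative ?f (at u) h * ?w u) * ?Y u $ i)) (at u)" for i
      by (rule has_derivative_transform_within_open[OF _ o True]) (simp add: V_def)
    have "frechet_derivative (V i) (at u) h = ?f u * ?w u * (frechet_derivative ?Y (at u) h $ i) +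
          (?f u * frechet_derivative ?w (at u) h + frechet_derivative ?f (at u) h * ?w u) * ?Y u $ i" for i h
      by (simp only: frechet_derivative_eqI[OF DVi])
    then have "(\<Sum>i\<in>UNIV. frechet_derivative (V i) (at u) (axis i 1)) =
       ?f u * (?w u * (\<Sum>i\<in>UNIV. frechet_derivative ?Y (at u) (axis i 1) $ i)) +
       ?f u * (\<Sum>i\<in>UNIV. ?Y u $ i * frechet_derivative ?w (at u) (axis i 1)) +
       ?w u * (\<Sum>i\<in>UNIV. ?Y u $ i * frechet_derivative ?f (at u) (axis i 1))"
      by (simp add: sum.distrib sum_distrib_left algebra_simps)
    moreover have rep: "(\<Sum>i\<in>UNIV. v $ i * h (axis i 1)) = h v" if "linear h" for h :: "real^'n \<Rightarrow> real" and v
    proof -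
      interpret h: linear h by fact
      have "v = (\<Sum>i\<in>UNIV. (v $ i) *\<^sub>R axis i 1)"
        using basis_expansion[of v] by (simp add: scalar_mult_eq_scaleR)
      then have "h v = h (\<Sum>i\<in>UNIV. (v $ i) *\<^sub>R axis i 1)" by simp
      then show ?thesis by (simp add: h.sum h.scale)
    qed
    ultimately have "(\<Sum>i\<in>UNIV. frechet_derivative (V i) (at u) (axis i 1)) =
       ?f u * (frechet_derivative ?w (at u) (?Y u) + ?w u * (\<Sum>i\<in>UNIV. frechet_derivative ?Y (at u) (axis i 1) $ i)) +
       ?w u * frechet_derivative ?f (at u) (?Y u)"
      using rep[OF has_derivative_linear[OF Df]] rep[OF has_derivative_linear[OF Dw]] by (simp add: algebra_simps)
    then show ?thesis
      using True inner_gradient_F[OF c True Ck_fun_imp_chart_differentiable[OF f']]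
      unfolding divergence_identity[OF c True] by (simp add: algebra_simps)
  next
    case False
    have "frechet_derivative (V i) (at u) = frechet_derivative (\<lambda>_. 0) (at u)" for i
      using False K Voff by (intro frechet_derivative_cong_open(1)[of "- K"]) (auto simp: compact_imp_closed)
    then show ?thesis using False by simp
  qed
  have "continuous_on UNIV (\<lambda>u. frechet_derivative (V i) (at u) (axis i 1))" for i
    using Ck_on_SucD(2)[of 0 UNIV "V i"] VC[of i] by simp
  moreover have "frechet_derivative (V i) (at u) (axis i 1) = 0" if "u \<notin> K" for i u
  proof -
    have "frechet_derivative (V i) (at u) = frechet_derivative (\<lambda>_. 0) (at u)"
      using that K Voff by (intro frechet_derivative_cong_open(1)[of "- K"]) (auto simp: compact_imp_closed)
    then show ?thesis by simp
  qed
  ultimately have "integrable lborel (\<lambda>u. frechet_derivative (V i) (at u) (axis i 1))" for i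
    using K(1) by (intro integrable_compact_support[of _ K]) auto
  then have "(\<integral>u. (\<Sum>i\<in>UNIV. frechet_derivative (V i) (at u) (axis i 1)) \<partial>lborel) = 0"
    using integral_directional_derivative_eq_0[OF VC K(1) Voff] by simp
  moreover have "(\<integral>x. div_x f x \<partial>\<mu>) = (\<integral>u. indicator U u * ?w u * div_x f (p u) \<partial>lborel)"
  proof (rule integral_riemannian_chart[OF c])
    show "div_x f \<in> borel_measurable borel"
      using continuous_div_x[OF f] by (rule borel_measurable_continuous_onI)
    fix x assume "x \<notin> p ` U"
    then have "x \<notin> p ` K" using K(2) by auto
    then show "div_x f x = 0" using radial_vanish[OF f K' K(3)] K(3) by simp
  qed
  ultimately show ?thesis by (simp add: DV)
qed

text \<open>Finitely many bump functions cover the support; normalized by their sum they split f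
  into functions supported in single charts.\<close>

theorem divergence_theorem:
  assumes f: "Ck_fun A 1 f" and C: "compact C" "\<And>x. x \<notin> C \<Longrightarrow> f x = 0"
  shows "(\<integral>x. div_x f x \<partial>\<mu>) = 0"
proof -
  have "\<exists>U p K (b :: 'm \<Rightarrow> real). (U, p) \<in> A \<and> compact K \<and> K \<subseteq> U \<and> Ck_fun A 1 b \<and> (\<forall>y. b y \<ge> 0) \<and> b x > 0 \<and>
     (\<forall>y. y \<notin> p ` K \<longrightarrow> b y = 0)" for x
    by (rule ex_bump[of x]) blast
  then obtain U p K and b :: "'m \<Rightarrow> 'm \<Rightarrow> real" where c: "\<And>x. (U x, p x) \<in> A" and K: "\<And>x. compact (K x)" "\<And>x. K x \<subseteq> U x"
    and bC: "\<And>x. Ck_fun A 1 (b x)" and b: "\<And>x y. b x y \<ge> 0" "\<And>x. b x x > 0" "\<And>x y. y \<notin> p x ` K x \<Longrightarrow> b x y = 0"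
    by metis
  have bcont: "continuous_on UNIV (b x)" for x by (rule Ck_fun_imp_continuous[OF bC])
  have "open {y. 0 < b x y}" for x
    using bcont[of x] by (intro open_Collect_less) auto
  then obtain D where D: "D \<subseteq> C" "finite D" "C \<subseteq> (\<Union>x\<in>D. {y. 0 < b x y})"
  proof (rule compactE_image[OF C(1)])
    show "C \<subseteq> (\<Union>x\<in>C. {y. 0 < b x y})" using b(2) by auto
  qed (use that in auto)
  define B where "B y = (\<Sum>x\<in>D. b x y)" for y
  have B: "B y > 0" if y: "y \<in> C" for y
  proof -
    obtain x where "x \<in> D" "0 < b x y" using D(3) y by blast
    then show ?thesis unfolding B_def using D(2) b(1) by (intro sum_pos2[of D x]) auto
  qed
  have Bcont: "continuous_on UNIV B" unfolding B_def by (intro continuous_intros bcont)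
  have Bo: "open {y. 0 < B y}" using Bcont by (intro open_Collect_less) auto
  \<comment> \<open>Division happens only where the sum of the bumps is positive. This open set
    contains C, and off C the function f vanishes, so the two open sets on which g is C^1 cover
    everything.\<close>
  define g where "g x y = (if B y > 0 then f y * b x y / B y else 0)" for x y
  have g0: "g x y = 0" if "y \<notin> C \<or> y \<notin> p x ` K x" for x y
    using that C(2) b(3) by (auto simp: g_def)
  have gC: "Ck_fun A 1 (g x)" for x
    unfolding Ck_fun_def
  proof clarify
    fix V q assume q: "(V, q) \<in> A"
    let ?S = "V \<inter> q -` {y. 0 < B y}" and ?T = "V \<inter> q -` (- C)"
    have o: "open ?S" "open ?T"
      using compact_imp_closed[OF C(1)] Bo by (intro open_chart_preimage[OF q]; simp add: open_Compl)+
    have BC: "Ck_on 1 V (\<lambda>v. B (q v))"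
      unfolding B_def by (intro Ck_on_sum chart(1)[OF q] Ck_funD[OF bC q])
    have "Ck_on 1 ?S (\<lambda>v. f (q v) * b x (q v) / B (q v))"
      by (intro Ck_on_divide Ck_on_mult o Ck_on_subset[OF Ck_funD[OF f q]] Ck_on_subset[OF Ck_funD[OF bC q]] Ck_on_subset[OF BC])
        auto
    then have "Ck_on 1 ?S (\<lambda>v. g x (q v))"
      by (subst Ck_on_cong[OF o(1)]) (auto simp: g_def)
    then have "Ck_on 1 (?S \<union> ?T) (\<lambda>v. g x (q v))"
      using g0 by (intro Ck_on_zero_extend o) auto
    moreover have "?S \<union> ?T = V" using B by auto
    ultimately show "Ck_on 1 V (g x \<circ> q)" by (simp add: comp_def)
  qed
  have fg: "f y = (\<Sum>x\<in>D. g x y)" for y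
  proof (cases "y \<in> C")
    case True
    then have "(\<Sum>x\<in>D. g x y) = f y * B y / B y"
      using B[OF True] unfolding B_def by (simp add: g_def B_def sum_distrib_left flip: sum_divide_distrib)
    then show ?thesis using B[OF True] by simp
  qed (simp add: g0 C(2))
  have cd: "chart_differentiable A (g x) y" for x y
    using gC[of x] Ck_fun_imp_chart_differentiable[of A 0 "g x"] by simp
  have rad: "radial f y = (\<Sum>x\<in>D. radial (g x) y)" for y
  proof -
    obtain V q v where q: "(V, q) \<in> A" "v \<in> V" "q v = y" by (rule chart_cover)
    have "((\<lambda>v. g x (q v)) has_derivative frechet_derivative (\<lambda>v. g x (q v)) (at v)) (at v)" for x
      using cd[of x y] q unfolding chart_differentiable_def comp_def by (intro has_derivative_frechet) blast
    then have "((\<lambda>v. \<Sum>x\<in>D. g x (q v)) has_derivative (\<lambda>h. \<Sum>x\<in>D. frechet_derivative (\<lambda>v. g x (q v)) (at v) h)) (at v)"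
      by (intro has_derivative_sum)
    then have "frechet_derivative (\<lambda>v. f (q v)) (at v) = (\<lambda>h. \<Sum>x\<in>D. frechet_derivative (\<lambda>v. g x (q v)) (at v) h)"
      unfolding fg by (rule frechet_derivative_eqI)
    then show ?thesis
      using inner_gradient_F[OF q(1,2)] cd Ck_fun_imp_chart_differentiable[of A 0 f] f q(3) by force
  qed
  have int: "integrable \<mu> (div_x (g x))" for x
  proof (rule integrable_compact_supp[OF continuous_div_x[OF gC] C(1)])
    fix y assume "y \<notin> C"
    then show "div_x (g x) y = 0"
      using radial_vanish[OF gC C(1)] g0 by simp
  qed
  have "(\<integral>y. div_x f y \<partial>\<mu>) = (\<integral>y. (\<Sum>x\<in>D. div_x (g x) y) \<partial>\<mu>)"
    by (intro Bochner_Integration.integral_cong) (simp_all add: rad fg sum.distrib sum_distrib_right)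
  also have "\<dots> = (\<Sum>x\<in>D. \<integral>y. div_x (g x) y \<partial>\<mu>)"
    using int by simp
  also have "\<dots> = 0"
    using divergence_chart[OF c gC K] g0 by (intro sum.neutral) blast
  finally show ?thesis .
qed

section \<open>The energy identity\<close>

abbreviation w :: "'m \<Rightarrow> real" where "w x \<equiv> exp ((norm (F x))\<^sup>2 / 4)"

definition \<tau> :: "'m \<Rightarrow> real" where "\<tau> x = (norm (F x))\<^sup>2 - \<sigma> x"

text \<open>The expanded form of |\<nabla>f + 2 a f x^T|^2, where \<open>\<tau>\<close> is
  |x^T|^2.\<close>

definition excess :: "real \<Rightarrow> ('m \<Rightarrow> real) \<Rightarrow> 'm \<Rightarrow> real" where
  "excess a f x = (norm (gradient A F f x))\<^sup>2 + 4 * a * f x * radial f x + 4 * a\<^sup>2 * (f x)\<^sup>2 * \<tau> x"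

lemma Ck_w: "Ck_fun A k w"
proof -
  have "Ck_on k U (\<lambda>u. w (p u))" if c: "(U, p) \<in> A" for U p
  proof -
    have "Ck_on k U (\<lambda>u. exp ((F (p u) \<bullet> F (p u)) * (1 / 4)))"
      by (rule Ck_on_real_compose[where g = exp, OF chart(1)[OF c] _ Ck_on_exp])
        (intro Ck_on_mult Ck_on_inner Ck_on_const Ck_F[OF c] chart(1)[OF c])
    then show ?thesis by (simp add: power2_norm_eq_inner)
  qed
  then show ?thesis by (auto simp: Ck_fun_def comp_def)
qed

lemma Ck_weight_square:
  assumes "Ck_fun A k f" shows "Ck_fun A k (\<lambda>x. w x * (f x)\<^sup>2)"
proof -
  have "Ck_on k U (\<lambda>u. w (p u) * (f (p u) * f (p u)))" if c: "(U, p) \<in> A" for U p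
    by (intro Ck_on_mult chart(1)[OF c] Ck_funD[OF Ck_w c] Ck_funD[OF assms c])
  then show ?thesis by (auto simp: Ck_fun_def comp_def power2_eq_square[of "f _"])
qed

lemma continuous_w: "continuous_on UNIV w"
  by (rule Ck_fun_imp_continuous[OF Ck_w])

lemma continuous_\<tau>: "continuous_on UNIV \<tau>"
  unfolding \<tau>_def[abs_def] by (intro continuous_intros continuous_F continuous_\<sigma>)

lemma \<tau>_chart:
  fixes e :: "'n \<Rightarrow> real^'n"
  assumes "(U, p) \<in> A" "u \<in> U" "\<And>a b. dF p u (e a) \<bullet> dF p u (e b) = (if a = b then 1 else 0)"
  shows "\<tau> (p u) = (\<Sum>a\<in>UNIV. (F (p u) \<bullet> dF p u (e a))\<^sup>2)"
  using norm_F_sq[OF assms] by (simp add: \<tau>_def)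

lemma \<sigma>_nonneg: "\<sigma> x \<ge> 0" by (simp add: \<sigma>_def)

lemma excess_chart:
  assumes c: "(U, p) \<in> A" "u \<in> U" and f: "chart_differentiable A f (p u)"
  shows "excess a f (p u) =
    (\<Sum>b\<in>UNIV. (frechet_derivative (\<lambda>u. f (p u)) (at u) (frame U p b u) + 2 * a * f (p u) * (F (p u) \<bullet> dF p u (frame U p b u)))\<^sup>2)"
proof -
  let ?D = "frechet_derivative (\<lambda>u. f (p u)) (at u)" and ?E = "\<lambda>b. frame U p b u"
  have "(\<lambda>u. f (p u)) differentiable (at u)"
    using f c by (auto simp: chart_differentiable_def comp_def)
  then interpret D: linear ?D
    using has_derivative_frechet has_derivative_linear by blast
  have r: "radial f (p u) = (\<Sum>b\<in>UNIV. (F (p u) \<bullet> dF p u (?E b)) * ?D (?E b))"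
    unfolding inner_gradient_F[OF c f] tangential_def by (simp add: D.sum D.scale)
  show ?thesis
    unfolding excess_def norm_gradient_sq[OF c f frame_orthonormal[OF c]] r \<tau>_chart[OF c frame_orthonormal[OF c]]
    by (simp add: sum_distrib_left sum.distrib power2_sum power_mult_distrib algebra_simps)
qed

lemma excess_nonneg: "chart_differentiable A f x \<Longrightarrow> excess a f x \<ge> 0"
proof -
  assume f: "chart_differentiable A f x"
  obtain U p u where c: "(U, p) \<in> A" "u \<in> U" "p u = x" by (rule chart_cover)
  show ?thesis using excess_chart[OF c(1,2)] f c(3) by (simp add: sum_nonneg)
qed

text \<open>The gradient of the weight is w x^T / 2, so its derivative along x^T is w
  \<open>\<tau>\<close> / 2.\<close>

lemma radial_weight:
  assumes f: "Ck_fun A 1 f"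
  shows "radial (\<lambda>x. w x * (f x)\<^sup>2) x = w x * (2 * f x * radial f x + \<tau> x * (f x)\<^sup>2 / 2)"
proof -
  have f': "Ck_fun A (Suc 0) f" using f by simp
  obtain U p u where c: "(U, p) \<in> A" "u \<in> U" "p u = x" by (rule chart_cover)
  let ?Y = "tangential U p u"
  have wf: "Ck_fun A (Suc 0) (\<lambda>x. w x * (f x)\<^sup>2)"
    by (rule Ck_weight_square[OF f'])
  have Df: "((\<lambda>u. f (p u)) has_derivative frechet_derivative (\<lambda>u. f (p u)) (at u)) (at u)"
    using Ck_on_SucD(1)[OF Ck_funD[OF f' c(1)] c(2)] .
  have X: "((\<lambda>u. F (p u)) has_derivative dF p u) (at u)"
    using Ck_on_SucD(1)[OF Ck_F[OF c(1)] c(2)] .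
  have "((\<lambda>u. 1 / 4 * (F (p u) \<bullet> F (p u))) has_derivative (\<lambda>h. 1 / 4 * (F (p u) \<bullet> dF p u h + dF p u h \<bullet> F (p u)))) (at u)"
    by (intro has_derivative_mult_right has_derivative_inner X)
  note Dexp = has_derivative_exp[OF this]
  have weq: "w x = exp (1 / 4 * (F x \<bullet> F x))" for x by (simp add: power2_norm_eq_inner)
  have Dw: "((\<lambda>u. w (p u)) has_derivative (\<lambda>h. w (p u) * (F (p u) \<bullet> dF p u h) / 2)) (at u)"
    unfolding weq by (rule has_derivative_eq_rhs[OF Dexp]) (simp add: inner_commute[of "dF p u _"] fun_eq_iff)
  have "((\<lambda>u. w (p u) * (f (p u))\<^sup>2) has_derivative
      (\<lambda>h. w (p u) * (2 * f (p u) * frechet_derivative (\<lambda>u. f (p u)) (at u) h) + w (p u) * (F (p u) \<bullet> dF p u h) / 2 * (f (p u))\<^sup>2)) (at u)"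
    by (rule has_derivative_eq_rhs[OF has_derivative_mult[OF Dw has_derivative_power[OF Df, of 2]]])
      (simp add: fun_eq_iff mult_ac)
  then have "radial (\<lambda>x. w x * (f x)\<^sup>2) x = w x * (2 * f x * radial f x) + w x * (F x \<bullet> dF p u ?Y) / 2 * (f x)\<^sup>2"
    using inner_gradient_F[OF c(1,2) Ck_fun_imp_chart_differentiable[OF wf]]
      inner_gradient_F[OF c(1,2) Ck_fun_imp_chart_differentiable[OF f']] c(3)
    by (simp add: frechet_derivative_eqI)
  moreover have "F x \<bullet> dF p u ?Y = \<tau> x"
  proof -
    interpret L: linear "dF p u" by (rule linear_dF[OF c(1,2)])
    show ?thesis
      using \<tau>_chart[OF c(1,2) frame_orthonormal[OF c(1,2)]] c(3)
      by (simp add: tangential_def L.sum L.scale inner_sum_right power2_eq_square)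
  qed
  ultimately show ?thesis by (simp add: algebra_simps)
qed

lemma continuous_excess:
  assumes "Ck_fun A 1 f" shows "continuous_on UNIV (excess a f)"
  unfolding excess_def[abs_def]
  by (intro continuous_intros continuous_radial[OF assms] continuous_norm_gradient[OF assms]
      continuous_\<tau> Ck_fun_imp_continuous[OF assms])

lemma integrable_weighted:
  assumes "continuous_on UNIV f" "compact C" "\<And>x. x \<notin> C \<Longrightarrow> f x = 0"
  shows "integrable \<mu> (\<lambda>x. f x * w x)"
  using assms continuous_w
  by (intro integrable_compact_supp[where C = C] continuous_on_mult) auto

lemma
  assumes f: "Ck_fun A 1 f" and C: "compact C" "\<And>x. x \<notin> C \<Longrightarrow> f x = 0"
  shows integrable_excess: "integrable \<mu> (\<lambda>x. excess a f x * w x)"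
    and integrable_square: "continuous_on UNIV g \<Longrightarrow> integrable \<mu> (\<lambda>x. g x * (f x)\<^sup>2 * w x)"
proof -
  have "excess a f x = 0" if "x \<notin> C" for x
    using gradient_vanish[OF f C that] radial_vanish[OF f C that] C(2)[OF that] by (simp add: excess_def)
  then show "integrable \<mu> (\<lambda>x. excess a f x * w x)"
    by (rule integrable_weighted[OF continuous_excess[OF f] C(1)])
  show "integrable \<mu> (\<lambda>x. g x * (f x)\<^sup>2 * w x)" if "continuous_on UNIV g"
    using that C(2) by (intro integrable_weighted[where C = C] C(1) continuous_intros Ck_fun_imp_continuous[OF f]) auto
qed

theorem energy_identity:
  assumes f: "Ck_fun A 1 f" and C: "compact C" "\<And>x. x \<notin> C \<Longrightarrow> f x = 0"
  shows "(\<integral>x. (norm (gradient A F f x))\<^sup>2 * w x \<partial>\<mu>) = (\<integral>x. excess a f x * w x \<partial>\<mu>) +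
    (\<integral>x. (2 * a * (real CARD('n) + \<sigma> x / 2) + (a - 4 * a\<^sup>2) * \<tau> x) * (f x)\<^sup>2 * w x \<partial>\<mu>)"
proof -
  have f': "Ck_fun A (Suc 0) f" using f by simp
  let ?g = "\<lambda>x. w x * (f x)\<^sup>2"
  have wf: "Ck_fun A 1 ?g"
    by (rule Ck_weight_square[OF f])
  have div0: "(\<integral>x. div_x ?g x \<partial>\<mu>) = 0"
    using C(2) by (intro divergence_theorem[OF wf C(1)]) simp
  have int: "integrable \<mu> (div_x ?g)"
    using C(2) radial_vanish[OF wf C(1)] by (intro integrable_compact_supp[OF continuous_div_x[OF wf] C(1)]) auto
  let ?V = "\<lambda>x. (2 * a * (real CARD('n) + \<sigma> x / 2) + (a - 4 * a\<^sup>2) * \<tau> x) * (f x)\<^sup>2 * w x"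
  have intV: "integrable \<mu> ?V"
    by (intro integrable_square[OF f C] continuous_intros continuous_\<sigma> continuous_\<tau>) auto
  \<comment> \<open>Pointwise completion of the square. The divergence of w f^2 x^T, taken 2 a
    times, cancels the mixed term 4 a f x . \<nabla>f; the derivative of the weight contributes a
    \<open>\<tau>\<close> and the square 4 a^2 \<open>\<tau>\<close>.\<close>
  have "(norm (gradient A F f x))\<^sup>2 * w x = excess a f x * w x + ?V x - 2 * a * div_x ?g x" for x
    unfolding radial_weight[OF f] excess_def by (simp add: algebra_simps power2_eq_square)
  then have "(\<integral>x. (norm (gradient A F f x))\<^sup>2 * w x \<partial>\<mu>) = (\<integral>x. excess a f x * w x + ?V x - 2 * a * div_x ?g x \<partial>\<mu>)"
    by simp
  also have "\<dots> = (\<integral>x. excess a f x * w x \<partial>\<mu>) + (\<integral>x. ?V x \<partial>\<mu>) - 2 * a * (\<integral>x. div_x ?g x \<partial>\<mu>)"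
    using int intV integrable_excess[OF f C] by simp
  finally show ?thesis using div0 by simp
qed

end

section \<open>Rigidity: the mean curvature is constant in the equality case\<close>

lemma nn_integral_lborel_translate:
  fixes g :: "'a::euclidean_space \<Rightarrow> ennreal"
  assumes "g \<in> borel_measurable borel"
  shows "(\<integral>\<^sup>+x. g (x + c) \<partial>lborel) = (\<integral>\<^sup>+x. g x \<partial>lborel)"
proof -
  have "(\<integral>\<^sup>+x. g x \<partial>lborel) = (\<integral>\<^sup>+x. g x \<partial>distr lborel borel ((+) c))"
    by (simp add: lborel_distr_plus)
  also have "\<dots> = (\<integral>\<^sup>+x. g (x + c) \<partial>lborel)"
    using assms by (subst nn_integral_distr) (auto simp: add.commute)
  finally show ?thesis by simp
qed

text \<open>With c = G 1 - G 0, the integral of (G' - c)^2 is nonnegative, which gives c^2 \<le>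
  \<integral>G'^2. The remaining inequality is (G 0 + c)^2 \<le> 2 (G 0)^2 + 2 c^2.\<close>

lemma square_le_integral_square:
  fixes G G' :: "real \<Rightarrow> real"
  assumes G: "\<And>t. t \<in> {0..1} \<Longrightarrow> (G has_real_derivative G' t) (at t)" and cont: "continuous_on {0..1} G'"
  shows "ennreal ((G 1)\<^sup>2) \<le> ennreal (2 * (G 0)\<^sup>2) + 2 * (\<integral>\<^sup>+t. indicator {0..1} t * ennreal ((G' t)\<^sup>2) \<partial>lborel)"
proof -
  define c where "c = G 1 - G 0"
  have 1: "(G' has_integral c) {0..1}"
    unfolding c_def using G
    by (intro fundamental_theorem_of_calculus)
      (auto simp: has_real_derivative_iff_has_vector_derivative[symmetric] intro: has_field_derivative_at_within)
  have "(\<lambda>t. (G' t)\<^sup>2) integrable_on {0..1}"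
    by (intro integrable_continuous_interval continuous_intros cont)
  then obtain I where I: "((\<lambda>t. (G' t)\<^sup>2) has_integral I) {0..1}" by (auto simp: integrable_on_def)
  have "((\<lambda>t. (G' t)\<^sup>2 - 2 * c * G' t + c\<^sup>2) has_integral (I - 2 * c * c + c\<^sup>2)) {0..1}"
    using has_integral_add[OF has_integral_diff[OF I has_integral_mult_right[OF 1, of "2 * c"]] has_integral_const_real[of "c\<^sup>2" 0 1]]
    by simp
  moreover have "0 \<le> (G' t)\<^sup>2 - 2 * c * G' t + c\<^sup>2" for t
    using zero_le_power2[of "G' t - c"] by (simp add: power2_eq_square algebra_simps)
  ultimately have "0 \<le> I - 2 * c * c + c\<^sup>2"
    by (rule has_integral_nonneg)
  then have cI: "c\<^sup>2 \<le> I" by (simp add: power2_eq_square)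
  then have "0 \<le> I" by (meson order_trans zero_le_power2)
  have "(\<integral>\<^sup>+t. ennreal (indicator {0..1} t * (G' t)\<^sup>2) \<partial>lborel) = ennreal I"
    by (rule nn_integral_has_integral_lebesgue[OF _ I]) simp
  moreover have "ennreal (indicator {0..1} t * (G' t)\<^sup>2) = indicator {0..1} t * ennreal ((G' t)\<^sup>2)" for t
    by (auto simp: indicator_def)
  ultimately have nn: "(\<integral>\<^sup>+t. indicator {0..1} t * ennreal ((G' t)\<^sup>2) \<partial>lborel) = ennreal I" by simp
  have "(G 1)\<^sup>2 \<le> 2 * (G 0)\<^sup>2 + 2 * c\<^sup>2"
    using zero_le_power2[of "G 0 - c"] by (simp add: c_def power2_eq_square algebra_simps)
  then have "(G 1)\<^sup>2 \<le> 2 * (G 0)\<^sup>2 + 2 * I" using cI by linarith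
  then have "ennreal ((G 1)\<^sup>2) \<le> ennreal (2 * (G 0)\<^sup>2 + 2 * I)" by (rule ennreal_leI)
  also have "\<dots> = ennreal (2 * (G 0)\<^sup>2) + 2 * ennreal I"
    using \<open>0 \<le> I\<close> by (simp add: ennreal_plus ennreal_mult)
  finally show ?thesis by (simp only: nn)
qed

text \<open>A form of Poincare's inequality: every point of the shifted ball is joined to its
  original by a segment parallel to v, the one-dimensional estimate is applied on each segment, and
  the result is integrated over the ball.\<close>

lemma shifted_ball_estimate:
  fixes f :: "real^'n::finite \<Rightarrow> real"
  assumes S: "open S" and f: "Ck_on 1 S f" and B: "B \<in> sets borel" "B \<subseteq> S"
    and sub: "\<And>z t. z \<in> ball y \<delta> \<Longrightarrow> t \<in> {0..1} \<Longrightarrow> z + t *\<^sub>R v \<in> B"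
  shows "(\<integral>\<^sup>+z. indicator (ball (y + v) \<delta>) z * ennreal ((f z)\<^sup>2) \<partial>lborel) \<le>
    2 * (\<integral>\<^sup>+z. indicator (ball y \<delta>) z * ennreal ((f z)\<^sup>2) \<partial>lborel) +
    2 * (\<integral>\<^sup>+z. indicator B z * ennreal ((frechet_derivative f (at z) v)\<^sup>2) \<partial>lborel)"
proof -
  have f': "Ck_on (Suc 0) S f" using f by simp
  let ?D = "\<lambda>z. frechet_derivative f (at z) v"
  have Dc: "continuous_on S ?D" using Ck_on_SucD(2)[OF f'] by simp
  have fc: "continuous_on S f" using Ck_on_imp_continuous_on[OF f] .
  have ballB: "ball y \<delta> \<subseteq> B" using sub[of _ 0] by auto
  have ball'B: "ball (y + v) \<delta> \<subseteq> B"
  proof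
    fix z assume "z \<in> ball (y + v) \<delta>"
    then have "z - v \<in> ball y \<delta>" by (simp add: dist_norm algebra_simps)
    from sub[OF this, of 1] show "z \<in> B" by simp
  qed
  have meas: "(\<lambda>z. indicator C z * ennreal ((h z)\<^sup>2)) \<in> borel_measurable borel"
    if "C \<in> sets borel" "C \<subseteq> S" "continuous_on S h" for C and h :: "real^'n \<Rightarrow> real"
  proof -
    have "(\<lambda>z. indicator C z * (h z)\<^sup>2) \<in> borel_measurable borel"
      using S that by (intro borel_measurable_indicator_mult[of S]) (auto intro!: continuous_intros)
    moreover have "(\<lambda>z. indicator C z * ennreal ((h z)\<^sup>2)) = (\<lambda>z. ennreal (indicator C z * (h z)\<^sup>2))"
      by (auto simp: indicator_def fun_eq_iff)
    ultimately show ?thesis by simp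
  qed
  \<comment> \<open>Cut off by the indicator of B, the squared derivative is a function on the whole
    space. After exchanging the integrals, translation invariance makes the inner one independent of
    t.\<close>
  define g where "g z = indicator B z * ennreal ((?D z)\<^sup>2)" for z
  have g[measurable]: "g \<in> borel_measurable borel"
    unfolding g_def by (rule meas[OF B Dc])
  define h where "h z = indicator (ball (y + v) \<delta>) z * ennreal ((f z)\<^sup>2)" for z
  have h[measurable]: "h \<in> borel_measurable borel"
    unfolding h_def using ball'B B by (intro meas fc) auto
  have m1[measurable]: "(\<lambda>z. indicator (ball y \<delta>) z * ennreal ((f z)\<^sup>2)) \<in> borel_measurable borel"
    using ballB B by (intro meas fc) auto
  have "(\<integral>\<^sup>+z. h z \<partial>lborel) = (\<integral>\<^sup>+z. h (z + v) \<partial>lborel)"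
    by (rule nn_integral_lborel_translate[OF h, symmetric])
  also have "\<dots> \<le> (\<integral>\<^sup>+z. 2 * (indicator (ball y \<delta>) z * ennreal ((f z)\<^sup>2)) +
      2 * (\<integral>\<^sup>+t. indicator {0..1::real} t * g (z + t *\<^sub>R v) \<partial>lborel) \<partial>lborel)"
  proof (rule nn_integral_mono)
    fix z :: "real^'n"
    show "h (z + v) \<le> 2 * (indicator (ball y \<delta>) z * ennreal ((f z)\<^sup>2)) +
      2 * (\<integral>\<^sup>+t. indicator {0..1::real} t * g (z + t *\<^sub>R v) \<partial>lborel)"
    proof (cases "z \<in> ball y \<delta>")
      case True
      have inS: "z + t *\<^sub>R v \<in> B" "z + t *\<^sub>R v \<in> S" if "t \<in> {0..1}" for t
        using sub[OF True that] B(2) by auto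
      have "ennreal ((f (z + 1 *\<^sub>R v))\<^sup>2) \<le> ennreal (2 * (f (z + 0 *\<^sub>R v))\<^sup>2) +
          2 * (\<integral>\<^sup>+t. indicator {0..1::real} t * ennreal ((?D (z + t *\<^sub>R v))\<^sup>2) \<partial>lborel)"
      proof (rule square_le_integral_square)
        show "((\<lambda>t. f (z + t *\<^sub>R v)) has_real_derivative ?D (z + t *\<^sub>R v)) (at t)" if "t \<in> {0..1}" for t
          using inS[OF that] by (intro has_real_derivative_along_line Ck_on_SucD(1)[OF f']) auto
        show "continuous_on {0..1} (\<lambda>t. ?D (z + t *\<^sub>R v))"
          by (rule continuous_on_compose2[OF Dc]) (use inS in \<open>auto intro!: continuous_intros\<close>)
      qed
      also have "(\<integral>\<^sup>+t. indicator {0..1::real} t * ennreal ((?D (z + t *\<^sub>R v))\<^sup>2) \<partial>lborel) =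
          (\<integral>\<^sup>+t. indicator {0..1::real} t * g (z + t *\<^sub>R v) \<partial>lborel)"
        using inS by (intro nn_integral_cong) (auto simp: g_def indicator_def)
      finally show ?thesis
        using True by (simp add: h_def dist_norm algebra_simps ennreal_mult)
    next
      case False
      then show ?thesis by (simp add: h_def dist_norm algebra_simps)
    qed
  qed
  also have "\<dots> = 2 * (\<integral>\<^sup>+z. indicator (ball y \<delta>) z * ennreal ((f z)\<^sup>2) \<partial>lborel) +
      2 * (\<integral>\<^sup>+z. (\<integral>\<^sup>+t. indicator {0..1::real} t * g (z + t *\<^sub>R v) \<partial>lborel) \<partial>lborel)"
    by (subst nn_integral_add) (auto simp: nn_integral_cmult)
  also have "(\<integral>\<^sup>+z. (\<integral>\<^sup>+t. indicator {0..1::real} t * g (z + t *\<^sub>R v) \<partial>lborel) \<partial>lborel) =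
      (\<integral>\<^sup>+t. (\<integral>\<^sup>+z. indicator {0..1::real} t * g (z + t *\<^sub>R v) \<partial>lborel) \<partial>lborel)"
    by (rule pair_sigma_finite.Fubini'[OF pair_sigma_finite.intro[OF sigma_finite_lborel sigma_finite_lborel]]) measurable
  also have "\<dots> = (\<integral>\<^sup>+t. indicator {0..1::real} t * (\<integral>\<^sup>+z. g z \<partial>lborel) \<partial>lborel)"
    by (intro nn_integral_cong, subst nn_integral_cmult) (auto simp: nn_integral_lborel_translate)
  also have "\<dots> = (\<integral>\<^sup>+z. g z \<partial>lborel)"
    by (subst nn_integral_multc) auto
  finally show ?thesis unfolding h_def g_def .
qed

section \<open>Test functions on a properly immersed self-expander and the lower bound\<close>

locale proper_expander = expander A F N
  for A :: "('n::finite, 'm::{t2_space, second_countable_topology}) param set" and F N :: "'m \<Rightarrow> real^'k::finite" +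
  assumes proper: "properly_immersed F"
begin

lemma compact_preimage: "compact K \<Longrightarrow> compact (F -` K)"
  using proper by (simp add: properly_immersed_def)

lemma emeasure_open_pos:
  assumes "open W" "x \<in> W" shows "emeasure \<mu> W > 0"
proof -
  obtain U p u where c: "(U, p) \<in> A" "u \<in> U" "p u = x" by (rule chart_cover)
  let ?B = "U \<inter> p -` W" and ?v = "volume_density (\<lambda>u. F (p u))"
  have B: "open ?B" "u \<in> ?B" using open_chart_preimage[OF c(1) assms(1)] c assms by auto
  have "p ` ?B \<subseteq> W" by auto
  have "emeasure \<mu> (p ` ?B) = (\<integral>\<^sup>+u. indicator ?B u * ennreal (?v u) \<partial>lborel)"
    using B by (intro emeasure_riemannian[OF c(1)]) auto
  also have "\<dots> \<noteq> 0"
  proof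
    assume "(\<integral>\<^sup>+u. indicator ?B u * ennreal (?v u) \<partial>lborel) = 0"
    moreover have "(\<lambda>u. indicator ?B u * ennreal (?v u)) \<in> borel_measurable lborel"
    proof -
      have "(\<lambda>u. indicator ?B u * ?v u) \<in> borel_measurable borel"
        using B chart(1)[OF c(1)] by (intro borel_measurable_indicator_mult[OF _ Ck_on_imp_continuous_on[OF Ck_volume_density[OF c(1)]]]) auto
      then have "(\<lambda>u. ennreal (indicator ?B u * ?v u)) \<in> borel_measurable lborel" by simp
      also have "(\<lambda>u. ennreal (indicator ?B u * ?v u)) = (\<lambda>u. indicator ?B u * ennreal (?v u))"
        by (auto simp: indicator_def)
      finally show ?thesis .
    qed
    ultimately have "AE u in lborel. indicator ?B u * ennreal (?v u) = 0"
      by (simp add: nn_integral_0_iff_AE)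
    then have "AE u in lborel. u \<notin> ?B"
      by eventually_elim (use volume_density_pos[OF c(1)] in \<open>force simp: indicator_def split: if_splits\<close>)
    then have "emeasure lborel ?B = 0"
      using B by (subst (asm) AE_iff_measurable[of ?B]) auto
    moreover obtain r where "r > 0" "ball u r \<subseteq> ?B" using B open_contains_ball by blast
    then have "emeasure lborel (ball u r) \<le> emeasure lborel ?B"
      using B by (intro emeasure_mono) auto
    moreover have "emeasure lborel (ball u r) > 0"
    proof -
      have "emeasure lborel (ball u r) \<noteq> 0"
        using content_ball_pos[OF \<open>r > 0\<close>, of u] by (auto simp: measure_def)
      then show ?thesis by (simp add: zero_less_iff_neq_zero)
    qed
    ultimately show False by simp
  qed
  finally have "emeasure \<mu> (p ` ?B) > 0" by (simp add: zero_less_iff_neq_zero)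
  also have "emeasure \<mu> (p ` ?B) \<le> emeasure \<mu> W"
    using \<open>p ` ?B \<subseteq> W\<close> assms(1) by (intro emeasure_mono) auto
  finally show ?thesis .
qed

lemma integral_pos:
  fixes f :: "'m \<Rightarrow> real"
  assumes f: "continuous_on UNIV f" "\<And>x. 0 \<le> f x" "0 < f x" and int: "integrable \<mu> f"
  shows "0 < (\<integral>x. f x \<partial>\<mu>)"
proof -
  have "(\<integral>x. f x \<partial>\<mu>) \<noteq> 0"
  proof
    assume "(\<integral>x. f x \<partial>\<mu>) = 0"
    then have "AE x in \<mu>. f x = 0"
      using integral_nonneg_eq_0_iff_AE[OF int] f(2) by simp
    moreover have o: "open {x. 0 < f x}" using f(1) by (intro open_Collect_less) auto
    ultimately have "emeasure \<mu> {x. 0 < f x} = 0"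
      using f(2) by (subst (asm) AE_iff_measurable[of "{x. 0 < f x}"]) (auto simp: less_le)
    then show False using emeasure_open_pos[OF o] f(3) by auto
  qed
  then show ?thesis using integral_nonneg_AE[of f \<mu>] f(2) by (simp add: less_le)
qed

abbreviation energy :: "('m \<Rightarrow> real) \<Rightarrow> real" where
  "energy f \<equiv> weighted_integral A F (\<lambda>x. (norm (gradient A F f x))\<^sup>2)"

abbreviation mass :: "('m \<Rightarrow> real) \<Rightarrow> real" where
  "mass f \<equiv> weighted_integral A F (\<lambda>x. (f x)\<^sup>2)"

lemma test_functionD:
  assumes "test_function A f"
  obtains C where "compact C" "\<And>x. x \<notin> C \<Longrightarrow> f x = 0" "\<And>k. Ck_fun A k f"
  using assms that[of "closure {x. f x \<noteq> 0}"] closure_subset[of "{x. f x \<noteq> 0}"]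
  unfolding test_function_def smooth_fun_on_UNIV by blast

text \<open>Two instances of the energy identity. For a = 1/4 the coefficient of
  \<open>\<tau>\<close> vanishes. For a = 1/8 the potential is n/4 + \<open>\<sigma>\<close>/16 +
  |x|^2/16 and the excess is dropped; this confines the mass of functions of bounded energy.\<close>

lemma
  assumes f: "test_function A f"
  shows energy_eq: "energy f = (\<integral>x. excess (1/4) f x * w x \<partial>\<mu>) + (\<integral>x. (real CARD('n) / 2 + \<sigma> x / 4) * (f x)\<^sup>2 * w x \<partial>\<mu>)"
    and energy_confinement: "(\<integral>x. (norm (F x))\<^sup>2 / 16 * (f x)\<^sup>2 * w x \<partial>\<mu>) \<le> energy f"
    and test_integrable: "continuous_on UNIV g \<Longrightarrow> integrable \<mu> (\<lambda>x. g x * (f x)\<^sup>2 * w x)"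
    and test_integrable_excess: "integrable \<mu> (\<lambda>x. excess a f x * w x)"
    and excess_test_nonneg: "excess a f x \<ge> 0"
    and mass_nonneg: "mass f \<ge> 0"
proof -
  obtain C where C: "compact C" "\<And>x. x \<notin> C \<Longrightarrow> f x = 0" and fC: "\<And>k. Ck_fun A k f"
    using test_functionD[OF f] by blast
  have e: "(\<integral>x. (norm (gradient A F f x))\<^sup>2 * w x \<partial>\<mu>) = (\<integral>x. excess a f x * w x \<partial>\<mu>) +
    (\<integral>x. (2 * a * (real CARD('n) + \<sigma> x / 2) + (a - 4 * a\<^sup>2) * \<tau> x) * (f x)\<^sup>2 * w x \<partial>\<mu>)" for a
    by (rule energy_identity[OF fC C])
  show *: "integrable \<mu> (\<lambda>x. g x * (f x)\<^sup>2 * w x)" if "continuous_on UNIV g" for g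
    by (rule integrable_square[OF fC C that])
  show **: "integrable \<mu> (\<lambda>x. excess a f x * w x)" for a by (rule integrable_excess[OF fC C])
  show pos: "excess a f x \<ge> 0" for a x
    by (rule excess_nonneg[OF Ck_fun_imp_chart_differentiable[OF fC]])
  show "energy f = (\<integral>x. excess (1/4) f x * w x \<partial>\<mu>) + (\<integral>x. (real CARD('n) / 2 + \<sigma> x / 4) * (f x)\<^sup>2 * w x \<partial>\<mu>)"
  proof -
    have 1: "1 / 4 - 4 * (1 / 4)\<^sup>2 = (0::real)" by (simp add: power2_eq_square)
    have 2: "2 * (1 / 4) * (real CARD('n) + \<sigma> x / 2) = real CARD('n) / 2 + \<sigma> x / 4" for x by simp
    show ?thesis
      unfolding weighted_integral_def
      using e[of "1/4"] by (simp only: 1 2 mult_zero_left add_0_right)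
  qed
  have "(\<integral>x. (norm (F x))\<^sup>2 / 16 * (f x)\<^sup>2 * w x \<partial>\<mu>) \<le>
      (\<integral>x. (2 * (1/8) * (real CARD('n) + \<sigma> x / 2) + (1/8 - 4 * (1/8)\<^sup>2) * \<tau> x) * (f x)\<^sup>2 * w x \<partial>\<mu>)"
  proof (intro integral_mono * mult_right_mono)
    show "(norm (F x))\<^sup>2 / 16 \<le> 2 * (1/8) * (real CARD('n) + \<sigma> x / 2) + (1/8 - 4 * (1/8)\<^sup>2) * \<tau> x" for x
      using \<sigma>_nonneg[of x] by (simp add: \<tau>_def power2_eq_square[of "8::real"] field_simps)
  qed (auto intro!: continuous_intros continuous_F continuous_\<sigma> continuous_\<tau>)
  also have "\<dots> \<le> (\<integral>x. excess (1/8) f x * w x \<partial>\<mu>) + \<dots>"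
    using pos by simp
  also have "\<dots> = energy f"
    unfolding weighted_integral_def by (rule e[of "1/8", symmetric])
  finally show "(\<integral>x. (norm (F x))\<^sup>2 / 16 * (f x)\<^sup>2 * w x \<partial>\<mu>) \<le> energy f" .
  show "mass f \<ge> 0" unfolding weighted_integral_def by simp
qed

abbreviation H2_inf :: real where "H2_inf \<equiv> (INF x. (mean_curvature A F N x)\<^sup>2)"

lemma H2_inf_le: "H2_inf \<le> \<sigma> x / 4"
  unfolding mean_curvature_sq by (rule cINF_lower) (auto intro!: bdd_belowI[of _ 0] simp: \<sigma>_nonneg)

lemma H2_inf_nonneg: "0 \<le> H2_inf"
  unfolding mean_curvature_sq by (rule cINF_greatest) (auto simp: \<sigma>_nonneg)

text \<open>The defect of the Rayleigh quotient as a sum of two integrals. For c =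
  \<open>H2_inf\<close> both are nonnegative, so a quotient near the bound makes both small; on a
  hyperplane the choice c = 0 leaves the excess alone.\<close>

lemma mass_eq_potential:
  assumes f: "test_function A f"
  shows "energy f - (real CARD('n) / 2 + c) * mass f =
    (\<integral>x. excess (1/4) f x * w x \<partial>\<mu>) + (\<integral>x. (\<sigma> x / 4 - c) * (f x)\<^sup>2 * w x \<partial>\<mu>)"
proof -
  have i1: "integrable \<mu> (\<lambda>x. (real CARD('n) / 2 + c) * (f x)\<^sup>2 * w x)"
    and i2: "integrable \<mu> (\<lambda>x. (\<sigma> x / 4 - c) * (f x)\<^sup>2 * w x)"
    by (intro test_integrable[OF f] continuous_intros continuous_\<sigma>; simp)+
  have "(\<integral>x. (real CARD('n) / 2 + \<sigma> x / 4) * (f x)\<^sup>2 * w x \<partial>\<mu>) =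
      (\<integral>x. (real CARD('n) / 2 + c) * (f x)\<^sup>2 * w x + (\<sigma> x / 4 - c) * (f x)\<^sup>2 * w x \<partial>\<mu>)"
    by (intro Bochner_Integration.integral_cong) (auto simp: algebra_simps)
  also have "\<dots> = (\<integral>x. (real CARD('n) / 2 + c) * (f x)\<^sup>2 * w x \<partial>\<mu>) + (\<integral>x. (\<sigma> x / 4 - c) * (f x)\<^sup>2 * w x \<partial>\<mu>)"
    by (rule Bochner_Integration.integral_add[OF i1 i2])
  also have "(\<integral>x. (real CARD('n) / 2 + c) * (f x)\<^sup>2 * w x \<partial>\<mu>) = (real CARD('n) / 2 + c) * mass f"
    unfolding weighted_integral_def by (simp add: mult.assoc)
  finally show ?thesis unfolding energy_eq[OF f] by simp
qed

lemma energy_lower_bound: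
  assumes f: "test_function A f"
  shows "(real CARD('n) / 2 + H2_inf) * mass f \<le> energy f"
proof -
  have "0 \<le> (\<integral>x. excess (1/4) f x * w x \<partial>\<mu>)" "0 \<le> (\<integral>x. (\<sigma> x / 4 - H2_inf) * (f x)\<^sup>2 * w x \<partial>\<mu>)"
    using H2_inf_le excess_test_nonneg[OF f] by (auto intro!: integral_nonneg)
  then show ?thesis using mass_eq_potential[OF f, of H2_inf] by linarith
qed

text \<open>\<open>smooth_step\<close> vanishes from 1 on, so the support lies in |x|^2 \<le> R + 1,
  and the preimage of a ball is compact by properness.\<close>

lemma test_function_cutoff:
  assumes g: "\<And>k. Ck_on k UNIV g"
  shows "test_function A (\<lambda>x. g ((norm (F x))\<^sup>2) * smooth_step ((norm (F x))\<^sup>2 - R))"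
proof -
  let ?f = "\<lambda>x. g ((norm (F x))\<^sup>2) * smooth_step ((norm (F x))\<^sup>2 - R)"
  have "Ck_on k U (\<lambda>u. ?f (p u))" if c: "(U, p) \<in> A" for U p k
  proof -
    note o = chart(1)[OF c]
    have 1: "Ck_on k U (\<lambda>u. (norm (F (p u)))\<^sup>2)"
      unfolding power2_norm_eq_inner by (intro Ck_on_inner o Ck_F[OF c])
    show ?thesis
      by (intro Ck_on_mult o Ck_on_compose[OF o open_UNIV 1 g]
          Ck_on_compose[OF o open_UNIV Ck_on_diff[OF o 1 Ck_on_const] Ck_on_smooth_step]) auto
  qed
  then have "smooth_fun_on A UNIV ?f" by (auto simp: smooth_fun_on_UNIV Ck_fun_def comp_def)
  moreover have "compact (closure {x. ?f x \<noteq> 0})"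
  proof -
    have K: "compact (F -` cball 0 (sqrt (max 0 (R + 1))))" by (rule compact_preimage) simp
    have "{x. ?f x \<noteq> 0} \<subseteq> F -` cball 0 (sqrt (max 0 (R + 1)))"
    proof
      fix x assume "x \<in> {x. ?f x \<noteq> 0}"
      then have "(norm (F x))\<^sup>2 - R < 1" using smooth_step(2)[of "(norm (F x))\<^sup>2 - R"] by force
      then have "norm (F x) \<le> sqrt (max 0 (R + 1))" by (intro real_le_rsqrt) auto
      then show "x \<in> F -` cball 0 (sqrt (max 0 (R + 1)))" by simp
    qed
    then have "closure {x. ?f x \<noteq> 0} \<subseteq> F -` cball 0 (sqrt (max 0 (R + 1)))"
      using compact_imp_closed[OF K] by (rule closure_minimal)
    then show ?thesis using compact_Int_closed[OF K closed_closure, of "{x. ?f x \<noteq> 0}"] by (simp add: Int_absorb1)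
  qed
  ultimately show ?thesis by (simp add: test_function_def)
qed

lemma mass_pos:
  assumes f: "test_function A f" and x: "f x \<noteq> 0"
  shows "mass f > 0"
proof -
  have "continuous_on UNIV f"
    using f by (metis test_functionD Ck_fun_imp_continuous)
  then have "continuous_on UNIV (\<lambda>x. (f x)\<^sup>2 * w x)"
    by (intro continuous_intros continuous_F) auto
  moreover have "integrable \<mu> (\<lambda>x. (f x)\<^sup>2 * w x)"
    using test_integrable[OF f, of "\<lambda>_. 1"] by simp
  ultimately show ?thesis
    unfolding weighted_integral_def using x by (intro integral_pos[of _ x]) auto
qed

text \<open>The infimum that defines \<open>spectrum_bottom\<close> must be taken over a nonempty
  set to be meaningful.\<close>

lemma ex_test_function: "\<exists>f. test_function A f \<and> mass f \<noteq> 0"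
proof -
  obtain x :: 'm where True by simp
  let ?f = "\<lambda>y. 1 * smooth_step ((norm (F y))\<^sup>2 - (norm (F x))\<^sup>2)"
  have "test_function A ?f"
    using test_function_cutoff[OF Ck_on_const] .
  moreover have "mass ?f > 0"
    by (rule mass_pos[OF \<open>test_function A ?f\<close>, of x]) (simp add: smooth_step(1))
  ultimately show ?thesis by (intro exI[of _ ?f]) auto
qed

theorem spectrum_bottom_ge: "real CARD('n) / 2 + H2_inf \<le> spectrum_bottom A F"
  unfolding spectrum_bottom_def
proof (rule cInf_greatest)
  show "{energy f / mass f |f. test_function A f \<and> mass f \<noteq> 0} \<noteq> {}"
    using ex_test_function by blast
  fix r assume "r \<in> {energy f / mass f |f. test_function A f \<and> mass f \<noteq> 0}"
  then obtain f where f: "r = energy f / mass f" "test_function A f" "mass f \<noteq> 0" by blast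
  then have "mass f > 0" using mass_nonneg[OF f(2)] by linarith
  then show "real CARD('n) / 2 + H2_inf \<le> r"
    using energy_lower_bound[OF f(2)] f(1) by (simp add: pos_le_divide_eq)
qed

lemma spectrum_bottom_le:
  assumes "test_function A f" "mass f \<noteq> 0" shows "spectrum_bottom A F \<le> energy f / mass f"
  unfolding spectrum_bottom_def
proof (rule cInf_lower)
  have "real CARD('n) / 2 + H2_inf \<le> energy f / mass f" if "test_function A f" "mass f \<noteq> 0" for f
  proof -
    have "mass f > 0" using mass_nonneg[OF that(1)] that(2) by linarith
    then show ?thesis using energy_lower_bound[OF that(1)] by (simp add: pos_le_divide_eq)
  qed
  then show "bdd_below {energy f / mass f |f. test_function A f \<and> mass f \<noteq> 0}"
    by (intro bdd_belowI[of _ "real CARD('n) / 2 + H2_inf"]) blast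
qed (use assms in blast)

end

section \<open>Propagation of vanishing mass and constancy of the squared mean curvature\<close>

context proper_expander
begin

lemma nn_integral_chart_bounds:
  assumes c: "(U, p) \<in> A" and B: "B \<in> sets borel" "B \<subseteq> U" and g: "continuous_on UNIV g" "\<And>x. 0 \<le> g x"
  shows "(\<integral>\<^sup>+x. indicator (p ` B) x * ennreal (g x) \<partial>\<mu>) =
    (\<integral>\<^sup>+u. indicator B u * ennreal (volume_density (\<lambda>u. F (p u)) u * g (p u)) \<partial>lborel)"
proof -
  let ?v = "volume_density (\<lambda>u. F (p u))"
  have pB: "p ` B \<in> sets borel" by (rule sets_chart_image[OF c B])
  have "(\<integral>\<^sup>+x. indicator (p ` B) x * ennreal (g x) \<partial>\<mu>) =
      (\<integral>\<^sup>+x. indicator (p ` U) x * (indicator (p ` B) x * ennreal (g x)) \<partial>\<mu>)"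
    using B(2) by (intro nn_integral_cong) (auto simp: indicator_def)
  also have "\<dots> = (\<integral>\<^sup>+u. ennreal (indicator U u * ?v u) * (indicator (p ` B) (p u) * ennreal (g (p u))) \<partial>lborel)"
    using pB borel_measurable_continuous_onI[OF g(1)] by (intro nn_integral_riemannian_chart[OF c]) simp
  also have "\<dots> = (\<integral>\<^sup>+u. indicator B u * ennreal (?v u * g (p u)) \<partial>lborel)"
  proof (rule nn_integral_cong)
    fix u :: "real^'n"
    show "ennreal (indicator U u * ?v u) * (indicator (p ` B) (p u) * ennreal (g (p u))) = indicator B u * ennreal (?v u * g (p u))"
    proof (cases "u \<in> U")
      case True
      then have "p u \<in> p ` B \<longleftrightarrow> u \<in> B" using inj_on_image_mem_iff[OF chart(4)[OF c] _ B(2)] by blast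
      then show ?thesis
        using True volume_density_pos[OF c True] g(2)[of "p u"] by (auto simp: indicator_def ennreal_mult)
    qed (use B(2) in \<open>auto simp: indicator_def\<close>)
  qed
  finally show ?thesis .
qed

text \<open>Multiplication by the weight is division by the supersolution exp (-|x|^2 / 4), the
  inverse of the weight.\<close>

lemma Ck_inverse_weight: "Ck_fun A k (\<lambda>x. exp ((norm (F x))\<^sup>2 / 4) * (f x :: real))" if "Ck_fun A k f"
proof -
  have "Ck_on k U (\<lambda>u. w (p u) * f (p u))" if c: "(U, p) \<in> A" for U p
    by (intro Ck_on_mult chart(1)[OF c] Ck_funD[OF Ck_w c] Ck_funD[OF \<open>Ck_fun A k f\<close> c])
  then show ?thesis by (auto simp: Ck_fun_def comp_def)
qed

text \<open>
  Dividing by the positive supersolution \<open>exp (-|x|\<^sup>2 / 4)\<close> turns the excess into a Dirichlet integrand.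
\<close>

lemma quotient_derivative_bound:
  assumes c: "(U, p) \<in> A" "u \<in> U" and f: "Ck_fun A 1 f"
  shows "(frechet_derivative (\<lambda>u. w (p u) * f (p u)) (at u) v)\<^sup>2 \<le>
    ((w (p u)) * (\<Sum>b\<in>UNIV. (dF p u v \<bullet> dF p u (frame U p b u))\<^sup>2)) * (excess (1/4) f (p u) * w (p u))"
proof -
  let ?E = "\<lambda>b. frame U p b u" and ?D = "frechet_derivative (\<lambda>u. f (p u)) (at u)"
  have f': "Ck_fun A (Suc 0) f" using f by simp
  have Df: "((\<lambda>u. f (p u)) has_derivative ?D) (at u)"
    using Ck_on_SucD(1)[OF Ck_funD[OF f' c(1)] c(2)] .
  interpret D: linear ?D using Df by (rule has_derivative_linear)
  interpret L: linear "dF p u" by (rule linear_dF[OF c])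
  have X: "((\<lambda>u. F (p u)) has_derivative dF p u) (at u)"
    using Ck_on_SucD(1)[OF Ck_F[OF c(1)] c(2)] .
  have "((\<lambda>u. 1 / 4 * (F (p u) \<bullet> F (p u))) has_derivative (\<lambda>h. 1 / 4 * (F (p u) \<bullet> dF p u h + dF p u h \<bullet> F (p u)))) (at u)"
    by (intro has_derivative_mult_right has_derivative_inner X)
  note Dexp = has_derivative_exp[OF this]
  have weq: "w x = exp (1 / 4 * (F x \<bullet> F x))" for x by (simp add: power2_norm_eq_inner)
  have Dw: "((\<lambda>u. w (p u)) has_derivative (\<lambda>h. w (p u) * (F (p u) \<bullet> dF p u h) / 2)) (at u)"
    unfolding weq by (rule has_derivative_eq_rhs[OF Dexp]) (simp add: inner_commute[of "dF p u _"] fun_eq_iff)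
  let ?s = "\<lambda>b. dF p u v \<bullet> dF p u (?E b)"
  let ?t = "\<lambda>b. ?D (?E b) + 2 * (1/4) * f (p u) * (F (p u) \<bullet> dF p u (?E b))"
  have v: "v = (\<Sum>b\<in>UNIV. ?s b *\<^sub>R ?E b)"
    by (rule orthonormal_expansion[OF linear_dF[OF c] frame_orthonormal[OF c]])
  have "frechet_derivative (\<lambda>u. w (p u) * f (p u)) (at u) v = w (p u) * (?D v + 1/2 * f (p u) * (F (p u) \<bullet> dF p u v))"
    using frechet_derivative_eqI[OF has_derivative_mult[OF Dw Df]] by (simp add: algebra_simps)
  also have "?D v + 1/2 * f (p u) * (F (p u) \<bullet> dF p u v) = (\<Sum>b\<in>UNIV. ?s b * ?t b)"
  proof -
    have "?D v = (\<Sum>b\<in>UNIV. ?s b * ?D (?E b))" by (subst v) (simp add: D.sum D.scale)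
    moreover have "F (p u) \<bullet> dF p u v = (\<Sum>b\<in>UNIV. ?s b * (F (p u) \<bullet> dF p u (?E b)))"
      by (subst v) (simp add: L.sum L.scale inner_sum_right)
    ultimately show ?thesis by (simp add: sum.distrib sum_distrib_left algebra_simps)
  qed
  finally have D: "frechet_derivative (\<lambda>u. w (p u) * f (p u)) (at u) v = w (p u) * (\<Sum>b\<in>UNIV. ?s b * ?t b)" .
  have "(\<Sum>b\<in>UNIV. ?s b * ?t b)\<^sup>2 \<le> (\<Sum>b\<in>UNIV. (?s b)\<^sup>2) * (\<Sum>b\<in>UNIV. (?t b)\<^sup>2)"
    by (rule Cauchy_Schwarz_ineq_sum)
  also have "(\<Sum>b\<in>UNIV. (?t b)\<^sup>2) = excess (1/4) f (p u)"
    using excess_chart[OF c Ck_fun_imp_chart_differentiable[OF f'], of "1/4"] by simp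
  finally have "(w (p u))\<^sup>2 * (\<Sum>b\<in>UNIV. ?s b * ?t b)\<^sup>2 \<le> (w (p u))\<^sup>2 * ((\<Sum>b\<in>UNIV. (?s b)\<^sup>2) * excess (1/4) f (p u))"
    by (rule mult_left_mono) simp
  then show ?thesis
    unfolding D power_mult_distrib by (simp add: power2_eq_square[of "w (p u)"] mult_ac)
qed

text \<open>\<open>shifted_ball_estimate\<close> for w f, with the shift a - y from the ball at y to
  the ball at a. The segments stay in the ball of radius 2 \<epsilon> because |a - y| < \<epsilon>
  and \<delta> \<le> \<epsilon>. What matters is that K does not depend on f.\<close>

lemma mass_propagation:
  assumes c: "(U, p) \<in> A" and a: "cball a (2 * \<epsilon>) \<subseteq> U" "\<epsilon> > 0" and y: "y \<in> ball a \<epsilon>" and \<delta>: "0 < \<delta>" "\<delta> \<le> \<epsilon>"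
  obtains K where "\<And>f. Ck_fun A 1 f \<Longrightarrow>
     (\<integral>\<^sup>+x. indicator (p ` ball a \<delta>) x * ennreal ((f x)\<^sup>2 * w x) \<partial>\<mu>) \<le>
     ennreal K * (\<integral>\<^sup>+x. indicator (p ` ball y \<delta>) x * ennreal ((f x)\<^sup>2 * w x) \<partial>\<mu>) +
     ennreal K * (\<integral>\<^sup>+x. ennreal (excess (1/4) f x * w x) \<partial>\<mu>)"
proof -
  let ?v = "volume_density (\<lambda>u. F (p u))" and ?B = "cball a (2 * \<epsilon>)"
  \<comment> \<open>Conversion factors on a compact ball: \<open>?q\<close> turns (w f)^2 du into
    the weighted mass of f, its reciprocal turns it back, and \<open>?k\<close> compares the squared
    derivative of w f with the weighted excess times the volume density.\<close>
  let ?q = "\<lambda>u. ?v u / w (p u)"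
  let ?k = "\<lambda>u. (w (p u) * (\<Sum>b\<in>UNIV. (dF p u (a - y) \<bullet> dF p u (frame U p b u))\<^sup>2)) / ?v u"
  note o = chart(1)[OF c]
  have vc: "continuous_on U ?v" by (rule Ck_on_imp_continuous_on[OF Ck_volume_density[OF c]])
  have Fc: "continuous_on U (\<lambda>u. F (p u))" by (rule Ck_on_imp_continuous_on[OF Ck_F[OF c, of 0]])
  have wc: "continuous_on U (\<lambda>u. w (p u))" by (rule Ck_on_imp_continuous_on[OF Ck_funD[OF Ck_w c]])
  have bdd: "\<exists>M>0. \<forall>u\<in>?B. h u \<le> M" if "continuous_on U h" for h :: "real^'n \<Rightarrow> real"
  proof -
    have "bounded (h ` ?B)"
      using a(1) that by (intro compact_imp_bounded compact_continuous_image) (auto intro: continuous_on_subset)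
    then obtain M where "M > 0" "\<And>u. u \<in> ?B \<Longrightarrow> \<bar>h u\<bar> \<le> M" by (auto simp: bounded_pos)
    then show ?thesis by (intro exI[of _ M]) (auto simp: abs_le_iff)
  qed
  have qc: "continuous_on U ?q" using vc wc Fc by (intro continuous_intros) auto
  have q'c: "continuous_on U (\<lambda>u. w (p u) / ?v u)"
    using vc wc Fc volume_density_pos[OF c] by (intro continuous_intros) (auto simp: less_imp_neq[symmetric])
  have kc: "continuous_on U ?k"
    using vc wc Fc volume_density_pos[OF c] Ck_on_imp_continuous_on[OF Ck_frame[OF c]]
    by (intro continuous_intros continuous_on_frechet[OF Ck_F[OF c]]) (auto simp: less_imp_neq[symmetric])
  obtain M1 M2 M3 where M: "M1 > 0" "M2 > 0" "M3 > 0" "\<And>u. u \<in> ?B \<Longrightarrow> ?q u \<le> M1"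
    "\<And>u. u \<in> ?B \<Longrightarrow> w (p u) / ?v u \<le> M2" "\<And>u. u \<in> ?B \<Longrightarrow> ?k u \<le> M3"
    using bdd[OF qc] bdd[OF q'c] bdd[OF kc] by blast
  have ballB: "ball a \<delta> \<subseteq> ?B" "ball y \<delta> \<subseteq> ?B"
  proof -
    show "ball a \<delta> \<subseteq> ?B" using \<delta> a(2) by (auto simp: subset_eq)
    show "ball y \<delta> \<subseteq> ?B"
    proof
      fix z assume "z \<in> ball y \<delta>"
      then show "z \<in> ?B" using y \<delta> dist_triangle[of a z y] by auto
    qed
  qed
  \<comment> \<open>Dominates both coefficients 2 M1 M2 and 2 M1 M3 that arise when the four
    estimates are chained.\<close>
  define K where "K = 2 * M1 * (M2 + M3)"
  have "(\<integral>\<^sup>+x. indicator (p ` ball a \<delta>) x * ennreal ((f x)\<^sup>2 * w x) \<partial>\<mu>) \<le>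
     ennreal K * (\<integral>\<^sup>+x. indicator (p ` ball y \<delta>) x * ennreal ((f x)\<^sup>2 * w x) \<partial>\<mu>) +
     ennreal K * (\<integral>\<^sup>+x. ennreal (excess (1/4) f x * w x) \<partial>\<mu>)" if f: "Ck_fun A 1 f" for f
  proof -
    have fc: "continuous_on UNIV f" by (rule Ck_fun_imp_continuous[OF f])
    have gc: "continuous_on UNIV (\<lambda>x. (f x)\<^sup>2 * w x)" by (intro continuous_intros continuous_F fc) auto
    have ec: "continuous_on UNIV (\<lambda>x. excess (1/4) f x * w x)" by (intro continuous_intros continuous_excess[OF f] continuous_w)
    have en: "0 \<le> excess (1/4) f x" for x
      using f by (intro excess_nonneg Ck_fun_imp_chart_differentiable[of A 0]) simp
    let ?g = "\<lambda>u. w (p u) * f (p u)"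
    have gC: "Ck_on 1 U ?g" using Ck_funD[OF Ck_inverse_weight[OF f] c] .
    have gq: "?v u * ((f (p u))\<^sup>2 * w (p u)) = ?q u * (?g u)\<^sup>2" for u
      by (simp add: power2_eq_square field_simps)
    have 1: "(\<integral>\<^sup>+x. indicator (p ` ball a \<delta>) x * ennreal ((f x)\<^sup>2 * w x) \<partial>\<mu>) \<le>
        ennreal M1 * (\<integral>\<^sup>+u. indicator (ball a \<delta>) u * ennreal ((?g u)\<^sup>2) \<partial>lborel)"
    proof -
      have "(\<integral>\<^sup>+x. indicator (p ` ball a \<delta>) x * ennreal ((f x)\<^sup>2 * w x) \<partial>\<mu>) =
        (\<integral>\<^sup>+u. indicator (ball a \<delta>) u * ennreal (?q u * (?g u)\<^sup>2) \<partial>lborel)"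
        unfolding gq[symmetric] using ballB(1) a(1) by (intro nn_integral_chart_bounds[OF c _ _ gc]) auto
      also have "\<dots> \<le> (\<integral>\<^sup>+u. ennreal M1 * (indicator (ball a \<delta>) u * ennreal ((?g u)\<^sup>2)) \<partial>lborel)"
      proof (rule nn_integral_mono)
        fix u show "indicator (ball a \<delta>) u * ennreal (?q u * (?g u)\<^sup>2) \<le> ennreal M1 * (indicator (ball a \<delta>) u * ennreal ((?g u)\<^sup>2))"
        proof (cases "u \<in> ball a \<delta>")
          case True
          then have "?q u * (?g u)\<^sup>2 \<le> M1 * (?g u)\<^sup>2" using M(4) ballB by (intro mult_right_mono) auto
          then show ?thesis using True M(1) by (simp add: ennreal_leI flip: ennreal_mult)
        qed simp
      qed
      also have "\<dots> = ennreal M1 * (\<integral>\<^sup>+u. indicator (ball a \<delta>) u * ennreal ((?g u)\<^sup>2) \<partial>lborel)"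
      proof (rule nn_integral_cmult)
        have "(\<lambda>u. indicator (ball a \<delta>) u * (?g u)\<^sup>2) \<in> borel_measurable borel"
          using o ballB a(1) Ck_on_imp_continuous_on[OF gC]
          by (intro borel_measurable_indicator_mult[of U]) (auto intro!: continuous_intros)
        moreover have "(\<lambda>u. indicator (ball a \<delta>) u * ennreal ((?g u)\<^sup>2)) = (\<lambda>u. ennreal (indicator (ball a \<delta>) u * (?g u)\<^sup>2))"
          by (auto simp: indicator_def fun_eq_iff)
        ultimately show "(\<lambda>u. indicator (ball a \<delta>) u * ennreal ((?g u)\<^sup>2)) \<in> borel_measurable lborel" by simp
      qed
      finally show ?thesis .
    qed
    have 2: "(\<integral>\<^sup>+u. indicator (ball (y + (a - y)) \<delta>) u * ennreal ((?g u)\<^sup>2) \<partial>lborel) \<le>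
        2 * (\<integral>\<^sup>+u. indicator (ball y \<delta>) u * ennreal ((?g u)\<^sup>2) \<partial>lborel) +
        2 * (\<integral>\<^sup>+u. indicator ?B u * ennreal ((frechet_derivative ?g (at u) (a - y))\<^sup>2) \<partial>lborel)"
    proof (rule shifted_ball_estimate[OF o gC _ a(1)])
      fix z t assume z: "z \<in> ball y \<delta>" and t: "t \<in> {0..1::real}"
      have "dist a (z + t *\<^sub>R (a - y)) = norm ((y - z) + (1 - t) *\<^sub>R (a - y))"
        by (simp add: dist_norm algebra_simps)
      also have "\<dots> \<le> norm (y - z) + norm ((1 - t) *\<^sub>R (a - y))" by (rule norm_triangle_ineq)
      also have "norm ((1 - t) *\<^sub>R (a - y)) \<le> 1 * norm (a - y)"
        unfolding norm_scaleR using t by (intro mult_right_mono) auto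
      finally have "dist a (z + t *\<^sub>R (a - y)) \<le> norm (y - z) + norm (a - y)" by simp
      also have "\<dots> \<le> 2 * \<epsilon>" using z y \<delta> by (simp add: dist_norm)
      finally show "z + t *\<^sub>R (a - y) \<in> ?B" by simp
    qed simp
    have 3: "(\<integral>\<^sup>+u. indicator (ball y \<delta>) u * ennreal ((?g u)\<^sup>2) \<partial>lborel) \<le>
        ennreal M2 * (\<integral>\<^sup>+x. indicator (p ` ball y \<delta>) x * ennreal ((f x)\<^sup>2 * w x) \<partial>\<mu>)"
    proof -
      have eq: "(\<integral>\<^sup>+x. indicator (p ` ball y \<delta>) x * ennreal ((f x)\<^sup>2 * w x) \<partial>\<mu>) =
        (\<integral>\<^sup>+u. indicator (ball y \<delta>) u * ennreal (?v u * ((f (p u))\<^sup>2 * w (p u))) \<partial>lborel)"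
        using ballB(2) a(1) by (intro nn_integral_chart_bounds[OF c _ _ gc]) auto
      have m: "(\<lambda>u. indicator (ball y \<delta>) u * ennreal (?v u * ((f (p u))\<^sup>2 * w (p u)))) \<in> borel_measurable lborel"
      proof -
        have "(\<lambda>u. indicator (ball y \<delta>) u * (?v u * ((f (p u))\<^sup>2 * w (p u)))) \<in> borel_measurable borel"
          using o ballB a(1) vc wc Ck_on_imp_continuous_on[OF Ck_funD[OF f c]]
          by (intro borel_measurable_indicator_mult[of U]) (auto intro!: continuous_on_mult continuous_on_power)
        moreover have "(\<lambda>u. indicator (ball y \<delta>) u * ennreal (?v u * ((f (p u))\<^sup>2 * w (p u)))) =
            (\<lambda>u. ennreal (indicator (ball y \<delta>) u * (?v u * ((f (p u))\<^sup>2 * w (p u)))))"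
          by (auto simp: indicator_def fun_eq_iff)
        ultimately show ?thesis by simp
      qed
      have "(\<integral>\<^sup>+u. indicator (ball y \<delta>) u * ennreal ((?g u)\<^sup>2) \<partial>lborel) \<le>
         (\<integral>\<^sup>+u. ennreal M2 * (indicator (ball y \<delta>) u * ennreal (?v u * ((f (p u))\<^sup>2 * w (p u)))) \<partial>lborel)"
      proof (rule nn_integral_mono)
        fix u show "indicator (ball y \<delta>) u * ennreal ((?g u)\<^sup>2) \<le>
            ennreal M2 * (indicator (ball y \<delta>) u * ennreal (?v u * ((f (p u))\<^sup>2 * w (p u))))"
        proof (cases "u \<in> ball y \<delta>")
          case True
          then have u: "u \<in> ?B" "u \<in> U" using ballB a(1) by auto
          have v: "?v u > 0" by (rule volume_density_pos[OF c u(2)])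
          have le: "(w (p u) / ?v u) * (?v u * ((f (p u))\<^sup>2 * w (p u))) \<le> M2 * (?v u * ((f (p u))\<^sup>2 * w (p u)))"
            using M(5)[OF u(1)] v by (intro mult_right_mono) auto
          have "(w (p u) / ?v u) * (?v u * ((f (p u))\<^sup>2 * w (p u))) = (?g u)\<^sup>2"
            using v by (simp add: power2_eq_square)
          with le have "(?g u)\<^sup>2 \<le> M2 * (?v u * ((f (p u))\<^sup>2 * w (p u)))" by (simp only:)
          then show ?thesis using True M(2) v by (simp add: ennreal_leI flip: ennreal_mult)
        qed simp
      qed
      then show ?thesis unfolding eq using m by (simp add: nn_integral_cmult)
    qed
    have 4: "(\<integral>\<^sup>+u. indicator ?B u * ennreal ((frechet_derivative ?g (at u) (a - y))\<^sup>2) \<partial>lborel) \<le>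
        ennreal M3 * (\<integral>\<^sup>+x. ennreal (excess (1/4) f x * w x) \<partial>\<mu>)"
    proof -
      have eq: "(\<integral>\<^sup>+x. indicator (p ` ?B) x * ennreal (excess (1/4) f x * w x) \<partial>\<mu>) =
        (\<integral>\<^sup>+u. indicator ?B u * ennreal (?v u * (excess (1/4) f (p u) * w (p u))) \<partial>lborel)"
        using a(1) en by (intro nn_integral_chart_bounds[OF c _ _ ec]) auto
      have m: "(\<lambda>u. indicator ?B u * ennreal (?v u * (excess (1/4) f (p u) * w (p u)))) \<in> borel_measurable lborel"
      proof -
        have "continuous_on U (\<lambda>u. excess (1/4) f (p u))"
          by (rule continuous_on_compose2[OF continuous_excess[OF f] chart(5)[OF c]]) simp
        then have "(\<lambda>u. indicator ?B u * (?v u * (excess (1/4) f (p u) * w (p u)))) \<in> borel_measurable borel"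
          using o a(1) vc wc by (intro borel_measurable_indicator_mult[of U]) (auto intro!: continuous_on_mult)
        moreover have "(\<lambda>u. indicator ?B u * ennreal (?v u * (excess (1/4) f (p u) * w (p u)))) =
            (\<lambda>u. ennreal (indicator ?B u * (?v u * (excess (1/4) f (p u) * w (p u)))))"
          by (auto simp: indicator_def fun_eq_iff)
        ultimately show ?thesis by simp
      qed
      have "(\<integral>\<^sup>+u. indicator ?B u * ennreal ((frechet_derivative ?g (at u) (a - y))\<^sup>2) \<partial>lborel) \<le>
         (\<integral>\<^sup>+u. ennreal M3 * (indicator ?B u * ennreal (?v u * (excess (1/4) f (p u) * w (p u)))) \<partial>lborel)"
      proof (rule nn_integral_mono)
        fix u show "indicator ?B u * ennreal ((frechet_derivative ?g (at u) (a - y))\<^sup>2) \<le>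
            ennreal M3 * (indicator ?B u * ennreal (?v u * (excess (1/4) f (p u) * w (p u))))"
        proof (cases "u \<in> ?B")
          case True
          then have u: "u \<in> U" using a(1) by auto
          have v: "?v u > 0" by (rule volume_density_pos[OF c u])
          have "(frechet_derivative ?g (at u) (a - y))\<^sup>2 \<le> (?k u * ?v u) * (excess (1/4) f (p u) * w (p u))"
            using quotient_derivative_bound[OF c u f, of "a - y"] v by simp
          also have "\<dots> \<le> (M3 * ?v u) * (excess (1/4) f (p u) * w (p u))"
            using M(6)[OF True] v en by (intro mult_right_mono) auto
          finally have "(frechet_derivative ?g (at u) (a - y))\<^sup>2 \<le> M3 * (?v u * (excess (1/4) f (p u) * w (p u)))"
            by (simp add: mult_ac)
          then show ?thesis using True M(3) v en by (simp add: ennreal_leI flip: ennreal_mult)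
        qed simp
      qed
      also have "\<dots> = ennreal M3 * (\<integral>\<^sup>+x. indicator (p ` ?B) x * ennreal (excess (1/4) f x * w x) \<partial>\<mu>)"
        unfolding eq using m by (simp add: nn_integral_cmult)
      also have "\<dots> \<le> ennreal M3 * (\<integral>\<^sup>+x. ennreal (excess (1/4) f x * w x) \<partial>\<mu>)"
        by (intro mult_left_mono nn_integral_mono) (auto simp: indicator_def)
      finally show ?thesis .
    qed
    let ?I = "\<integral>\<^sup>+x. indicator (p ` ball y \<delta>) x * ennreal ((f x)\<^sup>2 * w x) \<partial>\<mu>"
    let ?J = "\<integral>\<^sup>+x. ennreal (excess (1/4) f x * w x) \<partial>\<mu>"
    have "(\<integral>\<^sup>+u. indicator (ball a \<delta>) u * ennreal ((?g u)\<^sup>2) \<partial>lborel) \<le> 2 * (ennreal M2 * ?I) + 2 * (ennreal M3 * ?J)"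
      using order_trans[OF 2 add_mono[OF mult_left_mono[OF 3] mult_left_mono[OF 4]]] by simp
    then have "(\<integral>\<^sup>+x. indicator (p ` ball a \<delta>) x * ennreal ((f x)\<^sup>2 * w x) \<partial>\<mu>) \<le>
       ennreal M1 * (2 * (ennreal M2 * ?I) + 2 * (ennreal M3 * ?J))"
      by (intro order_trans[OF 1] mult_left_mono) auto
    also have "\<dots> = ennreal (2 * M1 * M2) * ?I + ennreal (2 * M1 * M3) * ?J"
      using M by (simp add: ennreal_mult algebra_simps)
    also have "\<dots> \<le> ennreal K * ?I + ennreal K * ?J"
      using M by (intro add_mono mult_right_mono ennreal_leI) (auto simp: K_def algebra_simps)
    finally show ?thesis .
  qed
  then show ?thesis by (rule that)
qed

lemma test_nn_integral:
  assumes f: "test_function A f" and g: "continuous_on UNIV g" "\<And>x. 0 \<le> g x"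
  shows "(\<integral>\<^sup>+x. ennreal (g x * (f x)\<^sup>2 * w x) \<partial>\<mu>) = ennreal (\<integral>x. g x * (f x)\<^sup>2 * w x \<partial>\<mu>)"
  using g by (intro nn_integral_eq_integral test_integrable[OF f]) auto

theorem constant_curvature:
  assumes eq: "spectrum_bottom A F = real CARD('n) / 2 + H2_inf"
  shows "\<sigma> x / 4 = H2_inf"
proof (rule ccontr)
  assume "\<sigma> x / 4 \<noteq> H2_inf"
  then have x: "\<sigma> x / 4 > H2_inf" using H2_inf_le[of x] by simp
  define L where "L = real CARD('n) / 2 + H2_inf"
  have "\<exists>f. test_function A f \<and> mass f > 0 \<and> energy f < (L + inverse (real (Suc k))) * mass f" for k
  proof -
    have "Inf {energy f / mass f |f. test_function A f \<and> mass f \<noteq> 0} < L + inverse (real (Suc k))"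
      using eq by (simp add: spectrum_bottom_def L_def)
    from cInf_lessD[OF _ this] obtain f where f: "test_function A f" "mass f \<noteq> 0" "energy f / mass f < L + inverse (real (Suc k))"
      using ex_test_function by blast
    then have "mass f > 0" using mass_nonneg[OF f(1)] by linarith
    then show ?thesis using f by (auto simp: pos_divide_less_eq)
  qed
  then obtain f where f: "\<And>k. test_function A (f k)" "\<And>k. mass (f k) > 0"
    and fe: "\<And>k. energy (f k) < (L + inverse (real (Suc k))) * mass (f k)" by metis
  have fC: "Ck_fun A 1 (f k)" for k using f(1)[of k] by (metis test_functionD)
  have fcont: "continuous_on UNIV (f k)" for k by (rule Ck_fun_imp_continuous[OF fC])
  \<comment> \<open>\<open>r\<close> is the fraction of the mass of \<open>f k\<close> that lies in
    W, and \<open>s\<close> below is the excess relative to the mass. Extended nonnegative values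
    spare integrability conditions for arbitrary open W.\<close>
  define r where "r W k = (\<integral>\<^sup>+x. indicator W x * ennreal ((f k x)\<^sup>2 * w x) \<partial>\<mu>) / ennreal (mass (f k))" for W k
  define s where "s k = (\<integral>\<^sup>+x. ennreal (excess (1/4) (f k) x * w x) \<partial>\<mu>) / ennreal (mass (f k))" for k
  have div: "ennreal y / ennreal (mass (f k)) = ennreal (y / mass (f k))" if "0 \<le> y" for y k
    using f(2) that by (intro divide_ennreal) auto
  have inv0: "(\<lambda>k. inverse (real (Suc k))) \<longlonglongrightarrow> 0" by (rule LIMSEQ_inverse_real_of_nat)
  define P where "P k = (\<integral>x. excess (1/4) (f k) x * w x \<partial>\<mu>)" for k
  define Q where "Q k = (\<integral>x. (\<sigma> x / 4 - H2_inf) * (f k x)\<^sup>2 * w x \<partial>\<mu>)" for k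
  have P0: "P k \<ge> 0" for k unfolding P_def using excess_test_nonneg[OF f(1)] by (intro Bochner_Integration.integral_nonneg) auto
  have Q0: "Q k \<ge> 0" for k unfolding Q_def using H2_inf_le by (intro Bochner_Integration.integral_nonneg) auto
  \<comment> \<open>Both terms are nonnegative, so relative to the mass each of them is at most 1 /
    (k + 1).\<close>
  have PQ: "P k + Q k \<le> inverse (real (Suc k)) * mass (f k)" for k
    using mass_eq_potential[OF f(1), of k H2_inf] fe[of k] unfolding P_def Q_def L_def by (simp add: algebra_simps)
  have to0: "X \<longlonglongrightarrow> 0" if "\<And>k. X k \<le> ennreal (M * inverse (real (Suc k)))" for X :: "nat \<Rightarrow> ennreal" and M
  proof (rule tendsto_sandwich[of "\<lambda>_. 0" X sequentially "\<lambda>k. ennreal (M * inverse (real (Suc k)))"])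
    have "(\<lambda>k. ennreal (M * inverse (real (Suc k)))) \<longlonglongrightarrow> ennreal (M * 0)"
      by (intro tendsto_ennrealI tendsto_mult_left inv0)
    then show "(\<lambda>k. ennreal (M * inverse (real (Suc k)))) \<longlonglongrightarrow> 0" by simp
  qed (use that in auto)
  have s0: "s \<longlonglongrightarrow> 0"
  proof (rule to0[of _ 1])
    fix k
    have "(\<integral>\<^sup>+x. ennreal (excess (1/4) (f k) x * w x) \<partial>\<mu>) = ennreal (P k)"
      unfolding P_def using excess_test_nonneg[OF f(1)] by (intro nn_integral_eq_integral test_integrable_excess[OF f(1)]) auto
    then have "s k = ennreal (P k / mass (f k))" unfolding s_def using div[OF P0] by simp
    also have "\<dots> \<le> ennreal (1 * inverse (real (Suc k)))"
      using PQ[of k] Q0[of k] f(2)[of k] by (intro ennreal_leI) (simp add: pos_divide_le_eq)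
    finally show "s k \<le> ennreal (1 * inverse (real (Suc k)))" .
  qed
  have rmono: "r W k \<le> r W' k" if "W \<subseteq> W'" for W W' k
    unfolding r_def using that by (intro divide_right_mono_ennreal nn_integral_mono) (auto simp: indicator_def)
  have r_zero_mono: "r W \<longlonglongrightarrow> 0" if "r W' \<longlonglongrightarrow> 0" "W \<subseteq> W'" for W W'
    by (rule tendsto_sandwich[of "\<lambda>_. 0" "r W" sequentially "r W'"]) (use that rmono in auto)
  define G where "G = {z. \<exists>W. open W \<and> z \<in> W \<and> r W \<longlonglongrightarrow> 0}"
  have Gopen: "open G"
    by (rule iffD2[OF open_subopen]) (unfold G_def, blast)
  have xG: "x \<in> G"
  proof -
    \<comment> \<open>Chebyshev's inequality on the neighbourhood of x where the potential exceeds
      half of its value at x.\<close>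
    define d where "d = (\<sigma> x / 4 - H2_inf) / 2"
    have d: "d > 0" using x by (simp add: d_def)
    let ?W = "{z. \<sigma> z / 4 - H2_inf > d}"
    have o: "open ?W" by (intro open_Collect_less continuous_intros continuous_\<sigma>) auto
    have "r ?W \<longlonglongrightarrow> 0"
    proof (rule to0[of _ "1 / d"])
      fix k
      have "(\<integral>\<^sup>+x. indicator ?W x * ennreal ((f k x)\<^sup>2 * w x) \<partial>\<mu>) \<le>
          (\<integral>\<^sup>+x. ennreal ((1 / d * (\<sigma> x / 4 - H2_inf)) * (f k x)\<^sup>2 * w x) \<partial>\<mu>)"
      proof (rule nn_integral_mono)
        fix z
        have "1 * ((f k z)\<^sup>2 * w z) \<le> (1 / d * (\<sigma> z / 4 - H2_inf)) * ((f k z)\<^sup>2 * w z)" if "z \<in> ?W"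
          using that d by (intro mult_right_mono) (auto simp: field_simps)
        then show "indicator ?W z * ennreal ((f k z)\<^sup>2 * w z) \<le> ennreal ((1 / d * (\<sigma> z / 4 - H2_inf)) * (f k z)\<^sup>2 * w z)"
          by (cases "z \<in> ?W") (auto intro!: ennreal_leI simp: mult.assoc)
      qed
      also have "\<dots> = ennreal (\<integral>x. (1 / d * (\<sigma> x / 4 - H2_inf)) * (f k x)\<^sup>2 * w x \<partial>\<mu>)"
        using H2_inf_le d by (intro test_nn_integral[OF f(1)]) (auto intro!: continuous_intros continuous_\<sigma>)
      also have "(\<integral>x. (1 / d * (\<sigma> x / 4 - H2_inf)) * (f k x)\<^sup>2 * w x \<partial>\<mu>) = 1 / d * Q k"
        unfolding Q_def by (simp only: mult.assoc integral_mult_right_zero)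
      finally have "r ?W k \<le> ennreal (1 / d * Q k) / ennreal (mass (f k))"
        unfolding r_def by (rule divide_right_mono_ennreal)
      also have "\<dots> = ennreal (1 / d * Q k / mass (f k))"
        using d Q0 by (intro div) auto
      also have "\<dots> \<le> ennreal (1 / d * inverse (real (Suc k)))"
      proof (rule ennreal_leI)
        have "Q k \<le> inverse (real (Suc k)) * mass (f k)" using PQ[of k] P0[of k] by linarith
        then have "1 / d * Q k \<le> 1 / d * (inverse (real (Suc k)) * mass (f k))"
          using d by (intro mult_left_mono) auto
        then have "1 / d * Q k / mass (f k) \<le> 1 / d * (inverse (real (Suc k)) * mass (f k)) / mass (f k)"
          using f(2)[of k] by (intro divide_right_mono) auto
        also have "\<dots> = 1 / d * inverse (real (Suc k))" using f(2)[of k] by simp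
        finally show "1 / d * Q k / mass (f k) \<le> 1 / d * inverse (real (Suc k))" .
      qed
      finally show "r ?W k \<le> ennreal (1 / d * inverse (real (Suc k)))" .
    qed
    then show ?thesis unfolding G_def using o d x by (auto simp: d_def intro!: exI[of _ ?W])
  qed
  have Gclosed: "closed G"
  proof -
    have "z \<in> G" if z: "z \<in> closure G" for z
    proof -
      obtain U p a e where c: "(U, p) \<in> A" "p a = z" "e > 0" "cball a e \<subseteq> U" by (rule chart_cball)
      define \<epsilon> where "\<epsilon> = e / 2"
      have \<epsilon>: "\<epsilon> > 0" "cball a (2 * \<epsilon>) \<subseteq> U" using c by (auto simp: \<epsilon>_def)
      have sub: "ball a \<epsilon> \<subseteq> U" using \<epsilon> by (auto simp: subset_eq)
      have "open (p ` ball a \<epsilon>)" by (rule open_chart_image[OF c(1) open_ball sub])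
      moreover have "z \<in> p ` ball a \<epsilon>" using c \<epsilon> by auto
      ultimately obtain y where y: "y \<in> ball a \<epsilon>" "p y \<in> G"
        using z open_Int_closure_eq_empty[of "p ` ball a \<epsilon>" G] by blast
      then obtain W where W: "open W" "p y \<in> W" "r W \<longlonglongrightarrow> 0" unfolding G_def by blast
      have "open (U \<inter> p -` W)" "y \<in> U \<inter> p -` W"
        using open_chart_preimage[OF c(1) W(1)] y W sub by auto
      then obtain \<delta>' where \<delta>': "\<delta>' > 0" "ball y \<delta>' \<subseteq> U \<inter> p -` W" using open_contains_ball by blast
      define \<delta> where "\<delta> = min \<delta>' \<epsilon>"
      have \<delta>: "0 < \<delta>" "\<delta> \<le> \<epsilon>" "p ` ball y \<delta> \<subseteq> W" using \<delta>' \<epsilon> by (auto simp: \<delta>_def)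
      have ry: "r (p ` ball y \<delta>) \<longlonglongrightarrow> 0" by (rule r_zero_mono[OF W(3) \<delta>(3)])
      \<comment> \<open>The chart ball around z contains a point p y of G. The mass near z is
        controlled by the mass near p y and the excess, with a constant independent of k, and both
        tend to zero relative to the mass.\<close>
      obtain K where K: "\<And>f. Ck_fun A 1 f \<Longrightarrow>
         (\<integral>\<^sup>+x. indicator (p ` ball a \<delta>) x * ennreal ((f x)\<^sup>2 * w x) \<partial>\<mu>) \<le>
         ennreal K * (\<integral>\<^sup>+x. indicator (p ` ball y \<delta>) x * ennreal ((f x)\<^sup>2 * w x) \<partial>\<mu>) +
         ennreal K * (\<integral>\<^sup>+x. ennreal (excess (1/4) f x * w x) \<partial>\<mu>)"
        by (rule mass_propagation[OF c(1) \<epsilon>(2,1) y(1) \<delta>(1,2)]) blast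
      have "r (p ` ball a \<delta>) k \<le> ennreal K * r (p ` ball y \<delta>) k + ennreal K * s k" for k
      proof -
        have "r (p ` ball a \<delta>) k \<le> (ennreal K * (\<integral>\<^sup>+x. indicator (p ` ball y \<delta>) x * ennreal ((f k x)\<^sup>2 * w x) \<partial>\<mu>) +
         ennreal K * (\<integral>\<^sup>+x. ennreal (excess (1/4) (f k) x * w x) \<partial>\<mu>)) / ennreal (mass (f k))"
          unfolding r_def by (rule divide_right_mono_ennreal[OF K[OF fC]])
        then show ?thesis by (simp add: r_def s_def add_divide_distrib_ennreal ennreal_times_divide)
      qed
      moreover have "(\<lambda>k. ennreal K * r (p ` ball y \<delta>) k + ennreal K * s k) \<longlonglongrightarrow> ennreal K * 0 + ennreal K * 0"
        by (intro tendsto_add ennreal_tendsto_cmult ry s0) auto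
      ultimately have "r (p ` ball a \<delta>) \<longlonglongrightarrow> 0"
        by (intro tendsto_sandwich[of "\<lambda>_. 0" "r (p ` ball a \<delta>)" sequentially "\<lambda>k. ennreal K * r (p ` ball y \<delta>) k + ennreal K * s k"]) auto
      moreover have "open (p ` ball a \<delta>)"
        using sub \<delta>(2) by (intro open_chart_image[OF c(1) open_ball]) (auto simp: subset_eq)
      moreover have "z \<in> p ` ball a \<delta>" using c \<delta> by auto
      ultimately show ?thesis unfolding G_def by blast
    qed
    then show ?thesis using closure_subset_eq by blast
  qed
  have "G = UNIV"
    using connected_UNIV Gopen Gclosed xG connected_clopen[of "UNIV :: 'm set"] by auto
  \<comment> \<open>By the confinement estimate the relative mass outside |x|^2 \<le> R is at most
    (16 / R) (L + 2), which this choice makes equal to 1/2.\<close>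
  define R where "R = 32 * (L + 2)"
  have L0: "L \<ge> 0" using H2_inf_nonneg by (simp add: L_def)
  then have R: "R > 0" by (simp add: R_def)
  let ?K = "F -` cball 0 (sqrt R)"
  have Kc: "compact ?K" by (rule compact_preimage) simp
  have "\<forall>z. \<exists>W. open W \<and> z \<in> W \<and> r W \<longlonglongrightarrow> 0"
  proof
    fix z
    have "z \<in> G" unfolding \<open>G = UNIV\<close> by (rule UNIV_I)
    then show "\<exists>W. open W \<and> z \<in> W \<and> r W \<longlonglongrightarrow> 0" by (simp only: G_def mem_Collect_eq)
  qed
  from choice[OF this] obtain W where W: "\<And>z. open (W z)" "\<And>z. z \<in> W z" "\<And>z. r (W z) \<longlonglongrightarrow> 0"
    by blast
  obtain D where D: "D \<subseteq> ?K" "finite D" "?K \<subseteq> (\<Union>z\<in>D. W z)"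
  proof (rule compactE_image[OF Kc, of ?K W])
    show "?K \<subseteq> (\<Union>z\<in>?K. W z)" using W(2) by blast
    show "open (W z)" for z by (rule W(1))
    show thesis if "D \<subseteq> ?K" "finite D" "?K \<subseteq> (\<Union>z\<in>D. W z)" for D
      by (rule \<open>\<And>D. D \<subseteq> ?K \<Longrightarrow> finite D \<Longrightarrow> ?K \<subseteq> (\<Union>z\<in>D. W z) \<Longrightarrow> thesis\<close>) (fact that)+
  qed
  have mm: "(\<lambda>x. indicator V x * ennreal ((f k x)\<^sup>2 * w x)) \<in> borel_measurable borel" if "V \<in> sets borel" for V k
    using that borel_measurable_continuous_onI[OF fcont[of k]] borel_measurable_continuous_onI[OF continuous_w]
    by simp
  have rK: "r ?K k \<le> (\<Sum>z\<in>D. r (W z) k)" for k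
  proof -
    have "(\<integral>\<^sup>+x. indicator ?K x * ennreal ((f k x)\<^sup>2 * w x) \<partial>\<mu>) \<le>
       (\<integral>\<^sup>+x. (\<Sum>z\<in>D. indicator (W z) x * ennreal ((f k x)\<^sup>2 * w x)) \<partial>\<mu>)"
    proof (rule nn_integral_mono)
      fix y
      show "indicator ?K y * ennreal ((f k y)\<^sup>2 * w y) \<le> (\<Sum>z\<in>D. indicator (W z) y * ennreal ((f k y)\<^sup>2 * w y))"
      proof (cases "y \<in> ?K")
        case True
        then obtain z where "z \<in> D" "y \<in> W z" using D(3) by blast
        then have "indicator ?K y * ennreal ((f k y)\<^sup>2 * w y) \<le> indicator (W z) y * ennreal ((f k y)\<^sup>2 * w y)"
          by (simp add: indicator_def)
        also have "\<dots> \<le> (\<Sum>z\<in>D. indicator (W z) y * ennreal ((f k y)\<^sup>2 * w y))"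
          using \<open>z \<in> D\<close> D(2) by (intro member_le_sum) auto
        finally show ?thesis .
      qed simp
    qed
    also have "\<dots> = (\<Sum>z\<in>D. \<integral>\<^sup>+x. indicator (W z) x * ennreal ((f k x)\<^sup>2 * w x) \<partial>\<mu>)"
      using W(1) by (intro nn_integral_sum) (simp add: mm)
    finally have "r ?K k \<le> (\<Sum>z\<in>D. \<integral>\<^sup>+x. indicator (W z) x * ennreal ((f k x)\<^sup>2 * w x) \<partial>\<mu>) / ennreal (mass (f k))"
      unfolding r_def by (rule divide_right_mono_ennreal)
    also have "\<dots> = (\<Sum>z\<in>D. r (W z) k)"
      unfolding r_def by (simp add: divide_ennreal_def sum_distrib_right)
    finally show ?thesis .
  qed
  have "(\<lambda>k. \<Sum>z\<in>D. r (W z) k) \<longlonglongrightarrow> (\<Sum>z\<in>D. 0)" by (intro tendsto_sum W(3))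
  then have "r ?K \<longlonglongrightarrow> 0"
    using rK by (intro tendsto_sandwich[of "\<lambda>_. 0" "r ?K" sequentially "\<lambda>k. \<Sum>z\<in>D. r (W z) k"]) auto
  then have "\<forall>\<^sub>F k in sequentially. r ?K k < ennreal (1/2)"
  proof (rule order_tendstoD(2))
    show "(0::ennreal) < ennreal (1/2)"
      using ennreal_less_iff[of 0 "1/2"] by (simp only: ennreal_0 order_refl zero_less_divide_1_iff zero_less_numeral simp_thms)
  qed
  then obtain k where k: "r ?K k < ennreal (1/2)"
    using eventually_sequentially by auto
  have out: "r (- ?K) k \<le> ennreal (1/2)"
  proof -
    have "(\<integral>\<^sup>+x. indicator (- ?K) x * ennreal ((f k x)\<^sup>2 * w x) \<partial>\<mu>) \<le>
        (\<integral>\<^sup>+x. ennreal ((1 / R * (norm (F x))\<^sup>2) * (f k x)\<^sup>2 * w x) \<partial>\<mu>)"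
    proof (rule nn_integral_mono)
      fix z
      have "1 * ((f k z)\<^sup>2 * w z) \<le> (1 / R * (norm (F z))\<^sup>2) * ((f k z)\<^sup>2 * w z)" if "z \<in> - ?K"
      proof (rule mult_right_mono)
        have "sqrt R < norm (F z)" using that by simp
        then have "(sqrt R)\<^sup>2 < (norm (F z))\<^sup>2" using R by (intro power_strict_mono) auto
        then have "R < (norm (F z))\<^sup>2" using R by simp
        then show "1 \<le> 1 / R * (norm (F z))\<^sup>2" using R by (simp add: field_simps)
      qed simp
      then show "indicator (- ?K) z * ennreal ((f k z)\<^sup>2 * w z) \<le> ennreal ((1 / R * (norm (F z))\<^sup>2) * (f k z)\<^sup>2 * w z)"
        by (cases "z \<in> - ?K") (auto intro!: ennreal_leI simp: mult.assoc)
    qed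
    also have "\<dots> = ennreal (\<integral>x. (1 / R * (norm (F x))\<^sup>2) * (f k x)\<^sup>2 * w x \<partial>\<mu>)"
      using R by (intro test_nn_integral[OF f(1)]) (auto intro!: continuous_intros continuous_F)
    also have "\<dots> \<le> ennreal (1/2 * mass (f k))"
    proof (rule ennreal_leI)
      have "(\<integral>x. (1 / R * (norm (F x))\<^sup>2) * (f k x)\<^sup>2 * w x \<partial>\<mu>) = (\<integral>x. 16 / R * ((norm (F x))\<^sup>2 / 16 * (f k x)\<^sup>2 * w x) \<partial>\<mu>)"
        by (intro Bochner_Integration.integral_cong) auto
      also have "\<dots> = 16 / R * (\<integral>x. (norm (F x))\<^sup>2 / 16 * (f k x)\<^sup>2 * w x \<partial>\<mu>)"
        by (rule integral_mult_right_zero)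
      also have "\<dots> \<le> 16 / R * energy (f k)"
        using energy_confinement[OF f(1)] R by (intro mult_left_mono) auto
      also have "\<dots> \<le> 16 / R * ((L + 2) * mass (f k))"
      proof (intro mult_left_mono order_trans[OF less_imp_le[OF fe]] mult_right_mono)
        have "inverse (real (Suc k)) \<le> 1" by (simp add: field_simps)
        then show "L + inverse (real (Suc k)) \<le> L + 2" by simp
      qed (use R f(2)[of k] in auto)
      also have "\<dots> = 1/2 * mass (f k)" using L0 by (simp add: R_def field_simps)
      finally show "(\<integral>x. (1 / R * (norm (F x))\<^sup>2) * (f k x)\<^sup>2 * w x \<partial>\<mu>) \<le> 1/2 * mass (f k)" .
    qed
    finally have "r (- ?K) k \<le> ennreal (1/2 * mass (f k)) / ennreal (mass (f k))"
      unfolding r_def by (rule divide_right_mono_ennreal)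
    also have "\<dots> = ennreal (1/2)" using f(2)[of k] by (subst div) auto
    finally show ?thesis .
  qed
  have Kb: "?K \<in> sets borel" using compact_imp_closed[OF Kc] by simp
  \<comment> \<open>The relative masses inside and outside add up to 1, although one is below 1/2
    and the other at most 1/2.\<close>
  have "(1::ennreal) = r UNIV k"
  proof -
    have "(\<integral>\<^sup>+x. indicator UNIV x * ennreal ((f k x)\<^sup>2 * w x) \<partial>\<mu>) = ennreal (mass (f k))"
      using test_nn_integral[OF f(1), of "\<lambda>_. 1"] by (simp add: weighted_integral_def)
    then show ?thesis unfolding r_def using f(2)[of k] by (simp add: div)
  qed
  also have "r UNIV k = r ?K k + r (- ?K) k"
  proof -
    have "(\<integral>\<^sup>+x. indicator UNIV x * ennreal ((f k x)\<^sup>2 * w x) \<partial>\<mu>) =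
       (\<integral>\<^sup>+x. indicator ?K x * ennreal ((f k x)\<^sup>2 * w x) + indicator (- ?K) x * ennreal ((f k x)\<^sup>2 * w x) \<partial>\<mu>)"
      by (intro nn_integral_cong) (auto simp: indicator_def)
    also have "\<dots> = (\<integral>\<^sup>+x. indicator ?K x * ennreal ((f k x)\<^sup>2 * w x) \<partial>\<mu>) + (\<integral>\<^sup>+x. indicator (- ?K) x * ennreal ((f k x)\<^sup>2 * w x) \<partial>\<mu>)"
      using Kb by (intro nn_integral_add) (simp_all add: mm)
    finally show ?thesis unfolding r_def by (simp add: add_divide_distrib_ennreal)
  qed
  finally have sum1: "1 = r ?K k + r (- ?K) k" .
  obtain a where a: "r ?K k = ennreal a" "0 \<le> a" using k by (cases "r ?K k") auto
  obtain b where b: "r (- ?K) k = ennreal b" "0 \<le> b" using out by (cases "r (- ?K) k") (auto simp: top_unique)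
  have "a < 1/2" using k unfolding a(1) by (simp only: ennreal_less_iff[OF a(2)])
  moreover have "b \<le> 1/2" using out unfolding b(1) by (subst (asm) ennreal_le_iff) auto
  moreover have "ennreal 1 = ennreal (a + b)" using sum1 a b by simp
  then have "1 = a + b" using a b by (subst (asm) ennreal_inj) auto
  ultimately show False by linarith
qed

end

section \<open>The minimum of the distance to the origin and the vanishing of the mean
  curvature\<close>

context proper_expander
begin

lemma ex_min_norm: "\<exists>x. \<forall>y. norm (F x) \<le> norm (F y)"
proof -
  obtain y0 :: 'm where True by simp
  let ?K = "F -` cball 0 (norm (F y0))"
  have "compact ?K" by (rule compact_preimage) simp
  moreover have "?K \<noteq> {}" by (auto intro!: exI[of _ y0])
  moreover have "continuous_on ?K (\<lambda>x. norm (F x))"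
    by (intro continuous_intros continuous_on_subset[OF continuous_F]) auto
  ultimately obtain x where x: "x \<in> ?K" "\<forall>y\<in>?K. norm (F x) \<le> norm (F y)"
    using continuous_attains_inf by metis
  have "norm (F x) \<le> norm (F y)" for y
  proof (cases "y \<in> ?K")
    case False
    moreover have "norm (F x) \<le> norm (F y0)" using x(1) by simp
    ultimately show ?thesis by simp
  qed (use x(2) in blast)
  then show ?thesis by blast
qed

text \<open>
  If \<open>\<sigma>\<close> is constant, \<open>k = |x|\<^sup>2 - \<sigma>\<close> satisfies \<open>|\<nabla>k|\<^sup>2 = 4 k\<close>. Differentiating this twice at a minimum of \<open>|x|\<close>
  shows that half the Hessian of \<open>k\<close> has eigenvalues in \<open>{0, 1}\<close> there, while its trace is \<open>n + \<sigma> / 2\<close>.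
\<close>

theorem constant_\<sigma>_eq_0:
  assumes const: "\<And>x y. \<sigma> x = \<sigma> y"
  shows "\<sigma> x = 0"
proof -
  obtain x0 where x0: "\<And>y. norm (F x0) \<le> norm (F y)" using ex_min_norm by blast
  obtain U p u where c: "(U, p) \<in> A" "u \<in> U" and pu: "p u = x0" by (rule chart_cover)
  note o = chart(1)[OF c(1)]
  interpret L: linear "dF p u" by (rule linear_dF[OF c])
  let ?X = "\<lambda>u. F (p u)" and ?E = "frame U p"
  obtain e :: "'n \<Rightarrow> real^'n" where e: "\<And>a b. dF p u (e a) \<bullet> dF p u (e b) = (if a = b then 1 else 0)"
    and mcv: "\<And>y. y \<in> (tangent_space A F (p u))\<^sup>\<bottom> \<Longrightarrow>
       mean_curvature_vector A F (p u) \<bullet> y = (\<Sum>a\<in>UNIV. hess p u (e a) (e a) \<bullet> y)"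
    by (rule mean_curvature_vector_chart[OF c]) blast
  have X: "(?X has_derivative dF p v) (at v)" if "v \<in> U" for v
    using Ck_on_SucD(1)[OF Ck_F[OF c(1)] that] .
  have sq: "((\<lambda>v. ?X v \<bullet> ?X v) has_derivative (\<lambda>h. 2 * (?X v \<bullet> dF p v h))) (at v)" if "v \<in> U" for v
    by (rule has_derivative_eq_rhs[OF has_derivative_inner[OF X[OF that] X[OF that]]])
      (simp add: inner_commute[of "dF p v _"] fun_eq_iff)
  have "(\<lambda>h. 2 * (?X u \<bullet> dF p u h)) = (\<lambda>h. 0)"
  proof (rule has_derivative_local_min[OF sq[OF c(2)]])
    have "?X u \<bullet> ?X u \<le> ?X v \<bullet> ?X v" for v
      using x0[of "p v"] pu by (simp add: norm_le)
    then show "\<forall>\<^sub>F v in at u. ?X u \<bullet> ?X u \<le> ?X v \<bullet> ?X v" by simp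
  qed
  then have crit: "?X u \<bullet> dF p u h = 0" for h by (metis mult_eq_0_iff zero_neq_numeral)
  \<comment> \<open>The components of x^T in the frame: |x|^2 - \<open>\<sigma>\<close> is the sum
    of their squares, and all of them vanish at the minimum.\<close>
  define \<psi> where "\<psi> a v = ?X v \<bullet> dF p v (?E a v)" for a v
  have \<psi>C: "Ck_on k U (\<psi> a)" for k a
    unfolding \<psi>_def by (intro Ck_on_inner o Ck_F[OF c(1)] Ck_on_frechet[OF o Ck_F[OF c(1)] Ck_frame[OF c(1)]])
  have \<psi>d: "(\<psi> a has_derivative frechet_derivative (\<psi> a) (at v)) (at v)" if "v \<in> U" for v a
    using Ck_on_SucD(1)[OF \<psi>C that] .
  have \<psi>0: "\<psi> a u = 0" for a by (simp add: \<psi>_def crit)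
  have \<psi>': "frechet_derivative (\<psi> a) (at u) h = dF p u h \<bullet> dF p u (?E a u) + ?X u \<bullet> hess p u (?E a u) h" for a h
  proof -
    have "(?E a has_derivative frechet_derivative (?E a) (at u)) (at u)"
      using Ck_on_SucD(1)[OF Ck_frame[OF c(1)] c(2)] .
    from has_derivative_inner[OF X[OF c(2)] has_derivative_dF_apply[OF c this]]
    have "(\<psi> a has_derivative (\<lambda>h. ?X u \<bullet> (hess p u (?E a u) h + dF p u (frechet_derivative (?E a) (at u) h)) +
        dF p u h \<bullet> dF p u (?E a u))) (at u)"
      unfolding \<psi>_def[abs_def] .
    then show ?thesis by (simp add: frechet_derivative_eqI inner_add_right crit)
  qed
  have k: "?X v \<bullet> ?X v = (\<Sum>a\<in>UNIV. (\<psi> a v)\<^sup>2) + \<sigma> x" if "v \<in> U" for v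
    using norm_F_sq[OF c(1) that frame_orthonormal[OF c(1) that]] const[of "p v" x]
    by (simp add: \<psi>_def power2_norm_eq_inner)
  have first: "?X v \<bullet> dF p v h = (\<Sum>a\<in>UNIV. \<psi> a v * frechet_derivative (\<psi> a) (at v) h)" if v: "v \<in> U" for v h
  proof -
    have "((\<lambda>v. (\<Sum>a\<in>UNIV. \<psi> a v * \<psi> a v) + \<sigma> x) has_derivative
        (\<lambda>h. (\<Sum>a\<in>UNIV. \<psi> a v * frechet_derivative (\<psi> a) (at v) h + frechet_derivative (\<psi> a) (at v) h * \<psi> a v) + 0)) (at v)"
      by (intro has_derivative_add has_derivative_sum has_derivative_mult \<psi>d[OF v] has_derivative_const)
    then have "((\<lambda>v. ?X v \<bullet> ?X v) has_derivative
        (\<lambda>h. (\<Sum>a\<in>UNIV. \<psi> a v * frechet_derivative (\<psi> a) (at v) h + frechet_derivative (\<psi> a) (at v) h * \<psi> a v) + 0)) (at v)"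
      by (rule has_derivative_transform_within_open[OF _ o v]) (simp add: k power2_eq_square)
    from fun_cong[OF has_derivative_unique[OF sq[OF v] this], of h] show ?thesis
      by (simp add: sum.distrib mult.commute flip: sum_distrib_left)
  qed
  define b where "b v h = dF p u v \<bullet> dF p u h + ?X u \<bullet> hess p u v h" for v h
  \<comment> \<open>Here \<open>b\<close> is half the Hessian of |x|^2. Differentiating
    \<open>first\<close> once more at u, where every \<open>\<psi> a\<close> is zero, removes the
    second derivatives of \<open>\<psi>\<close> and leaves products of first derivatives.\<close>
  have second: "b (e c) (e c) = (\<Sum>a\<in>UNIV. (frechet_derivative (\<psi> a) (at u) (e c))\<^sup>2)" for c
  proof -
    have dFe: "((\<lambda>v. dF p v (e c)) has_derivative hess p u (e c)) (at u)"
      unfolding hess_def using Ck_on_SucD(1)[OF Ck_on_SucD(2)[OF Ck_F[OF \<open>(U, p) \<in> A\<close>]] \<open>u \<in> U\<close>] .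
    have \<psi>2: "((\<lambda>v. frechet_derivative (\<psi> a) (at v) (e c)) has_derivative
        frechet_derivative (\<lambda>v. frechet_derivative (\<psi> a) (at v) (e c)) (at u)) (at u)" for a
      using Ck_on_SucD(1)[OF Ck_on_SucD(2)[OF \<psi>C] \<open>u \<in> U\<close>] .
    have "((\<lambda>v. ?X v \<bullet> dF p v (e c)) has_derivative (\<lambda>h. ?X u \<bullet> hess p u (e c) h + dF p u h \<bullet> dF p u (e c))) (at u)"
      by (intro has_derivative_inner X dFe \<open>u \<in> U\<close>)
    moreover have "((\<lambda>v. \<Sum>a\<in>UNIV. \<psi> a v * frechet_derivative (\<psi> a) (at v) (e c)) has_derivative
      (\<lambda>h. \<Sum>a\<in>UNIV. \<psi> a u * frechet_derivative (\<lambda>v. frechet_derivative (\<psi> a) (at v) (e c)) (at u) h +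
         frechet_derivative (\<psi> a) (at u) h * frechet_derivative (\<psi> a) (at u) (e c))) (at u)"
      by (intro has_derivative_sum has_derivative_mult \<psi>d \<psi>2 \<open>u \<in> U\<close>)
    then have "((\<lambda>v. ?X v \<bullet> dF p v (e c)) has_derivative
      (\<lambda>h. \<Sum>a\<in>UNIV. \<psi> a u * frechet_derivative (\<lambda>v. frechet_derivative (\<psi> a) (at v) (e c)) (at u) h +
         frechet_derivative (\<psi> a) (at u) h * frechet_derivative (\<psi> a) (at u) (e c))) (at u)"
      by (rule has_derivative_transform_within_open[OF _ o \<open>u \<in> U\<close>]) (simp add: first)
    ultimately have "(\<lambda>h. ?X u \<bullet> hess p u (e c) h + dF p u h \<bullet> dF p u (e c)) =
      (\<lambda>h. \<Sum>a\<in>UNIV. \<psi> a u * frechet_derivative (\<lambda>v. frechet_derivative (\<psi> a) (at v) (e c)) (at u) h +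
         frechet_derivative (\<psi> a) (at u) h * frechet_derivative (\<psi> a) (at u) (e c))"
      by (rule has_derivative_unique)
    from fun_cong[OF this, of "e c"] show ?thesis
      by (simp add: b_def \<psi>0 power2_eq_square add.commute)
  qed
  have le1: "b (e c) (e c) \<le> 1" for c
  proof -
    let ?g = "\<lambda>a. dF p u (e c) \<bullet> dF p u (?E a u)"
    have ec: "e c = (\<Sum>a\<in>UNIV. ?g a *\<^sub>R ?E a u)"
      by (rule orthonormal_expansion[OF linear_dF[OF \<open>(U, p) \<in> A\<close> \<open>u \<in> U\<close>] frame_orthonormal[OF \<open>(U, p) \<in> A\<close> \<open>u \<in> U\<close>]])
    have hl: "hess p u (\<Sum>a\<in>UNIV. g a *\<^sub>R ?E a u) h = (\<Sum>a\<in>UNIV. g a *\<^sub>R hess p u (?E a u) h)" for g h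
    proof -
      have "linear (hess p u h)"
        unfolding hess_def using Ck_on_SucD(1)[OF Ck_on_SucD(2)[OF Ck_F[OF \<open>(U, p) \<in> A\<close>]] \<open>u \<in> U\<close>] has_derivative_linear by blast
      then interpret H: linear "hess p u h" .
      show ?thesis
        unfolding hess_commute[OF \<open>(U, p) \<in> A\<close> \<open>u \<in> U\<close>, of _ h] by (simp add: H.sum H.scale)
    qed
    have "b (e c) (e c) = b (\<Sum>a\<in>UNIV. ?g a *\<^sub>R ?E a u) (e c)" using ec by simp
    also have "\<dots> = (\<Sum>a\<in>UNIV. ?g a * frechet_derivative (\<psi> a) (at u) (e c))"
      unfolding b_def hl \<psi>' by (simp add: L.sum L.scale inner_sum_left inner_sum_right algebra_simps sum.distrib inner_commute)
    \<comment> \<open>The first derivatives of \<open>\<psi>\<close> are themselves the entries of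
      \<open>b\<close> against the frame, so the Cauchy-Schwarz inequality for the unit vector e c
      yields b^2 \<le> b on the diagonal, hence b \<le> 1.\<close>
    finally have "(b (e c) (e c))\<^sup>2 \<le> (\<Sum>a\<in>UNIV. (?g a)\<^sup>2) * (\<Sum>a\<in>UNIV. (frechet_derivative (\<psi> a) (at u) (e c))\<^sup>2)"
      using Cauchy_Schwarz_ineq_sum[of ?g "\<lambda>a. frechet_derivative (\<psi> a) (at u) (e c)" UNIV] by simp
    also have "(\<Sum>a\<in>UNIV. (?g a)\<^sup>2) = 1"
      using orthonormal_decomposition(2)[where L = "dF p u" and e = "\<lambda>a. ?E a u", OF dimension
          frame_orthonormal[OF \<open>(U, p) \<in> A\<close> \<open>u \<in> U\<close>] N_dF[OF \<open>(U, p) \<in> A\<close> \<open>u \<in> U\<close>] norm_N, of "dF p u (e c)"]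
        N_dF[OF \<open>(U, p) \<in> A\<close> \<open>u \<in> U\<close>, of "e c"] e[of c c] by (simp add: inner_commute)
    finally have "(b (e c) (e c))\<^sup>2 \<le> b (e c) (e c)" using second by simp
    then show ?thesis
      by (cases "b (e c) (e c) > 0") (auto simp: power2_eq_square)
  qed
  have "?X u \<in> (tangent_space A F (p u))\<^sup>\<bottom>"
    using crit orthogonal_tangent_iff[OF c] by blast
  then have "mean_curvature_vector A F (p u) \<bullet> ?X u = (\<Sum>a\<in>UNIV. hess p u (e a) (e a) \<bullet> ?X u)" by (rule mcv)
  moreover have "mean_curvature_vector A F (p u) \<bullet> ?X u = \<sigma> (p u) / 2"
    by (simp add: mean_curvature_vector_eq \<sigma>_def power2_eq_square inner_commute)
  ultimately have "(\<Sum>a\<in>UNIV. b (e a) (e a)) = real CARD('n) + \<sigma> (p u) / 2"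
    by (simp add: b_def e sum.distrib inner_commute)
  moreover have "(\<Sum>a\<in>UNIV. b (e a) (e a)) \<le> (\<Sum>a\<in>(UNIV::'n set). 1)"
    by (intro sum_mono le1)
  ultimately have "\<sigma> (p u) \<le> 0" by simp
  then show ?thesis using const[of x "p u"] \<sigma>_nonneg[of x] by simp
qed

end

section \<open>Rigidity: a properly immersed cone is a hyperplane\<close>

text \<open>Euler's relation says that f (s v) / s has derivative zero in s. Convexity keeps the
  points s v between t v and v inside V; t = 0 is treated separately since the quotient is singular
  there.\<close>

lemma euler_homogeneous:
  fixes f :: "'a::real_normed_vector \<Rightarrow> 'b::real_normed_vector"
  assumes V: "convex V" and der: "\<And>v. v \<in> V \<Longrightarrow> (f has_derivative D v) (at v)"
    and euler: "\<And>v. v \<in> V \<Longrightarrow> f v = D v v"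
    and v: "v \<in> V" "t *\<^sub>R v \<in> V" "0 \<le> t"
  shows "f (t *\<^sub>R v) = t *\<^sub>R f v"
proof (cases "t = 0")
  case True
  then show ?thesis using euler[OF v(2)] linear_0[OF has_derivative_linear[OF der[OF v(2)]]] by simp
next
  case False
  then have t: "t > 0" using v(3) by simp
  let ?I = "closed_segment t 1"
  have seg: "s *\<^sub>R v \<in> V \<and> s > 0" if s: "s \<in> ?I" for s
  proof -
    obtain r where r: "0 \<le> r" "r \<le> 1" "s = (1 - r) * t + r * 1"
      using s by (auto simp: closed_segment_def)
    have "s *\<^sub>R v = (1 - r) *\<^sub>R (t *\<^sub>R v) + r *\<^sub>R v" by (simp add: r algebra_simps)
    moreover have "s > 0"
      using r t by (cases "r = 1") (auto intro!: add_pos_nonneg)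
    ultimately show ?thesis using convexD_alt[OF V v(2,1) r(1,2)] by simp
  qed
  have "((\<lambda>s. inverse s *\<^sub>R f (s *\<^sub>R v)) has_derivative (\<lambda>h. 0)) (at s within ?I)" if "s \<in> ?I" for s
  proof -
    have sV: "s *\<^sub>R v \<in> V" "s > 0" using seg[OF that] by auto
    interpret D: linear "D (s *\<^sub>R v)" by (rule has_derivative_linear[OF der[OF sV(1)]])
    have "((\<lambda>s. s *\<^sub>R v) has_derivative (\<lambda>h. h *\<^sub>R v)) (at s)"
      by (auto intro!: derivative_eq_intros)
    from diff_chain_at[OF this der[OF sV(1)]]
    have 1: "((\<lambda>s. f (s *\<^sub>R v)) has_derivative (\<lambda>h. h *\<^sub>R D (s *\<^sub>R v) v)) (at s)"
      by (simp add: comp_def D.scale)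
    have 2: "(inverse has_derivative (\<lambda>h. - (inverse s * inverse s) * h)) (at s)"
      using sV by (intro has_derivative_real_mult) (auto intro!: derivative_eq_intros)
    have "((\<lambda>s. inverse s *\<^sub>R f (s *\<^sub>R v)) has_derivative (\<lambda>h. 0)) (at s)"
    proof (rule has_derivative_eq_rhs[OF has_derivative_scaleR[OF 2 1]], rule ext)
      fix h
      have "f (s *\<^sub>R v) = s *\<^sub>R D (s *\<^sub>R v) v" using euler[OF sV(1)] by (simp add: D.scale)
      then show "inverse s *\<^sub>R h *\<^sub>R D (s *\<^sub>R v) v + (- (inverse s * inverse s) * h) *\<^sub>R f (s *\<^sub>R v) = 0"
        using sV(2) by simp
    qed
    then show ?thesis by (rule has_derivative_at_withinI)
  qed
  then have "inverse t *\<^sub>R f (t *\<^sub>R v) = inverse 1 *\<^sub>R f (1 *\<^sub>R v)"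
    by (intro has_derivative_zero_unique[of ?I "\<lambda>s. inverse s *\<^sub>R f (s *\<^sub>R v)" t 1]) auto
  then have "t *\<^sub>R inverse t *\<^sub>R f (t *\<^sub>R v) = t *\<^sub>R f v" by simp
  then show ?thesis using t by simp
qed

context expander
begin

text \<open>
  A local section over a ball of the tangent plane; \<open>\<pi>\<close> is the orthogonal projection to the tangent plane
  at \<open>y\<close>, in orthonormal coordinates.
\<close>

definition cone_section :: "'m \<Rightarrow> (real^'k \<Rightarrow> real^'n) \<Rightarrow> 'm set \<Rightarrow> (real^'n) set \<Rightarrow> (real^'n \<Rightarrow> 'm) \<Rightarrow> bool" where
  "cone_section y \<pi> W V s \<longleftrightarrow> linear \<pi> \<and> open W \<and> y \<in> W \<and> open V \<and> convex V \<and> continuous_on V s \<and>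
    (\<forall>z\<in>W. \<pi> (F z) \<in> V \<and> s (\<pi> (F z)) = z) \<and> (\<forall>v\<in>V. s v \<in> W \<and> \<pi> (F (s v)) = v) \<and>
    (\<forall>v t. v \<in> V \<longrightarrow> t *\<^sub>R v \<in> V \<longrightarrow> 0 \<le> t \<longrightarrow> F (s (t *\<^sub>R v)) = t *\<^sub>R F (s v)) \<and>
    (\<exists>D. ((\<lambda>v. F (s v)) has_derivative D) (at (\<pi> (F y))) \<and> (\<forall>v. D v \<in> tangent_space A F y)) \<and>
    (\<forall>z. z \<bullet> N y = 0 \<longrightarrow> \<pi> z = 0 \<longrightarrow> z = 0)"

text \<open>The inverse function theorem makes the projection to the tangent plane at y a local
  coordinate. Since x is tangential, in this coordinate x^T is the radial field, so F satisfies
  Euler's relation and is homogeneous along rays.\<close>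

lemma ex_cone_section:
  assumes tangential: "\<And>x. \<sigma> x = 0"
  shows "\<exists>\<pi> W V s. cone_section y \<pi> W V s"
proof -
  obtain U p u where c: "(U, p) \<in> A" "u \<in> U" and pu: "p u = y" by (rule chart_cover)
  note o = chart(1)[OF c(1)]
  let ?e = "\<lambda>a. frame U p a u"
  define \<pi> where "\<pi> z = (\<chi> a. z \<bullet> dF p u (?e a))" for z :: "real^'k"
  have lin\<pi>: "linear \<pi>"
    by (rule linearI) (auto simp: \<pi>_def vec_eq_iff inner_add_left)
  have bl\<pi>: "bounded_linear \<pi>" using lin\<pi> linear_conv_bounded_linear by blast
  define \<psi> where "\<psi> v = \<pi> (F (p v))" for v
  have \<psi>C: "Ck_on k U \<psi>" for k
    unfolding \<psi>_def by (intro Ck_on_linear_compose[OF o bl\<pi>] Ck_F[OF c(1)])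
  have \<psi>d: "(\<psi> has_derivative frechet_derivative \<psi> (at v)) (at v)" if "v \<in> U" for v
    using Ck_on_SucD(1)[OF \<psi>C that] .
  have \<psi>D: "frechet_derivative \<psi> (at v) h = \<pi> (dF p v h)" if "v \<in> U" for v h
    using frechet_derivative_eqI[OF bounded_linear.has_derivative[OF bl\<pi> Ck_on_SucD(1)[OF Ck_F[OF c(1)] that]]]
    by (simp add: \<psi>_def[abs_def])
  let ?f' = "\<lambda>v. Blinfun (frechet_derivative \<psi> (at v))"
  have f': "blinfun_apply (?f' v) = frechet_derivative \<psi> (at v)" if "v \<in> U" for v
    using has_derivative_bounded_linear[OF \<psi>d[OF that]] by (rule bounded_linear_Blinfun_apply)
  have cont: "continuous_on U ?f'"
  proof (rule continuous_on_blinfun_componentwise)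
    fix i :: "real^'n" assume "i \<in> Basis"
    have "continuous_on U (\<lambda>v. frechet_derivative \<psi> (at v) i)"
      using Ck_on_imp_continuous_on[OF Ck_on_SucD(2)[OF \<psi>C]] .
    then show "continuous_on U (\<lambda>v. blinfun_apply (?f' v) i)"
      by (rule continuous_on_eq) (simp add: f')
  qed
  \<comment> \<open>The projection has derivative h \<mapsto> (dF h . dF (e a))_a at u, which this
    map inverts by the frame expansion.\<close>
  let ?inv = "Blinfun (\<lambda>v. \<Sum>a\<in>UNIV. (v $ a) *\<^sub>R ?e a)"
  have "bounded_linear (\<lambda>v. \<Sum>a\<in>UNIV. (v $ a) *\<^sub>R ?e a)"
    by (intro bounded_linear_sum bounded_linear_scaleR_left[THEN bounded_linear_compose] bounded_linear_vec_nth)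
  then have inv: "blinfun_apply ?inv v = (\<Sum>a\<in>UNIV. (v $ a) *\<^sub>R ?e a)" for v
    by (simp add: bounded_linear_Blinfun_apply)
  have invf: "?inv o\<^sub>L ?f' u = id_blinfun"
  proof (rule blinfun_eqI)
    fix h
    show "blinfun_apply (?inv o\<^sub>L ?f' u) h = blinfun_apply id_blinfun h"
      using orthonormal_expansion[OF linear_dF[OF c] frame_orthonormal[OF c], of h]
      by (simp add: f'[OF c(2)] inv \<psi>D[OF c(2)] \<pi>_def)
  qed
  obtain U' V' g g' where U': "open U'" "U' \<subseteq> U" "u \<in> U'" and V': "open V'" "\<psi> u \<in> V'"
    and hom: "homeomorphism U' V' \<psi> g" and g': "\<And>v. v \<in> V' \<Longrightarrow> (g has_derivative g' v) (at v)"
    and g'eq: "\<And>v. v \<in> V' \<Longrightarrow> g' v = inv (blinfun_apply (?f' (g v)))"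
    and bij: "\<And>v. v \<in> V' \<Longrightarrow> bij (blinfun_apply (?f' (g v)))"
    by (rule inverse_function_theorem[OF o _ cont c(2) invf, of \<psi>]) (use \<psi>d f' in auto)
  have g\<psi>: "g (\<psi> v) = v" "\<psi> v \<in> V'" if "v \<in> U'" for v using hom that by (auto simp: homeomorphism_def)
  have \<psi>g: "\<psi> (g v) = v" "g v \<in> U'" if "v \<in> V'" for v using hom that by (auto simp: homeomorphism_def)
  obtain \<rho> where \<rho>: "\<rho> > 0" "ball (\<psi> u) \<rho> \<subseteq> V'" using V' open_contains_ball by blast
  let ?V = "ball (\<psi> u) \<rho>"
  let ?B = "U' \<inter> \<psi> -` ?V"
  have "continuous_on U' \<psi>" using hom by (simp add: homeomorphism_def)
  then have "open ?B" using U'(1) by (metis Int_commute continuous_on_open_vimage open_ball)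
  define W where "W = p ` ?B"
  define s where "s v = p (g v)" for v
  have W: "open W" unfolding W_def using \<open>open ?B\<close> U'(2) by (intro open_chart_image[OF c(1)]) auto
  have gc: "continuous_on ?V g"
    using hom \<rho>(2) by (auto simp: homeomorphism_def intro: continuous_on_subset)
  have gU: "g v \<in> U" if "v \<in> V'" for v using \<psi>g that U' by auto
  have "continuous_on ?V s"
    unfolding s_def by (rule continuous_on_compose2[OF chart(5)[OF c(1)] gc]) (use gU \<rho> in auto)
  let ?D = "\<lambda>v h. dF p (g v) (g' v h)"
  have der: "((\<lambda>v. F (s v)) has_derivative ?D v) (at v)" if v: "v \<in> V'" for v
    using diff_chain_at[OF g'[OF v] Ck_on_SucD(1)[OF Ck_F[OF c(1)] gU[OF v]]] by (simp add: s_def comp_def)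
  \<comment> \<open>A tangential position vector is dF h for some h. Its projection is v, so h is
    the image of v under the derivative of the inverse coordinate.\<close>
  have euler: "F (s v) = ?D v v" if v: "v \<in> V'" for v
  proof -
    have f'g: "blinfun_apply (?f' (g v)) h = \<pi> (dF p (g v) h)" for h
      using f'[OF gU[OF v]] \<psi>D[OF gU[OF v]] by simp
    have surj: "blinfun_apply (?f' (g v)) (g' v h) = h" for h
      using g'eq[OF v] bij[OF v] by (simp add: bij_is_surj surj_f_inv_f)
    have "F (s v) \<bullet> N (s v) = 0" using tangential[of "s v"] by (simp add: \<sigma>_def)
    then have "F (s v) = dF p (g v) (local.tangential U p (g v))"
      using dF_tangential[OF c(1) gU[OF v]] by (simp add: s_def)
    then obtain h where h: "F (s v) = dF p (g v) h" by blast
    have "\<pi> (dF p (g v) h) = v" using \<psi>g[OF v] h by (simp add: \<psi>_def s_def)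
    then have "blinfun_apply (?f' (g v)) h = blinfun_apply (?f' (g v)) (g' v v)"
      using f'g surj by simp
    then have "h = g' v v" using bij[OF v] by (simp add: bij_is_inj inj_eq)
    then show ?thesis using h by simp
  qed
  have "cone_section y \<pi> W ?V s"
    unfolding cone_section_def
  proof (intro conjI ballI allI impI)
    show "linear \<pi>" "open W" "continuous_on ?V s" "open ?V" "convex ?V" by fact+ simp_all
    show "y \<in> W" unfolding W_def using U'(3) \<rho>(1) pu by auto
    show "\<pi> (F z) \<in> ?V" if "z \<in> W" for z using that unfolding W_def \<psi>_def by auto
    show "s (\<pi> (F z)) = z" if "z \<in> W" for z
      using that g\<psi> unfolding W_def s_def \<psi>_def by auto
    show "s v \<in> W" if "v \<in> ?V" for v
      unfolding W_def s_def using that \<rho>(2) \<psi>g by auto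
    show "\<pi> (F (s v)) = v" if "v \<in> ?V" for v
      using that \<rho>(2) \<psi>g unfolding s_def \<psi>_def by auto
    show "F (s (t *\<^sub>R v)) = t *\<^sub>R F (s v)" if "v \<in> ?V" "t *\<^sub>R v \<in> ?V" "0 \<le> t" for v t
      by (rule euler_homogeneous[of ?V "\<lambda>v. F (s v)" ?D]) (use that der euler \<rho>(2) in auto)
    have gu: "g (\<psi> u) = u" using g\<psi> U' by simp
    show "\<exists>D. ((\<lambda>v. F (s v)) has_derivative D) (at (\<pi> (F y))) \<and> (\<forall>v. D v \<in> tangent_space A F y)"
      using der[OF V'(2)] tangent_space_chart[OF c] pu gu unfolding \<psi>_def by auto
    show "z = 0" if "z \<bullet> N y = 0" "\<pi> z = 0" for z
    proof (rule orthonormal_complete[where L = "dF p u" and e = ?e, OF dimension frame_orthonormal[OF c] N_dF[OF c] norm_N])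
      show "z \<bullet> dF p u (?e a) = 0" for a using that(2) by (simp add: \<pi>_def vec_eq_iff)
      show "z \<bullet> N (p u) = 0" using that(1) pu by simp
    qed
  qed
  then show ?thesis by blast
qed

end

section \<open>Lifting segments to the origin\<close>

context proper_expander
begin

lemma
  assumes "cone_section y \<pi> W V s"
  shows section_linear: "linear \<pi>" and section_open: "open W" "open V" and section_self: "y \<in> W"
    and section_convex: "convex V" and section_cont: "continuous_on V s"
    and section_proj: "z \<in> W \<Longrightarrow> \<pi> (F z) \<in> V" "z \<in> W \<Longrightarrow> s (\<pi> (F z)) = z"
    and section_sec: "v \<in> V \<Longrightarrow> s v \<in> W" "v \<in> V \<Longrightarrow> \<pi> (F (s v)) = v"
    and section_ray: "v \<in> V \<Longrightarrow> t *\<^sub>R v \<in> V \<Longrightarrow> 0 \<le> t \<Longrightarrow> F (s (t *\<^sub>R v)) = t *\<^sub>R F (s v)"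
  using assms unfolding cone_section_def by auto

text \<open>A lift of the segment from F y towards the origin, run from t = 1 down to t = a. With a
  = 0 it reaches a preimage of the origin.\<close>

definition ray :: "real \<Rightarrow> 'm \<Rightarrow> (real \<Rightarrow> 'm) \<Rightarrow> bool" where
  "ray a y \<gamma> \<longleftrightarrow> continuous_on {a..1} \<gamma> \<and> \<gamma> 1 = y \<and> (\<forall>t\<in>{a..1}. F (\<gamma> t) = t *\<^sub>R F y)"

lemma
  assumes "ray a y \<gamma>"
  shows ray_cont: "continuous_on {a..1} \<gamma>" and ray_1: "\<gamma> 1 = y"
    and ray_F: "t \<in> {a..1} \<Longrightarrow> F (\<gamma> t) = t *\<^sub>R F y"
  using assms unfolding ray_def by blast+

lemma section_inj: "cone_section y \<pi> W V s \<Longrightarrow> z \<in> W \<Longrightarrow> z' \<in> W \<Longrightarrow> F z = F z' \<Longrightarrow> z = z'"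
  using section_proj(2) by metis

text \<open>\<open>F\<close> is locally injective, so lifts of the same path that agree somewhere agree everywhere.\<close>

lemma lift_unique:
  fixes \<gamma> \<gamma>' :: "real \<Rightarrow> 'm"
  assumes sec: "\<And>y. \<exists>\<pi> W V s. cone_section y \<pi> W V s"
    and c: "continuous_on {a..b} \<gamma>" "continuous_on {a..b} \<gamma>'"
    and eq: "\<And>t. t \<in> {a..b} \<Longrightarrow> F (\<gamma> t) = F (\<gamma>' t)"
    and t0: "t0 \<in> {a..b}" "\<gamma> t0 = \<gamma>' t0" and t: "t \<in> {a..b}"
  shows "\<gamma> t = \<gamma>' t"
proof -
  have "\<exists>T. openin (top_of_set {a..b}) T \<and> r \<in> T \<and> (\<forall>x\<in>T. \<forall>y\<in>T. \<gamma> x = \<gamma>' x \<longrightarrow> \<gamma> y = \<gamma>' y)" if r: "r \<in> {a..b}" for r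
  proof (cases "\<gamma> r = \<gamma>' r")
    case True
    obtain \<pi> W V s where S: "cone_section (\<gamma> r) \<pi> W V s" using sec by blast
    let ?T = "({a..b} \<inter> \<gamma> -` W) \<inter> ({a..b} \<inter> \<gamma>' -` W)"
    have "openin (top_of_set {a..b}) ?T"
      using section_open(1)[OF S] c by (intro openin_Int continuous_openin_preimage_gen) auto
    moreover have "r \<in> ?T" using r section_self[OF S] True by auto
    moreover have "\<gamma> y = \<gamma>' y" if "y \<in> ?T" for y
      using that eq section_inj[OF S] by auto
    ultimately show ?thesis by blast
  next
    case False
    then obtain P P' where P: "open P" "open P'" "\<gamma> r \<in> P" "\<gamma>' r \<in> P'" "P \<inter> P' = {}"
      using hausdorff by metis
    let ?T = "({a..b} \<inter> \<gamma> -` P) \<inter> ({a..b} \<inter> \<gamma>' -` P')"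
    have "openin (top_of_set {a..b}) ?T"
      using P c by (intro openin_Int continuous_openin_preimage_gen) auto
    moreover have "r \<in> ?T" using r P by auto
    moreover have "\<gamma> x \<noteq> \<gamma>' x" if "x \<in> ?T" for x
      using that P(5) by auto
    ultimately show ?thesis by blast
  qed
  then show ?thesis
    using connected_induction_simple[of "{a..b}" t0 t "\<lambda>t. \<gamma> t = \<gamma>' t"] t0 t by (auto simp: connected_Icc)
qed

text \<open>Inside a section the lift is forced to be s (t \<pi> (F y)), and homogeneity shows that
  it lies over the segment. Convexity of V means that only the new end needs to be checked.\<close>

lemma ray_extend:
  assumes S: "cone_section z \<pi> W V s" and \<gamma>: "ray a y \<gamma>" "\<gamma> a \<in> W" and a: "0 < a" "a \<le> 1"
    and b: "0 \<le> b" "b \<le> a" "b *\<^sub>R \<pi> (F y) \<in> V"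
  shows "\<exists>\<gamma>'. ray b y \<gamma>' \<and> (\<forall>t\<in>{b..a}. \<gamma>' t = s (t *\<^sub>R \<pi> (F y)))"
proof -
  interpret \<pi>: linear \<pi> by (rule section_linear[OF S])
  have Fa: "F (\<gamma> a) = a *\<^sub>R F y" using a by (intro ray_F[OF \<gamma>(1)]) auto
  have pa: "\<pi> (F (\<gamma> a)) = a *\<^sub>R \<pi> (F y)" by (simp add: Fa \<pi>.scale)
  have inV: "t *\<^sub>R \<pi> (F y) \<in> V" if "t \<in> {b..a}" for t
  proof -
    have aV: "a *\<^sub>R \<pi> (F y) \<in> V" using section_proj(1)[OF S \<gamma>(2)] pa by simp
    have "t \<in> closed_segment b a" using that b by (simp add: closed_segment_eq_real_ivl)
    then obtain r where r: "0 \<le> r" "r \<le> 1" "t = (1 - r) * b + r * a" by (auto simp: closed_segment_def)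
    then have "t *\<^sub>R \<pi> (F y) = (1 - r) *\<^sub>R (b *\<^sub>R \<pi> (F y)) + r *\<^sub>R (a *\<^sub>R \<pi> (F y))"
      by (simp only: r(3) scaleR_add_left scaleR_scaleR)
    then show ?thesis using convexD_alt[OF section_convex[OF S] b(3) aV r(1,2)] by simp
  qed
  define \<gamma>' where "\<gamma>' t = (if t \<le> a then s (t *\<^sub>R \<pi> (F y)) else \<gamma> t)" for t
  have glue: "s (a *\<^sub>R \<pi> (F y)) = \<gamma> a" using section_proj(2)[OF S \<gamma>(2)] pa by simp
  have "continuous_on ({b..a} \<union> {a..1}) \<gamma>'"
    unfolding \<gamma>'_def
  proof (rule continuous_on_cases)
    show "continuous_on {b..a} (\<lambda>t. s (t *\<^sub>R \<pi> (F y)))"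
      by (rule continuous_on_compose2[OF section_cont[OF S]]) (use inV in \<open>auto intro!: continuous_intros\<close>)
    show "continuous_on {a..1} \<gamma>" using \<gamma>(1) by (simp add: ray_def)
    show "\<forall>t. t \<in> {b..a} \<and> \<not> t \<le> a \<or> t \<in> {a..1} \<and> t \<le> a \<longrightarrow> s (t *\<^sub>R \<pi> (F y)) = \<gamma> t"
      using glue by (auto simp: order.antisym)
  qed auto
  moreover have "{b..a} \<union> {a..1} = {b..1}" using a b by auto
  moreover have "\<gamma>' 1 = y"
  proof -
    have "\<gamma> 1 = y" using \<gamma>(1) by (simp only: ray_def)
    then show ?thesis using glue a(2) by (cases "a = 1") (simp_all add: \<gamma>'_def)
  qed
  moreover have "F (\<gamma>' t) = t *\<^sub>R F y" if t: "t \<in> {b..1}" for t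
  proof (cases "t \<le> a")
    case True
    then have "t *\<^sub>R \<pi> (F y) \<in> V" "a *\<^sub>R \<pi> (F y) \<in> V" using inV t b by auto
    then have "F (s ((t / a) *\<^sub>R (a *\<^sub>R \<pi> (F y)))) = (t / a) *\<^sub>R F (s (a *\<^sub>R \<pi> (F y)))"
      using t b a by (intro section_ray[OF S]) simp_all
    then have "F (s (t *\<^sub>R \<pi> (F y))) = (t / a) *\<^sub>R F (s (a *\<^sub>R \<pi> (F y)))"
      using a by simp
    then show ?thesis using True a by (simp add: \<gamma>'_def glue Fa)
  next
    case False
    then show ?thesis using t ray_F[OF \<gamma>(1), of t] by (simp add: \<gamma>'_def)
  qed
  ultimately have "ray b y \<gamma>'" by (simp add: ray_def)
  then show ?thesis by (intro exI[of _ \<gamma>']) (auto simp: \<gamma>'_def)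
qed

text \<open>The end points of lifts whose parameters decrease to the infimum i stay in a compact set
  by properness. A section around a limit point z contains one of them and extends its lift past i,
  unless i = 0 is already reached.\<close>

lemma ex_ray:
  assumes sec: "\<And>y. \<exists>\<pi> W V s. cone_section y \<pi> W V s"
  shows "\<exists>\<gamma>. ray 0 y \<gamma>"
proof -
  define S where "S = {a\<in>{0..1}. \<exists>\<gamma>. ray a y \<gamma>}"
  have "ray 1 y (\<lambda>_. y)" by (simp add: ray_def)
  then have S1: "1 \<in> S" by (auto simp: S_def)
  define i where "i = Inf S"
  have bdd: "bdd_below S" unfolding S_def by (rule bdd_belowI[of _ 0]) auto
  have i: "0 \<le> i" "i \<le> 1"
    unfolding i_def using S1 bdd by (auto intro!: cInf_greatest cInf_lower simp: S_def)
  have "\<exists>a. a \<in> S \<and> a < i + inverse (real (Suc j))" for j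
    using cInf_lessD[of S "i + inverse (real (Suc j))"] S1 by (auto simp: i_def)
  then obtain a where a: "\<And>j. a j \<in> S" "\<And>j. a j < i + inverse (real (Suc j))" by metis
  have ia: "i \<le> a j" for j unfolding i_def by (rule cInf_lower[OF a(1) bdd])
  have "\<exists>\<gamma>. ray (a j) y \<gamma>" for j using a(1) by (auto simp: S_def)
  then obtain \<gamma> where \<gamma>: "\<And>j. ray (a j) y (\<gamma> j)" by metis
  have a01: "0 \<le> a j" "a j \<le> 1" for j using a(1)[of j] by (auto simp: S_def)
  have F\<gamma>: "F (\<gamma> j (a j)) = a j *\<^sub>R F y" for j using a01[of j] by (intro ray_F[OF \<gamma>]) auto
  have alim: "a \<longlonglongrightarrow> i"
  proof (rule tendsto_sandwich[of "\<lambda>_. i" a sequentially "\<lambda>j. i + inverse (real (Suc j))"])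
    show "(\<lambda>j. i + inverse (real (Suc j))) \<longlonglongrightarrow> i"
      using tendsto_add[OF tendsto_const LIMSEQ_inverse_real_of_nat, of i] by simp
  qed (use ia a(2) in \<open>auto intro!: always_eventually less_imp_le\<close>)
  let ?K = "F -` cball 0 (norm (F y))"
  have inK: "\<gamma> j (a j) \<in> ?K" for j
    using a01[of j] by (simp add: F\<gamma> mult_left_le_one_le)
  have "seq_compact ?K"
    by (rule compact_imp_seq_compact[OF compact_preimage]) simp
  then obtain z r where zr: "strict_mono r" "((\<lambda>j. \<gamma> j (a j)) \<circ> r) \<longlonglongrightarrow> z"
    by (rule seq_compactE[OF _ allI[OF inK]])
  have z: "strict_mono r" "(\<lambda>j. \<gamma> (r j) (a (r j))) \<longlonglongrightarrow> z"
    using zr by (simp_all add: comp_def)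
  obtain \<pi> W V s where SC: "cone_section z \<pi> W V s" using sec by blast
  interpret \<pi>: linear \<pi> by (rule section_linear[OF SC])
  have "(\<lambda>j. F (\<gamma> (r j) (a (r j)))) \<longlonglongrightarrow> F z"
    using continuous_F z(2) by (auto intro!: isCont_tendsto_compose[of _ F] simp: continuous_on_eq_continuous_at)
  moreover have "(\<lambda>j. a (r j) *\<^sub>R F y) \<longlonglongrightarrow> i *\<^sub>R F y"
    using LIMSEQ_subseq_LIMSEQ[OF alim z(1)] by (intro tendsto_intros) (simp add: comp_def)
  ultimately have Fz: "F z = i *\<^sub>R F y" by (simp add: F\<gamma> LIMSEQ_unique)
  then have iV: "i *\<^sub>R \<pi> (F y) \<in> V" using section_proj(1)[OF SC section_self[OF SC]] by (simp add: \<pi>.scale)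
  obtain j where j: "\<gamma> (r j) (a (r j)) \<in> W"
    using topological_tendstoD[OF z(2) section_open(1)[OF SC] section_self[OF SC]] eventually_sequentially by auto
  let ?a = "a (r j)"
  have "0 \<in> S"
  proof (cases "?a = 0")
    case True then show ?thesis using a(1) by metis
  next
    case False
    then have apos: "0 < ?a" using a01[of "r j"] by linarith
    have ext: "b \<in> S" if "0 \<le> b" "b \<le> ?a" "b *\<^sub>R \<pi> (F y) \<in> V" for b
      using ray_extend[OF SC \<gamma> j apos a01(2) that] that a01[of "r j"] by (auto simp: S_def)
    show ?thesis
    proof (cases "i = 0")
      case True
      then show ?thesis using ext[of 0] iV apos by simp
    next
      case False
      then have "0 < i" using i by simp
      have "open ((\<lambda>b. b *\<^sub>R \<pi> (F y)) -` V)"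
        using section_open(2)[OF SC] by (intro open_vimage) (auto intro!: continuous_intros)
      then obtain d where d: "d > 0" "ball i d \<subseteq> (\<lambda>b. b *\<^sub>R \<pi> (F y)) -` V"
        using iV open_contains_ball by blast
      \<comment> \<open>A parameter strictly below i whose multiple of \<pi> (F y) still lies in the
        open set V; the lift reaching it contradicts the choice of i.\<close>
      define b where "b = max 0 (i - d / 2)"
      have b: "0 \<le> b" "b < i" "b \<in> ball i d" using d \<open>0 < i\<close> by (auto simp: b_def dist_real_def)
      then have "b \<in> S" using ext[of b] d(2) ia[of "r j"] by auto
      then have "i \<le> b" unfolding i_def using bdd by (rule cInf_lower)
      then show ?thesis using b by simp
    qed
  qed
  then show ?thesis by (simp add: S_def)
qed

lemma ray_unique:
  assumes sec: "\<And>y. \<exists>\<pi> W V s. cone_section y \<pi> W V s"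
    and "ray a y \<gamma>" "ray a y \<gamma>'" "t \<in> {a..1}"
  shows "\<gamma> t = \<gamma>' t"
proof (rule lift_unique[OF sec, of a 1 \<gamma> \<gamma>' 1 t])
  show "F (\<gamma> r) = F (\<gamma>' r)" if "r \<in> {a..1}" for r
    using assms(2,3) that by (simp add: ray_def)
  show "1 \<in> {a..1}" using assms(4) by simp
qed (use assms(2-4) in \<open>simp_all add: ray_def\<close>)

text \<open>\<open>tip y\<close> is the preimage of the origin that the lift starting at y reaches.
  Once all tips coincide in q, the cone has a single sheet: uniqueness of lifts makes F injective,
  and the tangent plane at q determines the image.\<close>

theorem cone_is_hyperplane:
  assumes tang: "\<And>x. \<sigma> x = 0"
  shows "is_hyperplane_through_origin F"
proof -
  have sec: "\<exists>\<pi> W V s. cone_section y \<pi> W V s" for y by (rule ex_cone_section[OF tang])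
  define \<gamma> where "\<gamma> y = (SOME \<gamma>. ray 0 y \<gamma>)" for y
  have \<gamma>: "ray 0 y (\<gamma> y)" for y
    unfolding \<gamma>_def by (rule someI_ex[OF ex_ray[OF sec]])
  define tip where "tip y = \<gamma> y 0" for y
  have endI: "tip y = \<beta> 0" if "ray 0 y \<beta>" for y \<beta>
    unfolding tip_def using ray_unique[OF sec \<gamma> that] by simp
  have F\<gamma>: "F (\<gamma> y t) = t *\<^sub>R F y" if "t \<in> {0..1}" for y t using that by (rule ray_F[OF \<gamma>])
  have sub: "ray 0 (\<gamma> y l) (\<lambda>t. \<gamma> y (t * l))" if l: "l \<in> {0..1}" for y l
    unfolding ray_def
  proof (intro conjI ballI)
    have range: "t * l \<in> {0..1}" if "t \<in> {0..1}" for t using that l by (auto simp: mult_le_one)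
    show "continuous_on {0..1} (\<lambda>t. \<gamma> y (t * l))"
      by (rule continuous_on_compose2[OF ray_cont[OF \<gamma>]]) (intro continuous_intros, use range in blast)
    show "F (\<gamma> y (t * l)) = t *\<^sub>R F (\<gamma> y l)" if "t \<in> {0..1}" for t
      using F\<gamma>[OF range[OF that]] F\<gamma>[OF l] by simp
  qed simp
  have end_sub: "tip (\<gamma> y l) = tip y" if "l \<in> {0..1}" for y l
    using endI[OF sub[OF that]] by (simp add: tip_def)
  text \<open>Within a section, moving along a ray does not change the end point.\<close>
  have end_section: "tip z = tip (s (l *\<^sub>R \<pi> (F z)))"
    if S: "cone_section x \<pi> W V s" and z: "z \<in> W" and l: "0 \<le> l" "l \<le> 1" "l *\<^sub>R \<pi> (F z) \<in> V" for x \<pi> W V s z l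
  proof -
    have "ray 1 z (\<lambda>_. z)" by (simp add: ray_def)
    from ray_extend[OF S this z _ _ l] obtain \<beta> where \<beta>: "ray l z \<beta>" "\<forall>t\<in>{l..1}. \<beta> t = s (t *\<^sub>R \<pi> (F z))" by auto
    have "ray l z (\<gamma> z)"
      unfolding ray_def using ray_cont[OF \<gamma>, of z] ray_1[OF \<gamma>, of z] ray_F[OF \<gamma>, of _ z] l(1)
      by (intro conjI ballI) (auto intro: continuous_on_subset)
    then have "\<gamma> z l = \<beta> l" using l by (intro ray_unique[OF sec _ \<beta>(1)]) auto
    then have "\<gamma> z l = s (l *\<^sub>R \<pi> (F z))" using \<beta>(2) l by auto
    then show ?thesis using end_sub[of l z] l by simp
  qed
  \<comment> \<open>Local constancy of \<open>tip\<close> at z. It is evident near preimages of the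
    origin and is transported outwards along rays.\<close>
  define P where "P z \<longleftrightarrow> (\<exists>Q. open Q \<and> z \<in> Q \<and> (\<forall>z'\<in>Q. tip z' = tip z))" for z
  \<comment> \<open>Inside a section, scaling by l carries points near z to points near z1, scaling
    by 1 / l carries them back, and neither changes the tip. The induction over an interval uses
    both directions.\<close>
  have transfer: "P z \<longleftrightarrow> P z1" if S: "cone_section x \<pi> W V s" and z: "z \<in> W" "z1 \<in> W" and l: "0 < l" "l \<le> 1" "F z1 = l *\<^sub>R F z" for x \<pi> W V s z z1 l
  proof -
    interpret \<pi>: linear \<pi> by (rule section_linear[OF S])
    have p1: "\<pi> (F z1) = l *\<^sub>R \<pi> (F z)" by (simp add: l(3) \<pi>.scale)
    have cF: "continuous_on UNIV (\<lambda>z. \<pi> (F z))"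
      using linear_continuous_on[of \<pi>] section_linear[OF S] linear_conv_bounded_linear
      by (intro continuous_on_compose2[OF _ continuous_F]) auto
    have pull: "\<exists>Q'. open Q' \<and> y \<in> Q' \<and> (\<forall>y'\<in>Q'. y' \<in> W \<and> c *\<^sub>R \<pi> (F y') \<in> V \<and> s (c *\<^sub>R \<pi> (F y')) \<in> Q)"
      if "y \<in> W" "c *\<^sub>R \<pi> (F y) \<in> V" "open Q" "s (c *\<^sub>R \<pi> (F y)) \<in> Q" for y c Q
    proof -
      have o1: "open (V \<inter> s -` Q)"
        using section_cont[OF S] section_open(2)[OF S] that(3) continuous_on_open_vimage by (metis Int_commute)
      have "open ((\<lambda>y. c *\<^sub>R \<pi> (F y)) -` (V \<inter> s -` Q))"
        using o1 cF by (intro open_vimage) (auto intro!: continuous_intros)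
      then have "open (W \<inter> (\<lambda>y. c *\<^sub>R \<pi> (F y)) -` (V \<inter> s -` Q))"
        using section_open(1)[OF S] by (intro open_Int)
      then show ?thesis using that by (intro exI[of _ "W \<inter> (\<lambda>y. c *\<^sub>R \<pi> (F y)) -` (V \<inter> s -` Q)"]) auto
    qed
    have z1eq: "s (l *\<^sub>R \<pi> (F z)) = z1" using section_proj(2)[OF S z(2)] p1 by simp
    have zeq: "s ((1 / l) *\<^sub>R \<pi> (F z1)) = z" using section_proj(2)[OF S z(1)] p1 l(1) by simp
    have inV: "l *\<^sub>R \<pi> (F z) \<in> V" using section_proj(1)[OF S z(2)] p1 by simp
    have inV': "(1 / l) *\<^sub>R \<pi> (F z1) \<in> V" using section_proj(1)[OF S z(1)] p1 l(1) by simp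
    have ends: "tip z = tip z1" using end_section[OF S z(1), of l] l inV z1eq by simp
    show ?thesis
    proof
      assume "P z1"
      then obtain Q where Q: "open Q" "z1 \<in> Q" "\<And>z'. z' \<in> Q \<Longrightarrow> tip z' = tip z1" unfolding P_def by blast
      obtain Q' where Q': "open Q'" "z \<in> Q'"
        "\<And>y'. y' \<in> Q' \<Longrightarrow> y' \<in> W \<and> l *\<^sub>R \<pi> (F y') \<in> V \<and> s (l *\<^sub>R \<pi> (F y')) \<in> Q"
        using pull[OF z(1) inV Q(1)] z1eq Q(2) by auto
      have "tip y' = tip z" if "y' \<in> Q'" for y'
        using end_section[OF S, of y' l] Q'(3)[OF that] Q(3) l ends by auto
      then show "P z" unfolding P_def using Q' by blast
    next
      assume "P z"
      then obtain Q where Q: "open Q" "z \<in> Q" "\<And>z'. z' \<in> Q \<Longrightarrow> tip z' = tip z" unfolding P_def by blast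
      obtain Q' where Q': "open Q'" "z1 \<in> Q'"
        "\<And>y'. y' \<in> Q' \<Longrightarrow> y' \<in> W \<and> (1 / l) *\<^sub>R \<pi> (F y') \<in> V \<and> s ((1 / l) *\<^sub>R \<pi> (F y')) \<in> Q"
        using pull[OF z(2) inV' Q(1)] zeq Q(2) by auto
      have "tip y' = tip z1" if y': "y' \<in> Q'" for y'
      proof -
        let ?y = "s ((1 / l) *\<^sub>R \<pi> (F y'))"
        have y: "y' \<in> W" "(1 / l) *\<^sub>R \<pi> (F y') \<in> V" "?y \<in> Q" using Q'(3)[OF y'] by auto
        have pe: "l *\<^sub>R \<pi> (F ?y) = \<pi> (F y')" using section_sec(2)[OF S y(2)] l(1) by simp
        have "tip ?y = tip (s (l *\<^sub>R \<pi> (F ?y)))"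
          using section_sec(1)[OF S y(2)] l section_proj(1)[OF S y(1)] unfolding pe
          by (intro end_section[OF S, of ?y l, unfolded pe]) auto
        then have "tip ?y = tip y'" unfolding pe using section_proj(2)[OF S y(1)] by simp
        then show ?thesis using Q(3)[OF y(3)] ends by simp
      qed
      then show "P z1" unfolding P_def using Q' by blast
    qed
  qed
  have Fend: "F (tip y) = 0" for y using F\<gamma>[of 0 y] by (simp add: tip_def)
  \<comment> \<open>A section around a zero q of F has s 0 = q, so scaling any of its points down to
    0 ends in q.\<close>
  have end_zero_section: "tip z = q" if q: "F q = 0" and S: "cone_section q \<pi> W V s" and z: "z \<in> W" for q \<pi> W V s z
  proof -
    interpret \<pi>: linear \<pi> by (rule section_linear[OF S])
    have sq: "s 0 = q" "0 \<in> V" using section_proj[OF S section_self[OF S]] q by (auto simp: \<pi>.zero)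
    have "tip z = tip (s (0 *\<^sub>R \<pi> (F z)))" using sq by (intro end_section[OF S z]) auto
    also have "\<dots> = tip q" by (simp add: sq)
    also have "tip q = q"
    proof -
      have "ray 0 q (\<lambda>_. q)" by (simp add: ray_def q)
      from endI[OF this] show ?thesis .
    qed
    finally show ?thesis .
  qed
  have "P y" for y
  proof -
    have "\<exists>T. openin (top_of_set {0..1}) T \<and> a \<in> T \<and> (\<forall>t\<in>T. \<forall>t'\<in>T. P (\<gamma> y t) \<longrightarrow> P (\<gamma> y t'))" if a: "a \<in> {0..1}" for a
    proof -
      obtain \<pi> W V s where S: "cone_section (\<gamma> y a) \<pi> W V s" using sec by blast
      let ?T = "{0..1} \<inter> \<gamma> y -` W"
      have oT: "openin (top_of_set {0..1}) ?T"
        using ray_cont[OF \<gamma>] section_open(1)[OF S] by (intro continuous_openin_preimage_gen)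
      have aT: "a \<in> ?T" using a section_self[OF S] by auto
      show ?thesis
      proof (cases "a = 0")
        case True
        then have "F (\<gamma> y a) = 0" using F\<gamma>[of 0 y] by simp
        then have "tip z = \<gamma> y a" if "z \<in> W" for z using end_zero_section[OF _ S that] by blast
        then have "P z" if "z \<in> W" for z
          unfolding P_def using section_open(1)[OF S] that by (intro exI[of _ W]) auto
        then show ?thesis using oT aT by blast
      next
        case False
        \<comment> \<open>Removing 0 keeps the ratios t / t' positive, as \<open>transfer\<close>
          requires; near t = 0 the section around the tip is used instead.\<close>
        let ?T' = "?T \<inter> {0<..}"
        have "P (\<gamma> y t')" if "t \<in> ?T'" "t' \<in> ?T'" "P (\<gamma> y t)" for t t'
        proof (cases "t \<le> t'")
          case True
          have "F (\<gamma> y t) = (t / t') *\<^sub>R F (\<gamma> y t')" using that F\<gamma>[of t y] F\<gamma>[of t' y] by simp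
          then show ?thesis using transfer[OF S, of "\<gamma> y t'" "\<gamma> y t" "t / t'"] that True by auto
        next
          case False
          have "F (\<gamma> y t') = (t' / t) *\<^sub>R F (\<gamma> y t)" using that F\<gamma>[of t y] F\<gamma>[of t' y] by simp
          then show ?thesis using transfer[OF S, of "\<gamma> y t" "\<gamma> y t'" "t' / t"] that False by auto
        qed
        moreover have "openin (top_of_set {0..1}) ?T'" using oT by (rule openin_Int_open) simp
        moreover have "a \<in> ?T'" using aT False a by auto
        ultimately show ?thesis by (intro exI[of _ ?T']) blast
      qed
    qed
    moreover have "P (\<gamma> y 0)"
    proof -
      have q: "F (\<gamma> y 0) = 0" using F\<gamma>[of 0 y] by simp
      obtain \<pi> W V s where S: "cone_section (\<gamma> y 0) \<pi> W V s" using sec by blast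
      have "tip z = \<gamma> y 0" if "z \<in> W" for z using end_zero_section[OF q S that] .
      then show ?thesis unfolding P_def using section_open(1)[OF S] section_self[OF S] by (intro exI[of _ W]) auto
    qed
    ultimately have "P (\<gamma> y 1)"
      using connected_induction_simple[of "{0..1::real}" 0 1 "\<lambda>t. P (\<gamma> y t)"] by (auto simp: connected_Icc)
    then show ?thesis by (simp only: ray_1[OF \<gamma>])
  qed
  then have locconst: "\<exists>T. open T \<and> z \<in> T \<and> (\<forall>z'\<in>T. tip z' = tip z)" for z unfolding P_def by blast
  obtain q where q: "\<And>y. tip y = q"
  proof -
    obtain y0 :: 'm where True by simp
    have "tip y = tip y0" for y
    proof -
      have level: "open {z. tip z \<in> Q}" for Q
      proof (rule Topological_Spaces.openI)
        fix z assume z: "z \<in> {z. tip z \<in> Q}"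
        obtain T where T: "open T" "z \<in> T" "\<forall>z'\<in>T. tip z' = tip z"
          using locconst[of z] by (elim exE conjE) (rule that)
        have "T \<subseteq> {z. tip z \<in> Q}" using T(3) z by (simp add: subset_eq)
        then show "\<exists>T. open T \<and> z \<in> T \<and> T \<subseteq> {z. tip z \<in> Q}" using T by (intro exI[of _ T] conjI)
      qed
      have "- {z. tip z \<in> {tip y0}} = {z. tip z \<in> - {tip y0}}" by (rule set_eqI) simp
      then have "closed {z. tip z \<in> {tip y0}}" using level[of "- {tip y0}"] by (simp only: closed_def)
      then have "{z. tip z \<in> {tip y0}} = {} \<or> {z. tip z \<in> {tip y0}} = UNIV"
        using connected_UNIV level[of "{tip y0}"] unfolding connected_clopen[of "UNIV :: 'm set"]
        by (simp only: closed_closedin[symmetric] open_openin[symmetric] subtopology_UNIV)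
      then have "y \<in> {z. tip z \<in> {tip y0}}" by blast
      then show ?thesis by simp
    qed
    then show ?thesis by (rule that)
  qed
  have Fq: "F q = 0" using Fend[of q] q by simp
  obtain \<pi> W V s where S: "cone_section q \<pi> W V s" using sec by blast
  interpret \<pi>: linear \<pi> by (rule section_linear[OF S])
  have V0: "0 \<in> V" "s 0 = q" using section_proj[OF S section_self[OF S]] Fq by (auto simp: \<pi>.zero)
  obtain D where D: "((\<lambda>v. F (s v)) has_derivative D) (at 0)" "\<And>v. D v \<in> tangent_space A F q"
    and inj\<pi>: "\<And>z. z \<bullet> N q = 0 \<Longrightarrow> \<pi> z = 0 \<Longrightarrow> z = 0"
    using S Fq unfolding cone_section_def by (auto simp: \<pi>.zero)
  interpret D: linear D using D(1) by (rule has_derivative_linear)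
  have DN: "D v \<bullet> N q = 0" for v
    using N_orth[of q] D(2)[of v] by (auto simp: orthogonal_comp_def orthogonal_def inner_commute)
  text \<open>Near its end point the cone coincides with its tangent plane.\<close>
  have FD: "F (s v) = D v" if v: "v \<in> V" for v
  proof -
    have "((\<lambda>t. F (s (t *\<^sub>R v))) has_vector_derivative D v) (at 0 within {0..1})"
    proof -
      have "((\<lambda>t. t *\<^sub>R v) has_derivative (\<lambda>h. h *\<^sub>R v)) (at 0)" by (auto intro!: derivative_eq_intros)
      moreover have "((\<lambda>v. F (s v)) has_derivative D) (at (0 *\<^sub>R v))" using D(1) by simp
      ultimately have "((\<lambda>t. F (s (t *\<^sub>R v))) has_derivative (\<lambda>h. D (h *\<^sub>R v))) (at 0)"
        using diff_chain_at by (fastforce simp: comp_def)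
      then show ?thesis
        by (simp add: has_vector_derivative_def D.scale has_derivative_at_withinI)
    qed
    moreover have "((\<lambda>t. F (s (t *\<^sub>R v))) has_vector_derivative F (s v)) (at 0 within {0..1})"
    proof (rule has_vector_derivative_transform[where f = "\<lambda>t. t *\<^sub>R F (s v)"])
      show "((\<lambda>t. t *\<^sub>R F (s v)) has_vector_derivative F (s v)) (at 0 within {0..1})"
        by (auto intro!: derivative_eq_intros simp: has_vector_derivative_def)
      fix t :: real assume t: "t \<in> {0..1}"
      have "(1 - t) *\<^sub>R 0 + t *\<^sub>R v \<in> V" using convexD_alt[OF section_convex[OF S] V0(1) v] t by auto
      then show "F (s (t *\<^sub>R v)) = t *\<^sub>R F (s v)" using section_ray[OF S v] t by simp
    qed simp
    ultimately show ?thesis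
      using vector_derivative_unique_within_closed_interval[of 0 1 0] by fastforce
  qed
  let ?H = "{z. N q \<bullet> z = 0}"
  \<comment> \<open>A short initial piece of the ray from q to y lies in W, where F takes values
    orthogonal to N q. As F is t times F y along the ray, F y itself is orthogonal to N q.\<close>
  have FH: "F y \<in> ?H" for y
  proof -
    have "continuous_on {0..1} (\<gamma> y)" "\<gamma> y 0 \<in> W"
      using ray_cont[OF \<gamma>] q[of y] section_self[OF S] by (simp_all add: tip_def)
    then have "openin (top_of_set {0..1}) ({0..1} \<inter> \<gamma> y -` W)"
      using section_open(1)[OF S] by (intro continuous_openin_preimage_gen)
    then obtain d where d: "d > 0" "ball 0 d \<inter> {0..1} \<subseteq> {0..1} \<inter> \<gamma> y -` W"
      using \<open>\<gamma> y 0 \<in> W\<close> by (force simp: openin_contains_ball)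
    define t where "t = min 1 (d / 2)"
    have t: "t \<in> {0..1}" "t > 0" "\<gamma> y t \<in> W" using d by (auto simp: t_def subset_eq)
    have "F (\<gamma> y t) \<bullet> N q = 0"
      using FD[OF section_proj(1)[OF S t(3)]] section_proj(2)[OF S t(3)] DN by metis
    then show ?thesis using F\<gamma>[OF t(1)] t(2) by (simp add: inner_commute)
  qed
  have injF: "inj F"
  proof (rule injI)
    fix y y' assume eq: "F y = F y'"
    have "\<gamma> y 1 = \<gamma> y' 1"
    proof (rule lift_unique[OF sec, of 0 1 "\<gamma> y" "\<gamma> y'" 0 1])
      show "F (\<gamma> y t) = F (\<gamma> y' t)" if "t \<in> {0..1}" for t using F\<gamma>[OF that] eq by simp
      show "\<gamma> y 0 = \<gamma> y' 0" using q[of y] q[of y'] by (simp add: tip_def)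
    qed (use ray_cont[OF \<gamma>] in simp_all)
    then show "y = y'" by (simp only: ray_1[OF \<gamma>])
  qed
  \<comment> \<open>A convergent sequence of images stays in a ball, whose preimage is compact by
    properness.\<close>
  have closed_image: "closed (F ` C)" if C: "closed C" for C
  proof (unfold closed_sequential_limits, intro allI impI, elim conjE)
    fix x l assume x: "\<forall>j. x j \<in> F ` C" and l: "x \<longlonglongrightarrow> l"
    obtain R where R: "\<And>j. norm (x j) \<le> R"
      using convergent_imp_Bseq[OF convergentI[OF l]] by (auto simp: Bseq_def)
    have "compact (F -` cball 0 R \<inter> C)"
      using compact_preimage[of "cball 0 R"] C by (intro compact_Int_closed) auto
    then have "compact (F ` (F -` cball 0 R \<inter> C))"
      by (intro compact_continuous_image) (auto intro: continuous_on_subset[OF continuous_F])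
    moreover have "x j \<in> F ` (F -` cball 0 R \<inter> C)" for j
      using x R[of j] by fastforce
    ultimately have "l \<in> F ` (F -` cball 0 R \<inter> C)"
      by (rule closed_sequentially[OF compact_imp_closed _ l])
    then show "l \<in> F ` C" by auto
  qed
  \<comment> \<open>The positive multiples of z that lie in the range form a closed set, an open one
    because sections are homogeneous, and a nonempty one because near q the image is the tangent
    plane. Connectedness of the half-line leads to z itself.\<close>
  have surj: "z \<in> range F" if z: "z \<in> ?H" for z
  proof -
    let ?T = "{0<..} \<inter> (\<lambda>r. r *\<^sub>R z) -` range F"
    have cl: "closedin (top_of_set {0<..}) ?T"
      using closed_image[OF closed_UNIV] by (intro continuous_closedin_preimage continuous_intros)
    have op: "openin (top_of_set {0<..}) ?T"
    proof (subst openin_subopen, intro ballI)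
      fix r assume r: "r \<in> ?T"
      then obtain y where y: "r *\<^sub>R z = F y" and r0: "0 < r" by auto
      obtain \<pi>' W' V' s' where S': "cone_section y \<pi>' W' V' s'" using sec by blast
      interpret \<pi>': linear \<pi>' by (rule section_linear[OF S'])
      have yV: "\<pi>' (F y) \<in> V'" "s' (\<pi>' (F y)) = y" using section_proj[OF S' section_self[OF S']] by auto
      let ?Q = "{0<..} \<inter> (\<lambda>t. (t / r) *\<^sub>R \<pi>' (F y)) -` V'"
      have "open ((\<lambda>t. (t / r) *\<^sub>R \<pi>' (F y)) -` V')"
        using section_open(2)[OF S'] r0 by (intro open_vimage) (auto intro!: continuous_intros)
      then have "openin (top_of_set {0<..}) ?Q" by (auto simp: openin_open)
      moreover have "r \<in> ?Q" using yV r0 by auto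
      moreover have "?Q \<subseteq> ?T"
      proof
        fix t assume t: "t \<in> ?Q"
        then have "F (s' ((t / r) *\<^sub>R \<pi>' (F y))) = (t / r) *\<^sub>R F y"
          using section_ray[OF S' yV(1), of "t / r"] r0 yV(2) by auto
        also have "\<dots> = t *\<^sub>R z" using r0 by (simp flip: y)
        finally have "t *\<^sub>R z \<in> range F" by (metis rangeI)
        then show "t \<in> ?T" using t by auto
      qed
      ultimately show "\<exists>Q. openin (top_of_set {0<..}) Q \<and> r \<in> Q \<and> Q \<subseteq> ?T" by blast
    qed
    have "open ((\<lambda>t. t *\<^sub>R \<pi> z) -` V)"
      using section_open(2)[OF S] by (intro open_vimage) (auto intro!: continuous_intros)
    then obtain d where d: "d > 0" "ball (0::real) d \<subseteq> (\<lambda>t. t *\<^sub>R \<pi> z) -` V"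
      using V0 open_contains_ball by (metis scaleR_zero_left vimageI)
    have conn: "connected {0::real<..}" by (intro convex_connected convex_real_interval)
    have "d / 2 \<in> ?T"
    proof -
      have V: "(d / 2) *\<^sub>R \<pi> z \<in> V" using d by (auto simp: subset_eq)
      let ?x = "F (s ((d / 2) *\<^sub>R \<pi> z))"
      \<comment> \<open>Both vectors lie in the tangent plane at q and have the same
        projection.\<close>
      have "?x - (d / 2) *\<^sub>R z = 0"
      proof (rule inj\<pi>)
        show "(?x - (d / 2) *\<^sub>R z) \<bullet> N q = 0"
          unfolding FD[OF V] inner_diff_left using DN[of "(d / 2) *\<^sub>R \<pi> z"] z by (simp add: inner_commute)
        show "\<pi> (?x - (d / 2) *\<^sub>R z) = 0"
          using section_sec(2)[OF S V] by (simp add: \<pi>.diff \<pi>.scale)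
      qed
      then have "(d / 2) *\<^sub>R z = ?x" by simp
      then show ?thesis using d(1) by auto
    qed
    then have "?T = {0<..}"
      using iffD1[OF connected_clopen, OF conn, THEN spec, THEN mp, OF conjI[OF op cl]] by blast
    then have "1 \<in> ?T" by auto
    then show ?thesis by simp
  qed
  have range: "range F = ?H" using FH surj by blast
  obtain g where "homeomorphism UNIV ?H F g"
  proof (rule homeomorphism_injective_closed_map[OF continuous_F range injF])
    fix C :: "'m set" assume "closedin (top_of_set UNIV) C"
    then have "closed (F ` C)" using closed_image by simp
    then show "closedin (top_of_set ?H) (F ` C)"
      using range by (intro closed_subset) auto
  qed
  moreover have "N q \<noteq> 0" using norm_N[of q] by auto
  ultimately show ?thesis unfolding is_hyperplane_through_origin_def by blast
qed

end

section \<open>The spectrum of a hyperplane\<close>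

lemma smooth_step_derivative_bounded:
  obtains c where "c > 0" "\<And>s. \<bar>frechet_derivative smooth_step (at s) 1\<bar> \<le> c"
    "\<And>s. s < 0 \<or> s > 1 \<Longrightarrow> frechet_derivative smooth_step (at s) 1 = 0"
proof -
  let ?d = "\<lambda>s. frechet_derivative smooth_step (at s) 1"
  have cont: "continuous_on UNIV ?d"
    using Ck_on_SucD(2)[OF Ck_on_smooth_step[of "Suc 0" UNIV]] by simp
  have zero: "?d s = 0" if s: "s < 0 \<or> s > 1" for s
  proof -
    consider "s < 0" | "s > 1" using s by blast
    then show ?thesis
    proof cases
      case 1
      then have "frechet_derivative smooth_step (at s) = frechet_derivative (\<lambda>_. 1) (at s)"
        by (intro frechet_derivative_cong_open(1)[of "{..<0}"]) (auto simp: smooth_step(1))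
      then show ?thesis by simp
    next
      case 2
      then have "frechet_derivative smooth_step (at s) = frechet_derivative (\<lambda>_. 0) (at s)"
        by (intro frechet_derivative_cong_open(1)[of "{1<..}"]) (auto simp: smooth_step(2))
      then show ?thesis by simp
    qed
  qed
  have "bounded (?d ` {0..1})"
    by (intro compact_imp_bounded compact_continuous_image continuous_on_subset[OF cont]) auto
  then obtain c where "c > 0" "\<And>s. s \<in> {0..1} \<Longrightarrow> \<bar>?d s\<bar> \<le> c" by (auto simp: bounded_pos)
  then have "\<bar>?d s\<bar> \<le> c" for s using zero[of s] by (cases "s \<in> {0..1}") auto
  then show ?thesis using that \<open>c > 0\<close> zero by blast
qed

context proper_expander
begin

text \<open>Differentiating a . F = 0 shows that a is normal, hence a nonzero multiple of N x; the
  relation itself then says that x has no normal part.\<close>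

lemma hyperplane_\<sigma>_eq_0:
  assumes a: "a \<noteq> 0" and F: "\<And>x. a \<bullet> F x = 0"
  shows "\<sigma> x = 0"
proof -
  obtain U p u where c: "(U, p) \<in> A" "u \<in> U" and x: "p u = x" by (rule chart_cover)
  have "((\<lambda>u. a \<bullet> F (p u)) has_derivative (\<lambda>h. a \<bullet> dF p u h)) (at u)"
    by (rule has_derivative_inner_right[OF Ck_on_SucD(1)[OF Ck_F[OF c(1)] c(2)]])
  then have "a \<bullet> dF p u h = 0" for h
    using has_derivative_unique[of "\<lambda>u. 0" "\<lambda>h. a \<bullet> dF p u h" u "\<lambda>h. 0"] by (simp add: F) metis
  then have "a \<in> (tangent_space A F x)\<^sup>\<bottom>" using orthogonal_tangent_iff[OF c] x by blast
  then have aN: "a = (a \<bullet> N x) *\<^sub>R N x" by (rule normal_eq)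
  then have "a \<bullet> N x \<noteq> 0" using a by auto
  moreover have "(a \<bullet> N x) * (N x \<bullet> F x) = 0"
    using F[of x] arg_cong[OF aN, of "\<lambda>z. z \<bullet> F x"] by simp
  ultimately show ?thesis by (simp add: \<sigma>_def inner_commute)
qed

text \<open>T is an isometric parametrization L of the hyperplane followed by the inverse of F. In a
  chart, the projection \<pi> after F is isometric, so the Gram matrix is M^T M with M its
  derivative and |det M| is the volume density; uniqueness of the Riemannian measure
  concludes.\<close>

lemma hyperplane_measure:
  assumes a: "a \<noteq> 0" and hom: "homeomorphism UNIV {y. a \<bullet> y = 0} F g"
  obtains T where "\<mu> = distr lborel borel T" "T \<in> borel_measurable borel" "\<And>v. norm (F (T v)) = norm (v :: real^'n)"
proof -
  have Fa: "a \<bullet> F x = 0" for x using hom by (auto simp: homeomorphism_def)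
  have gF: "g (F x) = x" for x using hom by (auto simp: homeomorphism_def)
  have Fg: "F (g z) = z" if "a \<bullet> z = 0" for z using hom that by (auto simp: homeomorphism_def)
  obtain x0 :: 'm where True by simp
  obtain U0 p0 u0 where c0: "(U0, p0) \<in> A" "u0 \<in> U0" and "p0 u0 = x0" by (rule chart_cover)
  let ?e = "\<lambda>b. dF p0 u0 (frame U0 p0 b u0)"
  have ON: "?e b \<bullet> ?e b' = (if b = b' then 1 else 0)" for b b'
    by (rule frame_orthonormal[OF c0])
  define \<nu> where "\<nu> = a /\<^sub>R norm a"
  have \<nu>: "norm \<nu> = 1" using a by (simp add: \<nu>_def)
  have adF: "a \<bullet> dF p u h = 0" if "(U, p) \<in> A" "u \<in> U" for U p u h
  proof -
    have "((\<lambda>u. a \<bullet> F (p u)) has_derivative (\<lambda>h. a \<bullet> dF p u h)) (at u)"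
      by (rule has_derivative_inner_right[OF Ck_on_SucD(1)[OF Ck_F[OF that(1)] that(2)]])
    then show ?thesis
      using has_derivative_unique[of "\<lambda>u. 0" "\<lambda>h. a \<bullet> dF p u h" u "\<lambda>h. 0"] by (simp add: Fa) metis
  qed
  have \<nu>e: "\<nu> \<bullet> ?e b = 0" for b using adF[OF c0] by (simp add: \<nu>_def)
  define \<pi> where "\<pi> z = (\<chi> b. z \<bullet> ?e b)" for z :: "real^'k"
  define L where "L v = (\<Sum>b\<in>UNIV. (v $ b) *\<^sub>R ?e b)" for v :: "real^'n"
  have bl\<pi>: "bounded_linear \<pi>"
    by (intro linear_conv_bounded_linear[THEN iffD1] linearI) (auto simp: \<pi>_def vec_eq_iff inner_add_left)
  have blL: "bounded_linear L"
    by (intro linear_conv_bounded_linear[THEN iffD1] linearI) (auto simp: L_def scaleR_add_left sum.distrib scaleR_sum_right)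
  have \<pi>L: "\<pi> (L v) = v" for v
    by (simp add: \<pi>_def L_def vec_eq_iff inner_sum_left ON if_distrib cong: if_cong)
  have aL: "a \<bullet> L v = 0" for v
    using adF[OF c0] by (simp add: L_def inner_sum_right)
  have L\<pi>: "L (\<pi> z) = z" if "a \<bullet> z = 0" for z
    using orthonormal_decomposition(1)[where L = "dF p0 u0" and e = "\<lambda>b. frame U0 p0 b u0", OF dimension ON \<nu>e \<nu>, of z] that
    by (simp add: L_def \<pi>_def \<nu>_def inner_commute)
  have iso: "\<pi> z \<bullet> \<pi> z' = z \<bullet> z'" if "a \<bullet> z = 0" for z z'
  proof -
    have "z \<bullet> z' = L (\<pi> z) \<bullet> z'" using L\<pi>[OF that] by simp
    also have "\<dots> = (\<Sum>b\<in>UNIV. (\<pi> z $ b) * (\<pi> z' $ b))" by (simp add: L_def inner_sum_left) (simp add: \<pi>_def inner_commute)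
    finally show ?thesis by (simp add: inner_vec_def)
  qed
  define T where "T v = g (L v)" for v
  have FT: "F (T v) = L v" for v using Fg[OF aL] by (simp add: T_def)
  have T_inv: "T (\<pi> (F x)) = x" "\<pi> (F (T v)) = v" for x v
    using L\<pi>[OF Fa] gF by (simp_all add: T_def FT[unfolded T_def] \<pi>L)
  have Tcont: "continuous_on UNIV T"
  proof -
    have "continuous_on {y. a \<bullet> y = 0} g" using hom by (simp add: homeomorphism_def)
    from continuous_on_compose2[OF this linear_continuous_on[OF blL]] aL
    show ?thesis unfolding T_def by blast
  qed
  have Tm: "T \<in> borel_measurable borel" by (rule borel_measurable_continuous_onI[OF Tcont])
  have normL: "norm (L v) = norm v" for v
    using iso[OF aL, of v "L v"] by (simp add: \<pi>L norm_eq_sqrt_inner)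
  have "\<mu> = distr lborel borel T"
  proof (rule riemannian_measure_eqI)
    fix U p B assume c: "(U, p) \<in> A" and B: "B \<in> sets borel" "B \<subseteq> U"
    define \<psi> where "\<psi> u = \<pi> (F (p u))" for u
    have \<psi>d: "(\<psi> has_derivative (\<lambda>h. \<pi> (dF p u h))) (at u)" if "u \<in> U" for u
      unfolding \<psi>_def by (rule bounded_linear.has_derivative[OF bl\<pi> Ck_on_SucD(1)[OF Ck_F[OF c] that]])
    have T\<psi>: "T (\<psi> u) = p u" for u by (simp add: \<psi>_def T_inv)
    have det: "\<bar>det (matrix (\<lambda>h. \<pi> (dF p u h)))\<bar> = volume_density (\<lambda>u. F (p u)) u" if "u \<in> U" for u
    proof -
      let ?M = "matrix (\<lambda>h. \<pi> (dF p u h))"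
      have "(\<chi> i j. dF p u (axis i 1) \<bullet> dF p u (axis j 1)) = transpose ?M ** ?M"
      proof -
        have "dF p u (axis i 1) \<bullet> dF p u (axis j 1) = (\<Sum>k\<in>UNIV. \<pi> (dF p u (axis i 1)) $ k * \<pi> (dF p u (axis j 1)) $ k)" for i j
          using iso[OF adF[OF c that]] by (simp add: inner_vec_def)
        then show ?thesis by (simp add: vec_eq_iff matrix_matrix_mult_def transpose_def matrix_def)
      qed
      then show ?thesis
        by (simp add: volume_density_def det_mul det_transpose flip: power2_eq_square)
    qed
    have \<psi>U: "\<psi> ` C = T -` (p ` C)" for C
    proof
      show "\<psi> ` C \<subseteq> T -` (p ` C)" using T\<psi> by auto
      show "T -` (p ` C) \<subseteq> \<psi> ` C"
      proof
        fix v assume "v \<in> T -` (p ` C)"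
        then obtain u where "u \<in> C" "T v = p u" by auto
        then have "\<psi> u = v" using T_inv(2)[of v] by (simp add: \<psi>_def)
        then show "v \<in> \<psi> ` C" using \<open>u \<in> C\<close> by blast
      qed
    qed
    have pB: "p ` B \<in> sets borel" by (rule sets_chart_image[OF c B])
    have \<psi>B: "\<psi> ` B \<in> sets borel"
      unfolding \<psi>U using measurable_sets[OF Tm pB] by simp
    have "emeasure (distr lborel borel T) (p ` B) = emeasure lborel (\<psi> ` B)"
      unfolding \<psi>U using Tm pB by (subst emeasure_distr) auto
    also have "\<dots> = (\<integral>\<^sup>+u. ennreal (indicator B u * \<bar>det (matrix (\<lambda>h. \<pi> (dF p u h)))\<bar>) \<partial>lborel)"
    proof (rule emeasure_lborel_image[OF B(1) \<psi>B])
      show "inj_on \<psi> B"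
        using T\<psi> B(2) chart(4)[OF c] by (metis inj_onI inj_on_contraD subsetD)
      have eq: "(\<lambda>u. indicator B u * \<bar>det (matrix (\<lambda>h. \<pi> (dF p u h)))\<bar>) = (\<lambda>u. indicator B u * volume_density (\<lambda>u. F (p u)) u)"
        using det B(2) by (auto simp: indicator_def fun_eq_iff)
      show "(\<lambda>u. indicator B u * \<bar>det (matrix (\<lambda>h. \<pi> (dF p u h)))\<bar>) \<in> borel_measurable borel"
        unfolding eq using chart(1)[OF c] B
        by (intro borel_measurable_indicator_mult[of U] Ck_on_imp_continuous_on[OF Ck_volume_density[OF c]]) auto
    qed (use \<psi>d B(2) in auto)
    also have "\<dots> = (\<integral>\<^sup>+u. indicator B u * ennreal (volume_density (\<lambda>u. F (p u)) u) \<partial>lborel)"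
      using det B(2) by (intro nn_integral_cong) (auto simp: indicator_def)
    finally show "emeasure \<mu> (p ` B) = emeasure (distr lborel borel T) (p ` B)"
      by (simp add: emeasure_riemannian[OF c B])
  qed simp_all
  then show ?thesis using that[of T] Tm FT normL by simp
qed

text \<open>For f = exp (-|x|^2 / 4) the field \<nabla>f + f x^T / 2 vanishes, so only the term with
  the derivative of the cutoff remains, with x^T = x since \<open>\<sigma>\<close> is zero.\<close>

lemma excess_cutoff:
  fixes R :: real
  assumes tang: "\<And>x. \<sigma> x = 0"
  defines "f \<equiv> \<lambda>x. exp (- ((norm (F x))\<^sup>2 / 4)) * smooth_step ((norm (F x))\<^sup>2 - R)"
  shows "excess (1/4) f x * w x =
    4 * exp (- ((norm (F x))\<^sup>2 / 4)) * (frechet_derivative smooth_step (at ((norm (F x))\<^sup>2 - R)) 1)\<^sup>2 * (norm (F x))\<^sup>2"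
proof -
  obtain U p u where c: "(U, p) \<in> A" "u \<in> U" and x: "p u = x" by (rule chart_cover)
  have tf: "test_function A (\<lambda>x. (\<lambda>s. exp (- (s / 4))) ((norm (F x))\<^sup>2) * smooth_step ((norm (F x))\<^sup>2 - R))"
  proof (rule test_function_cutoff)
    show "Ck_on k UNIV (\<lambda>s::real. exp (- (s / 4)))" for k
      by (rule Ck_on_real_compose[where g = exp, OF open_UNIV Ck_on_bounded_linear Ck_on_exp])
        (rule bounded_linear_minus[OF bounded_linear_divide])
  qed
  have fC: "Ck_fun A k f" for k unfolding f_def by (rule test_functionD[OF tf]) meson
  let ?E = "\<lambda>b. frame U p b u" and ?r = "\<lambda>u. F (p u) \<bullet> F (p u)"
  let ?d = "frechet_derivative smooth_step (at (?r u - R)) 1"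
  have X: "((\<lambda>u. F (p u)) has_derivative dF p u) (at u)"
    using Ck_on_SucD(1)[OF Ck_F[OF c(1)] c(2)] .
  have r: "(?r has_derivative (\<lambda>h. 2 * (F (p u) \<bullet> dF p u h))) (at u)"
    by (rule has_derivative_eq_rhs[OF has_derivative_inner[OF X X]]) (simp add: inner_commute[of "dF p u _"] fun_eq_iff)
  have h: "((\<lambda>u. exp (- (1/4) * ?r u)) has_derivative (\<lambda>h. (- (1/4) * (2 * (F (p u) \<bullet> dF p u h))) * exp (- (1/4) * ?r u))) (at u)"
    by (intro has_derivative_exp has_derivative_mult_right r)
  have "(smooth_step has_derivative (\<lambda>h. ?d * h)) (at (?r u - R))"
  proof -
    have 1: "(smooth_step has_derivative frechet_derivative smooth_step (at (?r u - R))) (at (?r u - R))"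
      using Ck_on_SucD(1)[OF Ck_on_smooth_step[of "Suc 0" UNIV]] by simp
    have "frechet_derivative smooth_step (at (?r u - R)) h = ?d * h" for h
      using linear_scale[OF has_derivative_linear[OF 1], of h 1] by (simp add: mult.commute)
    then have "frechet_derivative smooth_step (at (?r u - R)) = (\<lambda>h. ?d * h)" by (rule ext)
    then show ?thesis using 1 by (simp only:)
  qed
  moreover have "((\<lambda>u. ?r u - R) has_derivative (\<lambda>h. 2 * (F (p u) \<bullet> dF p u h))) (at u)"
    using has_derivative_diff[OF r has_derivative_const, of R] by simp
  ultimately have s: "((\<lambda>u. smooth_step (?r u - R)) has_derivative (\<lambda>h. ?d * (2 * (F (p u) \<bullet> dF p u h)))) (at u)"
    using diff_chain_at by (fastforce simp: comp_def)
  have feq: "f (p u) = exp (- (1/4) * ?r u) * smooth_step (?r u - R)" for u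
    by (simp add: f_def power2_norm_eq_inner)
  have fd: "frechet_derivative (\<lambda>u. f (p u)) (at u) h =
      exp (- (1/4) * ?r u) * (?d * (2 * (F (p u) \<bullet> dF p u h))) +
      (- (1/4) * (2 * (F (p u) \<bullet> dF p u h))) * exp (- (1/4) * ?r u) * smooth_step (?r u - R)" for h
    unfolding feq using frechet_derivative_eqI[OF has_derivative_mult[OF h s]] by simp
  have "excess (1/4) f (p u) = (\<Sum>b\<in>UNIV. (exp (- (1/4) * ?r u) * ?d * 2 * (F (p u) \<bullet> dF p u (?E b)))\<^sup>2)"
    unfolding excess_chart[OF c Ck_fun_imp_chart_differentiable[OF fC]] fd
    by (rule sum.cong) (simp_all add: feq algebra_simps)
  also have "\<dots> = (exp (- (1/4) * ?r u) * ?d * 2)\<^sup>2 * \<tau> (p u)"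
    unfolding \<tau>_chart[OF c frame_orthonormal[OF c]] by (simp add: power_mult_distrib sum_distrib_left)
  also have "\<tau> (p u) = ?r u" by (simp add: \<tau>_def tang power2_norm_eq_inner)
  finally have ex: "excess (1/4) f (p u) = 4 * (exp (- (1/4) * ?r u))\<^sup>2 * ?d\<^sup>2 * ?r u"
    by (simp add: power_mult_distrib)
  have "(exp (- (1/4) * ?r u))\<^sup>2 * exp (?r u / 4) = exp (- (?r u / 4))"
    by (simp add: power2_eq_square flip: exp_add)
  moreover have "4 * E * D * r * e = 4 * (E * e) * D * r" for E D r e :: real by simp
  ultimately have "4 * (exp (- (1/4) * ?r u))\<^sup>2 * ?d\<^sup>2 * ?r u * exp (?r u / 4) = 4 * exp (- (?r u / 4)) * ?d\<^sup>2 * ?r u"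
    by (simp only:)
  then show ?thesis using ex by (simp add: power2_norm_eq_inner flip: x)
qed

text \<open>The defect of the Rayleigh quotient of the cutoff at R is its excess over its mass. The
  excess is at most a power of R times exp (-R / 4), while the mass stays above that of the cutoff
  at 0.\<close>

theorem hyperplane_spectrum:
  assumes hyp: "is_hyperplane_through_origin F"
  shows "spectrum_bottom A F = real CARD('n) / 2 + H2_inf"
proof -
  obtain a g where a: "a \<noteq> 0" and hom: "homeomorphism UNIV {y. a \<bullet> y = 0} F g"
    using hyp unfolding is_hyperplane_through_origin_def by blast
  have Fa: "a \<bullet> F x = 0" for x using hom by (auto simp: homeomorphism_def)
  have tang: "\<sigma> x = 0" for x by (rule hyperplane_\<sigma>_eq_0[OF a Fa])
  have H0: "H2_inf = 0" by (simp add: mean_curvature_sq tang)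
  obtain T where T: "\<mu> = distr lborel borel T" "T \<in> borel_measurable borel" "\<And>v. norm (F (T v)) = norm (v :: real^'n)"
    using hyperplane_measure[OF a hom] by metis
  let ?n = "CARD('n)"
  define f where "f R x = exp (- ((norm (F x))\<^sup>2 / 4)) * smooth_step ((norm (F x))\<^sup>2 - R)" for R x
  have tf: "test_function A (f R)" for R
  proof -
    have "Ck_on k UNIV (\<lambda>s::real. exp (- (s / 4)))" for k
      by (rule Ck_on_real_compose[where g = exp, OF open_UNIV Ck_on_bounded_linear Ck_on_exp])
        (rule bounded_linear_minus[OF bounded_linear_divide])
    from test_function_cutoff[OF this, of R] show ?thesis by (simp add: f_def[abs_def])
  qed
  obtain c where c: "c > 0" "\<And>s. \<bar>frechet_derivative smooth_step (at s) 1\<bar> \<le> c"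
    "\<And>s. s < 0 \<or> s > 1 \<Longrightarrow> frechet_derivative smooth_step (at s) 1 = 0"
    using smooth_step_derivative_bounded by metis
  have mass0: "mass (f 0) > 0"
  proof (rule mass_pos[OF tf, of _ "g 0"])
    have "F (g 0) = 0" using hom by (auto simp: homeomorphism_def)
    then show "f 0 (g 0) \<noteq> 0" by (simp add: f_def smooth_step(1))
  qed
  have int: "integrable \<mu> (\<lambda>x. (f R x)\<^sup>2 * w x)" for R
    using test_integrable[OF tf, of "\<lambda>_. 1"] by simp
  \<comment> \<open>The cutoff at 0 is supported in |x|^2 \<le> 1, and there the cutoff at R \<ge> 1
    is the full exponential.\<close>
  have mass_mono: "mass (f 0) \<le> mass (f R)" if R: "R \<ge> 1" for R
    unfolding weighted_integral_def
  proof (rule integral_mono)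
    fix x
    have "f 0 x \<le> f R x"
    proof (cases "(norm (F x))\<^sup>2 \<le> 1")
      case True
      then show ?thesis using R smooth_step(4)[of "(norm (F x))\<^sup>2 - 0"] by (simp add: f_def smooth_step(1))
    next
      case False
      then show ?thesis using smooth_step(3) by (simp add: f_def smooth_step(2))
    qed
    moreover have "0 \<le> f 0 x" using smooth_step(3) by (simp add: f_def)
    ultimately show "(f 0 x)\<^sup>2 * w x \<le> (f R x)\<^sup>2 * w x"
      by (intro mult_right_mono power_mono) auto
  qed (rule int)+
  define V where "V = unit_ball_vol (real ?n)"
  have V: "V > 0" by (simp add: V_def)
  have vol: "measure \<mu> (F -` cball 0 r) = V * r ^ ?n" if "0 \<le> r" for r
  proof -
    have "F -` cball 0 r \<in> sets borel"
      using compact_imp_closed[OF compact_preimage[of "cball 0 r"]] by auto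
    then have "measure \<mu> (F -` cball 0 r) = measure lborel (T -` (F -` cball 0 r))"
      unfolding T(1) using T(2) by (subst measure_distr) auto
    also have "T -` (F -` cball 0 r) = cball 0 r" using T(3) by auto
    finally show ?thesis using content_cball[OF that, of "0 :: real^'n"] by (simp add: V_def)
  qed
  \<comment> \<open>The derivative of the cutoff lives in the shell R \<le> |x|^2 \<le> R + 1, where
    the exponential is at most exp (-R / 4); the shell lies in a ball of known volume.\<close>
  have bound: "(\<integral>x. excess (1/4) (f R) x * w x \<partial>\<mu>) \<le> 4 * exp (- (R / 4)) * c\<^sup>2 * (R + 1) * (V * (sqrt (R + 1)) ^ ?n)"
    if R: "R \<ge> 0" for R
  proof -
    let ?S = "F -` cball 0 (sqrt (R + 1))" and ?C = "4 * exp (- (R / 4)) * c\<^sup>2 * (R + 1)"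
    have Sc: "compact ?S" by (rule compact_preimage) simp
    have S: "?S \<in> sets borel" using compact_imp_closed[OF Sc] by auto
    have "(\<integral>x. excess (1/4) (f R) x * w x \<partial>\<mu>) \<le> (\<integral>x. ?C * indicator ?S x \<partial>\<mu>)"
    proof (rule integral_mono)
      show "integrable \<mu> (\<lambda>x. excess (1/4) (f R) x * w x)" by (rule test_integrable_excess[OF tf])
      show "integrable \<mu> (\<lambda>x. ?C * indicator ?S x)"
        using emeasure_compact_finite[OF Sc] S by (intro integrable_mult_right integrable_real_indicator) auto
      fix x
      let ?r = "(norm (F x))\<^sup>2" and ?d = "frechet_derivative smooth_step (at ((norm (F x))\<^sup>2 - R)) 1"
      have e: "excess (1/4) (f R) x * w x = 4 * exp (- (?r / 4)) * ?d\<^sup>2 * ?r"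
        using excess_cutoff[OF tang, of R x] by (simp add: f_def[abs_def])
      show "excess (1/4) (f R) x * w x \<le> ?C * indicator ?S x"
      proof (cases "R \<le> ?r \<and> ?r \<le> R + 1")
        case True
        then have "norm (F x) \<le> sqrt (R + 1)" by (intro real_le_rsqrt) auto
        then have "x \<in> ?S" by simp
        moreover have "?d\<^sup>2 \<le> c\<^sup>2" using c(2)[of "?r - R"] c(1) by (metis abs_le_square_iff abs_of_pos)
        then have "4 * exp (- (?r / 4)) * ?d\<^sup>2 * ?r \<le> ?C"
          using True R by (intro mult_mono) auto
        ultimately show ?thesis unfolding e by simp
      next
        case False
        then have "?d = 0" using c(3)[of "?r - R"] by auto
        then show ?thesis unfolding e using R by simp
      qed
    qed
    also have "\<dots> = ?C * measure \<mu> ?S" using S by simp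
    also have "measure \<mu> ?S = V * (sqrt (R + 1)) ^ ?n" using R by (intro vol) auto
    finally show ?thesis .
  qed
  define M where "M = 4 * c\<^sup>2 * V * 5 ^ (?n + 1) / mass (f 0)"
  have main: "spectrum_bottom A F - real ?n / 2 \<le> M * (real j ^ (?n + 1) / exp (real j))" if j: "j \<ge> 1" for j :: nat
  proof -
    \<comment> \<open>Makes exp (-R / 4) equal to exp (-j), and R + 1 at most 5 j, whence the power
      of 5 in \<open>M\<close>.\<close>
    define R where "R = 4 * real j"
    have R: "R \<ge> 1" "R \<ge> 0" using j by (auto simp: R_def)
    have mR: "mass (f R) > 0" using mass_mono[OF R(1)] mass0 by linarith
    let ?X = "\<integral>x. excess (1/4) (f R) x * w x \<partial>\<mu>"
    have X0: "0 \<le> ?X" using excess_test_nonneg[OF tf] by (intro Bochner_Integration.integral_nonneg) auto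
    have "energy (f R) - (real ?n / 2 + 0) * mass (f R) = ?X"
      using mass_eq_potential[OF tf, of R 0] by (simp add: tang)
    then have "energy (f R) / mass (f R) = real ?n / 2 + ?X / mass (f R)"
      using mR by (simp add: field_simps)
    moreover have "spectrum_bottom A F \<le> energy (f R) / mass (f R)"
      using mR by (intro spectrum_bottom_le[OF tf]) simp
    ultimately have "spectrum_bottom A F - real ?n / 2 \<le> ?X / mass (f R)" by simp
    also have "\<dots> \<le> ?X / mass (f 0)"
      using mass_mono[OF R(1)] mass0 X0 by (intro divide_left_mono) (auto intro!: mult_pos_pos mR)
    also have "\<dots> \<le> (4 * c\<^sup>2 * V * (5 ^ (?n + 1) * real j ^ (?n + 1)) * exp (- real j)) / mass (f 0)"
    proof (rule divide_right_mono)
      \<comment> \<open>A crude bound that replaces a half-integer power by a natural one; the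
        exponential wins in any case.\<close>
      have "sqrt (R + 1) \<le> R + 1" using R by (intro real_le_lsqrt) (auto simp: power2_eq_square)
      then have "(sqrt (R + 1)) ^ ?n \<le> (R + 1) ^ ?n" using R by (intro power_mono) auto
      then have "(R + 1) * (sqrt (R + 1)) ^ ?n \<le> (R + 1) ^ (?n + 1)" using R by simp
      also have "\<dots> \<le> (5 * real j) ^ (?n + 1)" using R j by (intro power_mono) (auto simp: R_def)
      finally have le: "(R + 1) * (sqrt (R + 1)) ^ ?n \<le> 5 ^ (?n + 1) * real j ^ (?n + 1)" by (simp only: power_mult_distrib)
      have "?X \<le> (4 * c\<^sup>2 * V * exp (- real j)) * ((R + 1) * (sqrt (R + 1)) ^ ?n)"
        using bound[OF R(2)] by (simp add: R_def mult_ac)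
      also have "\<dots> \<le> (4 * c\<^sup>2 * V * exp (- real j)) * (5 ^ (?n + 1) * real j ^ (?n + 1))"
        using le V by (intro mult_left_mono) auto
      finally show "?X \<le> 4 * c\<^sup>2 * V * (5 ^ (?n + 1) * real j ^ (?n + 1)) * exp (- real j)"
        by (simp add: mult_ac)
    qed (use mass0 in simp)
    also have "\<dots> = M * (real j ^ (?n + 1) / exp (real j))"
      by (simp add: M_def exp_minus divide_inverse mult_ac)
    finally show ?thesis .
  qed
  have "((\<lambda>x::real. x ^ (?n + 1) / exp x) \<longlongrightarrow> 0) at_top" by (rule tendsto_power_div_exp_0)
  then have "(\<lambda>j. real j ^ (?n + 1) / exp (real j)) \<longlonglongrightarrow> 0"
    by (rule filterlim_compose[OF _ filterlim_real_sequentially])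
  then have "(\<lambda>j. M * (real j ^ (?n + 1) / exp (real j))) \<longlonglongrightarrow> M * 0"
    by (intro tendsto_mult_left)
  then have "spectrum_bottom A F - real ?n / 2 \<le> M * 0"
    by (rule tendsto_lowerbound) (use main in \<open>auto simp: eventually_sequentially intro!: exI[of _ 1]\<close>)
  then show ?thesis using spectrum_bottom_ge H0 by simp
qed

end

lemma expander_of_immersed:
  fixes A :: "('n::finite, 'm::{t2_space, second_countable_topology}) param set"
    and F N :: "'m \<Rightarrow> real^'k::finite"
  assumes "immersed_hypersurface A F" "unit_normal_field A F N" "self_expander A F N" "properly_immersed F"
  shows "proper_expander A F N"
proof -
  interpret atlas A using assms(1) by unfold_locales (simp add: immersed_hypersurface_def)
  show ?thesis
    using assms by unfold_locales (auto simp: immersed_hypersurface_def smooth_fun_on_UNIV)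
qed

theorem theorem1p3:
  fixes A :: "('n::finite, 'm::{t2_space, second_countable_topology}) param set"
    and F N :: "'m \<Rightarrow> real^'k::finite"
  assumes "immersed_hypersurface A F"
    and "unit_normal_field A F N"
    and "self_expander A F N"
    and "complete_hypersurface A F"
    and "properly_immersed F"
  shows "spectrum_bottom A F \<ge> real CARD('n) / 2 + (INF x. (mean_curvature A F N x)\<^sup>2) \<and>
    (spectrum_bottom A F = real CARD('n) / 2 + (INF x. (mean_curvature A F N x)\<^sup>2) \<longleftrightarrow>
       is_hyperplane_through_origin F)"
proof -
  interpret proper_expander A F N
    by (rule expander_of_immersed[OF assms(1-3,5)])
  have "is_hyperplane_through_origin F" if "spectrum_bottom A F = real CARD('n) / 2 + H2_inf"
  proof (rule cone_is_hyperplane, rule constant_\<sigma>_eq_0)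
    show "\<sigma> x = \<sigma> y" for x y
      using constant_curvature[OF that, of x] constant_curvature[OF that, of y] by simp
  qed
  then show ?thesis using spectrum_bottom_ge hyperplane_spectrum by blast
qed

end
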